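(* Let $n\ge2$ and let $f:\mathbb{B}^n\to\mathbb{R}^n$ be a bounded quasiregular mapping of the open unit ball $\mathbb{B}^n\subset\mathbb{R}^n$. Suppose that for some $0\le a<n-1$ and some constant $C$, $$N(f,B(0,r))\le C\,(1-r)^{-a}\qquad\text{for all }0<r<1.$$ Let $E\subset\partial\mathbb{B}^n$ be the set of points at which the nontangential limit of $f$ does not exist. Then $E$ has Hausdorff dimension at most $a$, i.e. $\dim_H(E)\le a$.
   Context: Quasiregular mapping: $f:\mathbb{B}^n\to\mathbb{R}^n$ whose coordinate functions belong to $W^{1,n}_{\rm loc}(\mathbb{B}^n)$ and whose dilatation $K(x)=|Df(x)|^n/J_f(x)$, with $J_f=\det Df$, is in $L^\infty(\mathbb{B}^n)$; that is, there is a constant $K<\infty$ with $|Df(x)|^n\le K\,J_f(x)$ for a.e. $x$. As usual, $f$ denotes the continuous representative. Multiplicity function: for $F\subset\mathbb{B}^n$, $n(y;f,F)=\operatorname{card}\{x\in F:f(x)=y\}$ and $N(f,F)=\sup_{y\in\mathbb{R}^n}n(y;f,F)$. $B(0,r)$ is the ball of radius $r$ centered at the origin. Nontangential limit: $f$ has a nontangential limit at $\zeta\in\partial\mathbb{B}^n$ if there is $L\in\mathbb{R}^n$ such that for every $c>1$, $f(x)\to L$ as $x\to\zeta$ within the Stolz cone $\{x\in\mathbb{B}^n:|\zeta-x|\le c(1-|x|)\}$. *)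

theory Defs
  imports "HOL-Analysis.Analysis"
begin

section \<open>Local Sobolev spaces\<close>

abbreviation partial :: "'n::finite \<Rightarrow> (real^'n \<Rightarrow> real) \<Rightarrow> real^'n \<Rightarrow> real"
  where "partial j \<phi> \<equiv> \<lambda>x. frechet_derivative \<phi> (at x) (axis j 1)"

primrec Ck :: "nat \<Rightarrow> (real^'n::finite \<Rightarrow> real) \<Rightarrow> bool" where
  "Ck 0 \<phi> \<longleftrightarrow> continuous_on UNIV \<phi>"
| "Ck (Suc k) \<phi> \<longleftrightarrow> (\<forall>x. \<phi> differentiable (at x)) \<and> (\<forall>j. Ck k (partial j \<phi>))"

text \<open>The space $C_c^\infty(\Omega)$, each function being extended by zero to the whole space.\<close>

definition test_function :: "(real^'n::finite) set \<Rightarrow> (real^'n \<Rightarrow> real) \<Rightarrow> bool" where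
  "test_function \<Omega> \<phi> \<longleftrightarrow>
     (\<forall>k. Ck k \<phi>) \<and> compact (closure {x. \<phi> x \<noteq> 0}) \<and> closure {x. \<phi> x \<noteq> 0} \<subseteq> \<Omega>"

definition Lp_loc :: "(real^'n::finite) set \<Rightarrow> real \<Rightarrow> (real^'n \<Rightarrow> real) \<Rightarrow> bool" where
  "Lp_loc \<Omega> p u \<longleftrightarrow> (\<forall>S. compact S \<and> S \<subseteq> \<Omega> \<longrightarrow>
     set_borel_measurable lebesgue S u \<and> set_integrable lebesgue S (\<lambda>x. \<bar>u x\<bar> powr p))"

definition weak_partial ::
    "(real^'n::finite) set \<Rightarrow> 'n \<Rightarrow> (real^'n \<Rightarrow> real) \<Rightarrow> (real^'n \<Rightarrow> real) \<Rightarrow> bool" where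
  "weak_partial \<Omega> j u g \<longleftrightarrow> Lp_loc \<Omega> 1 u \<and> Lp_loc \<Omega> 1 g \<and>
     (\<forall>\<phi>. test_function \<Omega> \<phi> \<longrightarrow>
        (LINT x:\<Omega>|lebesgue. u x * partial j \<phi> x) = - (LINT x:\<Omega>|lebesgue. g x * \<phi> x))"

definition W1p_loc :: "(real^'n::finite) set \<Rightarrow> real \<Rightarrow> (real^'n \<Rightarrow> real) \<Rightarrow> bool" where
  "W1p_loc \<Omega> p u \<longleftrightarrow> Lp_loc \<Omega> p u \<and> (\<forall>j. \<exists>g. weak_partial \<Omega> j u g \<and> Lp_loc \<Omega> p g)"


section \<open>Quasiregular mappings\<close>

definition weak_differential ::
    "(real^'n::finite) set \<Rightarrow> (real^'n \<Rightarrow> real^'n) \<Rightarrow> (real^'n \<Rightarrow> real^'n^'n) \<Rightarrow> bool" where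
  "weak_differential \<Omega> f Df \<longleftrightarrow>
     (\<forall>i j. weak_partial \<Omega> j (\<lambda>x. f x $ i) (\<lambda>x. Df x $ i $ j))"

text \<open>
  The weak differential is unique up to null sets, so it does not matter which version
  of \<open>Df\<close> is used. The mapping itself is the continuous representative of its class.
  The requirement \<open>K \<ge> 1\<close> is the usual normalisation: it forces the Jacobian determinant to
  be nonnegative a.e. and so excludes orientation-reversing maps, which a negative \<open>K\<close> would admit.
\<close>

definition quasiregular_on :: "(real^'n::finite) set \<Rightarrow> (real^'n \<Rightarrow> real^'n) \<Rightarrow> bool" where
  "quasiregular_on \<Omega> f \<longleftrightarrow>
     continuous_on \<Omega> f \<and>
     (\<forall>i. W1p_loc \<Omega> (real CARD('n)) (\<lambda>x. f x $ i)) \<and>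
     (\<exists>Df K. weak_differential \<Omega> f Df \<and> 1 \<le> K \<and>
        (AE x in lebesgue. x \<in> \<Omega> \<longrightarrow>
           onorm (\<lambda>v. Df x *v v) ^ CARD('n) \<le> K * det (Df x)))"


section \<open>Multiplicity\<close>

definition multiplicity_at :: "'b \<Rightarrow> ('a \<Rightarrow> 'b) \<Rightarrow> 'a set \<Rightarrow> enat" where
  "multiplicity_at y f F =
     (if finite {x \<in> F. f x = y} then enat (card {x \<in> F. f x = y}) else \<infinity>)"

definition max_multiplicity :: "('a \<Rightarrow> 'b) \<Rightarrow> 'a set \<Rightarrow> enat" where
  "max_multiplicity f F = (SUP y. multiplicity_at y f F)"


section \<open>Nontangential limits\<close>

definition stolz_cone :: "real \<Rightarrow> 'a::real_normed_vector \<Rightarrow> 'a set" where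
  "stolz_cone c \<zeta> = {x \<in> ball 0 1. norm (\<zeta> - x) \<le> c * (1 - norm x)}"

definition has_nontangential_limit ::
    "('a::real_normed_vector \<Rightarrow> 'b::topological_space) \<Rightarrow> 'a \<Rightarrow> bool" where
  "has_nontangential_limit f \<zeta> \<longleftrightarrow>
     (\<exists>L. \<forall>c>1. (f \<longlongrightarrow> L) (at \<zeta> within stolz_cone c \<zeta>))"


section \<open>Hausdorff dimension\<close>

text \<open>
  The \<open>s\<close>-th power of the diameter with the conventions $0^0 = 1$ for nonempty sets (whereas
  \<open>0 powr 0 = 0\<close>) and value \<open>0\<close> for the empty set, so that \<open>s = 0\<close> gives counting measure.
\<close>

definition diameter_powr :: "'a::metric_space set \<Rightarrow> real \<Rightarrow> real" where
  "diameter_powr U s = (if U = {} then 0 else if s = 0 then 1 else diameter U powr s)"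

text \<open>Boundedness of the covering sets is explicit because \<open>diameter\<close> is real-valued and
  meaningless on unbounded sets.\<close>

definition hausdorff_premeasure :: "real \<Rightarrow> real \<Rightarrow> 'a::metric_space set \<Rightarrow> ennreal" where
  "hausdorff_premeasure \<delta> s A =
     (INF U \<in> {U :: nat \<Rightarrow> 'a set. A \<subseteq> (\<Union>i. U i) \<and> (\<forall>i. bounded (U i) \<and> diameter (U i) \<le> \<delta>)}.
        \<Sum>i. ennreal (diameter_powr (U i) s))"

definition hausdorff_measure :: "real \<Rightarrow> 'a::metric_space set \<Rightarrow> ennreal" where
  "hausdorff_measure s A = (SUP \<delta> \<in> {0<..}. hausdorff_premeasure \<delta> s A)"

definition hausdorff_dim :: "'a::metric_space set \<Rightarrow> ereal" where
  "hausdorff_dim A = Inf {ereal s | s. 0 \<le> s \<and> hausdorff_measure s A = 0}"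

end

theory Submission
  imports Defs
begin

text \<open>
  Integrating the distortion inequality and using that \<open>f\<close> is differentiable almost everywhere, the
  multiplicity bound gives \<open>\<integral>\<^bsub>B(0,r)\<^esub> |Df|\<^sup>n \<le> C' (1 - r)\<^bsup>-a\<^esup>\<close>, so that \<open>|Df|\<^sup>n (1 - |x|)\<^sup>b\<close> is integrable on
  the ball for every \<open>b > a\<close>. If \<open>s > b\<close>, a covering argument shows that, outside a set of
  \<open>s\<close>-dimensional measure zero on the sphere, this density has mass at most \<open>r\<^sup>s\<close> in all small balls
  \<open>B(\<zeta>,r)\<close>. At such a point the oscillation of \<open>f\<close> on a Whitney ball at distance \<open>t\<close> in a Stolz cone is
  \<open>O(t\<^bsup>(s-b)/n\<^esup>)\<close>, and chains of Whitney balls yield the nontangential limit.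

  The oscillation of \<open>f\<close> on a ball is bounded by the \<open>n\<close>-energy on a larger ball. This rests on the
  monotonicity of the coordinate functions (Jacobians are null Lagrangians) together with a
  telescoping argument over averages and a covering lemma, which replaces Sobolev's inequality on
  spheres. The same estimate gives differentiability at the \<open>L\<^sup>n\<close>-Lebesgue points of \<open>Df\<close>, where
  Brouwer's theorem bounds the volume of images of small balls from below by the Jacobian; Vitali's
  theorem then bounds the integral of the Jacobian by the multiplicity without an area formula.
\<close>


section \<open>Smooth bump functions\<close>

text \<open>The exponent n is the borderline case of Sobolev embedding. The n-energy is scale
  invariant, so averages over cubes of side r/2^j may each move by the same amount, and telescoping
  alone bounds nothing at a given point. It converges where the energy near the point decays
  geometrically; a failure of decay charges a ball with energy proportional to its radius. One such
  ball proves too little. Monotonicity supplies one on every sphere with radius in an interval of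
  length r, which is what the covering argument needs. Since f is not smooth, the integral
  identities are proved for convolutions with a kernel and passed to the limit; the Jacobian
  survives because the determinant is continuous from L^n to L^1. Only an upper bound for the
  integral of the Jacobian is wanted, so one-sided information suffices: images of small balls are
  almost as large as the linear map predicts, and disjoint balls give distinct preimages. The strict
  inequalities a < b < s are spent separately: b > a sums the dyadic shells, and s > b leaves the
  exponent (s - b)/n that makes the chains summable.\<close>

lemma partial_eq:
  assumes "(\<phi> has_derivative D) (at x)"
  shows "partial j \<phi> x = D (axis j 1)"
  using frechet_derivative_at[OF assms] by simp

lemma Ck_imp_continuous:
  assumes "Ck k \<phi>"
  shows "continuous_on UNIV \<phi>"
proof (cases k)
  case (Suc m)
  then have "\<And>x. \<phi> differentiable (at x)" using assms by auto
  then show ?thesis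
    by (blast intro: continuous_at_imp_continuous_on differentiable_imp_continuous_within)
qed (use assms in auto)

lemma Ck_Suc_imp_Ck: "Ck (Suc k) \<phi> \<Longrightarrow> Ck k \<phi>"
proof (induction k arbitrary: \<phi>)
  case 0
  show ?case using Ck_imp_continuous[OF 0] by simp
next
  case (Suc k)
  then show ?case by (metis Ck.simps(2))
qed

lemma Ck_const: "Ck k (\<lambda>x::real^'n. c)"
proof (induction k arbitrary: c)
  case (Suc k)
  have "partial j (\<lambda>x::real^'n. c) = (\<lambda>x. 0)" for j
    by (rule ext, subst partial_eq[OF has_derivative_const]) simp
  then show ?case using Suc by (auto simp del: frechet_derivative_const)
qed auto

lemma Ck_add: "Ck k \<phi> \<Longrightarrow> Ck k \<psi> \<Longrightarrow> Ck k (\<lambda>x. \<phi> x + \<psi> x)"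
proof (induction k arbitrary: \<phi> \<psi>)
  case (Suc k)
  then have d: "\<And>x. \<phi> differentiable (at x)" "\<And>x. \<psi> differentiable (at x)" by auto
  have "partial j (\<lambda>x. \<phi> x + \<psi> x) = (\<lambda>x. partial j \<phi> x + partial j \<psi> x)" for j
  proof
    fix x
    show "partial j (\<lambda>x. \<phi> x + \<psi> x) x = partial j \<phi> x + partial j \<psi> x"
      by (rule partial_eq[OF has_derivative_add]) (use d frechet_derivative_works in blast)+
  qed
  then show ?case using Suc d by auto
qed (auto intro: continuous_intros)

lemma partial_mult:
  assumes d: "\<And>x. \<phi> differentiable (at x)" "\<And>x. \<psi> differentiable (at x)"
  shows "partial j (\<lambda>x. \<phi> x * \<psi> x) = (\<lambda>x. \<phi> x * partial j \<psi> x + partial j \<phi> x * \<psi> x)"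
proof
  fix x
  have "(\<phi> has_derivative frechet_derivative \<phi> (at x)) (at x)"
    "(\<psi> has_derivative frechet_derivative \<psi> (at x)) (at x)"
    using d frechet_derivative_works by blast+
  from has_derivative_mult[OF this]
  show "partial j (\<lambda>x. \<phi> x * \<psi> x) x = \<phi> x * partial j \<psi> x + partial j \<phi> x * \<psi> x"
    by (subst partial_eq) auto
qed

lemma Ck_mult: "Ck k \<phi> \<Longrightarrow> Ck k \<psi> \<Longrightarrow> Ck k (\<lambda>x. \<phi> x * \<psi> x)"
proof (induction k arbitrary: \<phi> \<psi>)
  case (Suc k)
  then have d: "\<And>x. \<phi> differentiable (at x)" "\<And>x. \<psi> differentiable (at x)" by auto
  have "Ck k (partial j (\<lambda>x. \<phi> x * \<psi> x))" for j
    unfolding partial_mult[OF d] using Suc Ck_Suc_imp_Ck by (intro Ck_add Suc.IH) (auto simp: Ck_Suc_imp_Ck)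
  then show ?case using d by (auto intro: differentiable_mult)
qed (auto intro: continuous_intros)

lemma partial_affine:
  assumes d: "\<And>x. \<phi> differentiable (at x)"
  shows "partial j (\<lambda>x. \<phi> (c *\<^sub>R x + b)) = (\<lambda>x. c * partial j \<phi> (c *\<^sub>R x + b))"
proof
  fix x
  have D: "((\<lambda>x. \<phi> (c *\<^sub>R x + b)) has_derivative
      (\<lambda>h. frechet_derivative \<phi> (at (c *\<^sub>R x + b)) (c *\<^sub>R h))) (at x)"
    by (rule has_derivative_compose[of "\<lambda>x. c *\<^sub>R x + b" "\<lambda>h. c *\<^sub>R h" _ _ \<phi>])
       (use d frechet_derivative_works in \<open>auto intro!: derivative_eq_intros\<close>)
  have "bounded_linear (frechet_derivative \<phi> (at (c *\<^sub>R x + b)))"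
    using d frechet_derivative_works has_derivative_bounded_linear by blast
  then show "partial j (\<lambda>x. \<phi> (c *\<^sub>R x + b)) x = c * partial j \<phi> (c *\<^sub>R x + b)"
    unfolding partial_eq[OF D] by (simp add: linear_simps)
qed

lemma Ck_affine: "Ck k \<phi> \<Longrightarrow> Ck k (\<lambda>x. \<phi> (c *\<^sub>R x + b))"
proof (induction k arbitrary: \<phi>)
  case 0
  then show ?case
    by (auto intro!: continuous_on_compose2[of UNIV \<phi>] continuous_intros)
next
  case (Suc k)
  then have d: "\<And>x. \<phi> differentiable (at x)" by auto
  have "(\<lambda>x. \<phi> (c *\<^sub>R x + b)) differentiable (at x)" for x
    by (rule differentiable_compose[OF d]) (auto intro!: derivative_intros)
  moreover have "Ck k (partial j (\<lambda>x. \<phi> (c *\<^sub>R x + b)))" for j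
    unfolding partial_affine[OF d] using Suc.prems by (intro Ck_mult Ck_const Suc.IH) simp
  ultimately show ?case by simp
qed

lemma Ck_component: "Ck k (\<lambda>x::real^'n. x $ i)"
proof (cases k)
  case (Suc m)
  have D: "((\<lambda>x::real^'n. x $ i) has_derivative (\<lambda>h. h $ i)) (at x)" for x
    by (rule bounded_linear_imp_has_derivative[OF bounded_linear_vec_nth])
  have "partial j (\<lambda>x::real^'n. x $ i) = (\<lambda>x. axis j 1 $ i)" for j
    by (rule ext, rule partial_eq[OF D])
  then show ?thesis using Suc D by (auto simp: differentiable_def intro!: Ck_const)
qed (auto intro: continuous_intros)

text \<open>Differentiating exp(-1/t) brings down powers of 1/t. With the power \<open>m\<close> as
  a parameter the family is closed under differentiation up to linear combinations, so smoothness
  follows by induction on the order, for all \<open>m\<close> at once.\<close>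

definition flat_exp :: "nat \<Rightarrow> real \<Rightarrow> real" where
  "flat_exp m t = (if t > 0 then (1 / t) ^ m * exp (- 1 / t) else 0)"

lemma flat_exp_nonneg: "0 \<le> flat_exp m t"
  by (auto simp: flat_exp_def)

lemma flat_exp_pos_iff: "0 < flat_exp m t \<longleftrightarrow> 0 < t"
  by (auto simp: flat_exp_def)

lemma flat_exp_tendsto_0: "((\<lambda>t. flat_exp m t) \<longlongrightarrow> 0) (at_right 0)"
proof -
  have "((\<lambda>t::real. (1/t) ^ m / exp (1/t)) \<longlongrightarrow> 0) (at_right 0)"
    by (rule filterlim_compose[OF tendsto_power_div_exp_0])
       (use filterlim_inverse_at_top_right in \<open>auto simp: divide_inverse\<close>)
  moreover have "\<forall>\<^sub>F t in at_right 0. (1/t) ^ m / exp (1/t) = flat_exp m t"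
    by (auto simp: flat_exp_def exp_minus field_simps eventually_at_right_less intro!: eventually_at_rightI[of 0 1])
  ultimately show ?thesis by (rule Lim_transform_eventually)
qed

lemma flat_exp_has_derivative:
  "(flat_exp m has_real_derivative flat_exp (m + 2) t - m * flat_exp (m + 1) t) (at t)"
proof -
  consider "t > 0" | "t < 0" | "t = 0" by linarith
  then show ?thesis
  proof cases
    case 1
    have "((\<lambda>t. (1 / t) ^ m * exp (- 1 / t)) has_real_derivative
        flat_exp (m + 2) t - m * flat_exp (m + 1) t) (at t)"
      using 1
      by (cases m) (auto intro!: derivative_eq_intros simp: flat_exp_def field_simps power2_eq_square,
        metis One_nat_def Suc_pred' not_gr_zero power_Suc)
    then show ?thesis
      by (rule DERIV_cong_ev[THEN iffD1, rotated 3, OF _ refl _ refl])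
         (use 1 in \<open>auto simp: flat_exp_def eventually_nhds intro!: exI[of _ "{0<..}"]\<close>)
  next
    case 2
    have "((\<lambda>t. 0::real) has_real_derivative 0) (at t)" by simp
    then show ?thesis
      by (rule DERIV_cong_ev[THEN iffD1, rotated 3])
         (use 2 in \<open>auto simp: flat_exp_def eventually_nhds intro!: exI[of _ "{..<0}"]\<close>)
  next
    case 3
    \<comment> \<open>From the right the quotient is \<open>flat_exp (Suc m) h\<close>; from the
      left it vanishes.\<close>
    have "((\<lambda>h. flat_exp m h / h) \<longlongrightarrow> 0) (at_right 0)"
      by (rule Lim_transform_eventually[OF flat_exp_tendsto_0[of "Suc m"]])
         (auto simp: flat_exp_def intro!: eventually_at_rightI[of 0 1])
    moreover have "((\<lambda>h. flat_exp m h / h) \<longlongrightarrow> 0) (at_left 0)"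
      by (rule Lim_transform_eventually[OF tendsto_const])
         (auto simp: flat_exp_def intro!: eventually_at_leftI[of "-1" 0])
    ultimately have "((\<lambda>h. flat_exp m h / h) \<longlongrightarrow> 0) (at 0)"
      by (simp add: filterlim_at_split)
    then show ?thesis using 3 by (simp add: DERIV_def flat_exp_def)
  qed
qed

lemma flat_exp_sphere_has_derivative:
  "((\<lambda>x::real^'n. flat_exp m (1 - x \<bullet> x)) has_derivative
     (\<lambda>h. (flat_exp (m + 2) (1 - x \<bullet> x) - m * flat_exp (m + 1) (1 - x \<bullet> x)) * (- 2 * (x \<bullet> h)))) (at x)"
proof -
  have "((\<lambda>x::real^'n. 1 - x \<bullet> x) has_derivative (\<lambda>h. - 2 * (x \<bullet> h))) (at x)"
    by (auto intro!: derivative_eq_intros simp: inner_commute fun_eq_iff)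
  from has_derivative_compose[OF this, of "flat_exp m" "(*) (flat_exp (m + 2) (1 - x \<bullet> x) - m * flat_exp (m + 1) (1 - x \<bullet> x))"]
  show ?thesis using flat_exp_has_derivative unfolding has_field_derivative_def by (auto simp: mult_ac)
qed

lemma partial_flat_exp_sphere:
  "partial j (\<lambda>x::real^'n. flat_exp m (1 - x \<bullet> x)) =
   (\<lambda>x. (flat_exp (m + 2) (1 - x \<bullet> x) + (- real m) * flat_exp (m + 1) (1 - x \<bullet> x)) * (- 2 * (x $ j)))"
  by (rule ext, subst partial_eq[OF flat_exp_sphere_has_derivative]) (simp add: inner_axis)

lemma Ck_flat_exp_sphere: "Ck k (\<lambda>x::real^'n. flat_exp m (1 - x \<bullet> x))"
proof (induction k arbitrary: m)
  case 0
  show ?case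
    using flat_exp_sphere_has_derivative has_derivative_continuous
    by (auto simp: continuous_on_eq_continuous_within intro!: has_derivative_continuous)
next
  case (Suc k)
  have "Ck k (partial j (\<lambda>x::real^'n. flat_exp m (1 - x \<bullet> x)))" for j
    unfolding partial_flat_exp_sphere
    by (intro Ck_mult Ck_add Ck_const Ck_component Suc.IH)
  then show ?case
    using flat_exp_sphere_has_derivative by (auto simp: differentiable_def)
qed

text \<open>Off the diagonal both sides are a radial factor times \<open>x $ i * x $ j\<close>, as
  the explicit formula shows. This symmetry is what later makes the rows of the mollified
  differential closed one-forms.\<close>

lemma partial_commute_flat_exp_sphere:
  "partial i (partial j (\<lambda>x::real^'n. flat_exp m (1 - x \<bullet> x))) =
   partial j (partial i (\<lambda>x. flat_exp m (1 - x \<bullet> x)))"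
proof -
  let ?F = "\<lambda>x::real^'n. flat_exp (m + 2) (1 - x \<bullet> x) + (- real m) * flat_exp (m + 1) (1 - x \<bullet> x)"
  let ?D = "\<lambda>x h. (flat_exp (m + 2 + 2) (1 - x \<bullet> x) - real (m + 2) * flat_exp (m + 2 + 1) (1 - x \<bullet> x)) * (- 2 * (x \<bullet> h))
        + (- real m) * ((flat_exp (m + 1 + 2) (1 - x \<bullet> x) - real (m + 1) * flat_exp (m + 1 + 1) (1 - x \<bullet> x)) * (- 2 * (x \<bullet> h)))"
  have F: "(?F has_derivative ?D x) (at x)" for x :: "real^'n"
    by (intro has_derivative_add has_derivative_mult_right)
       (use flat_exp_sphere_has_derivative[of "m+2"] flat_exp_sphere_has_derivative[of "m+1"] in simp_all)
  have "((\<lambda>x. ?F x * (- 2 * (x $ j))) has_derivative (\<lambda>h. ?F x * (- 2 * (h $ j)) + ?D x h * (- 2 * x $ j))) (at x)"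
    for x and j :: 'n
    by (intro has_derivative_mult[OF F] has_derivative_mult_right bounded_linear_imp_has_derivative
          bounded_linear_vec_nth)
  from partial_eq[OF this]
  have P: "partial i (\<lambda>x. ?F x * (- 2 * (x $ j))) =
      (\<lambda>x. ?F x * (- 2 * (axis i 1 $ j)) + ?D x (axis i 1) * (- 2 * x $ j))" for i j :: 'n
    by (rule ext)
  show ?thesis
  proof (cases "i = j")
    case False
    then have "axis i (1::real) $ j = 0" "axis j (1::real) $ i = 0"
      by (auto simp: axis_def)
    then show ?thesis
      unfolding partial_flat_exp_sphere P
      by (intro ext) (simp add: inner_axis algebra_simps)
  qed simp
qed

section \<open>Lebesgue points\<close>

text \<open>Additivity over a Vitali family. Writing the sum as an integral over
  \<open>count_space\<close> avoids enumerating the index set and lets termwise estimates be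
  monotonicity of integrals.\<close>

lemma disjoint_cballs_measure:
  fixes N :: "'a::euclidean_space measure"
  assumes sets: "sets N = sets borel" and "countable C"
    and disj: "pairwise (\<lambda>i j. disjnt (cball (a i) (r i)) (cball (a j) (r j))) C"
  shows "(\<integral>\<^sup>+i. emeasure N (cball (a i) (r i)) \<partial>count_space C) = emeasure N (\<Union>i\<in>C. cball (a i) (r i))"
  by (subst emeasure_UN_countable)
     (use assms in \<open>auto simp: disjoint_family_on_def pairwise_def disjnt_def\<close>)

text \<open>Outer regularity encloses \<open>Z\<close> in an open set of tiny \<open>N\<close>-mass.
  A Vitali family of balls inside it that violate the density bound has volume at most a constant
  times that mass.\<close>

lemma negligible_dense_at_null:
  fixes N :: "'a::euclidean_space measure"
  assumes sets: "sets N = sets borel" and fin: "emeasure N (space N) \<noteq> \<infinity>"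
    and Z: "Z \<in> sets borel" "emeasure N Z = 0" and "\<epsilon> > 0"
  shows "negligible {x \<in> Z. \<forall>d>0. \<exists>r. 0 < r \<and> r < d \<and> \<epsilon> * r ^ DIM('a) < measure N (cball x r)}"
    (is "negligible ?B")
proof -
  interpret finite_measure N by (rule finite_measureI) (use fin in simp)
  define V where "V = unit_ball_vol (real DIM('a))"
  have V: "V > 0" by (simp add: V_def)
  show ?thesis
    unfolding negligible_outer_le
  proof (intro allI impI)
    fix e :: real assume "e > 0"
    \<comment> \<open>A ball whose \<open>N\<close>-mass exceeds \<epsilon> r^d has volume V r^d
      below V/\<epsilon> times that mass, so mass \<delta> becomes volume \<open>e\<close>.\<close>
    define \<delta> where "\<delta> = \<epsilon> * e / V"
    have "\<delta> > 0" using \<open>e > 0\<close> \<open>\<epsilon> > 0\<close> V by (simp add: \<delta>_def)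
    have "(INF U\<in>{U. Z \<subseteq> U \<and> open U}. emeasure N U) < ennreal \<delta>"
      using outer_regular[OF sets fin Z(1)] Z(2) \<open>\<delta> > 0\<close> by simp
    then obtain U where U: "Z \<subseteq> U" "open U" "emeasure N U < ennreal \<delta>"
      by (auto simp: INF_less_iff)
    define K where "K = {(x, r). x \<in> ?B \<and> 0 < r \<and> cball x r \<subseteq> U \<and> \<epsilon> * r ^ DIM('a) < measure N (cball x r)}"
    have cover: "\<exists>i. i \<in> K \<and> x \<in> cball (fst i) (snd i) \<and> snd i < d" if x: "x \<in> ?B" and d: "d > 0" for x d
    proof -
      obtain d' where d': "d' > 0" "cball x d' \<subseteq> U"
        using x U open_contains_cball by blast
      obtain r where "0 < r" "r < min d d'" "\<epsilon> * r ^ DIM('a) < measure N (cball x r)"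
      proof -
        have m: "0 < min d d'" using d d' by simp
        from x have "\<forall>d>0. \<exists>r. 0 < r \<and> r < d \<and> \<epsilon> * r ^ DIM('a) < measure N (cball x r)" by blast
        with m show ?thesis using that by blast
      qed
      moreover have "cball x r \<subseteq> cball x d'" using calculation by auto
      ultimately have "(x, r) \<in> K" using d' x unfolding K_def by blast
      then show ?thesis using \<open>0 < r\<close> \<open>r < min d d'\<close> by (intro exI[of _ "(x,r)"]) auto
    qed
    have "\<And>i. i \<in> K \<Longrightarrow> 0 < snd i" by (auto simp: K_def)
    from Vitali_covering_theorem_cballs[of K snd ?B fst, OF this cover]
    obtain C where C: "countable C" "C \<subseteq> K"
      "pairwise (\<lambda>i j. disjnt (cball (fst i) (snd i)) (cball (fst j) (snd j))) C"
      "negligible (?B - (\<Union>i\<in>C. cball (fst i) (snd i)))"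
      by blast
    let ?W = "\<Union>i\<in>C. cball (fst i) (snd i)"
    have W: "?W \<in> sets borel" using C(1) by (intro sets.countable_UN') auto
    have "emeasure lborel ?W = (\<integral>\<^sup>+i. emeasure lborel (cball (fst i) (snd i)) \<partial>count_space C)"
      by (rule disjoint_cballs_measure[symmetric]) (use C in auto)
    also have "\<dots> \<le> (\<integral>\<^sup>+i. ennreal (V / \<epsilon>) * emeasure N (cball (fst i) (snd i)) \<partial>count_space C)"
    proof (rule nn_integral_mono)
      fix i assume "i \<in> space (count_space C)"
      then have i: "i \<in> K" using C by auto
      then have "emeasure lborel (cball (fst i) (snd i)) = ennreal (V * snd i ^ DIM('a))"
        by (subst emeasure_cball) (auto simp: V_def K_def)
      also have "V * snd i ^ DIM('a) \<le> V / \<epsilon> * measure N (cball (fst i) (snd i))"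
        using i V \<open>\<epsilon> > 0\<close> by (auto simp: K_def field_simps)
      finally show "emeasure lborel (cball (fst i) (snd i)) \<le> ennreal (V / \<epsilon>) * emeasure N (cball (fst i) (snd i))"
        using V \<open>\<epsilon> > 0\<close> by (simp add: emeasure_eq_measure ennreal_mult' ennreal_leI flip: ennreal_mult)
    qed
    also have "\<dots> = ennreal (V / \<epsilon>) * emeasure N ?W"
      by (subst nn_integral_cmult) (use disjoint_cballs_measure[OF sets C(1,3)] in auto)
    also have "\<dots> \<le> ennreal (V / \<epsilon>) * emeasure N U"
    proof (intro mult_left_mono emeasure_mono)
      show "?W \<subseteq> U" using C(2) unfolding K_def by (intro UN_least) (metis (mono_tags, lifting) case_prod_beta mem_Collect_eq subsetD)
    qed (use U sets in auto)
    also have "\<dots> \<le> ennreal (V / \<epsilon>) * ennreal \<delta>"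
      using U by (intro mult_left_mono) auto
    also have "\<dots> = ennreal e"
      using V \<open>\<epsilon> > 0\<close> \<open>e > 0\<close> \<open>\<delta> > 0\<close> by (simp add: \<delta>_def flip: ennreal_mult)
    finally have We: "emeasure lborel ?W \<le> ennreal e" .
    \<comment> \<open>The set \<open>?B\<close> carries no measurability, but its part outside
      \<open>?W\<close> is null; adding \<open>?W\<close> gives a Lebesgue measurable
      superset.\<close>
    let ?T = "(?B - ?W) \<union> ?W"
    have N0: "?B - ?W \<in> null_sets lebesgue" using C(4) by (simp add: negligible_iff_null_sets)
    have W': "?W \<in> sets lborel" using W by simp
    have "emeasure lebesgue ?T = emeasure lebesgue ?W"
      using N0 W by (intro emeasure_Un_null_set[of ?W lebesgue, unfolded Un_commute[of ?W]]) auto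
    then have T: "emeasure lebesgue ?T \<le> ennreal e" using We W' by simp
    have "?T \<in> lmeasurable"
    proof (rule fmeasurableI)
      show "?T \<in> sets lebesgue" using N0 W' by (intro sets.Un) auto
      show "emeasure lebesgue ?T < \<infinity>" using T by (simp add: le_less_trans)
    qed
    moreover have "measure lebesgue ?T \<le> e"
      using T \<open>e > 0\<close> by (simp add: measure_def enn2real_leI)
    ultimately show "\<exists>T. ?B \<subseteq> T \<and> T \<in> lmeasurable \<and> measure lebesgue T \<le> e"
      by (intro exI[of _ ?T]) auto
  qed
qed

text \<open>The measure with density \<open>g\<close> vanishes on the zero set of \<open>g\<close>,
  so the preceding lemma applies to it; the countably many thresholds 1/(k+1) together give the
  limit.\<close>

lemma AE_density_0:
  fixes g :: "'a::euclidean_space \<Rightarrow> real"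
  assumes g: "integrable lborel g" and nn: "\<And>x. 0 \<le> g x"
  shows "AE x in lborel. g x = 0 \<longrightarrow>
    ((\<lambda>r. (LINT y:cball x r|lborel. g y) / r ^ DIM('a)) \<longlongrightarrow> 0) (at_right 0)"
proof -
  have gb[measurable]: "g \<in> borel_measurable borel" using g by auto
  define N where "N = density lborel g"
  have sets: "sets N = sets borel" by (simp add: N_def)
  have fin: "emeasure N (space N) \<noteq> \<infinity>"
    using g nn by (simp add: N_def emeasure_density nn_integral_eq_integral)
  interpret finite_measure N by (rule finite_measureI) (use fin in simp)
  have meas: "measure N A = (LINT y:A|lborel. g y)" if "A \<in> sets borel" for A
  proof -
    have "emeasure N A = (\<integral>\<^sup>+y. ennreal (indicator A y *\<^sub>R g y) \<partial>lborel)"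
      using that by (simp add: N_def emeasure_density ennreal_mult'' ennreal_indicator mult.commute nn
        ennreal_mult)
    also have "\<dots> = ennreal (LINT y:A|lborel. g y)"
      unfolding set_lebesgue_integral_def
      by (rule nn_integral_eq_integral) (use that nn integrable_mult_indicator[OF _ g, of A] in auto)
    finally show ?thesis
      using nn unfolding measure_def set_lebesgue_integral_def
      by (simp add: integral_nonneg_AE)
  qed
  define Z where "Z = {x. g x = 0}"
  have Z: "Z \<in> sets borel" "emeasure N Z = 0"
  proof -
    show "Z \<in> sets borel" unfolding Z_def by measurable
    then show "emeasure N Z = 0"
      unfolding N_def by (auto simp: emeasure_density Z_def nn_integral_0_iff_AE indicator_def)
  qed
  define B where "B k = {x \<in> Z. \<forall>d>0. \<exists>r. 0 < r \<and> r < d \<and> (1 / Suc k) * r ^ DIM('a) < measure N (cball x r)}" for k :: nat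
  have "negligible (\<Union>k. B k)"
  proof (intro negligible_countable_Union countable_image)
    fix S assume "S \<in> range B"
    then obtain k where k: "S = B k" by auto
    show "negligible S"
      unfolding k B_def by (rule negligible_dense_at_null[OF sets fin Z]) simp
  qed simp
  then have "AE x in lebesgue. x \<notin> (\<Union>k. B k)"
    unfolding negligible_iff_null_sets by (rule AE_not_in)
  then have "AE x in lborel. x \<notin> (\<Union>k. B k)"
    by (simp only: AE_completion_iff)
  then show ?thesis
  proof (rule AE_mp, intro AE_I2 impI)
    fix x assume x: "x \<notin> (\<Union>k. B k)" and gx: "g x = 0"
    have xZ: "x \<in> Z" using gx by (simp add: Z_def)
    show "((\<lambda>r. (LINT y:cball x r|lborel. g y) / r ^ DIM('a)) \<longlongrightarrow> 0) (at_right 0)"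
    proof (rule tendstoI)
      fix e :: real assume "e > 0"
      then obtain k where k: "1 / real (Suc k) < e" using nat_approx_posE by blast
      have "x \<notin> B k" using x by auto
      then obtain d where d: "d > 0" "\<And>r. 0 < r \<Longrightarrow> r < d \<Longrightarrow> measure N (cball x r) \<le> (1 / Suc k) * r ^ DIM('a)"
      proof -
        from \<open>x \<notin> B k\<close> xZ have "\<not> (\<forall>d>0. \<exists>r. 0 < r \<and> r < d \<and> (1 / Suc k) * r ^ DIM('a) < measure N (cball x r))"
          unfolding B_def by blast
        then show ?thesis using that by (meson not_less)
      qed
      have "dist ((LINT y:cball x r|lborel. g y) / r ^ DIM('a)) 0 < e" if "0 < r" "r < d" for r
      proof -
        have "0 \<le> (LINT y:cball x r|lborel. g y)"
          unfolding set_lebesgue_integral_def by (auto intro!: integral_nonneg_AE simp: nn)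
        moreover have "(LINT y:cball x r|lborel. g y) / r ^ DIM('a) \<le> 1 / Suc k"
          using d(2)[OF that] meas[of "cball x r"] that by (simp add: field_simps)
        ultimately show ?thesis using k that by simp
      qed
      then show "\<forall>\<^sub>F r in at_right 0. dist ((LINT y:cball x r|lborel. g y) / r ^ DIM('a)) 0 < e"
        using d(1) by (intro eventually_at_rightI[of 0 d]) auto
    qed
  qed
qed

text \<open>Bounding the sum by twice the maximum avoids convexity; the constant is not sharp, which
  never matters below.\<close>

lemma norm_power_triangle:
  fixes u v :: "'a::real_normed_vector"
  shows "norm (u + v) ^ p \<le> 2 ^ p * (norm u ^ p + norm v ^ p)"
proof -
  have "norm (u + v) \<le> 2 * max (norm u) (norm v)"
    using norm_triangle_ineq[of u v] by linarith
  then have "norm (u + v) ^ p \<le> (2 * max (norm u) (norm v)) ^ p"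
    by (intro power_mono) auto
  also have "\<dots> = 2 ^ p * max (norm u) (norm v) ^ p" by (simp add: power_mult_distrib)
  also have "\<dots> \<le> 2 ^ p * (norm u ^ p + norm v ^ p)"
    by (intro mult_left_mono) (auto simp: max_def)
  finally show ?thesis .
qed

text \<open>Reduction to points where a density vanishes. For \<open>q\<close> close to
  \<open>h x\<close>, the function |h - q|^p with its small values cut to zero vanishes at
  \<open>x\<close>, and what the cut removes is at most \<eta>^p. The centres \<open>q\<close>, the
  thresholds and the radii \<open>M\<close> range over countable sets, so one null set serves all of
  them.\<close>

theorem AE_Lebesgue_point:
  fixes h :: "'a::euclidean_space \<Rightarrow> 'b::euclidean_space"
  assumes [measurable]: "h \<in> borel_measurable borel" and h: "integrable lborel (\<lambda>x. norm (h x) ^ p)"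
    and p: "p > 0"
  shows "AE x in lborel.
    ((\<lambda>r. (LINT y:cball x r|lborel. norm (h y - h x) ^ p) / r ^ DIM('a)) \<longlongrightarrow> 0) (at_right 0)"
proof -
  define V where "V = unit_ball_vol (real DIM('a))"
  have V: "V > 0" by (simp add: V_def)
  obtain Q :: "'b set" where Q: "countable Q" "\<And>S. open S \<Longrightarrow> S \<noteq> {} \<Longrightarrow> \<exists>q\<in>Q. q \<in> S"
    using countable_dense_setE by blast
  have int: "integrable lborel (\<lambda>y. indicator (cball 0 M) y *\<^sub>R norm (h y - q) ^ p)" for M q
  proof (rule Bochner_Integration.integrable_bound)
    have "integrable lborel (\<lambda>y. indicator (cball 0 M) y *\<^sub>R norm q ^ p :: real)"
      by (cases "M \<ge> 0") (auto intro!: integrable_real_indicator simp: emeasure_cball)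
    then show "integrable lborel (\<lambda>y. 2 ^ p * (norm (h y) ^ p + indicator (cball 0 M) y *\<^sub>R norm q ^ p))"
      using h by auto
    show "AE y in lborel. norm (indicator (cball 0 M) y *\<^sub>R norm (h y - q) ^ p)
        \<le> norm (2 ^ p * (norm (h y) ^ p + indicator (cball 0 M) y *\<^sub>R norm q ^ p))"
      using norm_power_triangle[of "h _" "- q" p] by (auto intro!: AE_I2 simp: indicator_def)
  qed (auto intro!: borel_measurable_scaleR borel_measurable_indicator borel_measurable_power
      borel_measurable_norm borel_measurable_diff borel_measurable_times)
  define g where "g q \<eta> M y = (if norm (h y - q) > \<eta> \<and> norm y \<le> real M then norm (h y - q) ^ p else 0)"
    for q and \<eta> :: real and M :: nat and y
  have g_int: "integrable lborel (g q \<eta> M)" for q \<eta> M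
    by (rule Bochner_Integration.integrable_bound[OF int[of "real M" q]]) (auto simp: g_def[abs_def])
  have "AE x in lborel. \<forall>q\<in>Q. \<forall>k::nat. \<forall>M. g q (1 / Suc k) M x = 0 \<longrightarrow>
    ((\<lambda>r. (LINT y:cball x r|lborel. g q (1 / Suc k) M y) / r ^ DIM('a)) \<longlongrightarrow> 0) (at_right 0)"
    using Q(1) by (auto simp: AE_ball_countable AE_all_countable intro!: AE_density_0 g_int) (auto simp: g_def)
  then show ?thesis
  proof (rule AE_mp, intro AE_I2 impI)
    fix x assume x: "\<forall>q\<in>Q. \<forall>k::nat. \<forall>M. g q (1 / Suc k) M x = 0 \<longrightarrow>
      ((\<lambda>r. (LINT y:cball x r|lborel. g q (1 / Suc k) M y) / r ^ DIM('a)) \<longlongrightarrow> 0) (at_right 0)"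
    show "((\<lambda>r. (LINT y:cball x r|lborel. norm (h y - h x) ^ p) / r ^ DIM('a)) \<longlongrightarrow> 0) (at_right 0)"
    proof (rule tendstoI)
      fix e :: real assume e: "e > 0"
      \<comment> \<open>The final bound is 2^p (e' + 2 e' V) = e/2: one e' for the cut function, two
        for the errors \<eta>^p coming from |h y - q| below the cut and from |q - h x|.\<close>
      define e' where "e' = e / (2 * 2 ^ p * (1 + 2 * V))"
      have e': "e' > 0" using e V by (simp add: e'_def)
      obtain k where k0: "1 / real (Suc k) < min 1 e'" using e' nat_approx_posE[of "min 1 e'"] by auto
      define \<eta> where "\<eta> = 1 / real (Suc k)"
      have \<eta>: "\<eta> > 0" "\<eta> ^ p \<le> e'"
      proof -
        show "\<eta> > 0" by (simp add: \<eta>_def)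
        have "\<eta> ^ p \<le> \<eta> ^ 1" using p k0 by (intro power_decreasing) (auto simp: \<eta>_def)
        then show "\<eta> ^ p \<le> e'" using k0 by (simp add: \<eta>_def)
      qed
      obtain q where q: "q \<in> Q" "q \<in> ball (h x) \<eta>" using Q(2)[of "ball (h x) \<eta>"] \<eta> by auto
      then have qx: "norm (h x - q) < \<eta>" by (simp add: dist_norm)
      obtain M :: nat where M: "norm x + 1 \<le> real M" using real_arch_simple by blast
      have "g q \<eta> M x = 0" using qx by (simp add: g_def)
      then have lim: "((\<lambda>r. (LINT y:cball x r|lborel. g q \<eta> M y) / r ^ DIM('a)) \<longlongrightarrow> 0) (at_right 0)"
        using x q(1) unfolding \<eta>_def by blast
      have "\<forall>\<^sub>F r in at_right 0. dist ((LINT y:cball x r|lborel. g q \<eta> M y) / r ^ DIM('a)) 0 < e'"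
        using tendstoD[OF lim e'] .
      moreover have "\<forall>\<^sub>F r::real in at_right 0. 0 < r \<and> r < 1"
        by (intro eventually_at_rightI[of 0 1]) auto
      ultimately show "\<forall>\<^sub>F r in at_right 0. dist ((LINT y:cball x r|lborel. norm (h y - h x) ^ p) / r ^ DIM('a)) 0 < e"
      proof eventually_elim
        case (elim r)
        have sub: "cball x r \<subseteq> cball 0 M"
        proof
          fix y assume "y \<in> cball x r"
          then have "norm (y - x) \<le> 1" using elim by (simp add: dist_norm norm_minus_commute)
          then show "y \<in> cball 0 M" using M norm_triangle_sub[of y x] by simp
        qed
        have I1: "set_integrable lborel (cball x r) (g q \<eta> M)"
          unfolding set_integrable_def by (intro integrable_mult_indicator g_int) auto
        have "set_integrable lborel (cball 0 (real M)) (\<lambda>y. norm (h y - h x) ^ p)"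
          using int[of "real M" "h x"] unfolding set_integrable_def by simp
        then have I2: "set_integrable lborel (cball x r) (\<lambda>y. norm (h y - h x) ^ p)"
          by (rule set_integrable_subset) (use sub in auto)
        have fin: "emeasure lborel (cball x r) < \<infinity>" using elim by (simp add: emeasure_cball)
        have Ic: "set_integrable lborel (cball x r) (\<lambda>y. c)" for c :: real
          using fin unfolding set_integrable_def by (auto intro!: integrable_real_indicator)
        have "(LINT y:cball x r|lborel. norm (h y - h x) ^ p)
            \<le> (LINT y:cball x r|lborel. 2 ^ p * (g q \<eta> M y + 2 * e'))"
        proof (rule set_integral_mono[OF I2])
          show "set_integrable lborel (cball x r) (\<lambda>y. 2 ^ p * (g q \<eta> M y + 2 * e'))"
            by (intro set_integrable_mult_right set_integral_add I1 Ic)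
          fix y assume "y \<in> cball x r"
          then have y: "norm y \<le> M" using sub by auto
          have "norm (h y - h x) ^ p \<le> 2 ^ p * (norm (h y - q) ^ p + norm (q - h x) ^ p)"
            using norm_power_triangle[of "h y - q" "q - h x" p] by simp
          also have "norm (q - h x) ^ p \<le> e'"
            using power_mono[of "norm (q - h x)" \<eta> p] qx \<eta> by (simp add: norm_minus_commute)
          also have "norm (h y - q) ^ p \<le> g q \<eta> M y + e'"
          proof (cases "norm (h y - q) > \<eta>")
            case False
            then have "norm (h y - q) ^ p \<le> \<eta> ^ p" by (intro power_mono) auto
            then show ?thesis using \<eta>(2) False by (simp add: g_def)
          qed (use y e' in \<open>simp add: g_def\<close>)
          finally show "norm (h y - h x) ^ p \<le> 2 ^ p * (g q \<eta> M y + 2 * e')" by (simp add: algebra_simps)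
        qed
        also have "\<dots> = 2 ^ p * ((LINT y:cball x r|lborel. g q \<eta> M y) + 2 * e' * (V * r ^ DIM('a)))"
        proof -
          have "(LINT y:cball x r|lborel. g q \<eta> M y + 2 * e') = (LINT y:cball x r|lborel. g q \<eta> M y) + (LINT y:cball x r|lborel. 2 * e')"
            by (rule set_integral_add[OF I1 Ic])
          also have "(LINT y:cball x r|lborel. 2 * e') = 2 * e' * (V * r ^ DIM('a))"
            using fin elim by (subst set_integral_const) (auto simp: content_cball V_def)
          finally show ?thesis by simp
        qed
        finally have "(LINT y:cball x r|lborel. norm (h y - h x) ^ p) / r ^ DIM('a)
            \<le> 2 ^ p * ((LINT y:cball x r|lborel. g q \<eta> M y) / r ^ DIM('a) + 2 * e' * V)"
          using elim by (simp add: field_simps)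
        also have "\<dots> \<le> 2 ^ p * (e' + 2 * e' * V)"
          using elim by (intro mult_left_mono add_right_mono) (auto simp: dest: abs_le_D1 intro: order_trans[OF abs_ge_self] less_imp_le)
        also have "\<dots> = e / 2" using V by (simp add: e'_def divide_simps) (simp add: algebra_simps)?
        also have "\<dots> < e" using e by simp
        finally show ?case
          using elim unfolding set_lebesgue_integral_def by (simp add: integral_nonneg_AE)
      qed
    qed
  qed
qed

section \<open>Mollification\<close>

lemma lborel_integral_affine:
  fixes f :: "'a::euclidean_space \<Rightarrow> 'b::{banach, second_countable_topology}"
  assumes c: "c \<noteq> 0" and [measurable]: "f \<in> borel_measurable borel"
  shows "(LINT x|lborel. f x) = \<bar>c\<bar> ^ DIM('a) *\<^sub>R (LINT x|lborel. f (t + c *\<^sub>R x))"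
  by (subst lborel_affine[OF c, of t]) (simp add: integral_density integral_distr)

lemma lborel_integrable_affine:
  fixes f :: "'a::euclidean_space \<Rightarrow> 'b::{banach, second_countable_topology}"
  assumes c: "c \<noteq> 0" and f: "integrable lborel f"
  shows "integrable lborel (\<lambda>x. f (t + c *\<^sub>R x))"
proof -
  have [measurable]: "f \<in> borel_measurable borel" using f by auto
  have "integrable (density (distr lborel borel (\<lambda>x. t + c *\<^sub>R x)) (\<lambda>_. \<bar>c\<bar> ^ DIM('a))) f"
    using f by (simp only: lborel_affine[OF c, of t, symmetric])
  then have "integrable lborel (\<lambda>x. \<bar>c\<bar> ^ DIM('a) *\<^sub>R f (t + c *\<^sub>R x))"
    by (simp add: integrable_density integrable_distr_eq)
  from integrable_scaleR_right[OF this, of "inverse (\<bar>c\<bar> ^ DIM('a))"]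
  show ?thesis using c by simp
qed

section \<open>Jensen's inequality for powers\<close>

lemma power_tangent_le:
  fixes a t :: real
  assumes "0 \<le> a" "0 \<le> t" "p > 0"
  shows "a ^ p + p * a ^ (p - 1) * (t - a) \<le> t ^ p"
proof (cases "a = 0")
  case True
  then show ?thesis using assms by (cases "p = 1") (auto simp: power_0_left)
next
  case False
  then have a: "a > 0" using assms by simp
  \<comment> \<open>Bernoulli's inequality at t/a is the tangent line inequality up to the factor
    a^p.\<close>
  have "1 + real p * (t / a - 1) \<le> (1 + (t / a - 1)) ^ p"
    using a assms by (intro Bernoulli_inequality) simp
  then have "a ^ p * (1 + real p * (t / a - 1)) \<le> a ^ p * (t / a) ^ p"
    using a by (intro mult_left_mono) auto
  also have "\<dots> = t ^ p" using a by (simp add: power_divide)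
  also have "a ^ p * (1 + real p * (t / a - 1)) = a ^ p + p * a ^ (p - 1) * (t - a)"
    using a assms by (cases p) (auto simp: field_simps)
  finally show ?thesis .
qed

text \<open>The tangent line inequality at the mean \<open>a\<close>, integrated against the
  weight.\<close>

lemma jensen_power:
  fixes w X :: "'a \<Rightarrow> real"
  assumes w: "\<And>x. 0 \<le> w x" "integrable M w" "(LINT x|M. w x) = 1"
    and X: "\<And>x. 0 \<le> X x" "integrable M (\<lambda>x. w x * X x)" "integrable M (\<lambda>x. w x * X x ^ p)"
    and p: "p > 0"
  shows "(LINT x|M. w x * X x) ^ p \<le> (LINT x|M. w x * X x ^ p)"
proof -
  define a where "a = (LINT x|M. w x * X x)"
  have a: "a \<ge> 0" unfolding a_def using w X by (intro integral_nonneg_AE) auto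
  have "(LINT x|M. (a ^ p - p * a ^ (p - 1) * a) * w x + p * a ^ (p - 1) * (w x * X x)) \<le> (LINT x|M. w x * X x ^ p)"
  proof (rule integral_mono)
    fix x
    have "w x * (a ^ p + p * a ^ (p - 1) * (X x - a)) \<le> w x * X x ^ p"
      using w X a p by (intro mult_left_mono power_tangent_le) auto
    then show "(a ^ p - p * a ^ (p - 1) * a) * w x + p * a ^ (p - 1) * (w x * X x) \<le> w x * X x ^ p"
      by (simp add: algebra_simps)
  qed (use w X in auto)
  also have "(LINT x|M. (a ^ p - p * a ^ (p - 1) * a) * w x + p * a ^ (p - 1) * (w x * X x)) = a ^ p"
    using w X by (simp add: a_def[symmetric])
  finally show ?thesis unfolding a_def .
qed

section \<open>The standard mollifier and its convergence in L^p\<close>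

definition bump :: "real^'n::finite \<Rightarrow> real" where
  "bump x = flat_exp 0 (1 - x \<bullet> x) / (LINT y|lborel. flat_exp 0 (1 - (y::real^'n) \<bullet> y))"

lemma flat_exp_0_le_1: "flat_exp 0 t \<le> 1"
  by (simp add: flat_exp_def)

lemma continuous_flat_exp_sphere: "continuous_on UNIV (\<lambda>x::real^'n. flat_exp m (1 - x \<bullet> x))"
  using Ck_flat_exp_sphere[of 0] by simp

lemma flat_exp_sphere_eq_0: "1 \<le> norm x \<Longrightarrow> flat_exp m (1 - x \<bullet> x) = 0"
  by (simp add: flat_exp_def dot_square_norm not_less power2_eq_square) (metis mult_mono' mult_1 zero_le_one)

lemma integrable_continuous_bounded_support:
  fixes f :: "'a::euclidean_space \<Rightarrow> 'b::{banach, second_countable_topology}"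
  assumes "continuous_on UNIV f" "\<And>x. norm x > B \<Longrightarrow> f x = 0"
  shows "integrable lborel f"
proof -
  have "integrable lborel (\<lambda>x. indicator (cball 0 B) x *\<^sub>R f x)"
    using assms by (intro borel_integrable_compact) (auto intro: continuous_on_subset)
  also have "(\<lambda>x. indicator (cball 0 B) x *\<^sub>R f x) = f"
    using assms(2) by (auto simp: indicator_def fun_eq_iff not_le)
  finally show ?thesis .
qed

lemma integrable_flat_exp_sphere: "integrable lborel (\<lambda>x::real^'n. flat_exp m (1 - x \<bullet> x))"
  by (rule integrable_continuous_bounded_support[OF continuous_flat_exp_sphere, of 1])
     (simp add: flat_exp_sphere_eq_0)

lemma integral_flat_exp_sphere_pos: "0 < (LINT y|lborel. flat_exp 0 (1 - (y::real^'n) \<bullet> y))"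
proof -
  let ?f = "\<lambda>y::real^'n. flat_exp 0 (1 - y \<bullet> y)"
  have "(LINT y|lborel. ?f y) \<noteq> 0"
  proof
    assume "(LINT y|lborel. ?f y) = 0"
    then have "AE y in lborel. ?f y = 0"
      using integral_nonneg_eq_0_iff_AE[OF integrable_flat_exp_sphere[where 'n='n and m=0]] by (simp add: flat_exp_nonneg)
    then have "AE y in lborel. (y::real^'n) \<notin> ball 0 1"
    proof eventually_elim
      case (elim y)
      then have "\<not> 0 < 1 - y \<bullet> y" using flat_exp_pos_iff[of 0 "1 - y \<bullet> y"] by simp
      moreover have "y \<bullet> y < 1" if "norm y < 1"
        using that by (simp add: dot_square_norm power_less_one_iff)
      ultimately show ?case by auto
    qed
    then have "emeasure lborel (ball (0::real^'n) 1) = 0"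
      by (subst (asm) AE_iff_measurable[of "ball 0 1"]) auto
    moreover have "unit_ball_vol (real CARD('n)) \<noteq> 0"
      by (metis unit_ball_vol_pos of_nat_0_le_iff less_irrefl)
    ultimately show False by (simp add: emeasure_ball)
  qed
  moreover have "(LINT y|lborel. ?f y) \<ge> 0" by (simp add: flat_exp_nonneg integral_nonneg_AE)
  ultimately show ?thesis by simp
qed

lemma integral_flat_exp_sphere_neq_0: "(LINT y|lborel. flat_exp 0 (1 - (y::real^'n) \<bullet> y)) \<noteq> 0"
  using integral_flat_exp_sphere_pos[where 'n='n] by simp

lemma bump_nonneg: "0 \<le> bump x"
  unfolding bump_def by (intro divide_nonneg_pos flat_exp_nonneg integral_flat_exp_sphere_pos)

lemma bump_eq_0: "1 \<le> norm x \<Longrightarrow> bump x = 0"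
  by (simp add: bump_def flat_exp_sphere_eq_0)

lemma bump_bounded: "\<exists>C>0. \<forall>x::real^'n. bump x \<le> C"
  using integral_flat_exp_sphere_pos[where 'n='n] flat_exp_0_le_1
  by (intro exI[of _ "1 / (LINT y|lborel. flat_exp 0 (1 - (y::real^'n) \<bullet> y))"])
     (auto simp: bump_def divide_right_mono)

lemma continuous_bump: "continuous_on UNIV bump"
  unfolding bump_def
  by (intro continuous_intros continuous_flat_exp_sphere) (simp add: integral_flat_exp_sphere_neq_0)

lemma integrable_bump: "integrable lborel bump"
  unfolding bump_def by (intro integrable_divide_zero integrable_flat_exp_sphere)

lemma integral_bump: "(LINT x|lborel. bump (x::real^'n)) = 1"
  unfolding bump_def using integral_flat_exp_sphere_pos[where 'n='n] by simp

definition mkern :: "real \<Rightarrow> real^'n::finite \<Rightarrow> real" where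
  "mkern \<delta> z = bump (z /\<^sub>R \<delta>) / \<delta> ^ CARD('n)"

lemma mkern_nonneg: "\<delta> > 0 \<Longrightarrow> 0 \<le> mkern \<delta> z"
  by (simp add: mkern_def bump_nonneg)

lemma mkern_eq_0: "\<delta> > 0 \<Longrightarrow> \<delta> \<le> norm z \<Longrightarrow> mkern \<delta> z = 0"
  by (simp add: mkern_def bump_eq_0 field_simps)

lemma continuous_mkern: "continuous_on UNIV (mkern \<delta>)"
  unfolding mkern_def
  by (cases "\<delta> = 0") (auto intro!: continuous_intros continuous_on_compose2[OF continuous_bump])

lemma borel_mkern[measurable]: "mkern \<delta> \<in> borel_measurable borel"
  by (rule borel_measurable_continuous_onI[OF continuous_mkern])

lemma mkern_shift:
  fixes x :: "real^'n"
  assumes "\<delta> > 0"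
  shows "integrable lborel (\<lambda>y. mkern \<delta> (x - y))" "(LINT y|lborel. mkern \<delta> (x - y)) = 1"
    "integrable lborel (\<lambda>y. mkern \<delta> (y - x))" "(LINT y|lborel. mkern \<delta> (y - x)) = 1"
proof -
  have i: "integrable lborel (mkern \<delta> :: real^'n \<Rightarrow> real)"
    using lborel_integrable_affine[OF _ integrable_bump, of "1/\<delta>" 0] assms
    by (auto simp: mkern_def[abs_def] divide_inverse)
  have e: "(LINT z|lborel. mkern \<delta> (z::real^'n)) = 1"
  proof -
    have "bump \<in> borel_measurable (borel :: (real^'n) measure)"
      by (rule borel_measurable_continuous_onI[OF continuous_bump])
    from lborel_integral_affine[OF _ this, of "inverse \<delta>" 0] assms integral_bump[where 'n='n]
    have "inverse \<delta> ^ CARD('n) * (LINT z|lborel. bump (z /\<^sub>R \<delta> :: real^'n)) = 1" by simp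
    then show ?thesis by (simp add: mkern_def[abs_def] power_inverse divide_inverse mult.commute)
  qed
  show "integrable lborel (\<lambda>y. mkern \<delta> (x - y))" "(LINT y|lborel. mkern \<delta> (x - y)) = 1"
    using lborel_integrable_affine[OF _ i, of "-1" x] lborel_integral_affine[of "-1" "mkern \<delta>" x] e by auto
  show "integrable lborel (\<lambda>y. mkern \<delta> (y - x))" "(LINT y|lborel. mkern \<delta> (y - x)) = 1"
    using lborel_integrable_affine[OF _ i, of "1" "-x"] lborel_integral_affine[of "1" "mkern \<delta>" "-x"] e
    by (auto simp: algebra_simps)
qed

definition mollify :: "real \<Rightarrow> (real^'n::finite \<Rightarrow> 'b) \<Rightarrow> real^'n \<Rightarrow> 'b::{banach, second_countable_topology}" where
  "mollify \<delta> g x = (LINT y|lborel. mkern \<delta> (x - y) *\<^sub>R g y)"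

lemma mkern_bounded: "\<exists>C>0. \<forall>\<delta>>0. \<forall>z::real^'n. mkern \<delta> z \<le> C / \<delta> ^ CARD('n)"
  using bump_bounded[where 'n='n] by (auto simp: mkern_def divide_right_mono)

lemma mollify_integrable:
  fixes g :: "real^'n \<Rightarrow> 'b::{banach, second_countable_topology}"
  assumes "\<delta> > 0" "integrable lborel g"
  shows "integrable lborel (\<lambda>y. mkern \<delta> (x - y) *\<^sub>R g y)"
proof -
  obtain C where C: "C > 0" "\<forall>\<delta>>0. \<forall>z::real^'n. mkern \<delta> z \<le> C / \<delta> ^ CARD('n)"
    using mkern_bounded by blast
  have [measurable]: "g \<in> borel_measurable borel" using assms by auto
  show ?thesis
  proof (rule Bochner_Integration.integrable_bound)
    show "integrable lborel (\<lambda>y. (C / \<delta> ^ CARD('n)) * norm (g y))" using assms by auto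
    show "AE y in lborel. norm (mkern \<delta> (x - y) *\<^sub>R g y) \<le> norm ((C / \<delta> ^ CARD('n)) * norm (g y))"
    proof (rule AE_I2)
      fix y
      have "mkern \<delta> (x - y) * norm (g y) \<le> C / \<delta> ^ CARD('n) * norm (g y)"
        using C assms by (intro mult_right_mono) auto
      then show "norm (mkern \<delta> (x - y) *\<^sub>R g y) \<le> norm ((C / \<delta> ^ CARD('n)) * norm (g y))"
        using C assms by (simp add: mkern_nonneg)
    qed
  qed measurable
qed

lemma borel_mollify[measurable]:
  fixes g :: "real^'n \<Rightarrow> 'b::{banach, second_countable_topology}"
  assumes [measurable]: "g \<in> borel_measurable borel"
  shows "mollify \<delta> g \<in> borel_measurable borel"
  unfolding mollify_def[abs_def] by measurable

text \<open>The kernel lives in a ball of radius \<delta> and is at most C/\<delta>^n there, so the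
  error is bounded by \<open>C\<close> times the average in hypothesis \<open>L\<close>. The
  exponent 1 is kept because \<open>AE_Lebesgue_point\<close> delivers \<open>L\<close> in this
  shape.\<close>

lemma mollify_tendsto:
  fixes g :: "real^'n \<Rightarrow> 'b::{banach, second_countable_topology}"
  assumes g: "integrable lborel g" and \<delta>: "\<And>k. \<delta> k > 0" "\<delta> \<longlonglongrightarrow> 0"
    and L: "((\<lambda>r. (LINT y:cball x r|lborel. norm (g y - g x) ^ 1) / r ^ DIM(real^'n)) \<longlongrightarrow> 0) (at_right 0)"
  shows "(\<lambda>k. mollify (\<delta> k) g x) \<longlonglongrightarrow> g x"
proof -
  obtain C where C: "C > 0" "\<forall>\<delta>>0. \<forall>z::real^'n. mkern \<delta> z \<le> C / \<delta> ^ CARD('n)"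
    using mkern_bounded by blast
  have [measurable]: "g \<in> borel_measurable borel" using g by auto
  have bound: "norm (mollify (\<delta> k) g x - g x)
      \<le> C * ((LINT y:cball x (\<delta> k)|lborel. norm (g y - g x) ^ 1) / \<delta> k ^ DIM(real^'n))" for k
  proof -
    have i2: "integrable lborel (\<lambda>y. mkern (\<delta> k) (x - y) *\<^sub>R g x)"
      using mkern_shift(1)[OF \<delta>(1), of k x] by (intro integrable_scaleR_left) auto
    have "(LINT y|lborel. mkern (\<delta> k) (x - y) *\<^sub>R g x) = (LINT y|lborel. mkern (\<delta> k) (x - y)) *\<^sub>R g x"
      by (rule integral_scaleR_left) (use mkern_shift(1)[OF \<delta>(1), of k x] in auto)
    then have "mollify (\<delta> k) g x - g x = (LINT y|lborel. mkern (\<delta> k) (x - y) *\<^sub>R g y - mkern (\<delta> k) (x - y) *\<^sub>R g x)"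
      using mollify_integrable[OF \<delta>(1) g] i2 mkern_shift(2)[OF \<delta>(1)[of k], of x] by (simp add: mollify_def)
    also have "\<dots> = (LINT y|lborel. mkern (\<delta> k) (x - y) *\<^sub>R (g y - g x))" by (simp add: algebra_simps)
    also have "norm \<dots> \<le> (LINT y|lborel. norm (mkern (\<delta> k) (x - y) *\<^sub>R (g y - g x)))"
      by (rule integral_norm_bound)
    also have "\<dots> \<le> (LINT y:cball x (\<delta> k)|lborel. C / \<delta> k ^ CARD('n) * norm (g y - g x))"
      unfolding set_lebesgue_integral_def
    proof (rule integral_mono)
      have "integrable lborel (\<lambda>y. mkern (\<delta> k) (x - y) *\<^sub>R (g y - g x))"
        using Bochner_Integration.integrable_diff[OF mollify_integrable[OF \<delta>(1) g] i2] by (simp add: algebra_simps)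
      then show "integrable lborel (\<lambda>y. norm (mkern (\<delta> k) (x - y) *\<^sub>R (g y - g x)))" by (rule integrable_norm)
      have "integrable lborel (\<lambda>y. norm (g y) + indicator (cball x (\<delta> k)) y *\<^sub>R norm (g x))"
        using g by (auto intro!: integrable_real_indicator simp: emeasure_cball \<delta> less_imp_le)
      then have "integrable lborel (\<lambda>y. indicator (cball x (\<delta> k)) y *\<^sub>R norm (g y - g x))"
        by (rule Bochner_Integration.integrable_bound)
           (auto simp: indicator_def norm_triangle_ineq4 intro!: borel_measurable_times borel_measurable_indicator)
      then show "integrable lborel (\<lambda>y. indicator (cball x (\<delta> k)) y *\<^sub>R (C / \<delta> k ^ CARD('n) * norm (g y - g x)))"
        by (auto simp: mult.left_commute)
      fix y
      show "norm (mkern (\<delta> k) (x - y) *\<^sub>R (g y - g x))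
          \<le> indicator (cball x (\<delta> k)) y *\<^sub>R (C / \<delta> k ^ CARD('n) * norm (g y - g x))"
      proof (cases "y \<in> cball x (\<delta> k)")
        case True
        have "mkern (\<delta> k) (x - y) * norm (g y - g x) \<le> C / \<delta> k ^ CARD('n) * norm (g y - g x)"
          using C \<delta>(1) by (intro mult_right_mono) auto
        then show ?thesis using True \<delta>(1)[of k] by (simp add: mkern_nonneg)
      next
        case False
        then show ?thesis using mkern_eq_0[of "\<delta> k" "x - y"] \<delta>(1)[of k] by (simp add: dist_norm)
      qed
    qed
    finally show ?thesis by simp
  qed
  have "filterlim \<delta> (at_right 0) sequentially"
    unfolding filterlim_at
  proof
    show "\<forall>\<^sub>F k in sequentially. \<delta> k \<in> {0<..} \<and> \<delta> k \<noteq> 0"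
      using \<delta>(1) less_imp_neq[OF \<delta>(1)] by (intro always_eventually allI) (simp add: less_imp_neq[THEN not_sym])
  qed (rule \<delta>(2))
  from filterlim_compose[OF L this]
  have "(\<lambda>k. C * ((LINT y:cball x (\<delta> k)|lborel. norm (g y - g x) ^ 1) / \<delta> k ^ DIM(real^'n))) \<longlonglongrightarrow> C * 0"
    by (intro tendsto_mult tendsto_const)
  then have "(\<lambda>k. mollify (\<delta> k) g x - g x) \<longlonglongrightarrow> 0"
    by (intro Lim_null_comparison[OF always_eventually[OF allI[OF bound]]]) simp
  then show ?thesis by (simp add: LIM_zero_iff)
qed

text \<open>Jensen's inequality with the kernel as probability weight.\<close>

lemma norm_mollify_power_le:
  fixes g :: "real^'n \<Rightarrow> 'b::{banach, second_countable_topology}"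
  assumes "\<delta> > 0" and g: "integrable lborel g" "integrable lborel (\<lambda>x. norm (g x) ^ p)" and "p > 0"
  shows "norm (mollify \<delta> g x) ^ p \<le> mollify \<delta> (\<lambda>x. norm (g x) ^ p) x"
proof -
  have "norm (mollify \<delta> g x) \<le> (LINT y|lborel. norm (mkern \<delta> (x - y) *\<^sub>R g y))"
    unfolding mollify_def by (rule integral_norm_bound)
  also have "\<dots> = (LINT y|lborel. mkern \<delta> (x - y) * norm (g y))"
    using assms by (simp add: mkern_nonneg)
  finally have "norm (mollify \<delta> g x) ^ p \<le> \<dots> ^ p" by (intro power_mono) auto
  also have "\<dots> \<le> (LINT y|lborel. mkern \<delta> (x - y) * norm (g y) ^ p)"
    using mollify_integrable[OF assms(1) integrable_norm[OF g(1)], of x]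
      mollify_integrable[OF assms(1) g(2), of x] assms mkern_shift(1,2)[OF assms(1)]
    by (intro jensen_power) (auto simp: mkern_nonneg)
  finally show ?thesis by (simp add: mollify_def)
qed

text \<open>Tonelli's theorem, since the kernel has mass one in either variable. Preservation of
  mass is what gives the dominating functions in the next theorem a constant integral.\<close>

lemma mollify_nonneg_integral:
  fixes h :: "real^'n \<Rightarrow> real"
  assumes "\<delta> > 0" and h: "integrable lborel h" "\<And>x. 0 \<le> h x"
  shows "integrable lborel (mollify \<delta> h)" "(LINT x|lborel. mollify \<delta> h x) = (LINT x|lborel. h x)"
    "\<And>x. 0 \<le> mollify \<delta> h x"
proof -
  have [measurable]: "h \<in> borel_measurable borel" using h by auto
  show nn: "\<And>x. 0 \<le> mollify \<delta> h x"
    unfolding mollify_def using assms by (intro integral_nonneg_AE) (auto simp: mkern_nonneg)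
  have e: "ennreal (mollify \<delta> h x) = (\<integral>\<^sup>+y. ennreal (mkern \<delta> (x - y) * h y) \<partial>lborel)" for x
    unfolding mollify_def
    by (subst nn_integral_eq_integral[OF mollify_integrable[OF assms(1) h(1), of x, simplified]])
       (use assms in \<open>auto simp: mkern_nonneg\<close>)
  have "(\<integral>\<^sup>+x. ennreal (mollify \<delta> h x) \<partial>lborel) = (\<integral>\<^sup>+x. \<integral>\<^sup>+y. ennreal (mkern \<delta> (x - y) * h y) \<partial>lborel \<partial>lborel)"
    by (simp only: e)
  also have "\<dots> = (\<integral>\<^sup>+y. \<integral>\<^sup>+x. ennreal (mkern \<delta> (x - y) * h y) \<partial>lborel \<partial>lborel)"
    by (rule lborel_pair.Fubini') measurable
  also have "\<dots> = (\<integral>\<^sup>+y. ennreal (h y) \<partial>lborel)"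
  proof (rule nn_integral_cong)
    fix y
    have "(\<integral>\<^sup>+x. ennreal (mkern \<delta> (x - y) * h y) \<partial>lborel) = ennreal (LINT x|lborel. mkern \<delta> (x - y) * h y)"
      using mkern_shift(3)[OF assms(1), of y] assms
      by (intro nn_integral_eq_integral) (auto simp: mkern_nonneg)
    then show "(\<integral>\<^sup>+x. ennreal (mkern \<delta> (x - y) * h y) \<partial>lborel) = ennreal (h y)"
      using mkern_shift(3,4)[OF assms(1), of y] by simp
  qed
  also have "\<dots> = ennreal (LINT x|lborel. h x)" using h by (intro nn_integral_eq_integral) auto
  finally have E: "(\<integral>\<^sup>+x. ennreal (mollify \<delta> h x) \<partial>lborel) = ennreal (LINT x|lborel. h x)" .
  show I: "integrable lborel (mollify \<delta> h)"
    by (rule integrableI_nonneg) (use E nn in auto)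
  show "(LINT x|lborel. mollify \<delta> h x) = (LINT x|lborel. h x)"
    using E nn_integral_eq_integral[OF I] nn h(2)
    by (simp add: integral_nonneg_AE)
qed

text \<open>The differences tend to zero at common Lebesgue points of \<open>g\<close> and of |g|^p.
  They are dominated by functions that vary with \<open>k\<close> but all have the integral
  \<open>S\<close>, so dominated convergence is replaced by Fatou's lemma for the gap.\<close>

theorem mollify_Lp_tendsto:
  fixes g :: "real^'n \<Rightarrow> 'b::euclidean_space"
  assumes g: "integrable lborel g" "integrable lborel (\<lambda>x. norm (g x) ^ p)" and p: "p > 0"
    and \<delta>: "\<And>k. \<delta> k > 0" "\<delta> \<longlonglongrightarrow> 0"
  shows "\<And>k. integrable lborel (\<lambda>x. norm (mollify (\<delta> k) g x - g x) ^ p)"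
    and "(\<lambda>k. LINT x|lborel. norm (mollify (\<delta> k) g x - g x) ^ p) \<longlonglongrightarrow> 0"
proof -
  have [measurable]: "g \<in> borel_measurable borel" using g by auto
  define h where "h x = norm (g x) ^ p" for x
  have h: "integrable lborel h" "\<And>x. 0 \<le> h x" using g by (auto simp: h_def[abs_def])
  define H where "H k = mollify (\<delta> k) h" for k
  have H: "integrable lborel (H k)" "(LINT x|lborel. H k x) = (LINT x|lborel. h x)" "\<And>x. 0 \<le> H k x" for k
    unfolding H_def using mollify_nonneg_integral[OF \<delta>(1) h] by auto
  define d where "d k x = norm (mollify (\<delta> k) g x - g x) ^ p" for k x
  have d0: "0 \<le> d k x" for k x by (simp add: d_def)
  have le: "d k x \<le> 2 ^ p * (H k x + h x)" for k x
  proof -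
    have "d k x \<le> 2 ^ p * (norm (mollify (\<delta> k) g x) ^ p + norm (g x) ^ p)"
      using norm_power_triangle[of "mollify (\<delta> k) g x" "- g x" p] by (simp add: d_def)
    also have "\<dots> \<le> 2 ^ p * (H k x + h x)"
      using norm_mollify_power_le[OF \<delta>(1) g p, of k x] by (auto simp: H_def h_def[abs_def])
    finally show ?thesis .
  qed
  have dI: "integrable lborel (d k)" for k
  proof (rule Bochner_Integration.integrable_bound)
    show "integrable lborel (\<lambda>x. 2 ^ p * (H k x + h x))" using H h by auto
    show "d k \<in> borel_measurable lborel" unfolding d_def[abs_def] by measurable
    show "AE x in lborel. norm (d k x) \<le> norm (2 ^ p * (H k x + h x))"
      using le d0 H h by (intro AE_I2) (metis abs_of_nonneg order_trans real_norm_def)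
  qed
  then show "\<And>k. integrable lborel (\<lambda>x. norm (mollify (\<delta> k) g x - g x) ^ p)" by (simp add: d_def[abs_def])
  have L1: "AE x in lborel. ((\<lambda>r. (LINT y:cball x r|lborel. norm (g y - g x) ^ 1) / r ^ DIM(real^'n)) \<longlongrightarrow> 0) (at_right 0)"
    by (rule AE_Lebesgue_point) (use g in auto)
  have L2: "AE x in lborel. ((\<lambda>r. (LINT y:cball x r|lborel. norm (h y - h x) ^ 1) / r ^ DIM(real^'n)) \<longlongrightarrow> 0) (at_right 0)"
    by (rule AE_Lebesgue_point) (use h in \<open>auto simp: h_def[abs_def]\<close>)
  define S where "S = 2 ^ p * (2 * (LINT x|lborel. h x))"
  define a where "a k = (LINT x|lborel. d k x)" for k
  have a0: "0 \<le> a k" for k unfolding a_def using d0 by (intro integral_nonneg_AE) auto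
  have S0: "S \<ge> 0" unfolding S_def using h by (auto intro!: integral_nonneg_AE)
  have Sa: "(\<integral>\<^sup>+x. ennreal (2 ^ p * (H k x + h x) - d k x) \<partial>lborel) = ennreal (S - a k)" and aS: "a k \<le> S" for k
  proof -
    have i: "integrable lborel (\<lambda>x. 2 ^ p * (H k x + h x) - d k x)" using H h dI by auto
    have "(LINT x|lborel. 2 ^ p * (H k x + h x) - d k x) = S - a k"
      using H h dI by (simp add: S_def a_def)
    moreover have "0 \<le> (LINT x|lborel. 2 ^ p * (H k x + h x) - d k x)"
      using le by (intro integral_nonneg_AE) auto
    ultimately show "(\<integral>\<^sup>+x. ennreal (2 ^ p * (H k x + h x) - d k x) \<partial>lborel) = ennreal (S - a k)" "a k \<le> S"
      using nn_integral_eq_integral[OF i] le by auto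
  qed
  \<comment> \<open>The gap converges a.e. to a function of integral \<open>S\<close>, so Fatou
    gives S <= liminf (S - a k), which forces \<open>a k\<close> to zero.\<close>
  have "ennreal S = (\<integral>\<^sup>+x. ennreal (2 ^ p * (2 * h x)) \<partial>lborel)"
    using nn_integral_eq_integral[of lborel "\<lambda>x. 2 ^ p * (2 * h x)"] h by (simp add: S_def)
  also have "\<dots> = (\<integral>\<^sup>+x. liminf (\<lambda>k. ennreal (2 ^ p * (H k x + h x) - d k x)) \<partial>lborel)"
  proof (rule nn_integral_cong_AE)
    show "AE x in lborel. ennreal (2 ^ p * (2 * h x)) = liminf (\<lambda>k. ennreal (2 ^ p * (H k x + h x) - d k x))"
      using L1 L2
    proof eventually_elim
      case (elim x)
      have "(\<lambda>k. mollify (\<delta> k) g x - g x) \<longlonglongrightarrow> 0"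
        using mollify_tendsto[OF g(1) \<delta> elim(1)] by (simp add: LIM_zero)
      then have "(\<lambda>k. d k x) \<longlonglongrightarrow> 0 ^ p"
        unfolding d_def by (intro tendsto_power) (rule tendsto_norm_zero)
      moreover have "(\<lambda>k. H k x) \<longlonglongrightarrow> h x" unfolding H_def by (rule mollify_tendsto[OF h(1) \<delta> elim(2)])
      ultimately have "(\<lambda>k. 2 ^ p * (H k x + h x) - d k x) \<longlonglongrightarrow> 2 ^ p * (h x + h x) - 0 ^ p"
        by (intro tendsto_intros)
      then have "(\<lambda>k. ennreal (2 ^ p * (H k x + h x) - d k x)) \<longlonglongrightarrow> ennreal (2 ^ p * (2 * h x))"
        using p by (intro tendsto_ennrealI) (simp add: power_0_left)
      then show ?case by (intro lim_imp_Liminf[symmetric]) auto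
    qed
  qed
  also have "\<dots> \<le> liminf (\<lambda>k. \<integral>\<^sup>+x. ennreal (2 ^ p * (H k x + h x) - d k x) \<partial>lborel)"
    by (rule nn_integral_liminf) (use H h dI in auto)
  also have "\<dots> = liminf (\<lambda>k. ennreal (S - a k))" by (simp only: Sa)
  finally have lim: "ennreal S \<le> liminf (\<lambda>k. ennreal (S - a k))" .
  have "a \<longlonglongrightarrow> 0"
  proof (rule tendstoI)
    fix e :: real assume e: "e > 0"
    show "\<forall>\<^sub>F k in sequentially. dist (a k) 0 < e"
    proof (cases "S < e")
      case True
      then show ?thesis using a0 aS by (auto intro!: always_eventually intro: le_less_trans)
    next
      case False
      then have "ennreal (S - e) < ennreal S" using e by (simp add: ennreal_lessI)
      then have "ennreal (S - e) < liminf (\<lambda>k. ennreal (S - a k))" using lim by simp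
      then have "\<forall>\<^sub>F k in sequentially. ennreal (S - e) < ennreal (S - a k)" by (rule less_LiminfD)
      then show ?thesis
      proof eventually_elim
        case (elim k)
        then have "S - e < S - a k" using False by (simp add: ennreal_less_iff)
        then show ?case using a0[of k] by simp
      qed
    qed
  qed
  then show "(\<lambda>k. LINT x|lborel. norm (mollify (\<delta> k) g x - g x) ^ p) \<longlonglongrightarrow> 0"
    by (simp add: a_def[abs_def] d_def[abs_def])
qed

section \<open>Jacobians are null Lagrangians\<close>

text \<open>A directional derivative is a limit of difference quotients, each of integral zero by
  translation invariance; the Lipschitz bound together with the bounded support dominates
  them.\<close>

lemma integral_gradient_eq_0:
  fixes w :: "real^'n \<Rightarrow> real" and w' :: "real^'n \<Rightarrow> real^'n"
  assumes D: "\<And>x. (w has_derivative (\<lambda>v. w' x \<bullet> v)) (at x)" and c: "continuous_on UNIV w'"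
    and supp: "\<And>x. norm x > B \<Longrightarrow> w x = 0"
  shows "integrable lborel (\<lambda>x. w' x \<bullet> v)" "(LINT x|lborel. w' x \<bullet> v) = 0"
proof -
  have supp': "w' x = 0" if "norm x > B" for x
  proof -
    have "((\<lambda>x. 0) has_derivative (\<lambda>v. w' x \<bullet> v)) (at x)"
    proof (rule has_derivative_transform_within_open[OF D])
      have "open {x::real^'n. B < norm x}"
        by (intro open_Collect_less continuous_intros)
      then show "open {x::real^'n. B < norm x}" .
    qed (use that supp in auto)
    then have "(\<lambda>v. w' x \<bullet> v) = (\<lambda>v. 0)"
      using has_derivative_unique has_derivative_const by blast
    then have "w' x \<bullet> w' x = 0" by (rule fun_cong)
    then show ?thesis by simp
  qed
  show "integrable lborel (\<lambda>x. w' x \<bullet> v)"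
    by (rule integrable_continuous_bounded_support[of _ B])
       (use supp' in \<open>auto intro!: continuous_intros c\<close>)
  have cw: "continuous_on UNIV w"
    using D has_derivative_continuous by (blast intro: continuous_at_imp_continuous_on)
  have "compact (w' ` cball 0 B)" using c by (intro compact_continuous_image) (auto intro: continuous_on_subset)
  then obtain L0 where L0: "\<And>x. x \<in> cball 0 B \<Longrightarrow> norm (w' x) \<le> L0"
    using compact_imp_bounded bounded_iff by (metis imageI)
  define L where "L = max L0 0"
  have L: "norm (w' x) \<le> L" "L \<ge> 0" for x
    using L0[of x] supp'[of x] by (cases "norm x \<le> B"; auto simp: L_def)+
  have lip: "\<bar>w (x + u) - w x\<bar> \<le> L * norm u" for x u
  proof -
    have "norm (w (x + u) - w x) \<le> L * norm (x + u - x)"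
    proof (rule differentiable_bound[OF convex_UNIV])
      show "onorm (\<lambda>v. w' x \<bullet> v) \<le> L" for x
        using L(1) by (intro onorm_le order_trans[OF Cauchy_Schwarz_ineq2[unfolded real_norm_def[symmetric]]]
          mult_right_mono) auto
    qed (use D in auto)
    then show ?thesis by simp
  qed
  define t where "t k = 1 / real (Suc k)" for k
  have t: "t k > 0" "t k \<le> 1" for k by (auto simp: t_def)
  have t0: "t \<longlonglongrightarrow> 0" unfolding t_def using LIMSEQ_Suc[OF lim_1_over_n] by simp
  define q where "q k x = (w (x + t k *\<^sub>R v) - w x) / t k" for k x
  have wI: "integrable lborel w" by (rule integrable_continuous_bounded_support[OF cw supp])
  have "(LINT x|lborel. q k x) = 0" for k
  proof -
    have i: "integrable lborel (\<lambda>x. w (x + t k *\<^sub>R v))"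
      using lborel_integrable_affine[OF _ wI, of 1 "t k *\<^sub>R v"] by (simp add: add.commute)
    have "(LINT x|lborel. w (x + t k *\<^sub>R v)) = (LINT x|lborel. w x)"
      using lborel_integral_affine[of 1 w "t k *\<^sub>R v"] wI by (simp add: add.commute)
    then show ?thesis using i wI by (simp add: q_def)
  qed
  moreover have "(\<lambda>k. LINT x|lborel. q k x) \<longlonglongrightarrow> (LINT x|lborel. w' x \<bullet> v)"
  proof (rule integral_dominated_convergence)
    show "(\<lambda>x. w' x \<bullet> v) \<in> borel_measurable lborel"
      using c by (auto intro!: borel_measurable_continuous_onI continuous_intros)
    show "q k \<in> borel_measurable lborel" for k
      unfolding q_def using t(1)[of k]
      by (auto intro!: borel_measurable_continuous_onI continuous_intros continuous_on_compose2[OF cw])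
    \<comment> \<open>Because t k <= 1, outside this ball both \<open>x\<close> and its translate
      lie off the support.\<close>
    show "integrable lborel (\<lambda>x. indicator (cball 0 (\<bar>B\<bar> + norm v)) x *\<^sub>R (L * norm v))"
      by (auto intro!: integrable_real_indicator simp: emeasure_cball)
    show "AE x in lborel. (\<lambda>k. q k x) \<longlonglongrightarrow> w' x \<bullet> v"
    proof (rule AE_I2)
      fix x
      have "((\<lambda>s. x + s *\<^sub>R v) has_derivative (\<lambda>s. s *\<^sub>R v)) (at 0)"
        by (auto intro!: derivative_eq_intros)
      from has_derivative_compose[OF this, of w "\<lambda>u. w' x \<bullet> u"] D[of x]
      have "((\<lambda>s. w (x + s *\<^sub>R v)) has_derivative (\<lambda>s. w' x \<bullet> (s *\<^sub>R v))) (at 0)" by simp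
      then have "((\<lambda>s. w (x + s *\<^sub>R v)) has_real_derivative w' x \<bullet> v) (at 0)"
        unfolding has_field_derivative_def by (simp add: mult_commute_abs)
      then have "((\<lambda>s. (w (x + s *\<^sub>R v) - w x) / s) \<longlongrightarrow> w' x \<bullet> v) (at 0)"
        by (simp add: DERIV_def)
      moreover have "filterlim t (at 0) sequentially"
        using t0 t(1) by (auto simp: filterlim_at less_imp_neq[THEN not_sym])
      ultimately show "(\<lambda>k. q k x) \<longlonglongrightarrow> w' x \<bullet> v"
        unfolding q_def by (rule filterlim_compose)
    qed
    show "AE x in lborel. norm (q k x) \<le> indicator (cball 0 (\<bar>B\<bar> + norm v)) x *\<^sub>R (L * norm v)" for k
    proof (rule AE_I2)
      fix x
      show "norm (q k x) \<le> indicator (cball 0 (\<bar>B\<bar> + norm v)) x *\<^sub>R (L * norm v)"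
      proof (cases "x \<in> cball 0 (\<bar>B\<bar> + norm v)")
        case True
        have "\<bar>w (x + t k *\<^sub>R v) - w x\<bar> \<le> L * (t k * norm v)"
          using lip[of x "t k *\<^sub>R v"] t(1)[of k] by simp
        then show ?thesis using True t(1)[of k] by (simp add: q_def field_simps)
      next
        case False
        then have x: "norm x > \<bar>B\<bar> + norm v" by simp
        have "norm (t k *\<^sub>R v) \<le> norm v"
          using t(1)[of k] t(2)[of k] by (simp add: mult_left_le_one_le)
        then have "norm (x + t k *\<^sub>R v) > B"
          using x norm_diff_ineq[of x "t k *\<^sub>R v"] by linarith
        moreover have "norm x > B" using x norm_ge_zero[of v] by linarith
        ultimately have "q k x = 0" using supp[of x] supp[of "x + t k *\<^sub>R v"] by (simp add: q_def)
        then show ?thesis using False by simp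
      qed
    qed
  qed
  ultimately show "(LINT x|lborel. w' x \<bullet> v) = 0"
    by (simp add: LIMSEQ_const_iff)
qed

text \<open>
  The hypotheses say that the rows of \<open>A\<close> other than row \<open>i0\<close> are closed one-forms, so that the
  cofactors of row \<open>i0\<close> form a divergence-free field.
\<close>

theorem integral_det_gradient_row_eq_0:
  fixes h :: "real^'n \<Rightarrow> real" and h' :: "real^'n \<Rightarrow> real^'n" and A :: "real^'n \<Rightarrow> real^'n^'n"
    and H :: "'n \<Rightarrow> 'n \<Rightarrow> real^'n \<Rightarrow> real^'n"
  assumes h: "\<And>x. (h has_derivative (\<lambda>v. h' x \<bullet> v)) (at x)" "continuous_on UNIV h'"
    and supp: "\<And>x. norm x > B \<Longrightarrow> h x = 0"
    and A: "\<And>i j x. ((\<lambda>x. A x $ i $ j) has_derivative (\<lambda>v. H i j x \<bullet> v)) (at x)"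
    and Hc: "\<And>i j. continuous_on UNIV (H i j)" and sym: "\<And>i j l x. H i j x $ l = H i l x $ j"
  shows "(LINT x|lborel. det (\<chi> i. if i = i0 then h' x else A x $ i)) = 0"
proof -
  let ?S = "{\<sigma>. \<sigma> permutes (UNIV::'n set)}" and ?I = "UNIV - {i0}"
  define P where "P \<sigma> x = (\<Prod>i\<in>?I. A x $ i $ \<sigma> i)" for \<sigma> x
  define Q where "Q \<sigma> k x = (\<Prod>i\<in>?I - {k}. A x $ i $ \<sigma> i)" for \<sigma> k x
  \<comment> \<open>The derivative of \<open>w \<sigma>\<close> in direction
    \<open>\<sigma> i0\<close> starts with the Leibniz term of the determinant. The remaining terms,
    where another row is differentiated, cancel after summation over \<sigma>.\<close>
  define w where "w \<sigma> x = h x * P \<sigma> x" for \<sigma> x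
  define w' where "w' \<sigma> x = P \<sigma> x *\<^sub>R h' x + (\<Sum>k\<in>?I. (h x * Q \<sigma> k x) *\<^sub>R H k (\<sigma> k) x)" for \<sigma> x
  have hc: "continuous_on UNIV h"
    using h(1) has_derivative_continuous by (blast intro: continuous_at_imp_continuous_on)
  have Ac: "continuous_on UNIV (\<lambda>x. A x $ i $ j)" for i j
    using A has_derivative_continuous by (blast intro: continuous_at_imp_continuous_on)
  have D: "(w \<sigma> has_derivative (\<lambda>v. w' \<sigma> x \<bullet> v)) (at x)" for \<sigma> x
  proof -
    have "(P \<sigma> has_derivative (\<lambda>v. \<Sum>k\<in>?I. (H k (\<sigma> k) x \<bullet> v) * Q \<sigma> k x)) (at x)"
      unfolding P_def Q_def by (rule has_derivative_prod[OF A])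
    from has_derivative_mult[OF h(1) this]
    have "(w \<sigma> has_derivative (\<lambda>v. h x * (\<Sum>k\<in>?I. (H k (\<sigma> k) x \<bullet> v) * Q \<sigma> k x) + (h' x \<bullet> v) * P \<sigma> x)) (at x)"
      unfolding w_def .
    moreover have "(\<lambda>v. h x * (\<Sum>k\<in>?I. (H k (\<sigma> k) x \<bullet> v) * Q \<sigma> k x) + (h' x \<bullet> v) * P \<sigma> x) = (\<lambda>v. w' \<sigma> x \<bullet> v)"
      by (simp add: w'_def fun_eq_iff inner_add_left inner_sum_left sum_distrib_left mult_ac)
    ultimately show ?thesis by simp
  qed
  have c: "continuous_on UNIV (w' \<sigma>)" for \<sigma>
    unfolding w'_def P_def Q_def by (intro continuous_intros hc h(2) Ac Hc)
  have z: "norm x > B \<Longrightarrow> w \<sigma> x = 0" for \<sigma> x using supp by (simp add: w_def)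
  note int = integral_gradient_eq_0[OF D c z]
  \<comment> \<open>Composing \<sigma> with the transposition of \<open>i0\<close> and
    \<open>k\<close> flips the sign, leaves \<open>Q\<close> alone and exchanges the two indices of
    \<open>H\<close>, in which it is symmetric; so the sum equals its own negative.\<close>
  have cancel: "(\<Sum>\<sigma>\<in>?S. of_int (sign \<sigma>) * (Q \<sigma> k x * H k (\<sigma> k) x $ \<sigma> i0)) = 0" (is "?L = 0") if k: "k \<in> ?I" for k x
  proof -
    let ?\<tau> = "Transposition.transpose i0 k"
    have p: "?\<tau> permutes UNIV" by (simp add: permutes_swap_id)
    have "?L = (\<Sum>\<sigma>\<in>?S. of_int (sign (\<sigma> \<circ> ?\<tau>)) * (Q (\<sigma> \<circ> ?\<tau>) k x * H k ((\<sigma> \<circ> ?\<tau>) k) x $ (\<sigma> \<circ> ?\<tau>) i0))"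
      by (rule sum_permutations_compose_right[OF p])
    also have "\<dots> = (\<Sum>\<sigma>\<in>?S. - (of_int (sign \<sigma>) * (Q \<sigma> k x * H k (\<sigma> k) x $ \<sigma> i0)))"
    proof (rule sum.cong[OF refl])
      fix \<sigma> assume "\<sigma> \<in> ?S"
      then have "sign (\<sigma> \<circ> ?\<tau>) = sign \<sigma> * sign ?\<tau>"
        by (intro sign_compose permutation_swap_id) (auto simp: permutation_permutes intro!: exI[of _ UNIV])
      also have "sign ?\<tau> = -1" using k by (auto simp: sign_swap_id)
      finally have s: "sign (\<sigma> \<circ> ?\<tau>) = - sign \<sigma>" by (simp add: comp_def)
      have q: "Q (\<sigma> \<circ> ?\<tau>) k x = Q \<sigma> k x"
        unfolding Q_def by (intro prod.cong) (auto simp: transpose_def)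
      show "of_int (sign (\<sigma> \<circ> ?\<tau>)) * (Q (\<sigma> \<circ> ?\<tau>) k x * H k ((\<sigma> \<circ> ?\<tau>) k) x $ (\<sigma> \<circ> ?\<tau>) i0)
          = - (of_int (sign \<sigma>) * (Q \<sigma> k x * H k (\<sigma> k) x $ \<sigma> i0))"
        unfolding s q using sym[of k "\<sigma> i0" x "\<sigma> k"] by simp
    qed
    also have "\<dots> = - ?L" by (simp add: sum_negf)
    finally show ?thesis by simp
  qed
  have det: "det (\<chi> i. if i = i0 then h' x else A x $ i) = (\<Sum>\<sigma>\<in>?S. of_int (sign \<sigma>) * (w' \<sigma> x \<bullet> axis (\<sigma> i0) 1))" for x
  proof -
    have "(\<Sum>\<sigma>\<in>?S. of_int (sign \<sigma>) * (w' \<sigma> x \<bullet> axis (\<sigma> i0) 1))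
        = (\<Sum>\<sigma>\<in>?S. of_int (sign \<sigma>) * (h' x $ \<sigma> i0 * P \<sigma> x))
          + (\<Sum>\<sigma>\<in>?S. \<Sum>k\<in>?I. h x * (of_int (sign \<sigma>) * (Q \<sigma> k x * H k (\<sigma> k) x $ \<sigma> i0)))"
      unfolding sum.distrib[symmetric]
      by (rule sum.cong[OF refl]) (simp add: w'_def inner_axis sum_distrib_left algebra_simps)
    also have "(\<Sum>\<sigma>\<in>?S. \<Sum>k\<in>?I. h x * (of_int (sign \<sigma>) * (Q \<sigma> k x * H k (\<sigma> k) x $ \<sigma> i0))) = 0"
      by (subst sum.swap) (simp add: cancel sum_distrib_left[symmetric])
    also have "(\<Sum>\<sigma>\<in>?S. of_int (sign \<sigma>) * (h' x $ \<sigma> i0 * P \<sigma> x)) = det (\<chi> i. if i = i0 then h' x else A x $ i)"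
      unfolding det_def
    proof (rule sum.cong[OF refl])
      fix \<sigma>
      have "(\<Prod>i\<in>UNIV. (\<chi> i. if i = i0 then h' x else A x $ i) $ i $ \<sigma> i)
          = h' x $ \<sigma> i0 * (\<Prod>i\<in>?I. (\<chi> i. if i = i0 then h' x else A x $ i) $ i $ \<sigma> i)"
        by (subst prod.remove[of _ i0]) auto
      also have "(\<Prod>i\<in>?I. (\<chi> i. if i = i0 then h' x else A x $ i) $ i $ \<sigma> i) = P \<sigma> x"
        unfolding P_def by (rule prod.cong) auto
      finally show "of_int (sign \<sigma>) * (h' x $ \<sigma> i0 * P \<sigma> x)
          = of_int (sign \<sigma>) * (\<Prod>i\<in>UNIV. (\<chi> i. if i = i0 then h' x else A x $ i) $ i $ \<sigma> i)" by simp
    qed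
    finally show ?thesis by simp
  qed
  show ?thesis
    unfolding det by (subst Bochner_Integration.integral_sum) (use int in auto)
qed

section \<open>An oscillation estimate\<close>

lemma emeasure_density_set_integral:
  fixes \<phi> :: "'a::euclidean_space \<Rightarrow> real"
  assumes "\<phi> \<in> borel_measurable borel" "A \<in> sets borel" "set_integrable lborel A \<phi>" "\<And>x. 0 \<le> \<phi> x"
  shows "emeasure (density lborel \<phi>) A = ennreal (LINT y:A|lborel. \<phi> y)"
proof -
  have "emeasure (density lborel \<phi>) A = (\<integral>\<^sup>+y. ennreal (indicator A y *\<^sub>R \<phi> y) \<partial>lborel)"
    using assms by (simp add: emeasure_density ennreal_mult'' ennreal_indicator mult.commute ennreal_mult)
  also have "\<dots> = ennreal (LINT y:A|lborel. \<phi> y)"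
    using assms unfolding set_lebesgue_integral_def set_integrable_def
    by (intro nn_integral_eq_integral) auto
  finally show ?thesis .
qed

text \<open>Countable subadditivity in the same unenumerated form, for the enlarged, overlapping
  balls of a covering.\<close>

lemma emeasure_UN_le_nn_integral:
  assumes [measurable]: "\<And>i. i \<in> C \<Longrightarrow> X i \<in> sets M" and C: "countable C"
  shows "emeasure M (\<Union>i\<in>C. X i) \<le> (\<integral>\<^sup>+i. emeasure M (X i) \<partial>count_space C)"
proof -
  have "emeasure M (\<Union>i\<in>C. X i) = (\<integral>\<^sup>+x. indicator (\<Union>i\<in>C. X i) x \<partial>M)"
    using C by (subst nn_integral_indicator) auto
  also have "\<dots> \<le> (\<integral>\<^sup>+x. \<integral>\<^sup>+i. indicator (X i) x \<partial>count_space C \<partial>M)"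
  proof (rule nn_integral_mono)
    fix x
    show "indicator (\<Union>i\<in>C. X i) x \<le> (\<integral>\<^sup>+i. indicator (X i) x \<partial>count_space C :: ennreal)"
    proof (cases "x \<in> (\<Union>i\<in>C. X i)")
      case True
      then obtain i where i: "i \<in> C" "x \<in> X i" by auto
      have "(1::ennreal) = (\<integral>\<^sup>+j. indicator {i} j \<partial>count_space C)"
        using i by (subst nn_integral_indicator) auto
      also have "\<dots> \<le> (\<integral>\<^sup>+j. indicator (X j) x \<partial>count_space C)"
        using i by (intro nn_integral_mono) (auto simp: indicator_def)
      finally show ?thesis using True by simp
    qed simp
  qed
  also have "\<dots> = (\<integral>\<^sup>+i. \<integral>\<^sup>+x. indicator (X i) x \<partial>M \<partial>count_space C)"
    by (rule nn_integral_count_space_nn_integral[OF C]) auto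
  also have "\<dots> = (\<integral>\<^sup>+i. emeasure M (X i) \<partial>count_space C)"
    by (rule nn_integral_cong) (simp add: nn_integral_indicator)
  finally show ?thesis .
qed

section \<open>Averages of a C1 function over moving cubes\<close>

lemma norm_unit_cube_le: "z \<in> cbox 0 One \<Longrightarrow> norm (z::real^'n) \<le> real CARD('n)"
proof -
  assume z: "z \<in> cbox 0 One"
  have "norm z \<le> (\<Sum>i\<in>UNIV. \<bar>z $ i\<bar>)" by (rule norm_le_l1_cart)
  also have "\<dots> \<le> (\<Sum>i\<in>(UNIV::'n set). 1)"
  proof (rule sum_mono)
    fix i
    have "z \<bullet> axis i 1 \<le> 1" "0 \<le> z \<bullet> axis i 1"
      using z by (auto simp: mem_box axis_in_Basis_iff)
    then show "\<bar>z $ i\<bar> \<le> 1" by (simp add: inner_axis)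
  qed
  finally show ?thesis by simp
qed

text \<open>The point \<open>x\<close> is a corner of the cube, not its centre. Pulling back to the
  unit cube makes the average differentiable in \<open>x\<close> and \<rho> together and gives it
  the value \<open>v x\<close> at \<rho> = 0.\<close>

definition cube_avg :: "(real^'n::finite \<Rightarrow> real) \<Rightarrow> real^'n \<Rightarrow> real \<Rightarrow> real" where
  "cube_avg v x \<rho> = integral (cbox 0 One) (\<lambda>z. v (x + \<rho> *\<^sub>R z))"

lemma set_integrable_continuous_compact:
  fixes \<phi> :: "'a::euclidean_space \<Rightarrow> 'b::{banach, second_countable_topology}"
  assumes "continuous_on S \<phi>" "compact S"
  shows "set_integrable lborel S \<phi>"
  unfolding set_integrable_def using assms by (intro borel_integrable_compact) auto

locale C1_function =
  fixes v :: "real^'n \<Rightarrow> real" and v' :: "real^'n \<Rightarrow> real^'n"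
  assumes D: "\<And>x. (v has_derivative (\<lambda>u. v' x \<bullet> u)) (at x)" and cont': "continuous_on UNIV v'"
begin

definition energy :: "real^'n \<Rightarrow> real \<Rightarrow> real" where
  "energy p R = (LINT y:cball p R|lborel. norm (v' y) ^ CARD('n))"

lemma cont: "continuous_on UNIV v"
  using D has_derivative_continuous by (blast intro: continuous_at_imp_continuous_on)

lemma energy_integrable: "set_integrable lborel (cball p R) (\<lambda>y. norm (v' y) ^ CARD('n))"
  by (intro set_integrable_continuous_compact continuous_intros continuous_on_subset[OF cont']) auto

lemma energy_nonneg: "0 \<le> energy p R"
  unfolding energy_def set_lebesgue_integral_def by (intro integral_nonneg_AE) auto

text \<open>Corner and side move linearly at the same time, so one formula covers both translating
  and halving a cube.\<close>

lemma cube_avg_path_derivative: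
  fixes x0 x1 :: "real^'n" and \<rho>0 \<rho>1 s :: real
  defines "g \<equiv> \<lambda>s. cube_avg v (x0 + s *\<^sub>R (x1 - x0)) (\<rho>0 + s * (\<rho>1 - \<rho>0))"
  shows "(g has_vector_derivative integral (cbox 0 One) (\<lambda>z. v' (x0 + s *\<^sub>R (x1 - x0) + (\<rho>0 + s * (\<rho>1 - \<rho>0)) *\<^sub>R z)
            \<bullet> (x1 - x0 + (\<rho>1 - \<rho>0) *\<^sub>R z))) (at s)"
  unfolding g_def cube_avg_def
proof (rule leibniz_rule_vector_derivative[where U = UNIV])
  fix s z
  let ?p = "\<lambda>s. x0 + s *\<^sub>R (x1 - x0) + (\<rho>0 + s * (\<rho>1 - \<rho>0)) *\<^sub>R z"
  have "(?p has_derivative (\<lambda>h. h *\<^sub>R (x1 - x0 + (\<rho>1 - \<rho>0) *\<^sub>R z))) (at s)"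
    by (auto intro!: derivative_eq_intros simp: fun_eq_iff algebra_simps)
  from has_derivative_compose[OF this D]
  show "((\<lambda>s. v (?p s)) has_vector_derivative v' (?p s) \<bullet> (x1 - x0 + (\<rho>1 - \<rho>0) *\<^sub>R z)) (at s)"
    by (simp add: has_vector_derivative_def)
next
  fix s
  show "(\<lambda>z. v (x0 + s *\<^sub>R (x1 - x0) + (\<rho>0 + s * (\<rho>1 - \<rho>0)) *\<^sub>R z)) integrable_on cbox 0 One"
    by (intro integrable_continuous continuous_on_compose2[OF cont] continuous_intros) auto
next
  show "continuous_on (UNIV \<times> cbox 0 One) (\<lambda>(s, z). v' (x0 + s *\<^sub>R (x1 - x0) + (\<rho>0 + s * (\<rho>1 - \<rho>0)) *\<^sub>R z)
            \<bullet> (x1 - x0 + (\<rho>1 - \<rho>0) *\<^sub>R z))"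
    unfolding split_beta by (intro continuous_intros continuous_on_compose2[OF cont']) auto
qed auto

text \<open>Jensen's inequality on the unit cube, then the substitution y = x + \<rho> z. The lower
  bound \<open>\<rho>m\<close> makes the estimate uniform along a path of cubes.\<close>

lemma cube_integral_power_le:
  fixes \<rho> \<rho>m R :: real
  assumes \<rho>: "0 < \<rho>m" "\<rho>m \<le> \<rho>" and sub: "\<And>z. z \<in> cbox 0 One \<Longrightarrow> x + \<rho> *\<^sub>R z \<in> cball p R"
  shows "integral (cbox 0 One) (\<lambda>z. norm (v' (x + \<rho> *\<^sub>R z))) ^ CARD('n) \<le> energy p R / \<rho>m ^ CARD('n)"
proof -
  let ?Q = "cbox 0 One :: (real^'n) set"
  define X where "X z = norm (v' (x + \<rho> *\<^sub>R z))" for z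
  have cX: "continuous_on UNIV X"
    unfolding X_def by (intro continuous_intros continuous_on_compose2[OF cont']) auto
  have I1: "set_integrable lborel ?Q X" and I2: "set_integrable lborel ?Q (\<lambda>z. X z ^ CARD('n))"
    by (intro set_integrable_continuous_compact continuous_intros continuous_on_subset[OF cX]; simp)+
  have F: "integrable lborel (\<lambda>y. indicator (cball p R) y *\<^sub>R norm (v' y) ^ CARD('n))"
    using energy_integrable unfolding set_integrable_def .
  have m1: "emeasure lborel ?Q = 1"
    using content_unit[where 'a="real^'n"] by (simp add: emeasure_eq_ennreal_measure)
  have "integral ?Q X ^ CARD('n) = (LINT z|lborel. indicator ?Q z * X z) ^ CARD('n)"
    using set_borel_integral_eq_integral(2)[OF I1] by (simp add: set_lebesgue_integral_def)
  also have "\<dots> \<le> (LINT z|lborel. indicator ?Q z * X z ^ CARD('n))"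
  proof (rule jensen_power)
    show "integrable lborel (indicator ?Q :: real^'n \<Rightarrow> real)"
      by (rule integrable_real_indicator) (auto simp: m1)
    show "(LINT z|lborel. indicator ?Q z) = (1::real)" by simp
  qed (use I1 I2 in \<open>auto simp: set_integrable_def X_def\<close>)
  also have "\<dots> \<le> (LINT z|lborel. indicator (cball p R) (x + \<rho> *\<^sub>R z) *\<^sub>R norm (v' (x + \<rho> *\<^sub>R z)) ^ CARD('n))"
  proof (rule integral_mono)
    show "integrable lborel (\<lambda>z. indicator (cball p R) (x + \<rho> *\<^sub>R z) *\<^sub>R norm (v' (x + \<rho> *\<^sub>R z)) ^ CARD('n))"
      by (rule lborel_integrable_affine[OF _ F]) (use \<rho> in auto)
    show "indicator ?Q z * X z ^ CARD('n) \<le> indicator (cball p R) (x + \<rho> *\<^sub>R z) *\<^sub>R norm (v' (x + \<rho> *\<^sub>R z)) ^ CARD('n)" for z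
      using sub[of z] by (auto simp: indicator_def X_def)
  qed (use I2 in \<open>auto simp: set_integrable_def\<close>)
  also have "\<dots> = energy p R / \<rho> ^ CARD('n)"
    using lborel_integral_affine[of \<rho> "\<lambda>y. indicator (cball p R) y *\<^sub>R norm (v' y) ^ CARD('n)" x] F \<rho>
    by (simp add: energy_def set_lebesgue_integral_def)
  also have "\<dots> \<le> energy p R / \<rho>m ^ CARD('n)"
    using \<rho> energy_nonneg by (intro divide_left_mono power_mono mult_pos_pos zero_less_power) auto
  finally show ?thesis by (simp add: X_def[abs_def])
qed

text \<open>Mean value theorem along the path of cubes: no point of the moving cube is faster than
  |x1 - x0| + n |\<rho>1 - \<rho>0|. As the exponent equals the dimension, only the ratio of this
  speed to the side enters, so the bound is scale invariant.\<close>

lemma cube_avg_diff: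
  fixes \<rho>0 \<rho>1 \<rho>m R :: real
  assumes \<rho>: "0 < \<rho>m" "\<rho>m \<le> \<rho>0" "\<rho>m \<le> \<rho>1"
    and sub: "\<And>(s::real) z. 0 \<le> s \<Longrightarrow> s \<le> 1 \<Longrightarrow> z \<in> cbox 0 One \<Longrightarrow>
      x0 + s *\<^sub>R (x1 - x0) + (\<rho>0 + s * (\<rho>1 - \<rho>0)) *\<^sub>R z \<in> cball p R"
  shows "\<bar>cube_avg v x1 \<rho>1 - cube_avg v x0 \<rho>0\<bar> ^ CARD('n)
    \<le> ((norm (x1 - x0) + CARD('n) * \<bar>\<rho>1 - \<rho>0\<bar>) / \<rho>m) ^ CARD('n) * energy p R"
proof -
  let ?Q = "cbox 0 One :: (real^'n) set"
  define g where "g s = cube_avg v (x0 + s *\<^sub>R (x1 - x0)) (\<rho>0 + s * (\<rho>1 - \<rho>0))" for s :: real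
  define g' where "g' s = integral ?Q (\<lambda>z. v' (x0 + s *\<^sub>R (x1 - x0) + (\<rho>0 + s * (\<rho>1 - \<rho>0)) *\<^sub>R z)
            \<bullet> (x1 - x0 + (\<rho>1 - \<rho>0) *\<^sub>R z))" for s :: real
  have g: "(g has_real_derivative g' s) (at s)" for s
    using cube_avg_path_derivative[of x0 x1 \<rho>0 \<rho>1 s]
    by (simp add: has_real_derivative_iff_has_vector_derivative g_def[abs_def] g'_def)
  obtain s where s: "0 < s" "s < 1" "g 1 - g 0 = (1 - 0) * g' s"
    using MVT2[of 0 1 g g'] g by auto
  define d where "d = norm (x1 - x0) + CARD('n) * \<bar>\<rho>1 - \<rho>0\<bar>"
  have d: "d \<ge> 0" by (simp add: d_def)
  define x where "x = x0 + s *\<^sub>R (x1 - x0)"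
  define \<rho> where "\<rho> = \<rho>0 + s * (\<rho>1 - \<rho>0)"
  have \<rho>m: "\<rho>m \<le> \<rho>"
  proof -
    have "(1 - s) * \<rho>m + s * \<rho>m \<le> (1 - s) * \<rho>0 + s * \<rho>1"
      using s \<rho> by (intro add_mono mult_left_mono) auto
    then show ?thesis by (simp add: \<rho>_def algebra_simps)
  qed
  have "\<bar>g' s\<bar> = norm (integral ?Q (\<lambda>z. v' (x + \<rho> *\<^sub>R z) \<bullet> (x1 - x0 + (\<rho>1 - \<rho>0) *\<^sub>R z)))"
    by (simp add: g'_def x_def \<rho>_def)
  also have "\<dots> \<le> integral ?Q (\<lambda>z. d * norm (v' (x + \<rho> *\<^sub>R z)))"
  proof (rule integral_norm_bound_integral)
    fix z :: "real^'n" assume z: "z \<in> ?Q"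
    have "norm (x1 - x0 + (\<rho>1 - \<rho>0) *\<^sub>R z) \<le> norm (x1 - x0) + \<bar>\<rho>1 - \<rho>0\<bar> * norm z"
      using norm_triangle_ineq[of "x1 - x0" "(\<rho>1 - \<rho>0) *\<^sub>R z"] by simp
    also have "\<dots> \<le> d"
      using mult_left_mono[OF norm_unit_cube_le[OF z], of "\<bar>\<rho>1 - \<rho>0\<bar>"] by (simp add: d_def mult.commute)
    finally have "norm (v' (x + \<rho> *\<^sub>R z)) * norm (x1 - x0 + (\<rho>1 - \<rho>0) *\<^sub>R z) \<le> norm (v' (x + \<rho> *\<^sub>R z)) * d"
      by (rule mult_left_mono) simp
    then show "norm (v' (x + \<rho> *\<^sub>R z) \<bullet> (x1 - x0 + (\<rho>1 - \<rho>0) *\<^sub>R z)) \<le> d * norm (v' (x + \<rho> *\<^sub>R z))"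
      using Cauchy_Schwarz_ineq2[of "v' (x + \<rho> *\<^sub>R z)" "x1 - x0 + (\<rho>1 - \<rho>0) *\<^sub>R z"] by (simp add: mult.commute)
  qed (intro integrable_continuous continuous_intros continuous_on_compose2[OF cont']; auto)+
  also have "\<dots> = d * integral ?Q (\<lambda>z. norm (v' (x + \<rho> *\<^sub>R z)))" by simp
  finally have "\<bar>g' s\<bar> ^ CARD('n) \<le> (d * integral ?Q (\<lambda>z. norm (v' (x + \<rho> *\<^sub>R z)))) ^ CARD('n)"
    by (rule power_mono) simp
  also have "\<dots> \<le> d ^ CARD('n) * (energy p R / \<rho>m ^ CARD('n))"
    unfolding power_mult_distrib
    using cube_integral_power_le[OF \<rho>(1) \<rho>m, of x p R] sub[of s] s d
    by (intro mult_left_mono) (auto simp: x_def \<rho>_def)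
  finally show ?thesis using s(3) by (simp add: g_def d_def power_divide)
qed

lemma cube_avg_tendsto: "(\<lambda>j. cube_avg v x (r / 2 ^ j)) \<longlonglongrightarrow> v x"
proof -
  \<comment> \<open>A path of cubes that starts with side 0, where the average is
    \<open>v x\<close>; its differentiability at 0 yields the limit.\<close>
  define g where "g s = cube_avg v x (s * r)" for s :: real
  have "isCont g 0"
    using cube_avg_path_derivative[of x x 0 r 0]
    by (auto simp: g_def[abs_def] intro: has_vector_derivative_continuous)
  moreover have "g 0 = v x" by (simp add: g_def cube_avg_def)
  moreover have "(\<lambda>j. (1/2::real) ^ j) \<longlonglongrightarrow> 0" by (rule LIMSEQ_power_zero) simp
  ultimately have "(\<lambda>j. g ((1/2) ^ j)) \<longlonglongrightarrow> v x" by (metis isCont_tendsto_compose)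
  then show ?thesis by (simp add: g_def power_divide)
qed

text \<open>If the energy at scale r/2^j decays like 2^-j, successive averages differ by a multiple
  of q^j with q = 2^(-1/n), a convergent geometric series. The summand 2 pays for moving from
  \<open>p\<close> to \<open>x\<close> at scale \<open>r\<close>.\<close>

lemma telescope:
  fixes m k0 q r :: real
  assumes r: "r > 0" and m: "m > 0" and q: "0 < q" "q < 1" "q ^ CARD('n) = 1/2" and k0: "k0 > 0"
    and x: "norm (x - p) < 2 * r"
    and E0: "energy p ((real CARD('n) + 2) * r) \<le> (k0 * m) ^ CARD('n)"
    and E: "\<And>j. energy x (CARD('n) * (r / 2 ^ j)) \<le> (k0 * m) ^ CARD('n) / 2 ^ j"
  shows "\<bar>v x - cube_avg v p r\<bar> \<le> (2 + CARD('n) / (1 - q)) * (k0 * m)"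
proof -
  let ?n = "CARD('n)"
  have n0: "?n > 0" by simp
  \<comment> \<open>The corner stays within 2 r of \<open>p\<close>, and points of a cube of side
    \<open>r\<close> are within n r of its corner; hence the radius (n + 2) r.\<close>
  have b0: "\<bar>cube_avg v x r - cube_avg v p r\<bar> \<le> 2 * (k0 * m)"
  proof (rule power_le_imp_le_base)
    have "\<bar>cube_avg v x r - cube_avg v p r\<bar> ^ ?n \<le> ((norm (x - p) + ?n * \<bar>r - r\<bar>) / r) ^ ?n * energy p ((real ?n + 2) * r)"
    proof (rule cube_avg_diff)
      fix s :: real and z :: "real^'n" assume s: "0 \<le> s" "s \<le> 1" and z: "z \<in> cbox 0 One"
      define u where "u = s *\<^sub>R (x - p) + r *\<^sub>R z"
      have "norm u \<le> \<bar>s\<bar> * norm (x - p) + r * norm z"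
        using norm_triangle_ineq[of "s *\<^sub>R (x - p)" "r *\<^sub>R z"] r by (simp add: u_def)
      also have "\<dots> \<le> 1 * (2 * r) + r * ?n"
        using s x r norm_unit_cube_le[OF z] by (intro add_mono mult_mono) auto
      finally have "p + u \<in> cball p ((real ?n + 2) * r)" by (simp add: dist_norm algebra_simps)
      then show "p + s *\<^sub>R (x - p) + (r + s * (r - r)) *\<^sub>R z \<in> cball p ((real ?n + 2) * r)"
        by (simp add: u_def add.assoc)
    qed (use r in auto)
    also have "\<dots> \<le> 2 ^ ?n * (k0 * m) ^ ?n"
      using x r E0 energy_nonneg by (intro mult_mono power_mono) (auto simp: field_simps)
    finally show "\<bar>cube_avg v x r - cube_avg v p r\<bar> ^ Suc (?n - 1) \<le> (2 * (k0 * m)) ^ Suc (?n - 1)"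
      using n0 by (simp add: power_mult_distrib)
  qed (use k0 m in auto)
  have bj: "\<bar>cube_avg v x (r / 2 ^ Suc j) - cube_avg v x (r / 2 ^ j)\<bar> \<le> ?n * (k0 * m) * q ^ j" for j
  proof (rule power_le_imp_le_base)
    let ?\<rho> = "r / 2 ^ j"
    have "\<bar>cube_avg v x (?\<rho> / 2) - cube_avg v x ?\<rho>\<bar> ^ ?n
        \<le> ((norm (x - x) + ?n * \<bar>?\<rho> / 2 - ?\<rho>\<bar>) / (?\<rho> / 2)) ^ ?n * energy x (?n * ?\<rho>)"
    proof (rule cube_avg_diff)
      fix s :: real and z :: "real^'n" assume s: "0 \<le> s" "s \<le> 1" and z: "z \<in> cbox 0 One"
      define t where "t = ?\<rho> + s * (?\<rho> / 2 - ?\<rho>)"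
      have "t = ?\<rho> * (1 - s / 2)" by (simp add: t_def field_simps)
      moreover have "?\<rho> * (1 - s / 2) \<le> ?\<rho> * 1" "0 \<le> ?\<rho> * (1 - s / 2)"
        using s r by (intro mult_left_mono mult_nonneg_nonneg; simp)+
      ultimately have t: "0 \<le> t" "t \<le> ?\<rho>" by auto
      have "t * norm z \<le> ?\<rho> * ?n"
        using t r norm_unit_cube_le[OF z] by (intro mult_mono) auto
      then show "x + s *\<^sub>R (x - x) + (?\<rho> + s * (?\<rho> / 2 - ?\<rho>)) *\<^sub>R z \<in> cball x (?n * ?\<rho>)"
        using t unfolding t_def[symmetric] by (simp add: dist_norm mult.commute)
    qed (use r in \<open>auto intro!: divide_left_mono\<close>)
    also have "(norm (x - x) + ?n * \<bar>?\<rho> / 2 - ?\<rho>\<bar>) / (?\<rho> / 2) = ?n"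
      using r by (simp add: abs_if field_simps)
    also have "real ?n ^ ?n * energy x (?n * ?\<rho>) \<le> real ?n ^ ?n * ((k0 * m) ^ ?n / 2 ^ j)"
      by (intro mult_left_mono E) simp
    also have "\<dots> = (?n * (k0 * m) * q ^ j) ^ ?n"
    proof -
      have "(q ^ j) ^ ?n = (1/2) ^ j" using q(3) by (metis power_commutes power_mult mult.commute)
      then show ?thesis by (simp add: power_mult_distrib power_divide)
    qed
    finally show "\<bar>cube_avg v x (r / 2 ^ Suc j) - cube_avg v x ?\<rho>\<bar> ^ Suc (?n - 1) \<le> (?n * (k0 * m) * q ^ j) ^ Suc (?n - 1)"
      using n0 by (simp add: mult.commute)
  qed (use k0 m q in auto)
  have geo: "(\<Sum>j<J. q ^ j) \<le> 1 / (1 - q)" for J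
    using q by (simp add: sum_gp_strict divide_right_mono)
  have sum: "\<bar>cube_avg v x (r / 2 ^ J) - cube_avg v x r\<bar> \<le> ?n * (k0 * m) * (\<Sum>j<J. q ^ j)" for J
  proof (induction J)
    case (Suc J)
    have "?n * (k0 * m) * (\<Sum>j<Suc J. q ^ j) = ?n * (k0 * m) * (\<Sum>j<J. q ^ j) + ?n * (k0 * m) * q ^ J"
      by (simp add: algebra_simps)
    then show ?case using Suc bj[of J] by linarith
  qed simp
  have "\<bar>cube_avg v x (r / 2 ^ J) - cube_avg v p r\<bar> \<le> (2 + ?n / (1 - q)) * (k0 * m)" for J
  proof -
    have "?n * (k0 * m) * (\<Sum>j<J. q ^ j) \<le> ?n * (k0 * m) * (1 / (1 - q))"
      using geo k0 m by (intro mult_left_mono) auto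
    then have "\<bar>cube_avg v x (r / 2 ^ J) - cube_avg v p r\<bar> \<le> ?n * (k0 * m) * (1 / (1 - q)) + 2 * (k0 * m)"
      using sum[of J] b0 by linarith
    then show ?thesis by (simp add: algebra_simps)
  qed
  moreover have "(\<lambda>J. \<bar>cube_avg v x (r / 2 ^ J) - cube_avg v p r\<bar>) \<longlonglongrightarrow> \<bar>v x - cube_avg v p r\<bar>"
    by (intro tendsto_intros cube_avg_tendsto)
  ultimately show ?thesis by (intro LIMSEQ_le_const2) auto
qed

end

text \<open>The base of the power is half the reciprocal of the constant in
  \<open>telescope\<close>, so that decay at level k0 m would force a deviation of at most m/2. The
  factor 10 n is lost in the covering: a ball of radius n r/2^j, enlarged five times, accounts for
  an interval of length 10 n r/2^j.\<close>

definition osc_const :: "nat \<Rightarrow> real" where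
  "osc_const n = (1 / (2 * (2 + n / (1 - root n (1/2))))) ^ n / (10 * n)"

lemma root_half: assumes "n > 0" shows "0 < root n (1/2)" "root n (1/2) < 1" "root n (1/2) ^ n = 1/2"
  using assms real_root_lt_1_iff[of n "1/2"] by auto

lemma osc_const_pos: "n > 0 \<Longrightarrow> 0 < osc_const n"
  using root_half[of n] by (auto simp: osc_const_def intro!: divide_pos_pos zero_less_power add_pos_nonneg)

text \<open>
  If \<open>v\<close> is far from its mean at some point of every sphere of radius between \<open>r\<close> and \<open>2 r\<close>, then,
  by telescoping averages over shrinking cubes, each of these points is the centre of a ball carrying
  energy proportional to its radius; the radii of a disjoint subfamily add up to a multiple of \<open>r\<close>.
\<close>

theorem (in C1_function) oscillation_le_energy:
  assumes r: "r > 0" and m: "m > 0"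
    and far: "\<And>t. r < t \<Longrightarrow> t < 2 * r \<Longrightarrow> \<exists>x. norm (x - p) = t \<and> m \<le> \<bar>v x - cube_avg v p r\<bar>"
  shows "osc_const CARD('n) * m ^ CARD('n) \<le> energy p ((real CARD('n) + 2) * r)"
proof -
  let ?n = "CARD('n)"
  define q where "q = root ?n (1/2)"
  have q: "0 < q" "q < 1" "q ^ ?n = 1/2" using root_half[of ?n] by (auto simp: q_def)
  define k0 where "k0 = 1 / (2 * (2 + ?n / (1 - q)))"
  have pos: "0 < 2 + ?n / (1 - q)" using q by (intro add_pos_nonneg) auto
  then have k0: "k0 > 0" by (simp add: k0_def)
  have C: "osc_const ?n = k0 ^ ?n / (10 * ?n)" by (simp add: osc_const_def k0_def q_def)
  let ?E = "energy p ((real ?n + 2) * r)"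
  show ?thesis
  proof (cases "?E \<le> (k0 * m) ^ ?n")
    \<comment> \<open>Here the energy alone exceeds the claim, since 1/(10 n) is at most
      one.\<close>
    case False
    have "osc_const ?n * m ^ ?n \<le> (k0 * m) ^ ?n"
    proof -
      have "1 \<le> ?n" by (simp add: Suc_leI)
      then have "1 \<le> 10 * real ?n" by linarith
      then have "k0 ^ ?n / (10 * ?n) * m ^ ?n \<le> k0 ^ ?n / 1 * m ^ ?n"
        using k0 m by (intro mult_right_mono divide_left_mono) auto
      then show ?thesis by (simp add: C power_mult_distrib)
    qed
    then show ?thesis using False by simp
  next
    case True
    define good where "good t x j \<longleftrightarrow> norm (x - p) = t \<and> (k0 * m) ^ ?n / 2 ^ j \<le> energy x (?n * (r / 2 ^ j))" for t x and j :: nat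
    \<comment> \<open>If decay held at every scale, \<open>telescope\<close> would bound the
      deviation at the far point of radius \<open>t\<close> by m/2, although it is at least
      \<open>m\<close>.\<close>
    have "\<exists>x j. good t x j" if t: "r < t" "t < 2 * r" for t
    proof (rule ccontr)
      assume *: "\<nexists>x j. good t x j"
      obtain x where x: "norm (x - p) = t" "m \<le> \<bar>v x - cube_avg v p r\<bar>" using far[OF t] by blast
      have "energy x (?n * (r / 2 ^ j)) \<le> (k0 * m) ^ ?n / 2 ^ j" for j
      proof -
        have "\<not> good t x j" using * by blast
        then show ?thesis using x(1) by (simp add: good_def)
      qed
      from telescope[OF r m q k0 _ True this] x t
      have "m \<le> (2 + ?n / (1 - q)) * (k0 * m)" by linarith
      also have "\<dots> = m / 2"
      proof -
        have "d * (1 / (2 * d) * m) = m / 2" if "d > 0" for d :: real using that by simp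
        from this[OF pos] show ?thesis by (simp only: k0_def)
      qed
      finally show False using m by simp
    qed
    then obtain X J where XJ: "\<And>t. r < t \<Longrightarrow> t < 2 * r \<Longrightarrow> good t (X t) (J t)" by metis
    define K where "K = {r<..<2*r}"
    define rad where "rad t = ?n * (r / 2 ^ J t)" for t
    have radK: "0 < rad t \<and> rad t \<le> ?n * r" for t
      using r by (simp add: rad_def field_simps)
    obtain C0 where C0: "countable C0" "C0 \<subseteq> K"
      "pairwise (\<lambda>i j. disjnt (cball (X i) (rad i)) (cball (X j) (rad j))) C0"
      "\<And>i. i \<in> K \<Longrightarrow> \<exists>j. j \<in> C0 \<and> \<not> disjnt (cball (X i) (rad i)) (cball (X j) (rad j)) \<and>
                        cball (X i) (rad i) \<subseteq> ball (X j) (5 * rad j)"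
      by (rule Vitali_covering_lemma_cballs_balls[of K rad "?n * r" X]) (use radK in auto)
    have nX: "norm (X t - p) = t" if "t \<in> K" for t using XJ that by (auto simp: K_def good_def)
    \<comment> \<open>The distance to \<open>p\<close> is 1-Lipschitz and equals \<open>t\<close> at
      \<open>X t\<close>. The enlarged balls therefore project into intervals about their own
      parameters, and these cover \<open>K\<close>, of length \<open>r\<close>.\<close>
    have cov: "K \<subseteq> (\<Union>t\<in>C0. cball t (5 * rad t))"
    proof
      fix t assume t: "t \<in> K"
      then obtain j where j: "j \<in> C0" "cball (X t) (rad t) \<subseteq> ball (X j) (5 * rad j)" using C0(4) by blast
      have "X t \<in> cball (X t) (rad t)" using radK[of t] by simp
      then have "X t \<in> ball (X j) (5 * rad j)" by (rule subsetD[OF j(2)])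
      then have "dist (X j) (X t) < 5 * rad j" by simp
      moreover have "\<bar>norm (X j - p) - norm (X t - p)\<bar> \<le> dist (X j) (X t)"
        using norm_triangle_ineq3[of "X j - p" "X t - p"] by (simp add: dist_norm)
      ultimately have "t \<in> cball j (5 * rad j)"
        using nX[OF t] nX[of j] j(1) C0(2) by (auto simp: dist_real_def)
      then show "t \<in> (\<Union>t\<in>C0. cball t (5 * rad t))" using j(1) by blast
    qed
    define \<phi> where "\<phi> y = norm (v' y) ^ ?n" for y
    have \<phi>b: "\<phi> \<in> borel_measurable borel"
      unfolding \<phi>_def by (intro borel_measurable_continuous_onI continuous_intros cont')
    define N where "N = density lborel \<phi>"
    have sets: "sets N = sets borel" by (simp add: N_def)
    have Nball: "emeasure N (cball x R) = ennreal (energy x R)" for x R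
      unfolding N_def energy_def \<phi>_def[symmetric]
      by (rule emeasure_density_set_integral[OF \<phi>b])
         (use energy_integrable in \<open>auto simp: \<phi>_def[abs_def]\<close>)
    \<comment> \<open>The exchange rate between energy and length: 10 \<open>rad t\<close> is
      \<open>a\<close> times the energy guaranteed in the ball.\<close>
    define a where "a = 10 * ?n * r / (k0 * m) ^ ?n"
    have a: "a > 0" using r k0 m by (simp add: a_def)
    have "ennreal r = emeasure lborel K" using r by (simp add: K_def)
    also have "\<dots> \<le> emeasure lborel (\<Union>t\<in>C0. cball t (5 * rad t))"
      using cov C0(1) by (intro emeasure_mono) auto
    also have "\<dots> \<le> (\<integral>\<^sup>+t. emeasure lborel (cball t (5 * rad t)) \<partial>count_space C0)"
      by (rule emeasure_UN_le_nn_integral) (use C0 in auto)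
    also have "\<dots> \<le> (\<integral>\<^sup>+t. ennreal a * emeasure N (cball (X t) (rad t)) \<partial>count_space C0)"
    proof (rule nn_integral_mono)
      fix t assume "t \<in> space (count_space C0)"
      then have t: "t \<in> K" using C0 by auto
      then have E: "(k0 * m) ^ ?n / 2 ^ J t \<le> energy (X t) (rad t)"
        using XJ by (auto simp: K_def good_def rad_def)
      have "emeasure lborel (cball t (5 * rad t)) = ennreal (10 * rad t)"
        using radK[of t] by (simp add: cball_eq_atLeastAtMost)
      also have "10 * rad t = a * ((k0 * m) ^ ?n / 2 ^ J t)"
        using k0 m by (simp add: a_def rad_def)
      also have "ennreal \<dots> \<le> ennreal (a * energy (X t) (rad t))"
        using E a by (intro ennreal_leI mult_left_mono) auto
      finally show "emeasure lborel (cball t (5 * rad t)) \<le> ennreal a * emeasure N (cball (X t) (rad t))"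
        using a by (simp add: Nball ennreal_mult' energy_nonneg)
    qed
    also have "\<dots> = ennreal a * emeasure N (\<Union>t\<in>C0. cball (X t) (rad t))"
      by (subst nn_integral_cmult) (use disjoint_cballs_measure[OF sets C0(1,3)] in auto)
    also have "\<dots> \<le> ennreal a * emeasure N (cball p ((real ?n + 2) * r))"
    proof (intro mult_left_mono emeasure_mono UN_least)
      fix t assume "t \<in> C0"
      then have t: "t \<in> K" using C0 by auto
      show "cball (X t) (rad t) \<subseteq> cball p ((real ?n + 2) * r)"
      proof
        fix y assume "y \<in> cball (X t) (rad t)"
        then have "dist p y \<le> dist p (X t) + rad t"
          using dist_triangle[of p y "X t"] by simp
        also have "\<dots> \<le> 2 * r + ?n * r"
          using nX[OF t] t radK[of t] by (auto simp: K_def dist_norm norm_minus_commute)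
        finally show "y \<in> cball p ((real ?n + 2) * r)" by (simp add: algebra_simps)
      qed
    qed (use sets in auto)
    also have "\<dots> = ennreal (a * ?E)" using a by (simp add: Nball ennreal_mult' energy_nonneg)
    finally have "r \<le> a * ?E" using a energy_nonneg by (simp add: ennreal_le_iff)
    then show ?thesis
      using r k0 m by (simp add: a_def C power_mult_distrib field_simps)
  qed
qed

section \<open>Weak derivatives\<close>

lemma Ck_1_has_derivative:
  fixes \<phi> :: "real^'n \<Rightarrow> real"
  assumes "Ck (Suc 0) \<phi>"
  shows "(\<phi> has_derivative (\<lambda>h. (\<chi> j. partial j \<phi> x) \<bullet> h)) (at x)"
    and "continuous_on UNIV (\<lambda>x. \<chi> j. partial j \<phi> x)"
proof -
  let ?D = "frechet_derivative \<phi> (at x)"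
  have D: "(\<phi> has_derivative ?D) (at x)"
    using assms frechet_derivative_works by auto
  have eq: "?D h = (\<chi> j. partial j \<phi> x) \<bullet> h" for h
  proof -
    have lin: "linear ?D" using D has_derivative_linear by blast
    have "h = (\<Sum>j\<in>UNIV. h $ j *\<^sub>R axis j 1)"
      using basis_expansion[of h] by (simp add: scalar_mult_eq_scaleR)
    then have "?D h = ?D (\<Sum>j\<in>UNIV. h $ j *\<^sub>R axis j 1)" by simp
    also have "\<dots> = (\<Sum>j\<in>UNIV. h $ j * ?D (axis j 1))"
      by (simp add: linear_sum[OF lin] linear_cmul[OF lin])
    finally show ?thesis by (simp add: inner_vec_def mult.commute)
  qed
  show "(\<phi> has_derivative (\<lambda>h. (\<chi> j. partial j \<phi> x) \<bullet> h)) (at x)"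
    by (rule has_derivative_eq_rhs[OF D ext[OF eq]])
  show "continuous_on UNIV (\<lambda>x. \<chi> j. partial j \<phi> x)"
    using assms by (intro continuous_on_vec_lambda) auto
qed

text \<open>The form c x + b with b = 0 is the one expected by \<open>Ck_affine\<close> and
  \<open>partial_affine\<close>, so smoothness and derivatives of the kernel reduce to those of the
  unscaled bump.\<close>

lemma mkern_alt:
  obtains c where "mkern \<delta> = (\<lambda>z::real^'n. c * flat_exp 0 (1 - ((1/\<delta>) *\<^sub>R z + 0) \<bullet> ((1/\<delta>) *\<^sub>R z + 0)))"
  by (rule that[of "1 / (LINT y|lborel. flat_exp 0 (1 - (y::real^'n) \<bullet> y)) / \<delta> ^ CARD('n)"])
     (auto simp: fun_eq_iff mkern_def bump_def divide_inverse)

lemma Ck_mkern: "Ck k (mkern \<delta> :: real^'n \<Rightarrow> real)"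
proof -
  obtain c where c: "mkern \<delta> = (\<lambda>z::real^'n. c * flat_exp 0 (1 - ((1/\<delta>) *\<^sub>R z + 0) \<bullet> ((1/\<delta>) *\<^sub>R z + 0)))"
    by (rule mkern_alt)
  show ?thesis
    unfolding c by (intro Ck_mult Ck_const Ck_affine[OF Ck_flat_exp_sphere])
qed

lemma partial_cmult:
  assumes "\<And>x. \<phi> differentiable (at x)"
  shows "partial j (\<lambda>x. c * \<phi> x) = (\<lambda>x. c * partial j \<phi> x)"
proof
  fix x
  have "(\<phi> has_derivative frechet_derivative \<phi> (at x)) (at x)"
    using assms frechet_derivative_works by blast
  then show "partial j (\<lambda>x. c * \<phi> x) x = c * partial j \<phi> x"
    by (rule partial_eq[OF has_derivative_mult_right])
qed

lemma Ck_differentiable: "Ck (Suc k) \<phi> \<Longrightarrow> \<phi> differentiable (at x)"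
  by simp

text \<open>The factor \<open>c\<close> is the same for all \<open>j\<close>; this is what lets the
  symmetry of second derivatives pass to the kernel.\<close>

lemma partial_mkern:
  "\<exists>c. \<forall>j. partial j (mkern \<delta>) = (\<lambda>z::real^'n. c * partial j (\<lambda>x. flat_exp 0 (1 - x \<bullet> x)) ((1/\<delta>) *\<^sub>R z + 0))"
proof -
  obtain c where c: "mkern \<delta> = (\<lambda>z::real^'n. c * flat_exp 0 (1 - ((1/\<delta>) *\<^sub>R z + 0) \<bullet> ((1/\<delta>) *\<^sub>R z + 0)))"
    by (rule mkern_alt)
  let ?F = "\<lambda>x::real^'n. flat_exp 0 (1 - x \<bullet> x)"
  have d: "?F differentiable (at x)" for x by (rule Ck_differentiable[OF Ck_flat_exp_sphere[of "Suc 0"]])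
  have d2: "(\<lambda>z. ?F ((1/\<delta>) *\<^sub>R z + 0)) differentiable (at x)" for x
    by (rule Ck_differentiable[OF Ck_affine[OF Ck_flat_exp_sphere[of "Suc 0"]]])
  have "partial j (mkern \<delta>) z = (c * (1/\<delta>)) * partial j ?F ((1/\<delta>) *\<^sub>R z + 0)" for j z
    by (simp only: c fun_cong[OF partial_cmult[OF d2]] fun_cong[OF partial_affine[OF d]] mult.assoc)
  then show ?thesis by (intro exI[of _ "c * (1/\<delta>)"] allI ext)
qed

lemma partial_mkern_commute: "partial i (partial j (mkern \<delta>)) = partial j (partial i (mkern \<delta> :: real^'n \<Rightarrow> real))"
proof
  fix x :: "real^'n"
  let ?F = "\<lambda>x::real^'n. flat_exp 0 (1 - x \<bullet> x)"
  obtain c where c: "\<And>j. partial j (mkern \<delta>) = (\<lambda>z::real^'n. c * partial j ?F ((1/\<delta>) *\<^sub>R z + 0))"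
    using partial_mkern[of \<delta>, where 'n='n] by blast
  have C1: "Ck (Suc 0) (partial j ?F)" for j
    using iffD1[OF Ck.simps(2) Ck_flat_exp_sphere[of "Suc (Suc 0)" 0, where 'n='n]] by blast
  have d: "partial j ?F differentiable (at x)" for x j by (rule Ck_differentiable[OF C1])
  have d2: "(\<lambda>z. partial j ?F ((1/\<delta>) *\<^sub>R z + 0)) differentiable (at x)" for x j
    by (rule Ck_differentiable[OF Ck_affine[OF C1]])
  have "partial i (partial j (mkern \<delta>)) x = c * ((1/\<delta>) * partial i (partial j ?F) ((1/\<delta>) *\<^sub>R x + 0))" for i j
    unfolding c by (simp only: fun_cong[OF partial_cmult[OF d2]] fun_cong[OF partial_affine[OF d]])
  note this[of i j] this[of j i]
  then show "partial i (partial j (mkern \<delta>)) x = partial j (partial i (mkern \<delta>)) x"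
    using fun_cong[OF partial_commute_flat_exp_sphere[where i=i and j=j and m=0], of "(1/\<delta>) *\<^sub>R x + 0"] by simp
qed

lemma partial_mkern_eq_0:
  assumes "\<delta> > 0" "\<delta> \<le> norm (z::real^'n)"
  shows "partial j (mkern \<delta>) z = 0"
proof -
  obtain c where c: "\<And>j. partial j (mkern \<delta>) = (\<lambda>z::real^'n. c * partial j (\<lambda>x. flat_exp 0 (1 - x \<bullet> x)) ((1/\<delta>) *\<^sub>R z + 0))"
    using partial_mkern[of \<delta>, where 'n='n] by blast
  have n: "1 \<le> norm ((1/\<delta>) *\<^sub>R z + 0)" using assms by (simp add: field_simps)
  have "partial j (\<lambda>x. flat_exp 0 (1 - x \<bullet> x)) ((1/\<delta>) *\<^sub>R z + 0) = 0"
    unfolding fun_cong[OF partial_flat_exp_sphere] flat_exp_sphere_eq_0[OF n] by simp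
  then show ?thesis using fun_cong[OF c[of j], of z] by simp
qed

lemma partial_mkern_reflect:
  "partial j (\<lambda>y. mkern \<delta> (x - y)) y = - partial j (mkern \<delta>) (x - (y::real^'n))"
proof -
  have "mkern \<delta> differentiable (at x)" for x :: "real^'n"
    by (rule Ck_differentiable[OF Ck_mkern[of "Suc 0"]])
  from fun_cong[OF partial_affine[OF this, of "-1" x j], of y] show ?thesis by simp
qed

section \<open>Kernels as test functions, and uniqueness of weak derivatives\<close>

lemma test_function_mkern:
  assumes "\<delta> > 0" "cball x \<delta> \<subseteq> \<Omega>"
  shows "test_function \<Omega> (\<lambda>y. mkern \<delta> (x - (y::real^'n)))"
proof -
  have sub: "closure {y. mkern \<delta> (x - y) \<noteq> 0} \<subseteq> cball x \<delta>"
  proof (rule closure_minimal)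
    have "y \<in> cball x \<delta>" if "mkern \<delta> (x - y) \<noteq> 0" for y
      using mkern_eq_0[OF assms(1), of "x - y"] that by (cases "\<delta> \<le> norm (x - y)") (auto simp: dist_norm)
    then show "{y. mkern \<delta> (x - y) \<noteq> 0} \<subseteq> cball x \<delta>" by blast
  qed simp
  have "Ck k (\<lambda>y. mkern \<delta> ((-1) *\<^sub>R y + x))" for k by (intro Ck_affine Ck_mkern)
  then have "Ck k (\<lambda>y. mkern \<delta> (x - y))" for k by (simp add: algebra_simps)
  moreover have "compact (closure {y. mkern \<delta> (x - y) \<noteq> 0})"
    using sub by (auto intro: bounded_subset simp: compact_eq_bounded_closed)
  ultimately show ?thesis using sub assms(2) by (auto simp: test_function_def)
qed

lemma Lp_loc_1_set_integrable:
  assumes "Lp_loc \<Omega> 1 u" "compact S" "S \<subseteq> \<Omega>"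
  shows "set_integrable lebesgue S u"
proof -
  have m: "set_borel_measurable lebesgue S u" and i: "set_integrable lebesgue S (\<lambda>x. \<bar>u x\<bar>)"
    using assms by (auto simp: Lp_loc_def)
  show ?thesis using set_integrable_abs_iff[OF m] i by simp
qed

lemma set_integrable_mult_test:
  assumes u: "Lp_loc \<Omega> 1 u" and \<phi>: "test_function \<Omega> \<phi>"
  shows "set_integrable lebesgue \<Omega> (\<lambda>x. u x * \<phi> x)"
proof -
  define S where "S = closure {x. \<phi> x \<noteq> 0}"
  have S: "compact S" "S \<subseteq> \<Omega>" using \<phi> by (auto simp: test_function_def S_def)
  have c: "continuous_on UNIV \<phi>" using \<phi> Ck_imp_continuous by (auto simp: test_function_def)
  have "compact (\<phi> ` S)" using c S by (intro compact_continuous_image) (auto intro: continuous_on_subset)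
  then obtain B where B: "\<And>x. x \<in> S \<Longrightarrow> \<bar>\<phi> x\<bar> \<le> B"
    using compact_imp_bounded bounded_iff by (metis imageI real_norm_def)
  have i: "integrable lebesgue (\<lambda>x. indicator S x *\<^sub>R u x)"
    using Lp_loc_1_set_integrable[OF u S] by (simp add: set_integrable_def)
  have "integrable lebesgue (\<lambda>x. (indicator S x *\<^sub>R u x) * \<phi> x)"
  proof (rule Bochner_Integration.integrable_bound)
    show "integrable lebesgue (\<lambda>x. B * norm (indicator S x *\<^sub>R u x))" using i by (intro integrable_mult_right integrable_norm)
    have "\<phi> \<in> borel_measurable lebesgue"
      using borel_measurable_continuous_onI[OF c] by (simp add: measurable_completion)
    then show "(\<lambda>x. (indicator S x *\<^sub>R u x) * \<phi> x) \<in> borel_measurable lebesgue"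
      using i by (intro borel_measurable_times) auto
    show "AE x in lebesgue. norm ((indicator S x *\<^sub>R u x) * \<phi> x) \<le> norm (B * norm (indicator S x *\<^sub>R u x))"
    proof (rule AE_I2)
      fix x
      show "norm ((indicator S x *\<^sub>R u x) * \<phi> x) \<le> norm (B * norm (indicator S x *\<^sub>R u x))"
      proof (cases "x \<in> S")
        case True
        then have "\<bar>u x\<bar> * \<bar>\<phi> x\<bar> \<le> \<bar>u x\<bar> * \<bar>B\<bar>" using B[OF True] by (intro mult_left_mono) auto
        then show ?thesis using True by (simp add: abs_mult mult.commute)
      qed simp
    qed
  qed
  moreover have "(\<lambda>x. (indicator S x *\<^sub>R u x) * \<phi> x) = (\<lambda>x. indicator \<Omega> x *\<^sub>R (u x * \<phi> x))"
    using S(2) closure_subset[of "{x. \<phi> x \<noteq> 0}"] by (intro ext) (auto simp: indicator_def S_def)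
  ultimately show ?thesis unfolding set_integrable_def by (simp only:)
qed

text \<open>Trading a Lebesgue measurable function for a Borel one moves later integrals to
  \<open>lborel\<close>, where affine substitution and Tonelli's theorem are at hand.\<close>

lemma lborel_version:
  fixes h :: "'a::euclidean_space \<Rightarrow> real"
  assumes "h \<in> borel_measurable lebesgue"
  obtains h' where "h' \<in> borel_measurable borel" "AE x in lborel. h x = h' x" "AE x in lebesgue. h x = h' x"
proof -
  obtain h' where h': "h' \<in> borel_measurable lborel" "AE x in lborel. h x = h' x"
    using completion_ex_borel_measurable_real[OF assms] by blast
  moreover have "AE x in lebesgue. h x = h' x" using h'(2) by (simp only: AE_completion_iff)
  ultimately show ?thesis using that by auto
qed

text \<open>Small kernels about interior points are test functions, so the mollifications of g1 - g2
  vanish there, while at Lebesgue points they converge to the difference. This is needed because the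
  differential in the distortion inequality and the L^n gradients of the Sobolev hypothesis are
  given separately.\<close>

lemma weak_partial_unique:
  fixes u g1 g2 :: "real^'n \<Rightarrow> real"
  assumes "open \<Omega>" and w: "weak_partial \<Omega> j u g1" "weak_partial \<Omega> j u g2"
  shows "AE x in lborel. x \<in> \<Omega> \<longrightarrow> g1 x = g2 x"
proof -
  obtain S :: "nat \<Rightarrow> (real^'n) set" where S: "\<And>k. compact (S k)" "\<And>k. S k \<subseteq> \<Omega>" "\<Union>(range S) = \<Omega>"
      "\<And>k. S k \<subseteq> interior (S (Suc k))"
    using open_Union_compact_subsets[OF \<open>open \<Omega>\<close>] by metis
  have "AE x in lborel. x \<in> S k \<longrightarrow> g1 x = g2 x" for k
  proof -
    let ?S = "S (Suc k)"
    have i: "set_integrable lebesgue ?S g1" "set_integrable lebesgue ?S g2"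
      using w S by (auto simp: weak_partial_def intro!: Lp_loc_1_set_integrable[of \<Omega>])
    \<comment> \<open>Cutting off to the next larger compact set makes the difference globally
      integrable, and small kernels centred in \<open>S k\<close> do not notice the cut.\<close>
    define h where "h x = indicator ?S x *\<^sub>R (g1 x - g2 x)" for x
    have hi: "integrable lebesgue h"
      using set_integral_diff(1)[OF i] by (simp add: set_integrable_def h_def[abs_def])
    obtain h' where h': "h' \<in> borel_measurable borel" "AE x in lborel. h x = h' x" "AE x in lebesgue. h x = h' x"
      using lborel_version[of h] hi by auto
    have h'i: "integrable lborel h'"
    proof -
      have "integrable lebesgue h'"
        using integrable_cong_AE_imp[OF hi _ h'(3)] h'(1) by (simp add: measurable_completion)
      then show ?thesis using h'(1) by (simp add: integrable_completion)
    qed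
    have "AE x in lborel. ((\<lambda>r. (LINT y:cball x r|lborel. norm (h' y - h' x) ^ 1) / r ^ DIM(real^'n)) \<longlongrightarrow> 0) (at_right 0)"
      by (rule AE_Lebesgue_point) (use h'i h'(1) in auto)
    then show ?thesis
      using h'(2)
    proof eventually_elim
      case (elim x)
      show ?case
      proof
        assume x: "x \<in> S k"
        then have "x \<in> interior ?S" using S(4) by blast
        then obtain d where d: "d > 0" "cball x d \<subseteq> ?S"
          using open_contains_cball[of "interior ?S"] interior_subset by (metis open_interior subset_trans)
        define \<delta> where "\<delta> m = d / real (Suc m)" for m
        have \<delta>: "\<delta> m > 0" "\<delta> m \<le> d" for m using d by (auto simp: \<delta>_def field_simps)
        have "\<delta> \<longlonglongrightarrow> 0"
          unfolding \<delta>_def using LIMSEQ_Suc[OF lim_const_over_n[of d]] by simp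
        from mollify_tendsto[OF h'i \<delta>(1) this elim(1)]
        have "(\<lambda>m. mollify (\<delta> m) h' x) \<longlonglongrightarrow> h' x" .
        moreover have "mollify (\<delta> m) h' x = 0" for m
        proof -
          let ?\<phi> = "\<lambda>y. mkern (\<delta> m) (x - y)"
          have cb: "cball x (\<delta> m) \<subseteq> ?S" using \<delta>(2)[of m] d(2) by (meson subset_cball subset_trans)
          have t: "test_function \<Omega> ?\<phi>"
            by (rule test_function_mkern[OF \<delta>(1)]) (use cb S(2) in blast)
          have mb: "(\<lambda>y. ?\<phi> y * h' y) \<in> borel_measurable borel" using h'(1) by measurable
          have "mollify (\<delta> m) h' x = (LINT y|lebesgue. ?\<phi> y * h' y)"
            unfolding mollify_def using mb by (simp add: integral_completion)
          also have "\<dots> = (LINT y|lebesgue. indicator \<Omega> y *\<^sub>R (g1 y * ?\<phi> y) - indicator \<Omega> y *\<^sub>R (g2 y * ?\<phi> y))"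
          proof (rule integral_cong_AE)
            show "(\<lambda>y. ?\<phi> y * h' y) \<in> borel_measurable lebesgue" using mb by (simp add: measurable_completion)
            show "(\<lambda>y. indicator \<Omega> y *\<^sub>R (g1 y * ?\<phi> y) - indicator \<Omega> y *\<^sub>R (g2 y * ?\<phi> y)) \<in> borel_measurable lebesgue"
              using set_integrable_mult_test[OF _ t] w
              by (intro borel_measurable_diff) (auto simp: weak_partial_def set_integrable_def)
            show "AE y in lebesgue. ?\<phi> y * h' y = indicator \<Omega> y *\<^sub>R (g1 y * ?\<phi> y) - indicator \<Omega> y *\<^sub>R (g2 y * ?\<phi> y)"
              using h'(3)
            proof eventually_elim
              case (elim y)
              show ?case
              proof (cases "y \<in> cball x (\<delta> m)")
                case True
                then have "y \<in> ?S" "y \<in> \<Omega>" using cb S(2) by blast+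
                then show ?thesis using elim by (simp add: h_def algebra_simps)
              next
                case False
                then have "\<delta> m \<le> norm (x - y)" by (simp add: dist_norm)
                then have "?\<phi> y = 0" by (rule mkern_eq_0[OF \<delta>(1)])
                then show ?thesis by simp
              qed
            qed
          qed
          also have "\<dots> = (LINT y:\<Omega>|lebesgue. g1 y * ?\<phi> y) - (LINT y:\<Omega>|lebesgue. g2 y * ?\<phi> y)"
            unfolding set_lebesgue_integral_def
            using set_integrable_mult_test[OF _ t] w
            by (intro Bochner_Integration.integral_diff) (auto simp: weak_partial_def set_integrable_def)
          also have "\<dots> = 0" using w t by (simp add: weak_partial_def)
          finally show ?thesis .
        qed
        ultimately have "h' x = 0" by (simp add: LIMSEQ_const_iff)
        moreover have "x \<in> ?S" using d by auto
        ultimately show "g1 x = g2 x" using elim(2) by (simp add: h_def)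
      qed
    qed
  qed
  then have "AE x in lborel. \<forall>k. x \<in> S k \<longrightarrow> g1 x = g2 x"
    unfolding AE_all_countable by (rule allI)
  then show ?thesis by eventually_elim (use S(3) in blast)
qed

section \<open>Borel data of a quasiregular mapping\<close>

lemma borel_measurable_vecI:
  fixes F :: "'a \<Rightarrow> ('b::euclidean_space)^'n"
  assumes "\<And>i. (\<lambda>x. F x $ i) \<in> borel_measurable M"
  shows "F \<in> borel_measurable M"
  unfolding borel_measurable_euclidean_space[of F]
proof
  fix b :: "'b^'n" assume "b \<in> Basis"
  then obtain i u where "b = axis i u" by (auto simp: Basis_vec_def)
  then have "(\<lambda>x. F x \<bullet> b) = (\<lambda>x. F x $ i \<bullet> u)" by (simp add: inner_axis)
  then show "(\<lambda>x. F x \<bullet> b) \<in> borel_measurable M"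
    using assms[of i] by simp
qed

lemma borel_measurable_vec_nth:
  fixes F :: "'a \<Rightarrow> ('b::euclidean_space)^'n"
  assumes "F \<in> borel_measurable M"
  shows "(\<lambda>x. F x $ i) \<in> borel_measurable M"
  by (rule measurable_compose[OF assms borel_measurable_continuous_onI]) (intro continuous_intros)

lemma norm_matrix_le_sum: "norm (A::real^'n^'m) \<le> (\<Sum>i\<in>UNIV. \<Sum>j\<in>UNIV. \<bar>A $ i $ j\<bar>)"
proof -
  have "norm A \<le> (\<Sum>i\<in>UNIV. norm (A $ i))"
    unfolding norm_vec_def[of A] by (rule L2_set_le_sum) auto
  also have "\<dots> \<le> (\<Sum>i\<in>UNIV. \<Sum>j\<in>UNIV. \<bar>A $ i $ j\<bar>)" by (intro sum_mono norm_le_l1_cart)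
  finally show ?thesis .
qed

lemma entry_le_norm_matrix: "\<bar>A $ i $ j\<bar> \<le> norm (A::real^'n^'m)"
  using component_le_norm_cart[of "A $ i" j] Finite_Cartesian_Product.norm_nth_le[of A i] by linarith

text \<open>Unit vectors bound each entry by the operator norm. The crude factor n^2 only enlarges
  the distortion constant.\<close>

lemma norm_matrix_le_onorm: "norm (A::real^'n^'n) \<le> real (CARD('n))^2 * onorm (\<lambda>v. A *v v)"
proof -
  have "\<bar>A $ i $ j\<bar> \<le> onorm (\<lambda>v. A *v v)" for i j
  proof -
    have "A $ i $ j = (A *v axis j 1) $ i" by (simp add: matrix_vector_mul_component inner_axis)
    then have "\<bar>A $ i $ j\<bar> \<le> norm (A *v axis j 1)" using component_le_norm_cart by metis
    also have "\<dots> \<le> onorm (\<lambda>v. A *v v) * norm (axis j (1::real) :: real^'n)"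
      by (rule onorm[OF matrix_vector_mul_bounded_linear])
    finally show ?thesis by simp
  qed
  then have "(\<Sum>i\<in>UNIV. \<Sum>j\<in>UNIV. \<bar>A $ i $ j\<bar>) \<le> (\<Sum>i\<in>(UNIV::'n set). \<Sum>j\<in>(UNIV::'n set). onorm (\<lambda>v. A *v v))"
    by (intro sum_mono)
  then show ?thesis using norm_matrix_le_sum[of A] by (simp add: power2_eq_square)
qed

text \<open>Every term is replaced by the largest one.\<close>

lemma sum_power_le:
  fixes a :: "'i \<Rightarrow> real"
  assumes S: "finite S" and a: "\<And>s. s \<in> S \<Longrightarrow> 0 \<le> a s" and p: "p > 0"
  shows "(\<Sum>s\<in>S. a s) ^ p \<le> real (card S) ^ p * (\<Sum>s\<in>S. a s ^ p)"
proof (cases "S = {}")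
  case True
  then show ?thesis using p by (simp add: power_0_left)
next
  case False
  define M where "M = Max (a ` S)"
  have "M \<in> a ` S" unfolding M_def using S False by (intro Max_in) auto
  then obtain s where s: "s \<in> S" "M = a s" by auto
  have "(\<Sum>s\<in>S. a s) \<le> real (card S) * M"
    using S by (intro sum_bounded_above) (auto simp: M_def)
  then have "(\<Sum>s\<in>S. a s) ^ p \<le> (real (card S) * M) ^ p"
    using a by (intro power_mono sum_nonneg) auto
  also have "\<dots> = real (card S) ^ p * a s ^ p" by (simp add: power_mult_distrib s)
  also have "\<dots> \<le> real (card S) ^ p * (\<Sum>s\<in>S. a s ^ p)"
    using S s a by (intro mult_left_mono member_le_sum) auto
  finally show ?thesis .
qed

text \<open>Working form of quasiregularity: a Borel representative of the differential, integrals
  against \<open>lborel\<close>, and the Euclidean norm of matrices in place of the operator norm,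
  with \<open>K\<close> enlarged accordingly.\<close>

locale qr_map =
  fixes f :: "real^'n \<Rightarrow> real^'n" and g :: "real^'n \<Rightarrow> real^'n^'n" and K :: real
  assumes cont_f: "continuous_on (ball 0 1) f"
    and g_borel[measurable]: "g \<in> borel_measurable borel"
    and g_Ln: "\<And>R. R < 1 \<Longrightarrow> set_integrable lborel (cball 0 R) (\<lambda>x. norm (g x) ^ CARD('n))"
    and weak: "\<And>\<phi> i j. test_function (ball 0 1) \<phi> \<Longrightarrow>
      (LINT x:ball 0 1|lborel. f x $ i * partial j \<phi> x) = - (LINT x:ball 0 1|lborel. g x $ i $ j * \<phi> x)"
    and K_pos: "0 < K"
    and distortion: "AE x in lborel. x \<in> ball 0 1 \<longrightarrow> norm (g x) ^ CARD('n) \<le> K * det (g x)"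

lemma indicator_ball_lebesgue_measurable:
  fixes G :: "real^'n \<Rightarrow> real"
  assumes "\<And>S. compact S \<Longrightarrow> S \<subseteq> ball 0 1 \<Longrightarrow> set_borel_measurable lebesgue S G"
  shows "(\<lambda>x. indicator (ball 0 1) x * G x) \<in> borel_measurable lebesgue"
proof (rule borel_measurable_LIMSEQ_real)
  define S :: "nat \<Rightarrow> (real^'n) set" where "S k = cball 0 (1 - 1 / real (Suc k))" for k
  have S: "compact (S k)" "S k \<subseteq> ball 0 1" for k
  proof -
    show "compact (S k)" by (simp add: S_def)
    show "S k \<subseteq> ball 0 1"
    proof
      fix x assume "x \<in> S k"
      then have "norm x \<le> 1 - 1 / real (Suc k)" by (simp add: S_def)
      moreover have "1 / real (Suc k) > 0" by simp
      ultimately have "norm x < 1" by linarith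
      then show "x \<in> ball 0 1" by simp
    qed
  qed
  show "(\<lambda>x. indicator (S k) x * G x) \<in> borel_measurable lebesgue" for k
    using assms[OF S] by (simp add: set_borel_measurable_def)
  fix x :: "real^'n"
  show "(\<lambda>k. indicator (S k) x * G x) \<longlonglongrightarrow> indicator (ball 0 1) x * G x"
  proof (cases "norm x < 1")
    case True
    obtain k where k: "1 / real (Suc k) < 1 - norm x" using True nat_approx_posE[of "1 - norm x"] by auto
    have "indicator (S m) x = (1::real)" if "m \<ge> k" for m
    proof -
      have "1 / real (Suc m) \<le> 1 / real (Suc k)" using that by (intro divide_left_mono) auto
      then show ?thesis using k by (simp add: S_def)
    qed
    then have "\<forall>\<^sub>F m in sequentially. indicator (S m) x * G x = indicator (ball 0 1) x * G x"
      using True by (intro eventually_sequentiallyI[of k]) simp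
    then show ?thesis by (rule tendsto_eventually)
  next
    case False
    then have "x \<notin> S k" for k using S(2)[of k] by auto
    then show ?thesis using False by simp
  qed
qed

theorem quasiregular_imp_qr_map:
  fixes f :: "real^'n \<Rightarrow> real^'n"
  assumes "quasiregular_on (ball 0 1) f"
  shows "\<exists>g K. qr_map f g K"
proof -
  let ?B = "ball 0 1 :: (real^'n) set"
  have cont: "continuous_on ?B f" and W: "\<And>i. W1p_loc ?B (real CARD('n)) (\<lambda>x. f x $ i)"
    using assms by (auto simp: quasiregular_on_def)
  obtain Df K where Df: "weak_differential ?B f Df" and K: "1 \<le> K"
    and dist: "AE x in lebesgue. x \<in> ?B \<longrightarrow> onorm (\<lambda>v. Df x *v v) ^ CARD('n) \<le> K * det (Df x)"
    using assms by (auto simp: quasiregular_on_def)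
  \<comment> \<open>The gradients supplied by the Sobolev condition are locally in L^n; their
    agreement with \<open>Df\<close> is shown below.\<close>
  obtain G where G: "\<And>i j. weak_partial ?B j (\<lambda>x. f x $ i) (G i j)" "\<And>i j. Lp_loc ?B (real CARD('n)) (G i j)"
    using W unfolding W1p_loc_def by metis
  define h where "h i j x = indicator ?B x * G i j x" for i j x
  have h: "h i j \<in> borel_measurable lebesgue" for i j
    unfolding h_def using G(2)[of i j] by (intro indicator_ball_lebesgue_measurable) (auto simp: Lp_loc_def)
  have "\<exists>G'. G' \<in> borel_measurable borel \<and> (AE x in lborel. h i j x = G' x) \<and> (AE x in lebesgue. h i j x = G' x)" for i j
    by (rule lborel_version[OF h[of i j]]) blast
  then have "\<exists>G'. \<forall>i j. G' i j \<in> borel_measurable borel \<and> (AE x in lborel. h i j x = G' i j x) \<and> (AE x in lebesgue. h i j x = G' i j x)"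
    by (intro choice allI)
  then obtain G' where G': "\<And>i j. G' i j \<in> borel_measurable borel" "\<And>i j. AE x in lborel. h i j x = G' i j x"
     "\<And>i j. AE x in lebesgue. h i j x = G' i j x" by blast
  define g where "g x = (\<chi> i j. G' i j x)" for x
  have gb: "g \<in> borel_measurable borel"
    unfolding g_def by (intro borel_measurable_vecI) (simp add: G')
  have gn: "g x $ i $ j = G' i j x" for i j x by (simp add: g_def)
  have Ln: "set_integrable lborel (cball 0 R) (\<lambda>x. norm (g x) ^ CARD('n))" if R: "R < 1" for R
  proof -
    let ?S = "cball 0 R :: (real^'n) set"
    have sub: "?S \<subseteq> ?B" using R by auto
    have entry: "integrable lborel (\<lambda>x. indicator ?S x * \<bar>G' i j x\<bar> ^ CARD('n))" for i j
    proof -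
      have i0: "integrable lebesgue (\<lambda>x. indicator ?S x *\<^sub>R \<bar>G i j x\<bar> powr real CARD('n))"
        using G(2)[of i j] sub by (auto simp: Lp_loc_def set_integrable_def)
      have eq0: "AE x in lebesgue. indicator ?S x *\<^sub>R \<bar>G i j x\<bar> powr real CARD('n) = indicator ?S x * \<bar>G' i j x\<bar> ^ CARD('n)"
        using G'(3)[of i j]
      proof eventually_elim
        case (elim x)
        show ?case
        proof (cases "x \<in> ?S")
          case True
          then have "G i j x = G' i j x" using elim sub by (auto simp: h_def)
          then show ?thesis using True by (cases "G' i j x = 0") (auto simp: powr_realpow)
        qed simp
      qed
      have m: "(\<lambda>x. indicator ?S x * \<bar>G' i j x\<bar> ^ CARD('n)) \<in> borel_measurable borel"
        by (intro borel_measurable_times borel_measurable_indicator borel_measurable_power borel_measurable_abs G'(1)) auto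
      have "integrable lebesgue (\<lambda>x. indicator ?S x * \<bar>G' i j x\<bar> ^ CARD('n))"
        by (rule integrable_cong_AE_imp[OF i0 _ eq0]) (rule measurable_completion, use m in simp)
      moreover have "(\<lambda>x. indicator ?S x * \<bar>G' i j x\<bar> ^ CARD('n)) \<in> borel_measurable lborel" using m by simp
      ultimately show ?thesis by (subst (asm) integrable_completion)
    qed
    define U where "U = (UNIV :: ('n \<times> 'n) set)"
    define C where "C = real (card U) ^ CARD('n)"
    show ?thesis
      unfolding set_integrable_def
    proof (rule Bochner_Integration.integrable_bound)
      show "integrable lborel (\<lambda>x. C * (\<Sum>p\<in>U. indicator ?S x * \<bar>G' (fst p) (snd p) x\<bar> ^ CARD('n)))"
        by (intro integrable_mult_right Bochner_Integration.integrable_sum entry)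
      show "(\<lambda>x. indicator ?S x *\<^sub>R norm (g x) ^ CARD('n)) \<in> borel_measurable lborel"
        by (intro borel_measurable_scaleR borel_measurable_indicator borel_measurable_power borel_measurable_norm) (use gb in auto)
      show "AE x in lborel. norm (indicator ?S x *\<^sub>R norm (g x) ^ CARD('n))
          \<le> norm (C * (\<Sum>p\<in>U. indicator ?S x * \<bar>G' (fst p) (snd p) x\<bar> ^ CARD('n)))"
      proof (rule AE_I2)
        fix x
        have "norm (g x) \<le> (\<Sum>p\<in>U. \<bar>G' (fst p) (snd p) x\<bar>)"
          using norm_matrix_le_sum[of "g x"]
          by (simp add: gn sum.cartesian_product U_def case_prod_unfold)
        then have "norm (g x) ^ CARD('n) \<le> (\<Sum>p\<in>U. \<bar>G' (fst p) (snd p) x\<bar>) ^ CARD('n)"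
          by (intro power_mono) auto
        also have "\<dots> \<le> C * (\<Sum>p\<in>U. \<bar>G' (fst p) (snd p) x\<bar> ^ CARD('n))"
          unfolding C_def by (rule sum_power_le) (auto simp: U_def)
        finally have "indicator ?S x * norm (g x) ^ CARD('n) \<le> indicator ?S x * (C * (\<Sum>p\<in>U. \<bar>G' (fst p) (snd p) x\<bar> ^ CARD('n)))"
          by (intro mult_left_mono) auto
        also have "\<dots> = C * (\<Sum>p\<in>U. indicator ?S x * \<bar>G' (fst p) (snd p) x\<bar> ^ CARD('n))"
          by (cases "x \<in> ?S") auto
        finally show "norm (indicator ?S x *\<^sub>R norm (g x) ^ CARD('n))
          \<le> norm (C * (\<Sum>p\<in>U. indicator ?S x * \<bar>G' (fst p) (snd p) x\<bar> ^ CARD('n)))" by simp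
      qed
    qed
  qed
  have wk: "(LINT x:?B|lborel. f x $ i * partial j \<phi> x) = - (LINT x:?B|lborel. g x $ i $ j * \<phi> x)"
    if t: "test_function ?B \<phi>" for \<phi> i j
  proof -
    have "Ck (Suc 0) \<phi>" using t by (auto simp: test_function_def simp del: Ck.simps)
    then have c: "continuous_on UNIV \<phi>" "continuous_on UNIV (partial j \<phi>)"
      using Ck_imp_continuous[of "Suc 0" \<phi>] by simp_all
    have m1: "(\<lambda>x. indicator ?B x *\<^sub>R (f x $ i * partial j \<phi> x)) \<in> borel_measurable borel"
      by (rule borel_measurable_continuous_on_indicator)
         (auto intro!: continuous_intros cont continuous_on_subset[OF c(2)])
    have m2: "(\<lambda>x. indicator ?B x *\<^sub>R (g x $ i $ j * \<phi> x)) \<in> borel_measurable borel"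
      unfolding gn by (intro borel_measurable_scaleR borel_measurable_indicator borel_measurable_times G'(1)
        borel_measurable_continuous_onI[OF c(1)]) auto
    have m3: "(\<lambda>x. indicator ?B x *\<^sub>R (G i j x * \<phi> x)) \<in> borel_measurable lebesgue"
      using set_integrable_mult_test[OF _ t] G(1)[of j i] G(1)[of i j] by (auto simp: weak_partial_def set_integrable_def)
    have "(LINT x:?B|lborel. f x $ i * partial j \<phi> x) = (LINT x:?B|lebesgue. f x $ i * partial j \<phi> x)"
      unfolding set_lebesgue_integral_def using m1 by (simp add: integral_completion)
    also have "\<dots> = - (LINT x:?B|lebesgue. G i j x * \<phi> x)"
      using G(1)[of j i] t unfolding weak_partial_def by blast
    also have "(LINT x:?B|lebesgue. G i j x * \<phi> x) = (LINT x:?B|lebesgue. g x $ i $ j * \<phi> x)"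
      unfolding set_lebesgue_integral_def
    proof (rule integral_cong_AE)
      show "AE x in lebesgue. indicator ?B x *\<^sub>R (G i j x * \<phi> x) = indicator ?B x *\<^sub>R (g x $ i $ j * \<phi> x)"
        using G'(3)[of i j] by eventually_elim (auto simp: h_def gn indicator_def)
    qed (use m2 m3 in \<open>auto simp: measurable_completion\<close>)
    also have "\<dots> = (LINT x:?B|lborel. g x $ i $ j * \<phi> x)"
      unfolding set_lebesgue_integral_def using m2 by (simp add: integral_completion)
    finally show ?thesis .
  qed
  define K' where "K' = (real (CARD('n))^2) ^ CARD('n) * K"
  \<comment> \<open>Uniqueness of weak derivatives carries the distortion inequality over from
    \<open>Df\<close> to the L^n gradients.\<close>
  have eq: "AE x in lborel. \<forall>i j. x \<in> ?B \<longrightarrow> Df x $ i $ j = G' i j x"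
  proof (intro eventually_all_finite)
    fix i j
    have "AE x in lborel. x \<in> ?B \<longrightarrow> Df x $ i $ j = G i j x"
      by (rule weak_partial_unique[OF open_ball]) (use Df G(1) in \<open>auto simp: weak_differential_def\<close>)
    then show "AE x in lborel. x \<in> ?B \<longrightarrow> Df x $ i $ j = G' i j x"
      using G'(2)[of i j] by eventually_elim (auto simp: h_def)
  qed
  have "AE x in lborel. x \<in> ?B \<longrightarrow> onorm (\<lambda>v. Df x *v v) ^ CARD('n) \<le> K * det (Df x)"
    using dist by (simp only: AE_completion_iff)
  then have "AE x in lborel. x \<in> ?B \<longrightarrow> norm (g x) ^ CARD('n) \<le> K' * det (g x)"
    using eq
  proof eventually_elim
    case (elim x)
    show ?case
    proof
      assume x: "x \<in> ?B"
      have gx: "g x = Df x" using elim(2) x by (simp add: vec_eq_iff gn)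
      have "norm (g x) ^ CARD('n) \<le> (real (CARD('n))^2 * onorm (\<lambda>v. Df x *v v)) ^ CARD('n)"
        unfolding gx by (intro power_mono norm_matrix_le_onorm) auto
      also have "\<dots> \<le> K' * det (g x)"
        unfolding power_mult_distrib K'_def gx mult.assoc using elim(1) x by (intro mult_left_mono) auto
      finally show "norm (g x) ^ CARD('n) \<le> K' * det (g x)" .
    qed
  qed
  moreover have "K' > 0" using K by (simp add: K'_def)
  ultimately have "qr_map f g K'"
    using cont gb Ln wk by unfold_locales auto
  then show ?thesis by blast
qed

section \<open>Smooth approximation\<close>

text \<open>Integrating over a fixed box instead of the moving support keeps the domain independent
  of \<open>x\<close>, so the derivative passes under the integral; the box is later chosen to
  contain the relevant supports.\<close>

lemma integral_kernel_has_derivative: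
  fixes w :: "real^'n \<Rightarrow> real" and \<phi> :: "real^'n \<Rightarrow> real" and \<phi>' :: "real^'n \<Rightarrow> real^'n"
  assumes w: "continuous_on UNIV w" and \<phi>: "\<And>z. (\<phi> has_derivative (\<lambda>h. \<phi>' z \<bullet> h)) (at z)"
    and \<phi>': "continuous_on UNIV \<phi>'"
  shows "((\<lambda>x. integral (cbox a b) (\<lambda>y. w y * \<phi> (x - y))) has_derivative
     (\<lambda>h. (\<chi> j. integral (cbox a b) (\<lambda>y. w y * \<phi>' (x - y) $ j)) \<bullet> h)) (at x)"
proof -
  have c\<phi>: "continuous_on UNIV \<phi>"
    using \<phi> has_derivative_continuous by (blast intro: continuous_at_imp_continuous_on)
  define D where "D x y = w y *\<^sub>R blinfun_inner_right (\<phi>' (x - y))" for x y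
  have cD: "continuous_on (UNIV \<times> cbox a b) (\<lambda>(x, y). D x y)"
    unfolding D_def split_beta
    by (intro continuous_intros bounded_linear.continuous_on[OF bounded_linear_blinfun_inner_right]
          continuous_on_compose2[OF w] continuous_on_compose2[OF \<phi>']) auto
  have "((\<lambda>x. integral (cbox a b) (\<lambda>y. w y * \<phi> (x - y))) has_derivative integral (cbox a b) (D x)) (at x within UNIV)"
  proof (rule leibniz_rule[OF _ _ cD])
    show "((\<lambda>x. w t * \<phi> (x - t)) has_derivative blinfun_apply (D x t)) (at x within UNIV)" for x t
    proof -
      have "((\<lambda>x. x - t) has_derivative (\<lambda>h. h)) (at x)" by (auto intro!: derivative_eq_intros)
      from has_derivative_mult_right[OF has_derivative_compose[OF this \<phi>], of "w t"]
      show ?thesis by (rule has_derivative_eq_rhs[OF has_derivative_at_withinI]) (auto simp: D_def blinfun.scaleR_left)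
    qed
    show "(\<lambda>y. w y * \<phi> (x - y)) integrable_on cbox a b" for x
      by (intro integrable_continuous continuous_intros continuous_on_compose2[OF w] continuous_on_compose2[OF c\<phi>]) auto
  qed auto
  moreover have "blinfun_apply (integral (cbox a b) (D x)) h = (\<chi> j. integral (cbox a b) (\<lambda>y. w y * \<phi>' (x - y) $ j)) \<bullet> h" for h
  proof -
    have iD: "D x integrable_on cbox a b"
      unfolding D_def
      by (intro integrable_continuous continuous_intros bounded_linear.continuous_on[OF bounded_linear_blinfun_inner_right]
          continuous_on_compose2[OF w] continuous_on_compose2[OF \<phi>']) auto
    have "blinfun_apply (integral (cbox a b) (D x)) h = integral (cbox a b) (\<lambda>y. blinfun_apply (D x y) h)"
      using integral_linear[OF iD blinfun.bounded_linear_left[of h]] by (simp add: o_def)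
    also have "\<dots> = integral (cbox a b) (\<lambda>y. \<Sum>j\<in>UNIV. (w y * \<phi>' (x - y) $ j) * h $ j)"
      by (simp add: D_def blinfun.scaleR_left inner_vec_def sum_distrib_left mult_ac)
    also have "\<dots> = (\<Sum>j\<in>UNIV. integral (cbox a b) (\<lambda>y. (w y * \<phi>' (x - y) $ j) * h $ j))"
      by (intro integral_sum integrable_continuous continuous_intros continuous_on_compose2[OF w]
           continuous_on_compose2[OF \<phi>']) auto
    also have "\<dots> = (\<chi> j. integral (cbox a b) (\<lambda>y. w y * \<phi>' (x - y) $ j)) \<bullet> h"
      by (simp add: inner_vec_def)
    finally show ?thesis .
  qed
  ultimately show ?thesis by (metis (no_types, lifting) has_derivative_eq_rhs ext)
qed

lemma continuous_integral_kernel: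
  fixes w :: "real^'n \<Rightarrow> real" and \<phi> :: "real^'n \<Rightarrow> real"
  assumes w: "continuous_on UNIV w" and \<phi>: "continuous_on UNIV \<phi>"
  shows "continuous_on UNIV (\<lambda>x. integral (cbox a b) (\<lambda>y. w y * \<phi> (x - y)))"
  by (rule integral_continuous_on_param)
     (auto simp: split_beta intro!: continuous_intros continuous_on_compose2[OF w] continuous_on_compose2[OF \<phi>])


context qr_map
begin

text \<open>Convolution puts all derivatives on the kernel, which makes \<open>G\<close> and
  \<open>H\<close> explicit and \<open>H\<close> symmetric. Tested with the kernel, the weak
  derivative formula identifies \<open>G\<close> on the ball with the mollification of
  \<open>g\<close>, whence convergence in L^n.\<close>

theorem smooth_approximation:
  assumes R: "0 < R" "R < 1"
  obtains F :: "nat \<Rightarrow> real^'n \<Rightarrow> real^'n" and G :: "nat \<Rightarrow> real^'n \<Rightarrow> real^'n^'n"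
    and H :: "nat \<Rightarrow> 'n \<Rightarrow> 'n \<Rightarrow> real^'n \<Rightarrow> real^'n"
  where "\<And>k i x. ((\<lambda>x. F k x $ i) has_derivative (\<lambda>v. G k x $ i \<bullet> v)) (at x)"
    and "\<And>k i j x. ((\<lambda>x. G k x $ i $ j) has_derivative (\<lambda>v. H k i j x \<bullet> v)) (at x)"
    and "\<And>k i j. continuous_on UNIV (H k i j)"
    and "\<And>k i j l x. H k i j x $ l = H k i l x $ j"
    and "uniform_limit (cball 0 R) F f sequentially"
    and "\<And>k. set_integrable lborel (cball 0 R) (\<lambda>x. norm (G k x - g x) ^ CARD('n))"
    and "(\<lambda>k. LINT x:cball 0 R|lborel. norm (G k x - g x) ^ CARD('n)) \<longlonglongrightarrow> 0"
proof -
  \<comment> \<open>Room for the kernel: its radius is at most R1 - R, so at points of the ball of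
    radius \<open>R\<close> only values in the ball of radius \<open>R1\<close> are seen.\<close>
  define R1 where "R1 = (R + 1) / 2"
  have R1: "R < R1" "R1 < 1" "0 < R1" using R by (auto simp: R1_def)
  define \<delta> where "\<delta> k = (R1 - R) / real (Suc k)" for k
  have \<delta>: "\<delta> k > 0" "\<delta> k \<le> R1 - R" for k
    using R1 divide_left_mono[of 1 "real (Suc k)" "R1 - R"] by (auto simp: \<delta>_def)
  have \<delta>0: "\<delta> \<longlonglongrightarrow> 0" unfolding \<delta>_def using LIMSEQ_Suc[OF lim_const_over_n[of "R1 - R"]] by simp
  define Q where "Q = cbox (-One) (One::real^'n)"
  have near: "y \<in> cball 0 R1" if "x \<in> cball 0 R" "norm (x - y) \<le> \<delta> k" for x y :: "real^'n" and k
    using that \<delta>(2)[of k] norm_triangle_sub[of y x] by (simp add: norm_minus_commute)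
  have Q: "cball 0 R1 \<subseteq> Q"
  proof
    fix y :: "real^'n" assume y: "y \<in> cball 0 R1"
    have "\<bar>y \<bullet> b\<bar> \<le> 1" if "b \<in> Basis" for b
      using Basis_le_norm[OF that, of y] y R1 by simp
    then show "y \<in> Q" by (auto simp: Q_def mem_box abs_le_iff minus_le_iff)
  qed
  \<comment> \<open>Radial retraction onto the ball of radius \<open>R1\<close>. Composing
    \<open>f\<close> with it gives a continuous function on the whole space that agrees with
    \<open>f\<close> wherever the kernel looks.\<close>
  define p where "p y = (R1 / max R1 (norm y)) *\<^sub>R y" for y :: "real^'n"
  have p: "p y \<in> cball 0 R1" "y \<in> cball 0 R1 \<Longrightarrow> p y = y" for y
    using R1 by (auto simp: p_def max_def field_simps)
  have p': "p y \<in> ball 0 1" for y using p(1)[of y] R1 by simp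
  have cp: "continuous_on UNIV p" unfolding p_def using R1 by (intro continuous_intros) auto
  define f1 where "f1 y = f (p y)" for y
  have f1: "continuous_on UNIV f1"
    unfolding f1_def by (rule continuous_on_compose2[OF cont_f cp]) (use p' in blast)
  have f1i: "continuous_on UNIV (\<lambda>y. f1 y $ i)" for i by (intro continuous_intros f1)
  have f1f: "f1 y = f y" if "y \<in> cball 0 R1" for y using p(2)[OF that] by (simp add: f1_def)
  define F where "F k x = (\<chi> i. integral Q (\<lambda>y. f1 y $ i * mkern (\<delta> k) (x - y)))" for k x
  define G where "G k x = (\<chi> i j. integral Q (\<lambda>y. f1 y $ i * partial j (mkern (\<delta> k)) (x - y)))" for k x
  define H where "H k i j x = (\<chi> l. integral Q (\<lambda>y. f1 y $ i * partial l (partial j (mkern (\<delta> k))) (x - y)))" for k i j x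
  have C1: "Ck (Suc 0) (mkern d :: real^'n \<Rightarrow> real)" for d by (rule Ck_mkern)
  have C1p: "Ck (Suc 0) (partial j (mkern d :: real^'n \<Rightarrow> real))" for d j
    using iffD1[OF Ck.simps(2) Ck_mkern[of "Suc (Suc 0)" d, where 'n='n]] by blast
  have C0pp: "continuous_on UNIV (partial l (partial j (mkern d :: real^'n \<Rightarrow> real)))" for d j l
    using iffD1[OF Ck.simps(2) C1p[where j=j and d=d]] Ck_imp_continuous by blast
  have dF: "((\<lambda>x. F k x $ i) has_derivative (\<lambda>v. G k x $ i \<bullet> v)) (at x)" for k i x
    using integral_kernel_has_derivative[OF f1i[of i] Ck_1_has_derivative[OF C1], of "-One" One "\<delta> k" x]
    by (simp add: F_def G_def Q_def)
  have dG: "((\<lambda>x. G k x $ i $ j) has_derivative (\<lambda>v. H k i j x \<bullet> v)) (at x)" for k i j x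
    using integral_kernel_has_derivative[OF f1i[of i] Ck_1_has_derivative[OF C1p[where j=j]], of "-One" One "\<delta> k" x]
    by (simp add: G_def H_def Q_def)
  have cH: "continuous_on UNIV (H k i j)" for k i j
    unfolding H_def Q_def by (intro continuous_on_vec_lambda continuous_integral_kernel f1i C0pp)
  have sH: "H k i j x $ l = H k i l x $ j" for k i j l x
    using partial_mkern_commute[where i=l and j=j and \<delta>="\<delta> k" and 'n='n] by (simp add: H_def fun_eq_iff)
  have cG: "continuous_on UNIV (G k)" for k
  proof -
    have "continuous_on UNIV (\<lambda>x. G k x $ i $ j)" for i j
      using dG has_derivative_continuous by (blast intro: continuous_at_imp_continuous_on)
    then have "continuous_on UNIV (\<lambda>x. \<chi> i j. G k x $ i $ j)" by (intro continuous_on_vec_lambda)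
    then show ?thesis by simp
  qed
  \<comment> \<open>The cutoff makes \<open>g\<close> integrable on the whole space, as
    \<open>mollify_Lp_tendsto\<close> requires.\<close>
  define g1 where "g1 x = indicator (cball 0 R1) x *\<^sub>R g x" for x
  have g1b: "g1 \<in> borel_measurable borel"
    unfolding g1_def by (intro borel_measurable_scaleR borel_measurable_indicator g_borel) auto
  have g1n: "integrable lborel (\<lambda>x. norm (g1 x) ^ CARD('n))"
  proof -
    have "(\<lambda>x. norm (g1 x) ^ CARD('n)) = (\<lambda>x. indicator (cball 0 R1) x *\<^sub>R norm (g x) ^ CARD('n))"
      by (auto simp: fun_eq_iff g1_def indicator_def)
    then show ?thesis using g_Ln[OF R1(2)] by (simp add: set_integrable_def)
  qed
  have g1i: "integrable lborel g1"
  proof (rule Bochner_Integration.integrable_bound)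
    show "integrable lborel (\<lambda>x. norm (g1 x) ^ CARD('n) + indicator (cball 0 R1) x)"
      using g1n R1 by (auto intro!: integrable_real_indicator simp: emeasure_cball)
    show "AE x in lborel. norm (g1 x) \<le> norm (norm (g1 x) ^ CARD('n) + indicator (cball 0 R1) x)"
    proof (rule AE_I2)
      fix x
      have "norm (g1 x) \<le> norm (g1 x) ^ CARD('n)" if "norm (g1 x) \<ge> 1"
        using power_increasing[of 1 "CARD('n)" "norm (g1 x)"] that by (simp add: Suc_leI)
      then show "norm (g1 x) \<le> norm (norm (g1 x) ^ CARD('n) + indicator (cball 0 R1) x)"
        by (cases "norm (g1 x) \<ge> 1"; cases "x \<in> cball 0 R1")
           (auto simp: g1_def intro: order_trans[of _ 1])
    qed
  qed (use g1b in simp)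
  have GM: "G k x = mollify (\<delta> k) g1 x" if x: "x \<in> cball 0 R" for k x
  proof -
    have cb: "cball x (\<delta> k) \<subseteq> cball 0 R1" using near[OF x] by (auto simp: dist_norm)
    have sub: "cball x (\<delta> k) \<subseteq> ball 0 1" using cb R1 by auto
    have t: "test_function (ball 0 1) (\<lambda>y. mkern (\<delta> k) (x - y))" by (rule test_function_mkern[OF \<delta>(1) sub])
    have "G k x $ i $ j = mollify (\<delta> k) g1 x $ i $ j" for i j
    proof -
      let ?P = "\<lambda>y. partial j (mkern (\<delta> k)) (x - y)"
      have cP: "continuous_on UNIV ?P"
        by (rule continuous_on_compose2[OF Ck_imp_continuous[OF C1p]]) (auto intro!: continuous_intros)
      have i: "set_integrable lborel Q (\<lambda>y. f1 y $ i * ?P y)"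
        unfolding Q_def
        by (rule set_integrable_continuous_compact) (auto intro!: continuous_intros continuous_on_subset[OF f1i] continuous_on_subset[OF cP])
      have "G k x $ i $ j = (LINT y:Q|lborel. f1 y $ i * ?P y)"
        using set_borel_integral_eq_integral(2)[OF i] by (simp add: G_def)
      \<comment> \<open>The sign arises from differentiating the kernel in \<open>y\<close> instead
        of \<open>x\<close>; it cancels the sign in the definition of the weak derivative.\<close>
      also have "\<dots> = (LINT y:ball 0 1|lborel. - (f y $ i * partial j (\<lambda>y. mkern (\<delta> k) (x - y)) y))"
        unfolding set_lebesgue_integral_def
      proof (rule Bochner_Integration.integral_cong[OF refl])
        fix y
        show "indicator Q y *\<^sub>R (f1 y $ i * ?P y) = indicator (ball 0 1) y *\<^sub>R - (f y $ i * partial j (\<lambda>y. mkern (\<delta> k) (x - y)) y)"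
        proof (cases "y \<in> cball x (\<delta> k)")
          case True
          then have "y \<in> cball 0 R1" "y \<in> Q" "y \<in> ball 0 1" using cb sub Q by blast+
          then show ?thesis using f1f[of y] unfolding partial_mkern_reflect by simp
        next
          case False
          then have "\<delta> k \<le> norm (x - y)" by (simp add: dist_norm)
          then have "?P y = 0" by (rule partial_mkern_eq_0[OF \<delta>(1)])
          then show ?thesis unfolding partial_mkern_reflect by simp
        qed
      qed
      also have "\<dots> = - (LINT y:ball 0 1|lborel. f y $ i * partial j (\<lambda>y. mkern (\<delta> k) (x - y)) y)"
        unfolding set_lebesgue_integral_def by simp
      also have "\<dots> = (LINT y:ball 0 1|lborel. g y $ i $ j * mkern (\<delta> k) (x - y))"
        unfolding weak[OF t] by simp
      also have "\<dots> = (LINT y|lborel. (mkern (\<delta> k) (x - y) *\<^sub>R g1 y) $ i $ j)"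
        unfolding set_lebesgue_integral_def
      proof (rule Bochner_Integration.integral_cong[OF refl])
        fix y
        show "indicator (ball 0 1) y *\<^sub>R (g y $ i $ j * mkern (\<delta> k) (x - y)) = (mkern (\<delta> k) (x - y) *\<^sub>R g1 y) $ i $ j"
        proof (cases "y \<in> cball x (\<delta> k)")
          case True
          then have "y \<in> cball 0 R1" "y \<in> ball 0 1" using cb sub by blast+
          then show ?thesis by (simp add: g1_def)
        next
          case False
          then have "\<delta> k \<le> norm (x - y)" by (simp add: dist_norm)
          then have "mkern (\<delta> k) (x - y) = 0" by (rule mkern_eq_0[OF \<delta>(1)])
          then show ?thesis by simp
        qed
      qed
      also have "\<dots> = mollify (\<delta> k) g1 x $ i $ j"
        unfolding mollify_def
        by (rule integral_bounded_linear[OF bounded_linear_compose[OF bounded_linear_vec_nth bounded_linear_vec_nth], unfolded o_def])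
           (rule mollify_integrable[OF \<delta>(1) g1i])
      finally show ?thesis .
    qed
    then show ?thesis by (simp add: vec_eq_iff)
  qed
  have n0: "0 < CARD('n)" by simp
  note conv = mollify_Lp_tendsto[of g1 "CARD('n)" \<delta>, OF g1i g1n n0 \<delta>(1) \<delta>0]
  have eqG: "indicator (cball 0 R) x *\<^sub>R norm (G k x - g x) ^ CARD('n)
      = indicator (cball 0 R) x *\<^sub>R norm (mollify (\<delta> k) g1 x - g1 x) ^ CARD('n)" for k x
    using GM[of x k] R1 by (cases "x \<in> cball 0 R") (auto simp: g1_def)
  have I: "set_integrable lborel (cball 0 R) (\<lambda>x. norm (G k x - g x) ^ CARD('n))" for k
    unfolding set_integrable_def eqG by (rule integrable_mult_indicator[OF _ conv(1)]) simp
  have L: "(\<lambda>k. LINT x:cball 0 R|lborel. norm (G k x - g x) ^ CARD('n)) \<longlonglongrightarrow> 0"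
  proof (rule Lim_null_comparison[OF always_eventually conv(2)], rule allI)
    fix k
    have "(LINT x:cball 0 R|lborel. norm (G k x - g x) ^ CARD('n)) \<le> (LINT x|lborel. norm (mollify (\<delta> k) g1 x - g1 x) ^ CARD('n))"
      unfolding set_lebesgue_integral_def eqG
      by (rule integral_mono[OF integrable_mult_indicator[OF _ conv(1)] conv(1)]) (auto simp: indicator_def)
    moreover have "0 \<le> (LINT x:cball 0 R|lborel. norm (G k x - g x) ^ CARD('n))"
      unfolding set_lebesgue_integral_def by (intro integral_nonneg_AE) auto
    ultimately show "norm (LINT x:cball 0 R|lborel. norm (G k x - g x) ^ CARD('n))
        \<le> (LINT x|lborel. norm (mollify (\<delta> k) g1 x - g1 x) ^ CARD('n))" by simp
  qed
  have U: "uniform_limit (cball 0 R) F f sequentially"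
  proof (rule uniform_limitI)
    fix e :: real assume e: "e > 0"
    define e' where "e' = e / (2 * real CARD('n))"
    have e': "e' > 0" using e by (simp add: e'_def)
    have "uniformly_continuous_on (cball 0 R1) f"
      using R1 by (intro compact_uniformly_continuous continuous_on_subset[OF cont_f]) auto
    then obtain d where d: "d > 0" "\<And>x y. x \<in> cball 0 R1 \<Longrightarrow> y \<in> cball 0 R1 \<Longrightarrow> dist y x < d \<Longrightarrow> dist (f y) (f x) < e'"
      using e' unfolding uniformly_continuous_on_def by metis
    have "\<forall>\<^sub>F k in sequentially. \<delta> k < d" using order_tendstoD(2)[OF \<delta>0 d(1)] .
    then show "\<forall>\<^sub>F k in sequentially. \<forall>x\<in>cball 0 R. dist (F k x) (f x) < e"
    proof eventually_elim
      case (elim k)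
      show ?case
      proof
        fix x :: "real^'n" assume x: "x \<in> cball 0 R"
        have xR1: "x \<in> cball 0 R1" using x R1 by auto
        let ?m = "\<lambda>y. mkern (\<delta> k) (x - y)"
        have comp: "\<bar>F k x $ i - f x $ i\<bar> \<le> e'" for i
        proof -
          have cm: "continuous_on UNIV ?m"
            by (rule continuous_on_compose2[OF continuous_mkern]) (auto intro!: continuous_intros)
          have iQ: "set_integrable lborel Q (\<lambda>y. f1 y $ i * ?m y)"
            unfolding Q_def
            by (rule set_integrable_continuous_compact) (auto intro!: continuous_intros continuous_on_subset[OF f1i] continuous_on_subset[OF cm])
          have m0: "?m y = 0" if "y \<notin> cball x (\<delta> k)" for y
            using that mkern_eq_0[OF \<delta>(1), of k "x - y"] by (simp add: dist_norm)
          have yR1: "y \<in> cball 0 R1" if "y \<in> cball x (\<delta> k)" for y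
            using near[OF x, of y k] that by (simp add: dist_norm)
          have eq: "indicator Q y *\<^sub>R (f1 y $ i * ?m y) = f1 y $ i * ?m y" for y
            using m0[of y] yR1[of y] Q by (cases "y \<in> cball x (\<delta> k)") auto
          have i1: "integrable lborel (\<lambda>y. f1 y $ i * ?m y)"
            using iQ unfolding set_integrable_def eq .
          have i2: "integrable lborel (\<lambda>y. f x $ i * ?m y)" using mkern_shift(1)[OF \<delta>(1), of k x] by (intro integrable_mult_right) auto
          have "F k x $ i = (LINT y|lborel. f1 y $ i * ?m y)"
            using set_borel_integral_eq_integral(2)[OF iQ] unfolding set_lebesgue_integral_def eq by (simp add: F_def)
          moreover have "f x $ i = (LINT y|lborel. f x $ i * ?m y)" using mkern_shift(2)[OF \<delta>(1), of k x] by simp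
          ultimately have "F k x $ i - f x $ i = (LINT y|lborel. f1 y $ i * ?m y - f x $ i * ?m y)"
            using i1 i2 by simp
          also have "\<bar>\<dots>\<bar> \<le> (LINT y|lborel. e' * ?m y)"
          proof (rule integral_abs_bound[THEN order_trans], rule integral_mono)
            show "integrable lborel (\<lambda>y. \<bar>f1 y $ i * ?m y - f x $ i * ?m y\<bar>)" using i1 i2 by auto
            show "integrable lborel (\<lambda>y. e' * ?m y)" using mkern_shift(1)[OF \<delta>(1), of k x] by (intro integrable_mult_right) auto
            fix y
            show "\<bar>f1 y $ i * ?m y - f x $ i * ?m y\<bar> \<le> e' * ?m y"
            proof (cases "y \<in> cball x (\<delta> k)")
              case True
              then have "dist (f y) (f x) < e'" using d(2)[OF xR1 yR1[OF True]] elim by (auto simp: dist_commute)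
              then have "\<bar>f1 y $ i - f x $ i\<bar> \<le> e'"
                using component_le_norm_cart[of "f y - f x" i] f1f[OF yR1[OF True]] by (simp add: dist_norm)
              then have "\<bar>f1 y $ i - f x $ i\<bar> * ?m y \<le> e' * ?m y" using \<delta>(1) by (intro mult_right_mono mkern_nonneg) auto
              moreover have "\<bar>f1 y $ i * ?m y - f x $ i * ?m y\<bar> = \<bar>f1 y $ i - f x $ i\<bar> * ?m y"
                using mkern_nonneg[OF \<delta>(1), of k "x - y"] by (simp add: left_diff_distrib[symmetric] abs_mult)
              ultimately show ?thesis by simp
            qed (simp add: m0)
          qed
          also have "\<dots> = e'" using mkern_shift(2)[OF \<delta>(1), of k x] by simp
          finally show ?thesis .
        qed
        have "norm (F k x - f x) \<le> (\<Sum>i\<in>UNIV. \<bar>(F k x - f x) $ i\<bar>)" by (rule norm_le_l1_cart)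
        also have "\<dots> \<le> (\<Sum>i\<in>(UNIV::'n set). e')" using comp by (intro sum_mono) simp
        also have "\<dots> < e" using e by (simp add: e'_def)
        finally show "dist (F k x) (f x) < e" by (simp add: dist_norm)
      qed
    qed
  qed
  show thesis by (rule that[OF dF dG cH sH U I L])
qed

end

section \<open>Monotonicity\<close>

lemma det_diff_le:
  fixes A B :: "real^'n^'n"
  shows "\<bar>det A - det B\<bar> \<le> fact CARD('n) * CARD('n) * norm (A - B) * (norm A + norm B) ^ (CARD('n) - 1)"
proof -
  \<comment> \<open>Dividing by \<open>s\<close> makes all entries at most one in modulus, as needed
    for telescoping a difference of products factor by factor.\<close>
  define s where "s = norm A + norm B"
  let ?S = "{\<sigma>. \<sigma> permutes (UNIV::'n set)}"
  show ?thesis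
  proof (cases "s = 0")
    case True
    then have "norm A = 0 \<and> norm B = 0"
      unfolding s_def by (simp add: add_nonneg_eq_0_iff)
    then have "A = 0" "B = 0" by auto
    then show ?thesis by simp
  next
    case False
    then have s: "s > 0" unfolding s_def by (simp add: order_less_le)
    have prod: "\<bar>(\<Prod>i\<in>UNIV. A $ i $ \<sigma> i) - (\<Prod>i\<in>UNIV. B $ i $ \<sigma> i)\<bar> \<le> CARD('n) * norm (A - B) * s ^ (CARD('n) - 1)" for \<sigma> :: "'n \<Rightarrow> 'n"
    proof -
      have "norm ((\<Prod>i\<in>UNIV. A $ i $ \<sigma> i / s) - (\<Prod>i\<in>UNIV. B $ i $ \<sigma> i / s)) \<le> (\<Sum>i\<in>UNIV. norm (A $ i $ \<sigma> i / s - B $ i $ \<sigma> i / s))"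
      proof (rule norm_prod_diff)
        fix i
        show "norm (A $ i $ \<sigma> i / s) \<le> 1" "norm (B $ i $ \<sigma> i / s) \<le> 1"
          using s entry_le_norm_matrix[of A i "\<sigma> i"] entry_le_norm_matrix[of B i "\<sigma> i"]
          by (auto simp: s_def intro: order_trans add_increasing add_increasing2)
      qed
      also have "\<dots> \<le> (\<Sum>i\<in>(UNIV::'n set). norm (A - B) / s)"
      proof (rule sum_mono)
        fix i
        have "\<bar>A $ i $ \<sigma> i - B $ i $ \<sigma> i\<bar> \<le> norm (A - B)" using entry_le_norm_matrix[of "A - B" i "\<sigma> i"] by simp
        then show "norm (A $ i $ \<sigma> i / s - B $ i $ \<sigma> i / s) \<le> norm (A - B) / s"
          using s by (simp add: diff_divide_distrib[symmetric] divide_right_mono)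
      qed
      finally have "\<bar>(\<Prod>i\<in>UNIV. A $ i $ \<sigma> i) - (\<Prod>i\<in>UNIV. B $ i $ \<sigma> i)\<bar> / s ^ CARD('n) \<le> CARD('n) * (norm (A - B) / s)"
        using s by (simp add: prod_dividef diff_divide_distrib[symmetric])
      then have "\<bar>(\<Prod>i\<in>UNIV. A $ i $ \<sigma> i) - (\<Prod>i\<in>UNIV. B $ i $ \<sigma> i)\<bar> \<le> CARD('n) * (norm (A - B) / s) * s ^ CARD('n)"
        using s by (simp add: pos_divide_le_eq)
      also have "\<dots> = CARD('n) * norm (A - B) * s ^ (CARD('n) - 1)"
        using s by (subst power_eq_if) auto
      finally show ?thesis .
    qed
    have "\<bar>det A - det B\<bar> = \<bar>\<Sum>\<sigma>\<in>?S. of_int (sign \<sigma>) * ((\<Prod>i\<in>UNIV. A $ i $ \<sigma> i) - (\<Prod>i\<in>UNIV. B $ i $ \<sigma> i))\<bar>"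
      by (simp add: det_def sum_subtractf right_diff_distrib)
    also have "\<dots> \<le> (\<Sum>\<sigma>\<in>?S. \<bar>of_int (sign \<sigma>) * ((\<Prod>i\<in>UNIV. A $ i $ \<sigma> i) - (\<Prod>i\<in>UNIV. B $ i $ \<sigma> i))\<bar>)"
      by (rule sum_abs)
    also have "\<dots> \<le> (\<Sum>\<sigma>\<in>?S. CARD('n) * norm (A - B) * s ^ (CARD('n) - 1))"
      using prod by (intro sum_mono) (simp add: abs_mult sign_def)
    also have "\<dots> = fact CARD('n) * CARD('n) * norm (A - B) * s ^ (CARD('n) - 1)"
      by (simp add: card_permutations[OF refl])
    finally show ?thesis by (simp add: s_def)
  qed
qed

text \<open>A small multiple of the fixed |B|^n plus a large multiple of |A - B|^n: after
  integration this yields L^1 convergence of determinants without Hoelder's inequality. The two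
  terms correspond to |A - B| being small or large compared with |B|.\<close>

lemma det_diff_Young:
  assumes "\<epsilon> > 0"
  obtains M where "M \<ge> 0" "\<And>A B :: real^'n^'n. \<bar>det A - det B\<bar> \<le> \<epsilon> * norm B ^ CARD('n) + M * norm (A - B) ^ CARD('n)"
proof -
  define C where "C = (fact CARD('n) * CARD('n) :: real)"
  have C: "C > 0" by (simp add: C_def)
  obtain N where n: "CARD('n) = Suc N" using gr0_conv_Suc zero_less_card_finite by blast
  \<comment> \<open>Threshold for the ratio of |A - B| to |B|; below it the difference of
    determinants is at most C L 3^N |B|^n.\<close>
  define L where "L = min 1 (\<epsilon> / (C * 3 ^ N))"
  have L: "0 < L" "L \<le> 1" "C * L * 3 ^ N \<le> \<epsilon>"
    using C assms by (auto simp: L_def min_def field_simps)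
  define M where "M = C * (1 + 2 / L) ^ N"
  have M: "M \<ge> 0" using C L by (simp add: M_def)
  have "\<bar>det A - det B\<bar> \<le> \<epsilon> * norm B ^ CARD('n) + M * norm (A - B) ^ CARD('n)" for A B :: "real^'n^'n"
  proof -
    define b d where "b = norm B" and "d = norm (A - B)"
    have bd: "b \<ge> 0" "d \<ge> 0" by (auto simp: b_def d_def)
    have s: "norm A + norm B \<le> d + 2 * b"
      using norm_triangle_ineq[of "A - B" B] by (simp add: b_def d_def)
    have "\<bar>det A - det B\<bar> \<le> C * d * (norm A + norm B) ^ N" using det_diff_le[of A B] n by (simp add: C_def d_def)
    also have "\<dots> \<le> C * d * (d + 2 * b) ^ N"
      using s C bd by (intro mult_left_mono power_mono) auto
    also have "\<dots> \<le> \<epsilon> * b ^ CARD('n) + M * d ^ CARD('n)"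
    proof (cases "d \<le> L * b")
      case True
      have "L * b \<le> b" using L bd by (simp add: mult_left_le_one_le)
      then have "C * d * (d + 2 * b) ^ N \<le> C * (L * b) * (3 * b) ^ N"
        using True C bd L by (intro mult_mono power_mono) auto
      also have "\<dots> = (C * L * 3 ^ N) * b ^ Suc N" by (simp add: power_mult_distrib)
      also have "\<dots> \<le> \<epsilon> * b ^ Suc N" using L(3) bd by (intro mult_right_mono) auto
      finally show ?thesis using M bd n by (simp add: add_increasing2)
    next
      case False
      then have "b \<le> d / L" using L by (simp add: field_simps)
      then have "C * d * (d + 2 * b) ^ N \<le> C * d * ((1 + 2 / L) * d) ^ N"
      proof (intro mult_left_mono power_mono)
        have "(1 + 2 / L) * d = d + 2 * (d / L)" using L by (simp add: field_simps)
        then show "d + 2 * b \<le> (1 + 2 / L) * d" using \<open>b \<le> d / L\<close> by simp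
      qed (use C bd in auto)
      also have "\<dots> = M * d ^ Suc N" by (simp add: power_mult_distrib M_def)
      finally show ?thesis using assms bd n by (simp add: add_increasing)
    qed
    finally show ?thesis by (simp add: b_def d_def)
  qed
  then show thesis using M that by blast
qed

lemma set_integrable_continuous_mult:
  fixes a X :: "'a::euclidean_space \<Rightarrow> real"
  assumes a: "continuous_on S a" and S: "compact S" and X: "set_integrable lborel S X"
  shows "set_integrable lborel S (\<lambda>x. a x * X x)"
proof -
  have "compact (a ` S)" using a S by (rule compact_continuous_image)
  then obtain B where B: "\<And>x. x \<in> S \<Longrightarrow> \<bar>a x\<bar> \<le> B"
    using compact_imp_bounded bounded_iff by (metis imageI real_norm_def)
  have m: "(\<lambda>x. indicator S x *\<^sub>R a x) \<in> borel_measurable borel"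
    using S a by (intro borel_measurable_continuous_on_indicator borel_closed compact_imp_closed)
  have i: "integrable lborel (\<lambda>x. indicator S x *\<^sub>R X x)" using X by (simp add: set_integrable_def)
  have "integrable lborel (\<lambda>x. (indicator S x *\<^sub>R a x) * (indicator S x *\<^sub>R X x))"
  proof (rule Bochner_Integration.integrable_bound)
    show "integrable lborel (\<lambda>x. B * norm (indicator S x *\<^sub>R X x))" using i by (intro integrable_mult_right integrable_norm)
    show "(\<lambda>x. (indicator S x *\<^sub>R a x) * (indicator S x *\<^sub>R X x)) \<in> borel_measurable lborel"
      using m i by (intro borel_measurable_times) auto
    show "AE x in lborel. norm ((indicator S x *\<^sub>R a x) * (indicator S x *\<^sub>R X x)) \<le> norm (B * norm (indicator S x *\<^sub>R X x))"
    proof (rule AE_I2)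
      fix x
      show "norm ((indicator S x *\<^sub>R a x) * (indicator S x *\<^sub>R X x)) \<le> norm (B * norm (indicator S x *\<^sub>R X x))"
      proof (cases "x \<in> S")
        case True
        then have "\<bar>a x\<bar> * \<bar>X x\<bar> \<le> \<bar>B\<bar> * \<bar>X x\<bar>" using B[OF True] by (intro mult_right_mono) auto
        then show ?thesis using True by (simp add: abs_mult)
      qed simp
    qed
  qed
  moreover have "(\<lambda>x. (indicator S x *\<^sub>R a x) * (indicator S x *\<^sub>R X x)) = (\<lambda>x. indicator S x *\<^sub>R (a x * X x))"
    by (auto simp: fun_eq_iff indicator_def)
  ultimately show ?thesis unfolding set_integrable_def by (simp only:)
qed

text \<open>Splits b Y - a X into b (Y - X) + (b - a) X: eventual uniform boundedness of
  \<open>b\<close> handles the first term, uniform convergence against the fixed \<open>X\<close>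
  the second.\<close>

lemma set_integral_mult_tendsto:
  fixes a :: "'a::euclidean_space \<Rightarrow> real" and X :: "'a \<Rightarrow> real"
  assumes S: "compact S" and X: "set_integrable lborel S X" "\<And>k. set_integrable lborel S (Y k)"
    and conv: "(\<lambda>k. LINT x:S|lborel. \<bar>Y k x - X x\<bar>) \<longlonglongrightarrow> 0"
    and a: "continuous_on S a" "\<And>k. continuous_on S (b k)" and unif: "uniform_limit S b a sequentially"
  shows "(\<lambda>k. LINT x:S|lborel. b k x * Y k x) \<longlonglongrightarrow> (LINT x:S|lborel. a x * X x)"
proof -
  have "compact (a ` S)" using a(1) S by (rule compact_continuous_image)
  then obtain B0 where B0: "\<And>x. x \<in> S \<Longrightarrow> \<bar>a x\<bar> \<le> B0"
    using compact_imp_bounded bounded_iff by (metis imageI real_norm_def)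
  define B where "B = \<bar>B0\<bar> + 1"
  have B: "B > 0" "\<And>x. x \<in> S \<Longrightarrow> \<bar>a x\<bar> + 1 \<le> B" using B0 by (fastforce simp: B_def)+
  define Z where "Z = (LINT x:S|lborel. \<bar>X x\<bar>)"
  have Z: "Z \<ge> 0" unfolding Z_def set_lebesgue_integral_def by (intro integral_nonneg_AE) auto
  have abX: "set_integrable lborel S (\<lambda>x. \<bar>X x\<bar>)" using X(1) by (rule set_integrable_abs)
  have abD: "set_integrable lborel S (\<lambda>x. \<bar>Y k x - X x\<bar>)" for k
    by (rule set_integrable_abs) (rule set_integral_diff(1)[OF X(2,1)])
  have "\<forall>\<^sub>F k in sequentially. dist (LINT x:S|lborel. b k x * Y k x) (LINT x:S|lborel. a x * X x) < e" if e: "e > 0" for e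
  proof -
    define \<eta> where "\<eta> = min 1 (e / (2 * (Z + 1)))"
    have \<eta>: "\<eta> > 0" "\<eta> \<le> 1" using e Z by (auto simp: \<eta>_def)
    have "\<eta> * Z \<le> e / (2 * (Z + 1)) * Z" using Z by (intro mult_right_mono) (auto simp: \<eta>_def)
    also have "\<dots> \<le> e / 2" using e Z by (simp add: field_simps)
    finally have \<eta>Z: "\<eta> * Z \<le> e / 2" .
    have 1: "\<forall>\<^sub>F k in sequentially. \<forall>x\<in>S. dist (b k x) (a x) < \<eta>" using uniform_limitD[OF unif \<eta>(1)] .
    have 2: "\<forall>\<^sub>F k in sequentially. (LINT x:S|lborel. \<bar>Y k x - X x\<bar>) < e / (2 * B)"
      by (rule order_tendstoD(2)[OF conv]) (use e B in simp)
    show ?thesis using 1 2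
    proof eventually_elim
      case (elim k)
      have i1: "set_integrable lborel S (\<lambda>x. b k x * Y k x)" and i2: "set_integrable lborel S (\<lambda>x. a x * X x)"
        by (intro set_integrable_continuous_mult a S X)+
      have "(LINT x:S|lborel. b k x * Y k x) - (LINT x:S|lborel. a x * X x) = (LINT x:S|lborel. b k x * Y k x - a x * X x)"
        using set_integral_diff(2)[OF i1 i2] by simp
      also have "\<bar>\<dots>\<bar> \<le> (LINT x:S|lborel. \<bar>b k x * Y k x - a x * X x\<bar>)"
        using integral_abs_bound[of lborel "\<lambda>x. indicator S x *\<^sub>R (b k x * Y k x - a x * X x)"]
        by (simp add: set_lebesgue_integral_def abs_mult)
      also have "\<dots> \<le> (LINT x:S|lborel. B * \<bar>Y k x - X x\<bar> + \<eta> * \<bar>X x\<bar>)"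
      proof (rule set_integral_mono)
        show "set_integrable lborel S (\<lambda>x. \<bar>b k x * Y k x - a x * X x\<bar>)"
          by (rule set_integrable_abs) (rule set_integral_diff(1)[OF i1 i2])
        show "set_integrable lborel S (\<lambda>x. B * \<bar>Y k x - X x\<bar> + \<eta> * \<bar>X x\<bar>)"
          by (intro set_integral_add(1) set_integrable_mult_right abX abD)
        fix x assume x: "x \<in> S"
        have d: "\<bar>b k x - a x\<bar> \<le> \<eta>" using elim(1) x by (fastforce simp: dist_real_def)
        then have bB: "\<bar>b k x\<bar> \<le> B" using B(2)[OF x] \<eta> by linarith
        have "b k x * Y k x - a x * X x = b k x * (Y k x - X x) + (b k x - a x) * X x" by (simp add: algebra_simps)
        also have "\<bar>\<dots>\<bar> \<le> \<bar>b k x\<bar> * \<bar>Y k x - X x\<bar> + \<bar>b k x - a x\<bar> * \<bar>X x\<bar>"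
          by (metis abs_mult abs_triangle_ineq)
        also have "\<dots> \<le> B * \<bar>Y k x - X x\<bar> + \<eta> * \<bar>X x\<bar>"
          using bB d by (intro add_mono mult_right_mono) auto
        finally show "\<bar>b k x * Y k x - a x * X x\<bar> \<le> B * \<bar>Y k x - X x\<bar> + \<eta> * \<bar>X x\<bar>" .
      qed
      also have "\<dots> = B * (LINT x:S|lborel. \<bar>Y k x - X x\<bar>) + \<eta> * Z"
        by (subst set_integral_add(2)) (auto simp: Z_def intro!: set_integrable_mult_right abX abD)
      also have "\<dots> < B * (e / (2 * B)) + e / 2"
        using elim(2) B(1) \<eta>Z by (intro add_less_le_mono mult_strict_left_mono) auto
      also have "\<dots> = e" using B(1) by simp
      finally show ?case by (simp add: dist_real_def)
    qed
  qed
  then show ?thesis by (rule tendstoI)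
qed

section \<open>A C1 truncation of the coordinate functions\<close>

lemma DERIV_max_square: "((\<lambda>u::real. (max u 0)^2) has_real_derivative 2 * max u 0) (at u)"
proof -
  consider "u > 0" | "u < 0" | "u = 0" by linarith
  then show ?thesis
  proof cases
    case 1
    have "((\<lambda>u::real. u^2) has_real_derivative 2 * max u 0) (at u)"
      using 1 by (auto intro!: derivative_eq_intros)
    then show ?thesis
      by (rule has_field_derivative_transform_within_open[of _ _ _ "{0<..}"]) (use 1 in auto)
  next
    case 2
    have "((\<lambda>u::real. 0) has_real_derivative 2 * max u 0) (at u)" using 2 by simp
    then show ?thesis
      by (rule has_field_derivative_transform_within_open[of _ _ _ "{..<0}"]) (use 2 in auto)
  next
    case 3
    have "((\<lambda>h::real. (max h 0)^2 / h) \<longlongrightarrow> 0) (at 0)"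
    proof (rule Lim_null_comparison)
      show "\<forall>\<^sub>F h in at 0. norm ((max h 0)^2 / h) \<le> \<bar>h\<bar>"
        by (intro always_eventually allI) (auto simp: max_def power2_eq_square)
      show "((\<lambda>h::real. \<bar>h\<bar>) \<longlongrightarrow> 0) (at 0)" by (rule tendsto_rabs_zero) (rule tendsto_ident_at)
    qed
    then show ?thesis using 3 by (simp add: DERIV_def)
  qed
qed

text \<open>For m >= 0 this is an odd function of t - c that vanishes while |t - c| <= m and
  increases strictly beyond. The squares make it C1, so it may be composed with smooth approximants;
  its nonnegative derivative serves as a weight for the Jacobian.\<close>

definition excess :: "real \<Rightarrow> real \<Rightarrow> real \<Rightarrow> real" where
  "excess c m t = (max (t - c - m) 0)^2 - (max (c - m - t) 0)^2"

definition excess_deriv :: "real \<Rightarrow> real \<Rightarrow> real \<Rightarrow> real" where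
  "excess_deriv c m t = 2 * max (t - c - m) 0 + 2 * max (c - m - t) 0"

lemma DERIV_excess: "(excess c m has_real_derivative excess_deriv c m t) (at t)"
proof -
  have "((\<lambda>t. t - c - m) has_real_derivative 1) (at t)" "((\<lambda>t. c - m - t) has_real_derivative -1) (at t)"
    by (auto intro!: derivative_eq_intros)
  from DERIV_diff[OF DERIV_chain2[OF DERIV_max_square this(1)] DERIV_chain2[OF DERIV_max_square this(2)]]
  show ?thesis by (simp add: excess_def[abs_def] excess_deriv_def)
qed

lemma excess_eq_0: "\<bar>t - c\<bar> \<le> m \<Longrightarrow> excess c m t = 0" "\<bar>t - c\<bar> \<le> m \<Longrightarrow> excess_deriv c m t = 0"
  by (auto simp: excess_def excess_deriv_def max_def)

lemma excess_neq_0: "m < \<bar>t - c\<bar> \<Longrightarrow> 0 \<le> m \<Longrightarrow> excess c m t \<noteq> 0"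
  by (auto simp: excess_def max_def abs_if split: if_splits)

lemma excess_deriv_nonneg: "0 \<le> excess_deriv c m t" by (simp add: excess_deriv_def)

lemma continuous_excess: "continuous_on S (excess c m)" "continuous_on S (excess_deriv c m)"
  unfolding excess_def excess_deriv_def by (intro continuous_intros)+

text \<open>The approximants eventually take values in a bounded neighbourhood of the range of
  \<open>f\<close>, where \<psi> is uniformly continuous.\<close>

lemma uniform_limit_continuous_compose:
  fixes f :: "'a \<Rightarrow> 'b::heine_borel"
  assumes u: "uniform_limit S F f sequentially" and b: "bounded (f ` S)" and \<psi>: "continuous_on UNIV \<psi>"
  shows "uniform_limit S (\<lambda>k x. \<psi> (F k x)) (\<lambda>x. \<psi> (f x)) sequentially"
proof (rule uniform_limitI)
  fix e :: real assume e: "e > 0"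
  obtain p R where R: "f ` S \<subseteq> cball p R" using b bounded_subset_cball by blast
  have "uniformly_continuous_on (cball p (R + 1)) \<psi>"
    by (intro compact_uniformly_continuous continuous_on_subset[OF \<psi>]) auto
  then obtain d where d: "d > 0" "\<And>x y. x \<in> cball p (R + 1) \<Longrightarrow> y \<in> cball p (R + 1) \<Longrightarrow> dist y x < d \<Longrightarrow> dist (\<psi> y) (\<psi> x) < e"
    using e unfolding uniformly_continuous_on_def by metis
  have "\<forall>\<^sub>F k in sequentially. \<forall>x\<in>S. dist (F k x) (f x) < min d 1"
    using uniform_limitD[OF u, of "min d 1"] d(1) by simp
  then show "\<forall>\<^sub>F k in sequentially. \<forall>x\<in>S. dist (\<psi> (F k x)) (\<psi> (f x)) < e"
  proof eventually_elim
    case (elim k)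
    show ?case
    proof
      fix x assume x: "x \<in> S"
      have "dist (F k x) (f x) < min d 1" using elim x by blast
      moreover have "dist p (f x) \<le> R" using R x by auto
      ultimately show "dist (\<psi> (F k x)) (\<psi> (f x)) < e"
        using dist_triangle[of p "F k x" "f x"] by (intro d(2)) (auto simp: dist_commute)
    qed
  qed
qed


text \<open>In the shell below the sphere the truncation is already zero, so extension by zero is
  harmless: the open ball and the open set \<open>V\<close> cover the space, and \<open>h\<close> is
  C1 on each of them.\<close>

lemma cutoff_excess_C1:
  fixes u :: "real^'n \<Rightarrow> real" and u' :: "real^'n \<Rightarrow> real^'n"
  assumes u: "\<And>x. (u has_derivative (\<lambda>v. u' x \<bullet> v)) (at x)" "continuous_on UNIV u'"
    and t: "t' < t" and flat: "\<And>x. t' < norm (x - p) \<Longrightarrow> norm (x - p) \<le> t \<Longrightarrow> \<bar>u x - c\<bar> \<le> m"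
  defines "h \<equiv> \<lambda>x. if x \<in> cball p t then excess c m (u x) else 0"
    and "h' \<equiv> \<lambda>x. if x \<in> cball p t then excess_deriv c m (u x) *\<^sub>R u' x else 0"
  shows "\<And>x. (h has_derivative (\<lambda>v. h' x \<bullet> v)) (at x)" and "continuous_on UNIV h'"
proof -
  define V where "V = {x. t' < norm (x - p)}"
  have V: "open V" unfolding V_def by (intro open_Collect_less continuous_intros)
  have cover: "x \<in> V \<or> x \<in> ball p t" for x using t by (auto simp: V_def dist_norm norm_minus_commute)
  have zero: "h x = 0" "h' x = 0" if "x \<in> V" for x
    using flat[of x] that excess_eq_0[of "u x" c m]
    by (auto simp: h_def h'_def V_def dist_norm norm_minus_commute)
  show "(h has_derivative (\<lambda>v. h' x \<bullet> v)) (at x)" for x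
  proof (cases "x \<in> V")
    case True
    have "((\<lambda>x. 0) has_derivative (\<lambda>v. h' x \<bullet> v)) (at x)" using zero[OF True] by simp
    then show ?thesis
      by (rule has_derivative_transform_within_open[OF _ V True]) (use zero in simp)
  next
    case False
    then have x: "x \<in> ball p t" using cover by blast
    have "((\<lambda>x. excess c m (u x)) has_derivative (\<lambda>v. excess_deriv c m (u x) * (u' x \<bullet> v))) (at x)"
      using has_derivative_compose[OF u(1) DERIV_excess[unfolded has_field_derivative_def]] .
    then have "((\<lambda>x. excess c m (u x)) has_derivative (\<lambda>v. h' x \<bullet> v)) (at x)"
      using x by (simp add: h'_def)
    then show ?thesis
      by (rule has_derivative_transform_within_open[OF _ open_ball x]) (simp add: h_def)
  qed
  have cu: "continuous_on UNIV u"
    using u(1) has_derivative_continuous by (blast intro: continuous_at_imp_continuous_on)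
  have 1: "continuous_on V h'"
    by (rule continuous_on_eq[of _ "\<lambda>x. 0"]) (auto simp: zero)
  have "continuous_on UNIV (\<lambda>x. excess_deriv c m (u x) *\<^sub>R u' x)"
    by (intro continuous_intros u(2) continuous_on_compose2[OF continuous_excess(2) cu]) auto
  then have 2: "continuous_on (ball p t) h'"
    by (rule continuous_on_eq[OF continuous_on_subset]) (auto simp: h'_def)
  have "V \<union> ball p t = UNIV" using cover by blast
  then show "continuous_on UNIV h'" using continuous_on_open_Un[OF V open_ball 1 2] by simp
qed

context qr_map
begin

text \<open>With the truncated coordinate in row \<open>i0\<close>, the null Lagrangian property
  says that the integral of the weight \<open>excess_deriv\<close> times det g vanishes. As det g >=
  0 a.e., distortion forces g = 0 a.e. where the coordinate deviates from \<open>c\<close> by more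
  than \<open>m'\<close>. A Poincare inequality then makes the truncation zero a.e., and continuity
  makes it zero everywhere. A strict bound on a whole shell is assumed so that it survives
  approximation.\<close>

lemma monotone_aux:
  assumes pt: "norm p + t < 1" and t: "0 < t" and m': "0 \<le> m'"
    and near: "t' < t" "\<And>x. t' < norm (x - p) \<Longrightarrow> norm (x - p) \<le> t \<Longrightarrow> \<bar>f x $ i0 - c\<bar> < m'"
    and x0: "x0 \<in> ball p t"
  shows "\<bar>f x0 $ i0 - c\<bar> \<le> m'"
proof -
  define S where "S = cball p t"
  have S: "compact S" by (simp add: S_def)
  define R where "R = norm p + t"
  have R: "0 < R" "R < 1" using pt t by (auto simp: R_def add_nonneg_pos)
  have SR: "S \<subseteq> cball 0 R"
  proof
    fix x assume "x \<in> S"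
    then show "x \<in> cball 0 R" using norm_triangle_sub[of x p] by (simp add: S_def R_def dist_norm norm_minus_commute)
  qed
  have Sb: "S \<subseteq> ball 0 1" using SR R by (force simp: subset_iff)
  obtain F G H where
      dF: "\<And>k i x. ((\<lambda>x. F k x $ i) has_derivative (\<lambda>v. G k x $ i \<bullet> v)) (at x)"
    and dG: "\<And>k i j x. ((\<lambda>x. G k x $ i $ j) has_derivative (\<lambda>v. H k i j x \<bullet> v)) (at x)"
    and cH: "\<And>k i j. continuous_on UNIV (H k i j)"
    and sH: "\<And>k i j l x. H k i j x $ l = H k i l x $ j"
    and U: "uniform_limit (cball 0 R) F f sequentially"
    and IR: "\<And>k. set_integrable lborel (cball 0 R) (\<lambda>x. norm (G k x - g x) ^ CARD('n))"
    and LR: "(\<lambda>k. LINT x:cball 0 R|lborel. norm (G k x - g x) ^ CARD('n)) \<longlonglongrightarrow> 0"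
    by (rule smooth_approximation[OF R]) (rule that; assumption)
  have cG: "continuous_on UNIV (G k)" for k
  proof -
    have "continuous_on UNIV (\<lambda>x. G k x $ i $ j)" for i j
      using dG has_derivative_continuous by (blast intro: continuous_at_imp_continuous_on)
    then have "continuous_on UNIV (\<lambda>x. \<chi> i j. G k x $ i $ j)" by (intro continuous_on_vec_lambda)
    then show ?thesis by simp
  qed
  have cF: "continuous_on UNIV (\<lambda>x. F k x $ i)" for k i
    using dF has_derivative_continuous by (blast intro: continuous_at_imp_continuous_on)
  have cdet: "continuous_on UNIV (\<lambda>x. det (G k x))" for k
    unfolding det_def by (intro continuous_intros cG)
  have Sm: "S \<in> sets lborel" by (simp add: S_def)
  have I: "set_integrable lborel S (\<lambda>x. norm (G k x - g x) ^ CARD('n))" for k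
    by (rule set_integrable_subset[OF IR Sm SR])
  have L: "(\<lambda>k. LINT x:S|lborel. norm (G k x - g x) ^ CARD('n)) \<longlonglongrightarrow> 0"
  proof (rule Lim_null_comparison[OF always_eventually LR], rule allI)
    fix k
    have "(LINT x:S|lborel. norm (G k x - g x) ^ CARD('n)) \<le> (LINT x:cball 0 R|lborel. norm (G k x - g x) ^ CARD('n))"
      using I IR SR unfolding set_lebesgue_integral_def set_integrable_def
      by (intro integral_mono) (auto simp: indicator_def)
    moreover have "0 \<le> (LINT x:S|lborel. norm (G k x - g x) ^ CARD('n))"
      unfolding set_lebesgue_integral_def by (intro integral_nonneg_AE) auto
    ultimately show "norm (LINT x:S|lborel. norm (G k x - g x) ^ CARD('n))
        \<le> (LINT x:cball 0 R|lborel. norm (G k x - g x) ^ CARD('n))" by simp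
  qed
  have gS: "set_integrable lborel S (\<lambda>x. norm (g x) ^ CARD('n))"
    by (rule set_integrable_subset[OF g_Ln[OF R(2)] Sm SR])
  have i1: "set_integrable lborel S (\<lambda>x. 1 :: real)"
    by (rule set_integrable_continuous_compact[OF continuous_on_const S])
  have ic: "set_integrable lborel S (\<lambda>x. r)" for r :: real
    by (rule set_integrable_continuous_compact[OF continuous_on_const S])
  have det_m: "(\<lambda>x. det (g x)) \<in> borel_measurable borel"
    unfolding det_def
    by (intro borel_measurable_sum borel_measurable_times borel_measurable_const borel_measurable_prod
        borel_measurable_vec_nth g_borel)
  have det_g: "set_integrable lborel S (\<lambda>x. det (g x))"
  proof -
    obtain M where M: "M \<ge> 0" "\<And>A B :: real^'n^'n. \<bar>det A - det B\<bar> \<le> 1 * norm B ^ CARD('n) + M * norm (A - B) ^ CARD('n)"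
      by (rule det_diff_Young[of 1]) auto
    have det0: "det (0 :: real^'n^'n) = 0"
      by (rule det_zero_row(1)[of undefined]) (simp add: row_def vec_eq_iff)
    have le: "\<bar>det (g x)\<bar> \<le> M * norm (g x) ^ CARD('n)" for x
      using M(2)[of "g x" 0] by (simp add: det0 power_0_left)
    have "set_integrable lborel S (\<lambda>x. M * norm (g x) ^ CARD('n))" using gS by (rule set_integrable_mult_right)
    then show ?thesis
      unfolding set_integrable_def
    proof (rule Bochner_Integration.integrable_bound)
      show "(\<lambda>x. indicator S x *\<^sub>R det (g x)) \<in> borel_measurable lborel"
        using det_m Sm by (intro borel_measurable_scaleR borel_measurable_indicator) auto
      show "AE x in lborel. norm (indicator S x *\<^sub>R det (g x)) \<le> norm (indicator S x *\<^sub>R (M * norm (g x) ^ CARD('n)))"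
        using le M(1) by (intro AE_I2) (auto simp: indicator_def)
    qed
  qed
  have det_G: "set_integrable lborel S (\<lambda>x. det (G k x))" for k
    by (intro set_integrable_continuous_compact continuous_on_subset[OF cdet] S) auto
  \<comment> \<open>The weight e/(2 (Z + 1)) keeps the fixed term of \<open>det_diff_Young\<close>
    at most e/2; the L^n error, tending to zero, absorbs the factor \<open>M\<close>.\<close>
  have det_L: "(\<lambda>k. LINT x:S|lborel. \<bar>det (G k x) - det (g x)\<bar>) \<longlonglongrightarrow> 0"
  proof (rule tendstoI)
    fix e :: real assume e: "e > 0"
    define Z where "Z = (LINT x:S|lborel. norm (g x) ^ CARD('n))"
    have Z: "Z \<ge> 0" unfolding Z_def set_lebesgue_integral_def by (intro integral_nonneg_AE) auto
    have e1: "e / (2 * (Z + 1)) > 0" using e Z by simp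
    obtain M where M: "M \<ge> 0" "\<And>A B :: real^'n^'n. \<bar>det A - det B\<bar> \<le> e / (2 * (Z + 1)) * norm B ^ CARD('n) + M * norm (A - B) ^ CARD('n)"
      by (rule det_diff_Young[OF e1, where 'n='n]) (rule that; assumption)
    have "\<forall>\<^sub>F k in sequentially. (LINT x:S|lborel. norm (G k x - g x) ^ CARD('n)) < e / (2 * (M + 1))"
      by (rule order_tendstoD(2)[OF L]) (use e M in simp)
    then show "\<forall>\<^sub>F k in sequentially. dist (LINT x:S|lborel. \<bar>det (G k x) - det (g x)\<bar>) 0 < e"
    proof eventually_elim
      case (elim k)
      let ?I = "LINT x:S|lborel. norm (G k x - g x) ^ CARD('n)"
      have "?I \<ge> 0" unfolding set_lebesgue_integral_def by (intro integral_nonneg_AE) auto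
      have "(LINT x:S|lborel. \<bar>det (G k x) - det (g x)\<bar>)
          \<le> (LINT x:S|lborel. e / (2 * (Z + 1)) * norm (g x) ^ CARD('n) + M * norm (G k x - g x) ^ CARD('n))"
        by (rule set_integral_mono)
           (intro set_integrable_abs set_integral_diff(1) det_g det_G set_integral_add(1) set_integrable_mult_right gS I M(2))+
      also have "\<dots> = e / (2 * (Z + 1)) * Z + M * ?I"
        by (subst set_integral_add(2)) (auto simp: Z_def intro!: set_integrable_mult_right gS I)
      also have "e / (2 * (Z + 1)) * Z \<le> e / 2" using e Z by (simp add: field_simps)
      also have "M * ?I < e / 2"
      proof -
        have "M * ?I \<le> M * (e / (2 * (M + 1)))" using elim M by (intro mult_left_mono) auto
        also have "\<dots> < e / 2" using e M by (simp add: field_simps)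
        finally show ?thesis .
      qed
      finally have "(LINT x:S|lborel. \<bar>det (G k x) - det (g x)\<bar>) < e" by simp
      moreover have "0 \<le> (LINT x:S|lborel. \<bar>det (G k x) - det (g x)\<bar>)"
        unfolding set_lebesgue_integral_def by (intro integral_nonneg_AE) auto
      ultimately show ?case by simp
    qed
  qed
  \<comment> \<open>Elementary substitute for Hoelder's inequality: an L^1 integral is bounded by a
    small constant plus a multiple of the L^n integral.\<close>
  have pow_le: "x \<le> \<epsilon> + (1/\<epsilon>) ^ (CARD('n) - 1) * x ^ CARD('n)" if "\<epsilon> > 0" "x \<ge> 0" for x \<epsilon> :: real
  proof (cases "x \<le> \<epsilon>")
    case True
    then show ?thesis using that by (simp add: add_increasing2)
  next
    case False
    obtain N where N: "CARD('n) = Suc N" using gr0_conv_Suc zero_less_card_finite by blast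
    have "1 \<le> x / \<epsilon>" using False that by simp
    then have "x * 1 \<le> x * (x / \<epsilon>) ^ N" using that by (intro mult_left_mono one_le_power) auto
    also have "\<dots> = (1/\<epsilon>) ^ (CARD('n) - 1) * x ^ CARD('n)" by (simp add: N power_divide)
    finally show ?thesis using that by simp
  qed
  have gm: "(\<lambda>x. indicator S x *\<^sub>R norm (g x)) \<in> borel_measurable lborel"
    using Sm g_borel by (intro borel_measurable_scaleR borel_measurable_indicator borel_measurable_norm) auto
  have n_g: "set_integrable lborel S (\<lambda>x. norm (g x))"
    unfolding set_integrable_def
  proof (rule Bochner_Integration.integrable_bound[OF _ gm])
    show "integrable lborel (\<lambda>x. indicator S x *\<^sub>R (1 + norm (g x) ^ CARD('n)))"
      using set_integral_add(1)[OF i1 gS] by (simp add: set_integrable_def)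
    show "AE x in lborel. norm (indicator S x *\<^sub>R norm (g x)) \<le> norm (indicator S x *\<^sub>R (1 + norm (g x) ^ CARD('n)))"
      using pow_le[of 1] by (intro AE_I2) (auto simp: indicator_def)
  qed
  have n_G: "set_integrable lborel S (\<lambda>x. norm (G k x))" for k
    by (intro set_integrable_continuous_compact continuous_intros continuous_on_subset[OF cG] S) auto
  have n_L: "(\<lambda>k. LINT x:S|lborel. \<bar>norm (G k x) - norm (g x)\<bar>) \<longlonglongrightarrow> 0"
  proof (rule tendstoI)
    fix e :: real assume e: "e > 0"
    define Z where "Z = (LINT x:S|lborel. 1 :: real)"
    have Z: "Z \<ge> 0" unfolding Z_def set_lebesgue_integral_def by (intro integral_nonneg_AE) auto
    define \<epsilon> where "\<epsilon> = e / (2 * (Z + 1))"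
    have e1: "\<epsilon> > 0" using e Z by (simp add: \<epsilon>_def)
    define M where "M = (1/\<epsilon>) ^ (CARD('n) - 1)"
    have M: "M \<ge> 0" using e1 by (simp add: M_def)
    have "\<forall>\<^sub>F k in sequentially. (LINT x:S|lborel. norm (G k x - g x) ^ CARD('n)) < e / (2 * (M + 1))"
      by (rule order_tendstoD(2)[OF L]) (use e M in simp)
    then show "\<forall>\<^sub>F k in sequentially. dist (LINT x:S|lborel. \<bar>norm (G k x) - norm (g x)\<bar>) 0 < e"
    proof eventually_elim
      case (elim k)
      let ?I = "LINT x:S|lborel. norm (G k x - g x) ^ CARD('n)"
      have "(LINT x:S|lborel. \<bar>norm (G k x) - norm (g x)\<bar>)
          \<le> (LINT x:S|lborel. \<epsilon> * 1 + M * norm (G k x - g x) ^ CARD('n))"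
      proof (rule set_integral_mono)
        fix x
        have "\<bar>norm (G k x) - norm (g x)\<bar> \<le> norm (G k x - g x)" by (rule norm_triangle_ineq3)
        also have "\<dots> \<le> \<epsilon> * 1 + M * norm (G k x - g x) ^ CARD('n)"
          using pow_le[OF e1, of "norm (G k x - g x)"] by (simp add: M_def)
        finally show "\<bar>norm (G k x) - norm (g x)\<bar> \<le> \<epsilon> * 1 + M * norm (G k x - g x) ^ CARD('n)" .
      qed (intro set_integrable_abs set_integral_diff(1) n_g n_G set_integral_add(1) set_integrable_mult_right i1 I)+
      also have "\<dots> = \<epsilon> * Z + M * ?I"
        by (subst set_integral_add(2)) (auto simp: Z_def set_integral_const Sm S_def emeasure_cball t less_imp_le intro!: set_integrable_mult_right ic[unfolded S_def] I[unfolded S_def])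
      also have "\<epsilon> * Z \<le> e / 2" using e Z by (simp add: \<epsilon>_def field_simps)
      also have "M * ?I < e / 2"
      proof -
        have "M * ?I \<le> M * (e / (2 * (M + 1)))" using elim M by (intro mult_left_mono) auto
        also have "\<dots> < e / 2" using e M by (simp add: field_simps)
        finally show ?thesis .
      qed
      finally have "(LINT x:S|lborel. \<bar>norm (G k x) - norm (g x)\<bar>) < e" by simp
      moreover have "0 \<le> (LINT x:S|lborel. \<bar>norm (G k x) - norm (g x)\<bar>)"
        unfolding set_lebesgue_integral_def by (intro integral_nonneg_AE) auto
      ultimately show ?case by simp
    qed
  qed
  let ?\<psi> = "excess c m'" and ?\<psi>' = "excess_deriv c m'"
  have fS: "continuous_on S f" by (rule continuous_on_subset[OF cont_f Sb])
  have fi: "continuous_on S (\<lambda>x. f x $ i0)" by (intro continuous_intros fS)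
  have bS: "bounded ((\<lambda>x. f x $ i0) ` S)" by (rule compact_imp_bounded[OF compact_continuous_image[OF fi S]])
  have Ui: "uniform_limit S (\<lambda>k x. F k x $ i0) (\<lambda>x. f x $ i0) sequentially"
    by (rule bounded_linear.uniform_limit[OF bounded_linear_vec_nth uniform_limit_on_subset[OF U SR]])
  note Uc = uniform_limit_continuous_compose[OF Ui bS]
  \<comment> \<open>Starting halfway, the shell is compact and still within the region of the strict
    bound. The largest deviation of \<open>f\<close> on it is below \<open>m'\<close>, a gap that
    uniform approximation respects.\<close>
  have near_k: "\<forall>\<^sub>F k in sequentially. \<forall>x. t1 < norm (x - p) \<and> norm (x - p) \<le> t \<longrightarrow> \<bar>F k x $ i0 - c\<bar> \<le> m'"
    if t1: "t1 = (t' + t) / 2" for t1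
  proof -
    have cpt: "compact {x. t1 \<le> norm (x - p) \<and> norm (x - p) \<le> t}" (is "compact ?A")
    proof -
      have "?A = S \<inter> {x. t1 \<le> norm (x - p)}" by (auto simp: S_def dist_norm norm_minus_commute)
      moreover have "closed {x. t1 \<le> norm (x - p)}" by (intro closed_Collect_le continuous_intros)
      ultimately show ?thesis using S by (simp add: compact_Int_closed)
    qed
    show ?thesis
    proof (cases "?A = {}")
      case True
      then have "\<not> (t1 < norm (x - p) \<and> norm (x - p) \<le> t)" for x by auto
      then show ?thesis by (intro always_eventually allI impI) blast
    next
      case False
      have AS: "?A \<subseteq> S" by (auto simp: S_def dist_norm norm_minus_commute)
      have "continuous_on ?A (\<lambda>x. \<bar>f x $ i0 - c\<bar>)"
        by (intro continuous_intros continuous_on_subset[OF fS AS])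
      from continuous_attains_sup[OF cpt False this]
      obtain z where z: "z \<in> ?A" "\<forall>y\<in>?A. \<bar>f y $ i0 - c\<bar> \<le> \<bar>f z $ i0 - c\<bar>" by blast
      have "\<bar>f z $ i0 - c\<bar> < m'" using z(1) near t1 by (intro near(2)) auto
      then have e: "m' - \<bar>f z $ i0 - c\<bar> > 0" by simp
      show ?thesis using uniform_limitD[OF Ui e]
      proof eventually_elim
        case (elim k)
        show ?case
        proof (intro allI impI)
          fix x assume x: "t1 < norm (x - p) \<and> norm (x - p) \<le> t"
          then have xA: "x \<in> ?A" by simp
          have "\<bar>F k x $ i0 - f x $ i0\<bar> < m' - \<bar>f z $ i0 - c\<bar>" using elim AS xA by (auto simp: dist_real_def)
          moreover have "\<bar>f x $ i0 - c\<bar> \<le> \<bar>f z $ i0 - c\<bar>" using z(2) xA by blast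
          ultimately show "\<bar>F k x $ i0 - c\<bar> \<le> m'" by linarith
        qed
      qed
    qed
  qed
  define t1 where "t1 = (t' + t) / 2"
  have t1: "t1 < t" using near(1) by (simp add: t1_def)
  \<comment> \<open>First the null Lagrangian identity for the approximants, then a Poincare
    inequality for their truncated coordinate, with the factor 2 t from the size of the
    ball.\<close>
  have key: "\<forall>\<^sub>F k in sequentially. (LINT x:S|lborel. ?\<psi>' (F k x $ i0) * det (G k x)) = 0 \<and>
      (LINT x:S|lborel. (?\<psi> (F k x $ i0))^2 * 1) \<le> 2 * t * (LINT x:S|lborel. (\<bar>?\<psi> (F k x $ i0)\<bar> * ?\<psi>' (F k x $ i0)) * norm (G k x))"
    using near_k[OF t1_def]
  proof eventually_elim
    case (elim k)
    define h where "h x = (if x \<in> cball p t then ?\<psi> (F k x $ i0) else 0)" for x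
    define h' where "h' x = (if x \<in> cball p t then ?\<psi>' (F k x $ i0) *\<^sub>R G k x $ i0 else 0)" for x
    have cGi: "continuous_on UNIV (\<lambda>x. G k x $ i0)" by (intro continuous_intros cG)
    have flat: "\<And>x. t1 < norm (x - p) \<Longrightarrow> norm (x - p) \<le> t \<Longrightarrow> \<bar>F k x $ i0 - c\<bar> \<le> m'" using elim by blast
    have dh: "(h has_derivative (\<lambda>v. h' x \<bullet> v)) (at x)" and ch': "continuous_on UNIV h'" for x
      unfolding h_def[abs_def] h'_def[abs_def] using cutoff_excess_C1[OF dF cGi t1 flat] by blast+
    have ch: "continuous_on UNIV h"
      using dh has_derivative_continuous by (blast intro: continuous_at_imp_continuous_on)
    have supp: "h x = 0" if "norm x > R" for x using that SR by (auto simp: h_def S_def)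
    have "(LINT x|lborel. det (\<chi> i. if i = i0 then h' x else G k x $ i)) = 0"
      by (rule integral_det_gradient_row_eq_0[OF dh ch' supp dG cH sH])
    also have "(\<lambda>x. det (\<chi> i. if i = i0 then h' x else G k x $ i)) = (\<lambda>x. indicator S x *\<^sub>R (?\<psi>' (F k x $ i0) * det (G k x)))"
    proof
      fix x
      show "det (\<chi> i. if i = i0 then h' x else G k x $ i) = indicator S x *\<^sub>R (?\<psi>' (F k x $ i0) * det (G k x))"
      proof (cases "x \<in> S")
        case True
        then have "h' x = ?\<psi>' (F k x $ i0) *s G k x $ i0" by (simp add: h'_def S_def scalar_mult_eq_scaleR)
        then have "det (\<chi> i. if i = i0 then h' x else G k x $ i)
            = ?\<psi>' (F k x $ i0) * det (\<chi> i. if i = i0 then G k x $ i0 else G k x $ i)"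
          by (simp only: det_row_mul)
        also have "(\<chi> i. if i = i0 then G k x $ i0 else G k x $ i) = G k x" by (simp add: vec_eq_iff)
        finally show ?thesis using True by simp
      next
        case False
        then have "det (\<chi> i. if i = i0 then h' x else G k x $ i) = 0"
          by (intro det_zero_row(1)[of i0]) (simp add: row_def h'_def S_def vec_eq_iff)
        then show ?thesis using False by simp
      qed
    qed
    finally have 1: "(LINT x:S|lborel. ?\<psi>' (F k x $ i0) * det (G k x)) = 0"
      by (simp add: set_lebesgue_integral_def)
    \<comment> \<open>The derivative of \<open>w\<close> along axis \<open>i0\<close> has integral
      zero. Differentiating the linear factor gives h^2, and |x - p| <= t controls the other term;
      this is the Poincare inequality.\<close>
    define w where "w x = (x - p) $ i0 * (h x)^2" for x
    define w' where "w' x = ((x - p) $ i0 * (2 * h x)) *\<^sub>R h' x + (h x)^2 *\<^sub>R axis i0 1" for x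
    have dw: "(w has_derivative (\<lambda>v. w' x \<bullet> v)) (at x)" for x
    proof -
      have a: "((\<lambda>x. (x - p) $ i0) has_derivative (\<lambda>v. v $ i0)) (at x)"
        by (auto intro!: derivative_eq_intros bounded_linear.has_derivative[OF bounded_linear_vec_nth])
      have b: "((\<lambda>x. (h x)^2) has_derivative (\<lambda>v. 2 * h x * (h' x \<bullet> v))) (at x)"
        using has_derivative_power[OF dh, of 2 x] by (simp add: mult_ac)
      show ?thesis
        unfolding w_def w'_def
        by (rule has_derivative_eq_rhs[OF has_derivative_mult[OF a b]])
           (auto simp: fun_eq_iff inner_add_left inner_axis inner_commute[of "axis i0 1"])
    qed
    have cw': "continuous_on UNIV w'" unfolding w'_def by (intro continuous_intros ch ch')
    have sw: "w x = 0" if "norm x > R" for x using supp[OF that] by (simp add: w_def)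
    have 0: "(LINT x|lborel. w' x \<bullet> axis i0 1) = 0" by (rule integral_gradient_eq_0(2)[OF dw cw' sw])
    have cF2: "continuous_on S (\<lambda>x. (?\<psi> (F k x $ i0))^2 * 1)"
      by (intro continuous_intros continuous_on_compose2[OF continuous_excess(1)[of UNIV] continuous_on_subset[OF cF]]) auto
    have cF3: "continuous_on S (\<lambda>x. (\<bar>?\<psi> (F k x $ i0)\<bar> * ?\<psi>' (F k x $ i0)) * norm (G k x))"
      by (intro continuous_intros continuous_on_compose2[OF continuous_excess(1)[of UNIV] continuous_on_subset[OF cF]]
          continuous_on_compose2[OF continuous_excess(2)[of UNIV] continuous_on_subset[OF cF]] continuous_on_subset[OF cG]) auto
    have "(LINT x|lborel. w' x \<bullet> axis i0 1) \<ge> (LINT x|lborel. indicator S x *\<^sub>R ((?\<psi> (F k x $ i0))^2 * 1)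
        - 2 * t * (indicator S x *\<^sub>R ((\<bar>?\<psi> (F k x $ i0)\<bar> * ?\<psi>' (F k x $ i0)) * norm (G k x))))"
    proof (rule integral_mono)
      show "integrable lborel (\<lambda>x. w' x \<bullet> axis i0 1)" by (rule integral_gradient_eq_0(1)[OF dw cw' sw])
      show "integrable lborel (\<lambda>x. indicator S x *\<^sub>R ((?\<psi> (F k x $ i0))^2 * 1)
        - 2 * t * (indicator S x *\<^sub>R ((\<bar>?\<psi> (F k x $ i0)\<bar> * ?\<psi>' (F k x $ i0)) * norm (G k x))))"
        using set_integrable_continuous_compact[OF cF2 S] set_integrable_continuous_compact[OF cF3 S]
        unfolding set_integrable_def by (intro Bochner_Integration.integrable_diff integrable_mult_right)
      fix x
      show "indicator S x *\<^sub>R ((?\<psi> (F k x $ i0))^2 * 1)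
        - 2 * t * (indicator S x *\<^sub>R ((\<bar>?\<psi> (F k x $ i0)\<bar> * ?\<psi>' (F k x $ i0)) * norm (G k x))) \<le> w' x \<bullet> axis i0 1"
      proof (cases "x \<in> S")
        case True
        then have hx: "h x = ?\<psi> (F k x $ i0)" "h' x = ?\<psi>' (F k x $ i0) *\<^sub>R G k x $ i0" by (auto simp: h_def h'_def S_def)
        have "\<bar>(x - p) $ i0\<bar> \<le> t" using component_le_norm_cart[of "x - p" i0] True by (simp add: S_def dist_norm norm_minus_commute)
        moreover have "\<bar>G k x $ i0 $ i0\<bar> \<le> norm (G k x)" by (rule entry_le_norm_matrix)
        ultimately have "\<bar>(x - p) $ i0\<bar> * (2 * \<bar>h x\<bar>) * (?\<psi>' (F k x $ i0) * \<bar>G k x $ i0 $ i0\<bar>)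
            \<le> t * (2 * \<bar>h x\<bar>) * (?\<psi>' (F k x $ i0) * norm (G k x))"
          using t by (intro mult_mono) (auto simp: excess_deriv_nonneg)
        moreover have "w' x \<bullet> axis i0 1 = (x - p) $ i0 * (2 * h x) * (?\<psi>' (F k x $ i0) * G k x $ i0 $ i0) + (h x)^2"
          by (simp add: w'_def inner_add_left inner_axis hx)
        moreover have "\<bar>(x - p) $ i0 * (2 * h x) * (?\<psi>' (F k x $ i0) * G k x $ i0 $ i0)\<bar>
            = \<bar>(x - p) $ i0\<bar> * (2 * \<bar>h x\<bar>) * (?\<psi>' (F k x $ i0) * \<bar>G k x $ i0 $ i0\<bar>)"
          by (simp add: abs_mult excess_deriv_nonneg)
        ultimately have "w' x \<bullet> axis i0 1 \<ge> (h x)^2 - t * (2 * \<bar>h x\<bar>) * (?\<psi>' (F k x $ i0) * norm (G k x))" by linarith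
        then show ?thesis using True by (simp add: hx(1) mult_ac)
      next
        case False
        then show ?thesis by (simp add: w'_def h_def S_def)
      qed
    qed
    also have "(LINT x|lborel. indicator S x *\<^sub>R ((?\<psi> (F k x $ i0))^2 * 1)
        - 2 * t * (indicator S x *\<^sub>R ((\<bar>?\<psi> (F k x $ i0)\<bar> * ?\<psi>' (F k x $ i0)) * norm (G k x))))
        = (LINT x:S|lborel. (?\<psi> (F k x $ i0))^2 * 1) - 2 * t * (LINT x:S|lborel. (\<bar>?\<psi> (F k x $ i0)\<bar> * ?\<psi>' (F k x $ i0)) * norm (G k x))"
      unfolding set_lebesgue_integral_def
      using set_integrable_continuous_compact[OF cF2 S] set_integrable_continuous_compact[OF cF3 S]
      unfolding set_integrable_def
      by (subst Bochner_Integration.integral_diff) (auto intro!: integrable_mult_right simp del: mult_1_right)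
    finally have 2: "(LINT x:S|lborel. (?\<psi> (F k x $ i0))^2 * 1) \<le> 2 * t * (LINT x:S|lborel. (\<bar>?\<psi> (F k x $ i0)\<bar> * ?\<psi>' (F k x $ i0)) * norm (G k x))"
      using 0 by linarith
    show ?case using 1 2 by blast
  qed
  have c\<psi>: "continuous_on UNIV ?\<psi>" "continuous_on UNIV ?\<psi>'" by (rule continuous_excess)+
  have cc: "continuous_on S (\<lambda>x. \<theta> (f x $ i0))" "continuous_on S (\<lambda>x. \<theta> (F k x $ i0))" if "continuous_on UNIV \<theta>" for \<theta> :: "real \<Rightarrow> real" and k
    by (rule continuous_on_compose2[OF that fi], simp) (rule continuous_on_compose2[OF that continuous_on_subset[OF cF]], auto)
  have "(\<lambda>k. LINT x:S|lborel. ?\<psi>' (F k x $ i0) * det (G k x)) \<longlonglongrightarrow> (LINT x:S|lborel. ?\<psi>' (f x $ i0) * det (g x))"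
    by (rule set_integral_mult_tendsto[OF S det_g det_G det_L cc(1)[OF c\<psi>(2)] cc(2)[OF c\<psi>(2)] Uc[OF c\<psi>(2)]])
  moreover have "(\<lambda>k. LINT x:S|lborel. ?\<psi>' (F k x $ i0) * det (G k x)) \<longlonglongrightarrow> 0"
    by (rule tendsto_eventually) (use key in \<open>auto elim: eventually_mono\<close>)
  ultimately have J0: "(LINT x:S|lborel. ?\<psi>' (f x $ i0) * det (g x)) = 0" by (rule LIMSEQ_unique)
  have dist_S: "AE x in lborel. x \<in> S \<longrightarrow> norm (g x) ^ CARD('n) \<le> K * det (g x)"
    using distortion by eventually_elim (use Sb in blast)
  \<comment> \<open>The integrand is nonnegative with integral zero. Where the weight is nonzero,
    det g = 0, and distortion gives g = 0.\<close>
  have AE0: "AE x in lborel. x \<in> S \<longrightarrow> ?\<psi>' (f x $ i0) * norm (g x) = 0"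
  proof -
    have iJ: "integrable lborel (\<lambda>x. indicator S x *\<^sub>R (?\<psi>' (f x $ i0) * det (g x)))"
      using set_integrable_continuous_mult[OF cc(1)[OF c\<psi>(2)] S det_g] by (simp add: set_integrable_def)
    have nn: "AE x in lborel. 0 \<le> indicator S x *\<^sub>R (?\<psi>' (f x $ i0) * det (g x))"
      using dist_S
    proof eventually_elim
      case (elim x)
      show ?case
      proof (cases "x \<in> S")
        case True
        then have "0 \<le> K * det (g x)" using elim by (metis order_trans zero_le_power norm_ge_zero)
        then have "0 \<le> det (g x)" using K_pos by (simp add: zero_le_mult_iff)
        then show ?thesis by (simp add: excess_deriv_nonneg)
      qed simp
    qed
    have "AE x in lborel. indicator S x *\<^sub>R (?\<psi>' (f x $ i0) * det (g x)) = 0"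
      using integral_nonneg_eq_0_iff_AE[OF iJ nn] J0 by (simp add: set_lebesgue_integral_def)
    then show ?thesis using dist_S
    proof eventually_elim
      case (elim x)
      show ?case
      proof
        assume x: "x \<in> S"
        show "?\<psi>' (f x $ i0) * norm (g x) = 0"
        proof (cases "?\<psi>' (f x $ i0) = 0")
          case False
          then have "det (g x) = 0" using elim(1) x by simp
          then have "norm (g x) ^ CARD('n) \<le> 0" using elim(2) x by simp
          then have "norm (g x) ^ CARD('n) = 0" by (metis antisym zero_le_power norm_ge_zero)
          then show ?thesis by simp
        qed simp
      qed
    qed
  qed
  let ?\<theta> = "\<lambda>s. \<bar>?\<psi> s\<bar> * ?\<psi>' s"
  have c\<theta>: "continuous_on UNIV ?\<theta>" by (intro continuous_intros c\<psi>)
  have c2: "continuous_on UNIV (\<lambda>s. (?\<psi> s)^2)" by (intro continuous_intros c\<psi>)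
  have "(\<lambda>k. LINT x:S|lborel. (\<bar>?\<psi> (F k x $ i0)\<bar> * ?\<psi>' (F k x $ i0)) * norm (G k x))
      \<longlonglongrightarrow> (LINT x:S|lborel. (\<bar>?\<psi> (f x $ i0)\<bar> * ?\<psi>' (f x $ i0)) * norm (g x))"
    by (rule set_integral_mult_tendsto[OF S n_g n_G n_L cc(1)[OF c\<theta>] cc(2)[OF c\<theta>] Uc[OF c\<theta>]])
  moreover have "(LINT x:S|lborel. (\<bar>?\<psi> (f x $ i0)\<bar> * ?\<psi>' (f x $ i0)) * norm (g x)) = 0"
    unfolding set_lebesgue_integral_def
  proof (rule integral_eq_zero_AE)
    show "AE x in lborel. indicator S x *\<^sub>R ((\<bar>?\<psi> (f x $ i0)\<bar> * ?\<psi>' (f x $ i0)) * norm (g x)) = 0"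
      using AE0 by eventually_elim (auto simp: indicator_def)
  qed
  ultimately have lim0: "(\<lambda>k. 2 * t * (LINT x:S|lborel. (\<bar>?\<psi> (F k x $ i0)\<bar> * ?\<psi>' (F k x $ i0)) * norm (G k x))) \<longlonglongrightarrow> 2 * t * 0"
    by (intro tendsto_intros) simp
  have "(\<lambda>k. LINT x:S|lborel. (?\<psi> (F k x $ i0))^2 * 1) \<longlonglongrightarrow> (LINT x:S|lborel. (?\<psi> (f x $ i0))^2 * 1)"
    by (rule set_integral_mult_tendsto[OF S i1 i1 _ cc(1)[OF c2] cc(2)[OF c2] Uc[OF c2]]) simp
  then have "(LINT x:S|lborel. (?\<psi> (f x $ i0))^2 * 1) \<le> 2 * t * 0"
    by (rule tendsto_le[OF sequentially_bot lim0]) (use key in \<open>auto elim: eventually_mono\<close>)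
  then have sq0: "(LINT x:S|lborel. (?\<psi> (f x $ i0))^2 * 1) \<le> 0" by simp
  show ?thesis
  proof (rule ccontr)
    assume "\<not> \<bar>f x0 $ i0 - c\<bar> \<le> m'"
    then have ne: "?\<psi> (f x0 $ i0) \<noteq> 0" using m' by (intro excess_neq_0) auto
    have iq: "integrable lborel (\<lambda>x. indicator S x *\<^sub>R ((?\<psi> (f x $ i0))^2 * 1))"
      using set_integrable_continuous_compact[OF cc(1)[OF c2] S] by (simp add: set_integrable_def)
    have nnq: "AE x in lborel. 0 \<le> indicator S x *\<^sub>R ((?\<psi> (f x $ i0))^2 * 1)" by (intro AE_I2) simp
    have "(LINT x|lborel. indicator S x *\<^sub>R ((?\<psi> (f x $ i0))^2 * 1)) = 0"
      by (rule antisym[OF sq0[unfolded set_lebesgue_integral_def] integral_nonneg_AE[OF nnq]])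
    then have z: "AE x in lborel. indicator S x *\<^sub>R ((?\<psi> (f x $ i0))^2 * 1) = 0"
      using integral_nonneg_eq_0_iff_AE[OF iq nnq] by simp
    \<comment> \<open>A truncation nonzero at \<open>x0\<close> is nonzero on a nonempty open set,
      contradicting that it vanishes almost everywhere.\<close>
    define W where "W = ball p t \<inter> (\<lambda>x. ?\<psi> (f x $ i0)) -` (- {0})"
    have "open W" unfolding W_def
      by (rule continuous_open_preimage) (auto intro!: continuous_on_subset[OF cc(1)[OF c\<psi>(1)]] simp: S_def)
    moreover have "x0 \<in> W" using x0 ne by (simp add: W_def)
    ultimately have "\<not> negligible W" using open_not_negligible by blast
    moreover have "AE x in lborel. x \<notin> W"
      using z by eventually_elim (auto simp: W_def S_def)
    then have "AE x in lebesgue. x \<notin> W" by (simp only: AE_completion_iff)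
    then have "W \<in> null_sets lebesgue"
      using AE_iff_null_sets[of W lebesgue] \<open>open W\<close> by auto
    ultimately show False by (simp add: negligible_iff_null_sets)
  qed
qed

text \<open>Uniform continuity carries the bound on the sphere, with a loss of \<open>e\<close>, to
  a thin shell inside it, which is the input of \<open>monotone_aux\<close>.\<close>

theorem monotone:
  assumes pt: "norm p + t < 1" and t: "0 < t"
    and sphere: "\<And>x. norm (x - p) = t \<Longrightarrow> \<bar>f x $ i - c\<bar> \<le> m" and x: "norm (x - p) \<le> t"
  shows "\<bar>f x $ i - c\<bar> \<le> m"
proof (cases "norm (x - p) = t")
  case False
  define S where "S = cball p t"
  have Sb: "S \<subseteq> ball 0 1"
  proof
    fix y assume "y \<in> S"
    then show "y \<in> ball 0 1" using norm_triangle_sub[of y p] pt by (simp add: S_def dist_norm norm_minus_commute)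
  qed
  have m: "m \<ge> 0"
    using sphere[of "p + t *\<^sub>R axis i 1"] t by (simp add: order_trans[OF abs_ge_zero])
  show ?thesis
  proof (rule field_le_epsilon)
    fix e :: real assume e: "e > 0"
    have "uniformly_continuous_on S f"
      using Sb by (intro compact_uniformly_continuous continuous_on_subset[OF cont_f]) (auto simp: S_def)
    then obtain d where d: "d > 0" "\<And>x y. x \<in> S \<Longrightarrow> y \<in> S \<Longrightarrow> dist y x < d \<Longrightarrow> dist (f y) (f x) < e"
      using e unfolding uniformly_continuous_on_def by metis
    \<comment> \<open>The maximum with 0 keeps the shell away from the centre, so that the radial
      projection onto the sphere used below is defined.\<close>
    define t' where "t' = max 0 (t - d)"
    show "\<bar>f x $ i - c\<bar> \<le> m + e"
    proof (rule monotone_aux[OF pt t])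
      show "t' < t" using t d by (simp add: t'_def)
      show "x \<in> ball p t" using x False by (simp add: dist_norm norm_minus_commute)
      show "0 \<le> m + e" using m e by simp
      fix z assume z: "t' < norm (z - p)" "norm (z - p) \<le> t"
      then have z0: "norm (z - p) > 0" "t - d < norm (z - p)" by (auto simp: t'_def)
      define y where "y = p + (t / norm (z - p)) *\<^sub>R (z - p)"
      have ny: "norm (y - p) = t" using t z0 by (simp add: y_def)
      have "y - z = (t / norm (z - p) - 1) *\<^sub>R (z - p)" by (simp add: y_def algebra_simps)
      then have "norm (y - z) = \<bar>t / norm (z - p) - 1\<bar> * norm (z - p)" by simp
      also have "\<dots> = t - norm (z - p)" using z z0 by (simp add: abs_if field_simps)
      finally have "dist z y < d" using z0 by (simp add: dist_norm norm_minus_commute)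
      then have "dist (f z) (f y) < e"
        using z ny by (intro d(2)) (auto simp: S_def dist_norm norm_minus_commute)
      then have "\<bar>f z $ i - f y $ i\<bar> < e"
        using component_le_norm_cart[of "f z - f y" i] by (simp add: dist_norm)
      then show "\<bar>f z $ i - c\<bar> < m + e" using sphere[OF ny] by linarith
    qed
  qed
qed (use sphere in blast)

end

section \<open>Differentiability almost everywhere\<close>

text \<open>One coordinate costs 4^n divided by \<open>osc_const n\<close>. Raising the sum of n
  coordinates to the power n contributes n^n, and adding the n equal bounds one more n.\<close>

definition qr_osc_const :: "nat \<Rightarrow> real" where
  "qr_osc_const n = real n ^ (n + 1) * (4 ^ n / osc_const n)"

lemma qr_osc_const_pos: "n > 0 \<Longrightarrow> 0 < qr_osc_const n"
  by (auto simp: qr_osc_const_def osc_const_pos)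

lemma set_integral_subset_le:
  fixes \<phi> :: "'a \<Rightarrow> real"
  assumes "set_integrable M B \<phi>" "A \<in> sets M" "A \<subseteq> B" "\<And>x. 0 \<le> \<phi> x"
  shows "(LINT x:A|M. \<phi> x) \<le> (LINT x:B|M. \<phi> x)"
  using assms set_integrable_subset[OF assms(1-3)] unfolding set_lebesgue_integral_def set_integrable_def
  by (intro integral_mono) (auto simp: indicator_def)

lemma set_integral_nonneg:
  fixes \<phi> :: "'a \<Rightarrow> real"
  assumes "\<And>x. 0 \<le> \<phi> x"
  shows "0 \<le> (LINT x:A|M. \<phi> x)"
  unfolding set_lebesgue_integral_def using assms by (intro integral_nonneg_AE) auto

lemma norm_row_le: "norm (A $ i) \<le> norm (A :: real^'n^'m)"
  by (rule Finite_Cartesian_Product.norm_nth_le)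

context qr_map
begin

section \<open>Oscillation of f against its energy\<close>

definition en :: "real^'n \<Rightarrow> real \<Rightarrow> real" where
  "en p \<rho> = (LINT x:cball p \<rho>|lborel. norm (g x) ^ CARD('n))"

lemma cball_sub: "norm p + \<rho> \<le> R \<Longrightarrow> cball (p::real^'n) \<rho> \<subseteq> cball 0 R"
proof
  fix x assume "norm p + \<rho> \<le> R" "x \<in> cball p \<rho>"
  then show "x \<in> cball 0 R" using norm_triangle_sub[of x p] by (simp add: dist_norm norm_minus_commute)
qed

lemma en_integrable: "norm p + \<rho> < 1 \<Longrightarrow> set_integrable lborel (cball p \<rho>) (\<lambda>x. norm (g x) ^ CARD('n))"
  by (rule set_integrable_subset[OF g_Ln[of "norm p + \<rho>"]]) (use cball_sub[of p \<rho>] in auto)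

lemma en_nonneg: "0 \<le> en p \<rho>"
  unfolding en_def by (rule set_integral_nonneg) simp

text \<open>The energy estimate is applied to the smooth \<open>F k\<close>, but the far points on
  the spheres come from monotonicity of \<open>f\<close>, which the approximants need not share. The
  uniform distance \<eta> between the two is lost and removed at the end.\<close>

lemma oscillation_component:
  assumes r: "0 < r" and pr: "norm p + (real CARD('n) + 2) * r < 1" and y: "norm (y - p) \<le> r"
  shows "\<bar>f y $ i - f p $ i\<bar> ^ CARD('n) \<le> 4 ^ CARD('n) / osc_const CARD('n) * en p ((real CARD('n) + 2) * r)"
proof -
  let ?n = "CARD('n)"
  define \<rho> where "\<rho> = (real ?n + 2) * r"
  define R where "R = norm p + \<rho>"
  have R: "0 < R" "R < 1" using r pr by (auto simp: R_def \<rho>_def intro: add_nonneg_pos)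
  have n1: "1 \<le> real ?n" by (simp add: Suc_leI)
  have \<rho>r: "3 * r \<le> \<rho>" unfolding \<rho>_def using n1 r by (intro mult_right_mono) auto
  have sub: "cball p \<rho> \<subseteq> cball 0 R" by (rule cball_sub) (simp add: R_def)
  obtain F G H where
      dF: "\<And>k i x. ((\<lambda>x. F k x $ i) has_derivative (\<lambda>v. G k x $ i \<bullet> v)) (at x)"
    and dG: "\<And>k i j x. ((\<lambda>x. G k x $ i $ j) has_derivative (\<lambda>v. H k i j x \<bullet> v)) (at x)"
    and cH: "\<And>k i j. continuous_on UNIV (H k i j)"
    and sH: "\<And>k i j l x. H k i j x $ l = H k i l x $ j"
    and U: "uniform_limit (cball 0 R) F f sequentially"
    and IR: "\<And>k. set_integrable lborel (cball 0 R) (\<lambda>x. norm (G k x - g x) ^ CARD('n))"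
    and LR: "(\<lambda>k. LINT x:cball 0 R|lborel. norm (G k x - g x) ^ CARD('n)) \<longlonglongrightarrow> 0"
    by (rule smooth_approximation[OF R]) (rule that; assumption)
  have cGi: "continuous_on UNIV (\<lambda>x. G k x $ i)" for k i
  proof -
    have "continuous_on UNIV (\<lambda>x. G k x $ i $ j)" for j
      using dG has_derivative_continuous by (blast intro: continuous_at_imp_continuous_on)
    then have "continuous_on UNIV (\<lambda>x. \<chi> j. G k x $ i $ j)" by (intro continuous_on_vec_lambda)
    then show ?thesis by simp
  qed
  define D where "D = \<bar>f y $ i - f p $ i\<bar>"
  define \<kappa> where "\<kappa> = osc_const ?n"
  have \<kappa>: "\<kappa> > 0" by (simp add: \<kappa>_def osc_const_pos)
  \<comment> \<open>The maximum with 0 makes the claim trivial when the deviation does not exceed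
    \<eta>. The factor 1/2 comes from D <= 2 m, the factor 2^n from comparing the energy of
    \<open>G k\<close> with that of \<open>g\<close>.\<close>
  have main: "\<kappa> * (max (D / 2 - \<eta>) 0) ^ ?n \<le> 2 ^ ?n * ((LINT x:cball 0 R|lborel. norm (G k x - g x) ^ ?n) + en p \<rho>)"
    if \<eta>: "\<eta> > 0" and k: "\<And>x. x \<in> cball 0 R \<Longrightarrow> dist (F k x) (f x) < \<eta>" for \<eta> k
  proof -
    interpret C1_function "\<lambda>x. F k x $ i" "\<lambda>x. G k x $ i"
      by unfold_locales (rule dF, rule cGi)
    let ?v = "\<lambda>x. F k x $ i"
    define c where "c = cube_avg ?v p r"
    have fcont: "continuous_on S f" if "S \<subseteq> cball 0 R" for S
      by (rule continuous_on_subset[OF cont_f]) (use that R in force)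
    have "cball p r \<subseteq> cball p \<rho>" using \<rho>r r by (intro subset_cball) linarith
    then have "cball p r \<subseteq> cball 0 R" using sub by blast
    then have cpr: "continuous_on (cball p r) (\<lambda>x. \<bar>f x $ i - c\<bar>)" by (intro continuous_intros fcont)
    have "cball p r \<noteq> {}" using r by simp
    from continuous_attains_sup[OF compact_cball this cpr]
    obtain z where z: "z \<in> cball p r" "\<And>x. x \<in> cball p r \<Longrightarrow> \<bar>f x $ i - c\<bar> \<le> \<bar>f z $ i - c\<bar>"
      by blast
    define m where "m = \<bar>f z $ i - c\<bar>"
    have "D \<le> 2 * m"
    proof -
      have "y \<in> cball p r" "p \<in> cball p r" using y r by (auto simp: dist_norm norm_minus_commute)
      then have "\<bar>f y $ i - c\<bar> \<le> m" "\<bar>f p $ i - c\<bar> \<le> m" unfolding m_def by (blast intro: z(2))+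
      then show ?thesis
        using abs_triangle_ineq4[of "f y $ i - c" "f p $ i - c"] by (simp add: D_def)
    qed
    show ?thesis
    proof (cases "m - \<eta> > 0")
      case False
      then have "max (D / 2 - \<eta>) 0 = 0" using \<open>D \<le> 2 * m\<close> by simp
      moreover have "0 \<le> (LINT x:cball 0 R|lborel. norm (G k x - g x) ^ ?n)" by (rule set_integral_nonneg) simp
      ultimately show ?thesis using en_nonneg[of p \<rho>] by (simp add: power_0_left)
    next
      case True
      have far: "\<exists>x. norm (x - p) = t \<and> m - \<eta> \<le> \<bar>?v x - cube_avg ?v p r\<bar>" if t: "r < t" "t < 2 * r" for t
      proof -
        have St: "sphere p t \<subseteq> cball 0 R"
          using sub \<rho>r t r by (intro subsetI) (auto simp: subset_iff)
        have cst: "continuous_on (sphere p t) (\<lambda>x. \<bar>f x $ i - c\<bar>)" by (intro continuous_intros fcont St)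
        have "sphere p t \<noteq> {}"
        proof -
          have "p + t *\<^sub>R axis i 1 \<in> sphere p t" using t r by (simp add: dist_norm)
          then show ?thesis by blast
        qed
        from continuous_attains_sup[OF compact_sphere this cst]
        obtain x where x: "x \<in> sphere p t" "\<And>w. w \<in> sphere p t \<Longrightarrow> \<bar>f w $ i - c\<bar> \<le> \<bar>f x $ i - c\<bar>"
          by blast
        \<comment> \<open>Monotonicity on the ball of radius \<open>t\<close>: the largest deviation
          over the inner ball is matched on every larger sphere.\<close>
        have "\<bar>f z $ i - c\<bar> \<le> \<bar>f x $ i - c\<bar>"
        proof (rule monotone)
          have "t < \<rho>" using t \<rho>r r by linarith
          then show "norm p + t < 1" using R by (simp add: R_def)
          show "0 < t" using t r by simp
          show "norm (z - p) \<le> t" using z(1) t by (simp add: dist_norm norm_minus_commute)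
          fix w assume "norm (w - p) = t"
          then show "\<bar>f w $ i - c\<bar> \<le> \<bar>f x $ i - c\<bar>" by (intro x(2)) (simp add: dist_norm norm_minus_commute)
        qed
        moreover have "\<bar>F k x $ i - f x $ i\<bar> \<le> \<eta>"
          using k[of x] x(1) St component_le_norm_cart[of "F k x - f x" i] by (auto simp: dist_norm)
        ultimately have "m - \<eta> \<le> \<bar>?v x - c\<bar>" unfolding m_def by linarith
        then show ?thesis using x(1) by (intro exI[of _ x]) (simp add: c_def dist_norm norm_minus_commute)
      qed
      have "\<kappa> * (max (D / 2 - \<eta>) 0) ^ ?n \<le> \<kappa> * (m - \<eta>) ^ ?n"
        using True \<open>D \<le> 2 * m\<close> \<kappa> by (intro mult_left_mono power_mono) auto
      also have "\<dots> \<le> energy p \<rho>"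
        unfolding \<kappa>_def \<rho>_def by (rule oscillation_le_energy[OF r True far])
      also have "\<dots> \<le> (LINT x:cball p \<rho>|lborel. 2 ^ ?n * (norm (G k x - g x) ^ ?n + norm (g x) ^ ?n))"
        unfolding energy_def
      proof (rule set_integral_mono[OF energy_integrable])
        show "set_integrable lborel (cball p \<rho>) (\<lambda>x. 2 ^ ?n * (norm (G k x - g x) ^ ?n + norm (g x) ^ ?n))"
          using set_integrable_subset[OF IR _ sub] en_integrable[of p \<rho>] R
          by (intro set_integrable_mult_right set_integral_add(1)) (auto simp: R_def)
        fix x
        have "norm (G k x $ i) ^ ?n \<le> norm (G k x) ^ ?n" by (intro power_mono norm_row_le) simp
        also have "\<dots> \<le> 2 ^ ?n * (norm (G k x - g x) ^ ?n + norm (g x) ^ ?n)"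
          using norm_power_triangle[of "G k x - g x" "g x" ?n] by simp
        finally show "norm (G k x $ i) ^ ?n \<le> 2 ^ ?n * (norm (G k x - g x) ^ ?n + norm (g x) ^ ?n)" .
      qed
      also have "\<dots> = 2 ^ ?n * ((LINT x:cball p \<rho>|lborel. norm (G k x - g x) ^ ?n) + en p \<rho>)"
        using set_integrable_subset[OF IR _ sub] en_integrable[of p \<rho>] R
        by (simp add: en_def R_def set_integral_add(2))
      also have "\<dots> \<le> 2 ^ ?n * ((LINT x:cball 0 R|lborel. norm (G k x - g x) ^ ?n) + en p \<rho>)"
        using set_integral_subset_le[OF IR _ sub] by (intro mult_left_mono add_right_mono) auto
      finally show ?thesis .
    qed
  qed
  \<comment> \<open>First \<open>k\<close> tends to infinity with \<eta> fixed, afterwards \<eta>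
    tends to zero.\<close>
  have lim: "\<kappa> * (max (D / 2 - \<eta>) 0) ^ ?n \<le> 2 ^ ?n * (0 + en p \<rho>)" if \<eta>: "\<eta> > 0" for \<eta>
  proof (rule tendsto_le[OF sequentially_bot])
    show "(\<lambda>k. 2 ^ ?n * ((LINT x:cball 0 R|lborel. norm (G k x - g x) ^ ?n) + en p \<rho>)) \<longlonglongrightarrow> 2 ^ ?n * (0 + en p \<rho>)"
      by (intro tendsto_intros LR)
    show "\<forall>\<^sub>F k in sequentially. \<kappa> * (max (D / 2 - \<eta>) 0) ^ ?n \<le> 2 ^ ?n * ((LINT x:cball 0 R|lborel. norm (G k x - g x) ^ ?n) + en p \<rho>)"
      using uniform_limitD[OF U \<eta>] by eventually_elim (use main[OF \<eta>] in blast)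
  qed (rule tendsto_const)
  have "\<kappa> * (max (D / 2 - 0) 0) ^ ?n \<le> 2 ^ ?n * (0 + en p \<rho>)"
  proof (rule tendsto_le[of "at_right 0"])
    show "((\<lambda>\<eta>. \<kappa> * (max (D / 2 - \<eta>) 0) ^ ?n) \<longlongrightarrow> \<kappa> * (max (D / 2 - 0) 0) ^ ?n) (at_right 0)"
      by (intro tendsto_intros)
    show "\<forall>\<^sub>F \<eta> in at_right 0. \<kappa> * (max (D / 2 - \<eta>) 0) ^ ?n \<le> 2 ^ ?n * (0 + en p \<rho>)"
      using lim by (intro eventually_at_rightI[of 0 1]) auto
  qed (auto intro: tendsto_const)
  moreover have "max (D / 2 - 0) 0 = D / 2" by (simp add: D_def)
  ultimately have "\<kappa> * (D ^ ?n / 2 ^ ?n) \<le> 2 ^ ?n * en p \<rho>" by (simp only: power_divide add_0)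
  then have "D ^ ?n \<le> (2 ^ ?n * 2 ^ ?n) / \<kappa> * en p \<rho>" using \<kappa> by (simp add: field_simps)
  also have "(2 ^ ?n * 2 ^ ?n :: real) = 4 ^ ?n" by (simp flip: power_mult_distrib)
  finally show ?thesis by (simp add: D_def \<kappa>_def \<rho>_def)
qed

theorem oscillation:
  assumes r: "0 < r" and pr: "norm p + (real CARD('n) + 2) * r < 1" and y: "norm (y - p) \<le> r"
  shows "norm (f y - f p) ^ CARD('n) \<le> qr_osc_const CARD('n) * en p ((real CARD('n) + 2) * r)"
proof -
  let ?n = "CARD('n)" and ?E = "en p ((real CARD('n) + 2) * r)"
  have "norm (f y - f p) ^ ?n \<le> (\<Sum>i\<in>UNIV. \<bar>(f y - f p) $ i\<bar>) ^ ?n"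
    by (intro power_mono norm_le_l1_cart) simp
  also have "\<dots> \<le> real ?n ^ ?n * (\<Sum>i\<in>UNIV. \<bar>(f y - f p) $ i\<bar> ^ ?n)"
    by (rule sum_power_le) auto
  also have "\<dots> \<le> real ?n ^ ?n * (\<Sum>i\<in>(UNIV::'n set). 4 ^ ?n / osc_const ?n * ?E)"
    using oscillation_component[OF r pr y] by (intro mult_left_mono sum_mono) auto
  also have "\<dots> = qr_osc_const ?n * ?E" by (simp add: qr_osc_const_def)
  finally show ?thesis .
qed

section \<open>L^n-Lebesgue points of the differential and approximation by affine maps\<close>

definition Lpoint :: "real^'n \<Rightarrow> bool" where
  "Lpoint x \<longleftrightarrow> ((\<lambda>r. (LINT y:cball x r|lborel. norm (g y - g x) ^ CARD('n)) / r ^ CARD('n)) \<longlongrightarrow> 0) (at_right 0)"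

lemma g_diff_integrable:
  assumes "norm p + \<rho> < 1"
  shows "set_integrable lborel (cball p \<rho>) (\<lambda>y. norm (g y - A) ^ CARD('n))"
  unfolding set_integrable_def
proof (rule Bochner_Integration.integrable_bound)
  have c: "set_integrable lborel (cball p \<rho>) (\<lambda>y. norm A ^ CARD('n))"
    by (rule set_integrable_continuous_compact) auto
  show "integrable lborel (\<lambda>y. indicator (cball p \<rho>) y *\<^sub>R (2 ^ CARD('n) * (norm (g y) ^ CARD('n) + norm A ^ CARD('n))))"
    using set_integrable_mult_right[OF set_integral_add(1)[OF en_integrable[OF assms] c]] unfolding set_integrable_def .
  show "(\<lambda>y. indicator (cball p \<rho>) y *\<^sub>R norm (g y - A) ^ CARD('n)) \<in> borel_measurable lborel"
    using g_borel by (intro borel_measurable_scaleR borel_measurable_indicator borel_measurable_power borel_measurable_norm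
      borel_measurable_diff) auto
  show "AE y in lborel. norm (indicator (cball p \<rho>) y *\<^sub>R norm (g y - A) ^ CARD('n))
      \<le> norm (indicator (cball p \<rho>) y *\<^sub>R (2 ^ CARD('n) * (norm (g y) ^ CARD('n) + norm A ^ CARD('n))))"
    using norm_power_triangle[of "g _" "- A" "CARD('n)"] by (intro AE_I2) (auto simp: indicator_def)
qed

lemma AE_Lpoint: "AE x in lborel. x \<in> ball 0 1 \<longrightarrow> Lpoint x"
proof -
  have "AE x in lborel. norm x < 1 - 1 / real (Suc k) \<longrightarrow> Lpoint x" for k
  proof -
    define R where "R = 1 - 1 / real (Suc k)"
    have "1 / real (Suc k) > 0" by simp
    then have R: "R < 1" unfolding R_def by linarith
    \<comment> \<open>The cutoff gives global integrability and does not change averages over small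
      balls about points of norm below \<open>R\<close>; letting \<open>R\<close> tend to 1 exhausts
      the ball.\<close>
    define h where "h x = indicator (cball 0 R) x *\<^sub>R g x" for x
    have hb: "h \<in> borel_measurable borel"
      unfolding h_def by (intro borel_measurable_scaleR borel_measurable_indicator g_borel) auto
    have "(\<lambda>x. norm (h x) ^ CARD('n)) = (\<lambda>x. indicator (cball 0 R) x *\<^sub>R norm (g x) ^ CARD('n))"
      by (auto simp: fun_eq_iff h_def indicator_def)
    then have hi: "integrable lborel (\<lambda>x. norm (h x) ^ CARD('n))" using g_Ln[OF R] by (simp add: set_integrable_def)
    have "AE x in lborel. ((\<lambda>r. (LINT y:cball x r|lborel. norm (h y - h x) ^ CARD('n)) / r ^ DIM(real^'n)) \<longlongrightarrow> 0) (at_right 0)"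
      by (rule AE_Lebesgue_point[OF hb hi]) simp
    then show ?thesis
    proof eventually_elim
      case (elim x)
      show ?case
      proof
        assume "norm x < 1 - 1 / real (Suc k)"
        then have x: "norm x < R" by (simp add: R_def)
        show "Lpoint x"
          unfolding Lpoint_def
        proof (rule Lim_transform_eventually)
          show "((\<lambda>r. (LINT y:cball x r|lborel. norm (h y - h x) ^ CARD('n)) / r ^ CARD('n)) \<longlongrightarrow> 0) (at_right 0)"
            using elim by simp
          have "(LINT y:cball x r|lborel. norm (h y - h x) ^ CARD('n)) = (LINT y:cball x r|lborel. norm (g y - g x) ^ CARD('n))"
            if "r < R - norm x" for r
            unfolding set_lebesgue_integral_def
          proof (rule Bochner_Integration.integral_cong[OF refl])
            fix y
            have "h x = g x" using x by (simp add: h_def)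
            moreover have "h y = g y" if "y \<in> cball x r"
              using cball_sub[of x r R] that \<open>r < R - norm x\<close> by (auto simp: h_def)
            ultimately show "indicator (cball x r) y *\<^sub>R norm (h y - h x) ^ CARD('n) = indicator (cball x r) y *\<^sub>R norm (g y - g x) ^ CARD('n)"
              by (auto simp: indicator_def)
          qed
          then show "\<forall>\<^sub>F r in at_right 0. (LINT y:cball x r|lborel. norm (h y - h x) ^ CARD('n)) / r ^ CARD('n)
              = (LINT y:cball x r|lborel. norm (g y - g x) ^ CARD('n)) / r ^ CARD('n)"
            using x by (intro eventually_at_rightI[of 0 "R - norm x"]) auto
        qed
      qed
    qed
  qed
  then have "AE x in lborel. \<forall>k. norm x < 1 - 1 / real (Suc k) \<longrightarrow> Lpoint x"
    unfolding AE_all_countable by (rule allI)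
  then show ?thesis
  proof eventually_elim
    case (elim x)
    show ?case
    proof
      assume "x \<in> ball 0 1"
      then have "0 < 1 - norm x" by simp
      then obtain k where "1 / real (Suc k) < 1 - norm x" by (rule nat_approx_posE)
      then have "norm x < 1 - 1 / real (Suc k)" by linarith
      then show "Lpoint x" using spec[OF elim, of k] by blast
    qed
  qed
qed

text \<open>
  At an \<open>L\<^sup>n\<close>-Lebesgue point of the differential, averages of \<open>f - g x\<close> over small cubes are
  nearly constant, and the oscillation estimate compares \<open>f\<close> with these averages pointwise.
\<close>

theorem nearly_affine:
  assumes x: "norm x < 1" and Lp: "Lpoint x" and e: "e > 0"
  shows "\<exists>s0>0. \<forall>s. 0 < s \<and> s < s0 \<longrightarrow> (\<exists>c. \<forall>y. norm (y - x) \<le> s \<longrightarrow> norm (f y - c - g x *v y) \<le> e * s)"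
proof -
  let ?n = "CARD('n)"
  define A where "A = g x"
  define L where "L = real ?n + 2"
  \<comment> \<open>With this factor, the oscillation estimate at a point within \<open>s\<close> of
    \<open>x\<close>, at scales up to n s, uses energy only inside
    \<open>cball x (\<Lambda> * s)\<close>.\<close>
  define \<Lambda> where "\<Lambda> = 1 + L * ?n"
  have n1: "1 \<le> real ?n" by (simp add: Suc_leI)
  have L: "L \<ge> 3" using n1 by (simp add: L_def)
  have Lam: "\<Lambda> \<ge> 1 + ?n" unfolding \<Lambda>_def using L n1 by (simp add: mult_le_cancel_right1)
  \<comment> \<open>Each of the n coordinates collects six errors of size \<epsilon> s: one from F k
    - f, four from replacing a value by a cube average, one from moving the cube to
    \<open>x\<close>.\<close>
  define \<epsilon> where "\<epsilon> = e / (6 * ?n)"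
  have \<epsilon>: "\<epsilon> > 0" using e n1 by (simp add: \<epsilon>_def)
  define V where "V = unit_ball_vol (real ?n)"
  have V: "V > 0" by (simp add: V_def)
  define C where "C = qr_osc_const ?n"
  have C: "C > 0" by (simp add: C_def qr_osc_const_pos)
  define B where "B = norm A ^ ?n * V * (L * ?n) ^ ?n"
  have B: "B \<ge> 0" using V L by (simp add: B_def)
  \<comment> \<open>The relative side of the cubes, \<rho> = \<beta> s. The last two conditions make
    the linear part over one cube, and the energy of the constant matrix \<open>A\<close> in the
    oscillation estimate, small.\<close>
  obtain \<beta> where \<beta>: "0 < \<beta>" "\<beta> \<le> 1" "norm A * ?n * \<beta> \<le> \<epsilon>" "C * 2 ^ ?n * B * \<beta> ^ ?n \<le> \<epsilon> ^ ?n / 2"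
  proof -
    define b where "b = min 1 (min (\<epsilon> / (norm A * ?n + 1)) ((\<epsilon> ^ ?n / 2) / (C * 2 ^ ?n * B + 1)))"
    have b: "0 < b" "b \<le> 1" "b \<le> \<epsilon> / (norm A * ?n + 1)" "b \<le> (\<epsilon> ^ ?n / 2) / (C * 2 ^ ?n * B + 1)"
      using \<epsilon> C B by (auto simp: b_def intro!: divide_pos_pos add_nonneg_pos)
    have "norm A * ?n * b \<le> (norm A * ?n + 1) * b" using b by (intro mult_right_mono) auto
    also have "\<dots> \<le> \<epsilon>" using b(3) by (subst (asm) pos_le_divide_eq) (auto simp: mult.commute add_nonneg_pos)
    finally have 1: "norm A * ?n * b \<le> \<epsilon>" .
    have "b ^ ?n \<le> b ^ 1" using b by (intro power_decreasing) (auto simp: Suc_leI)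
    then have "C * 2 ^ ?n * B * b ^ ?n \<le> (C * 2 ^ ?n * B + 1) * b" using b C B by (intro mult_mono) auto
    also have "\<dots> \<le> \<epsilon> ^ ?n / 2" using b(4) C B by (subst (asm) pos_le_divide_eq) (auto simp: mult.commute add_nonneg_pos)
    finally show thesis using that b 1 by blast
  qed
  \<comment> \<open>Chosen after \<beta>, because moving a cube of side \<beta> s over a distance
    \<open>s\<close> costs the factor \<beta>^-n.\<close>
  define \<tau> where "\<tau> = min ((\<epsilon> ^ ?n / 2) / (C * 2 ^ ?n)) (\<epsilon> ^ ?n * \<beta> ^ ?n / (2 * 2 ^ ?n))"
  have \<tau>: "\<tau> > 0" "C * 2 ^ ?n * \<tau> \<le> \<epsilon> ^ ?n / 2" "2 ^ ?n * (\<tau> + \<tau>) \<le> \<epsilon> ^ ?n * \<beta> ^ ?n"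
    using \<epsilon> C \<beta> by (auto simp: \<tau>_def min_def field_simps)
  have Lam0: "\<Lambda> > 0" using Lam n1 by linarith
  have "\<forall>\<^sub>F r in at_right 0. (LINT y:cball x r|lborel. norm (g y - g x) ^ ?n) / r ^ ?n < \<tau> / \<Lambda> ^ ?n"
    using order_tendstoD(2)[OF Lp[unfolded Lpoint_def], of "\<tau> / \<Lambda> ^ ?n"] \<tau> Lam0 by simp
  then obtain r0 where r0: "r0 > 0" "\<And>r. 0 < r \<Longrightarrow> r < r0 \<Longrightarrow> (LINT y:cball x r|lborel. norm (g y - g x) ^ ?n) / r ^ ?n < \<tau> / \<Lambda> ^ ?n"
    by (auto simp: eventually_at_right[OF zero_less_one])
  define s0 where "s0 = min (r0 / \<Lambda>) ((1 - norm x) / (2 * \<Lambda>))"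
  have s0: "s0 > 0" using r0 x Lam0 by (simp add: s0_def)
  have "\<exists>c. \<forall>y. norm (y - x) \<le> s \<longrightarrow> norm (f y - c - A *v y) \<le> e * s" if s: "0 < s" "s < s0" for s
  proof -
    have sl: "\<Lambda> * s < r0" "norm x + \<Lambda> * s < 1"
      using s Lam0 x by (auto simp: s0_def field_simps)
    define R where "R = norm x + \<Lambda> * s"
    have R: "0 < R" "R < 1" using sl s Lam0 by (auto simp: R_def intro: add_nonneg_pos)
    have subR: "cball x (\<Lambda> * s) \<subseteq> cball 0 R" by (rule cball_sub) (simp add: R_def)
    have gA: "set_integrable lborel (cball x (\<Lambda> * s)) (\<lambda>y. norm (g y - A) ^ ?n)" by (rule g_diff_integrable[OF sl(2)])
    have T: "(LINT y:cball x (\<Lambda> * s)|lborel. norm (g y - A) ^ ?n) \<le> \<tau> * s ^ ?n"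
    proof -
      have "(LINT y:cball x (\<Lambda> * s)|lborel. norm (g y - g x) ^ ?n) / (\<Lambda> * s) ^ ?n < \<tau> / \<Lambda> ^ ?n"
        using r0(2)[of "\<Lambda> * s"] s Lam0 sl by simp
      then have "(LINT y:cball x (\<Lambda> * s)|lborel. norm (g y - g x) ^ ?n) < \<tau> / \<Lambda> ^ ?n * (\<Lambda> * s) ^ ?n"
        using s Lam0 by (subst (asm) pos_divide_less_eq) auto
      also have "\<dots> = \<tau> * s ^ ?n" using Lam0 by (simp add: power_mult_distrib)
      finally show ?thesis by (simp add: A_def)
    qed
    define \<rho> where "\<rho> = \<beta> * s"
    have \<rho>: "0 < \<rho>" "\<rho> \<le> s" using \<beta> s by (auto simp: \<rho>_def mult_left_le_one_le)
    \<comment> \<open>The energy of \<open>g\<close> near \<open>y\<close> is at most a multiple of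
      that of g - A, small by \<tau>, plus that of the constant \<open>A\<close>, which scales like
      \<beta>^n.\<close>
    have osc: "norm (f z - f y) \<le> \<epsilon> * s" if y: "norm (y - x) \<le> s" and z: "norm (z - y) \<le> ?n * \<rho>" for y z
    proof (rule power_le_imp_le_base)
      have nr: "?n * \<rho> > 0" using \<rho> n1 by simp
      have sub: "cball y (L * (?n * \<rho>)) \<subseteq> cball x (\<Lambda> * s)"
      proof
        fix w assume "w \<in> cball y (L * (?n * \<rho>))"
        then have "dist x w \<le> dist x y + L * (?n * \<rho>)" using dist_triangle[of x w y] by simp
        also have "\<dots> \<le> s + L * (?n * s)" using y \<rho> L by (intro add_mono mult_left_mono) (auto simp: dist_norm norm_minus_commute)
        finally show "w \<in> cball x (\<Lambda> * s)" by (simp add: \<Lambda>_def algebra_simps)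
      qed
      have yR: "norm y + L * (?n * \<rho>) < 1"
      proof -
        have "norm y \<le> norm x + s" using y norm_triangle_sub[of y x] by linarith
        moreover have "L * (?n * \<rho>) \<le> L * (?n * s)" using \<rho> L by (intro mult_left_mono) auto
        ultimately show ?thesis using sl(2) by (simp add: \<Lambda>_def algebra_simps)
      qed
      have "norm (f z - f y) ^ ?n \<le> C * en y (L * (?n * \<rho>))"
        unfolding C_def L_def by (rule oscillation[OF nr yR[unfolded L_def] z])
      also have "en y (L * (?n * \<rho>)) \<le> (LINT w:cball y (L * (?n * \<rho>))|lborel. 2 ^ ?n * (norm (g w - A) ^ ?n + norm A ^ ?n))"
        unfolding en_def
      proof (rule set_integral_mono[OF en_integrable[OF yR]])
        show "set_integrable lborel (cball y (L * (?n * \<rho>))) (\<lambda>w. 2 ^ ?n * (norm (g w - A) ^ ?n + norm A ^ ?n))"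
          by (intro set_integrable_mult_right set_integral_add(1) g_diff_integrable[OF yR] set_integrable_continuous_compact) auto
        show "norm (g w) ^ ?n \<le> 2 ^ ?n * (norm (g w - A) ^ ?n + norm A ^ ?n)" for w
          using norm_power_triangle[of "g w - A" A ?n] by simp
      qed
      also have "\<dots> = 2 ^ ?n * ((LINT w:cball y (L * (?n * \<rho>))|lborel. norm (g w - A) ^ ?n) + (LINT w:cball y (L * (?n * \<rho>))|lborel. norm A ^ ?n))"
        by (simp add: set_integral_add(2)[OF g_diff_integrable[OF yR] set_integrable_continuous_compact])
      also have "(LINT w:cball y (L * (?n * \<rho>))|lborel. norm A ^ ?n) = B * \<beta> ^ ?n * s ^ ?n"
      proof -
        have "(LINT w:cball y (L * (?n * \<rho>))|lborel. norm A ^ ?n) = V * (L * (?n * \<rho>)) ^ ?n * norm A ^ ?n"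
          using L \<rho> by (subst set_integral_const) (auto simp: emeasure_cball content_cball V_def)
        then show ?thesis by (simp add: B_def \<rho>_def power_mult_distrib mult_ac)
      qed
      also have "(LINT w:cball y (L * (?n * \<rho>))|lborel. norm (g w - A) ^ ?n) \<le> \<tau> * s ^ ?n"
        using set_integral_subset_le[OF gA _ sub] T by simp
      finally have "norm (f z - f y) ^ ?n \<le> C * (2 ^ ?n * (\<tau> * s ^ ?n + B * \<beta> ^ ?n * s ^ ?n))"
        using C by simp
      also have "\<dots> = (C * 2 ^ ?n * \<tau> + C * 2 ^ ?n * B * \<beta> ^ ?n) * s ^ ?n" by (simp add: algebra_simps)
      also have "\<dots> \<le> (\<epsilon> ^ ?n / 2 + \<epsilon> ^ ?n / 2) * s ^ ?n" using \<tau> \<beta> s by (intro mult_right_mono add_mono) auto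
      also have "\<dots> = (\<epsilon> * s) ^ ?n" by (simp add: power_mult_distrib)
      finally show "norm (f z - f y) ^ Suc (?n - 1) \<le> (\<epsilon> * s) ^ Suc (?n - 1)" by simp
    qed (use \<epsilon> s in auto)
    obtain F G H where
        dF: "\<And>k i x. ((\<lambda>x. F k x $ i) has_derivative (\<lambda>v. G k x $ i \<bullet> v)) (at x)"
      and dG: "\<And>k i j x. ((\<lambda>x. G k x $ i $ j) has_derivative (\<lambda>v. H k i j x \<bullet> v)) (at x)"
      and cH: "\<And>k i j. continuous_on UNIV (H k i j)"
      and sH: "\<And>k i j l x. H k i j x $ l = H k i l x $ j"
      and U: "uniform_limit (cball 0 R) F f sequentially"
      and IR: "\<And>k. set_integrable lborel (cball 0 R) (\<lambda>x. norm (G k x - g x) ^ CARD('n))"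
      and LR: "(\<lambda>k. LINT x:cball 0 R|lborel. norm (G k x - g x) ^ CARD('n)) \<longlonglongrightarrow> 0"
      by (rule smooth_approximation[OF R]) (rule that; assumption)
    have es: "\<epsilon> * s > 0" "\<tau> * s ^ ?n > 0" using \<epsilon> \<tau> s by auto
    obtain k where k: "\<And>z. z \<in> cball 0 R \<Longrightarrow> dist (F k z) (f z) < \<epsilon> * s"
       "(LINT x:cball 0 R|lborel. norm (G k x - g x) ^ ?n) < \<tau> * s ^ ?n"
      using eventually_happens'[OF sequentially_bot eventually_conj[OF uniform_limitD[OF U es(1)] order_tendstoD(2)[OF LR es(2)]]]
      by blast
    \<comment> \<open>Removing the linear part leaves the gradient G k - A, whose L^n norm near
      \<open>x\<close> is small.\<close>
    define v where "v i z = F k z $ i - A $ i \<bullet> z" for i z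
    define v' where "v' i z = G k z $ i - A $ i" for i z
    have C1: "C1_function (v i) (v' i)" for i
    proof
      show "(v i has_derivative (\<lambda>u. v' i z \<bullet> u)) (at z)" for z
        unfolding v_def v'_def
        by (rule has_derivative_eq_rhs[OF has_derivative_diff[OF dF bounded_linear_imp_has_derivative[OF bounded_linear_inner_right]]])
           (simp add: inner_diff_left)
      have "continuous_on UNIV (\<lambda>x. G k x $ i $ j)" for j
        using dG has_derivative_continuous by (blast intro: continuous_at_imp_continuous_on)
      then have "continuous_on UNIV (\<lambda>x. \<chi> j. G k x $ i $ j)" by (intro continuous_on_vec_lambda)
      then have "continuous_on UNIV (\<lambda>x. G k x $ i)" by simp
      then show "continuous_on UNIV (v' i)" unfolding v'_def by (rule continuous_on_diff[OF _ continuous_on_const])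
    qed
    define c where "c = (\<chi> i. cube_avg (v i) x \<rho>)"
    have comp: "\<bar>f y $ i - c $ i - (A *v y) $ i\<bar> \<le> 6 * (\<epsilon> * s)" if y: "norm (y - x) \<le> s" for y i
    proof -
      interpret C1_function "v i" "v' i" by (rule C1)
      have Fz: "\<bar>F k z $ i - f z $ i\<bar> \<le> \<epsilon> * s" if "z \<in> cball 0 R" for z
        using k(1)[OF that] component_le_norm_cart[of "F k z - f z" i] by (simp add: dist_norm)
      have zin: "y + \<rho> *\<^sub>R z \<in> cball 0 R" and zn: "norm (\<rho> *\<^sub>R z) \<le> ?n * \<rho>" if z: "z \<in> cbox 0 One" for z
      proof -
        show zn: "norm (\<rho> *\<^sub>R z) \<le> ?n * \<rho>" using norm_unit_cube_le[OF z] \<rho> by (simp add: mult.commute mult_left_mono)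
        have "norm (y + \<rho> *\<^sub>R z) \<le> norm y + ?n * \<rho>" using norm_triangle_ineq[of y "\<rho> *\<^sub>R z"] zn by linarith
        also have "\<dots> \<le> norm x + s + ?n * s" using y norm_triangle_sub[of y x] \<rho> n1 by (intro add_mono mult_left_mono) auto
        also have "\<dots> \<le> R" using Lam s by (simp add: R_def) (metis add.commute distrib_right less_eq_real_def mult_1 mult_right_mono)
        finally show "y + \<rho> *\<^sub>R z \<in> cball 0 R" by simp
      qed
      have yin: "y \<in> cball 0 R" using zin[of 0] by (simp add: mem_box)
      \<comment> \<open>Four errors: F k - f at two points, the oscillation of \<open>f\<close> over
        the cube, and the linear part.\<close>
      have dev: "\<bar>cube_avg (v i) y \<rho> - v i y\<bar> \<le> 4 * (\<epsilon> * s)"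
      proof -
        have i1: "(\<lambda>z. v i (y + \<rho> *\<^sub>R z)) integrable_on cbox 0 One"
          by (intro integrable_continuous continuous_on_compose2[OF cont] continuous_intros) auto
        have "cube_avg (v i) y \<rho> - v i y = integral (cbox 0 One) (\<lambda>z::real^'n. v i (y + \<rho> *\<^sub>R z) - v i y)"
          unfolding cube_avg_def by (subst integral_diff[OF i1]) auto
        also have "norm \<dots> \<le> integral (cbox 0 One) (\<lambda>z::real^'n. 4 * (\<epsilon> * s))"
        proof (rule integral_norm_bound_integral)
          show "(\<lambda>z. v i (y + \<rho> *\<^sub>R z) - v i y) integrable_on cbox 0 One" by (intro integrable_diff i1) auto
          fix z :: "real^'n" assume z: "z \<in> cbox 0 One"
          have 1: "\<bar>f (y + \<rho> *\<^sub>R z) $ i - f y $ i\<bar> \<le> \<epsilon> * s"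
            using osc[OF y, of "y + \<rho> *\<^sub>R z"] zn[OF z] component_le_norm_cart[of "f (y + \<rho> *\<^sub>R z) - f y" i] by simp
          have "\<bar>A $ i \<bullet> (\<rho> *\<^sub>R z)\<bar> \<le> norm A * (?n * \<rho>)"
            using Cauchy_Schwarz_ineq2[of "A $ i" "\<rho> *\<^sub>R z"] mult_mono[OF norm_row_le[of A i] zn[OF z]] by simp
          also have "\<dots> = norm A * ?n * \<beta> * s" by (simp add: \<rho>_def)
          also have "\<dots> \<le> \<epsilon> * s" using \<beta> s by (intro mult_right_mono) auto
          finally have 2: "\<bar>A $ i \<bullet> (\<rho> *\<^sub>R z)\<bar> \<le> \<epsilon> * s" .
          have "v i (y + \<rho> *\<^sub>R z) - v i y = (F k (y + \<rho> *\<^sub>R z) $ i - f (y + \<rho> *\<^sub>R z) $ i) - (F k y $ i - f y $ i)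
              + (f (y + \<rho> *\<^sub>R z) $ i - f y $ i) - A $ i \<bullet> (\<rho> *\<^sub>R z)"
            by (simp add: v_def inner_add_right)
          then show "norm (v i (y + \<rho> *\<^sub>R z) - v i y) \<le> 4 * (\<epsilon> * s)"
            using 1 2 Fz[OF zin[OF z]] Fz[OF yin] by (simp add: abs_le_iff)
        qed auto
        also have "\<dots> = 4 * (\<epsilon> * s)" by simp
        finally show ?thesis by simp
      qed
      have avg: "\<bar>cube_avg (v i) y \<rho> - cube_avg (v i) x \<rho>\<bar> \<le> \<epsilon> * s"
      proof (rule power_le_imp_le_base)
        have "\<bar>cube_avg (v i) y \<rho> - cube_avg (v i) x \<rho>\<bar> ^ ?n
            \<le> ((norm (y - x) + ?n * \<bar>\<rho> - \<rho>\<bar>) / \<rho>) ^ ?n * energy x (\<Lambda> * s)"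
        proof (rule cube_avg_diff)
          fix a :: real and z :: "real^'n" assume a: "0 \<le> a" "a \<le> 1" and z: "z \<in> cbox 0 One"
          define u where "u = a *\<^sub>R (y - x) + \<rho> *\<^sub>R z"
          have "norm u \<le> \<bar>a\<bar> * norm (y - x) + norm (\<rho> *\<^sub>R z)"
            using norm_triangle_ineq[of "a *\<^sub>R (y - x)" "\<rho> *\<^sub>R z"] by (simp add: u_def)
          also have "\<dots> \<le> 1 * s + ?n * s" using a y zn[OF z] \<rho> n1
            by (intro add_mono mult_mono order_trans[OF zn[OF z]] mult_left_mono) auto
          also have "\<dots> \<le> \<Lambda> * s" using mult_right_mono[OF Lam, of s] s by (simp add: algebra_simps)
          finally have "x + u \<in> cball x (\<Lambda> * s)" by (simp add: dist_norm)
          then show "x + a *\<^sub>R (y - x) + (\<rho> + a * (\<rho> - \<rho>)) *\<^sub>R z \<in> cball x (\<Lambda> * s)" by (simp add: u_def add.assoc)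
        qed (use \<rho> in auto)
        also have "\<dots> \<le> (s / \<rho>) ^ ?n * (2 ^ ?n * (\<tau> * s ^ ?n + \<tau> * s ^ ?n))"
        proof (intro mult_mono power_mono divide_right_mono)
          have "energy x (\<Lambda> * s) \<le> (LINT w:cball x (\<Lambda> * s)|lborel. 2 ^ ?n * (norm (G k w - g w) ^ ?n + norm (g w - A) ^ ?n))"
            unfolding energy_def
          proof (rule set_integral_mono[OF energy_integrable])
            show "set_integrable lborel (cball x (\<Lambda> * s)) (\<lambda>w. 2 ^ ?n * (norm (G k w - g w) ^ ?n + norm (g w - A) ^ ?n))"
              by (intro set_integrable_mult_right set_integral_add(1) gA set_integrable_subset[OF IR _ subR]) auto
            fix w
            have "norm (v' i w) \<le> norm (G k w - A)" using norm_row_le[of "G k w - A" i] by (simp add: v'_def)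
            then have "norm (v' i w) ^ ?n \<le> norm (G k w - A) ^ ?n" by (intro power_mono) auto
            also have "\<dots> \<le> 2 ^ ?n * (norm (G k w - g w) ^ ?n + norm (g w - A) ^ ?n)"
              using norm_power_triangle[of "G k w - g w" "g w - A" ?n] by simp
            finally show "norm (v' i w) ^ ?n \<le> 2 ^ ?n * (norm (G k w - g w) ^ ?n + norm (g w - A) ^ ?n)" .
          qed
          also have "\<dots> = 2 ^ ?n * ((LINT w:cball x (\<Lambda> * s)|lborel. norm (G k w - g w) ^ ?n) + (LINT w:cball x (\<Lambda> * s)|lborel. norm (g w - A) ^ ?n))"
            using set_integral_add(2)[OF set_integrable_subset[OF IR _ subR] gA, of k] by simp
          also have "\<dots> \<le> 2 ^ ?n * (\<tau> * s ^ ?n + \<tau> * s ^ ?n)"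
            using set_integral_subset_le[OF IR _ subR, of k] k(2) T by (intro mult_left_mono add_mono) auto
          finally show "energy x (\<Lambda> * s) \<le> 2 ^ ?n * (\<tau> * s ^ ?n + \<tau> * s ^ ?n)" .
        qed (use y \<rho> energy_nonneg s in auto)
        also have "\<dots> = (2 ^ ?n * (\<tau> + \<tau>)) / \<beta> ^ ?n * s ^ ?n"
          using s \<beta> by (simp add: \<rho>_def power_divide power_mult_distrib field_simps)
        also have "\<dots> \<le> \<epsilon> ^ ?n * s ^ ?n"
          using \<tau>(3) \<beta>(1) s by (intro mult_right_mono) (auto simp: pos_divide_le_eq)
        finally show "\<bar>cube_avg (v i) y \<rho> - cube_avg (v i) x \<rho>\<bar> ^ Suc (?n - 1) \<le> (\<epsilon> * s) ^ Suc (?n - 1)"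
          by (simp add: power_mult_distrib)
      qed (use \<epsilon> s in auto)
      have "f y $ i - c $ i - (A *v y) $ i = (f y $ i - F k y $ i) + (v i y - cube_avg (v i) y \<rho>) + (cube_avg (v i) y \<rho> - cube_avg (v i) x \<rho>)"
        by (simp add: c_def v_def matrix_vector_mul_component)
      then show ?thesis using dev avg Fz[OF yin] by (simp add: abs_le_iff)
    qed
    have "norm (f y - c - A *v y) \<le> e * s" if y: "norm (y - x) \<le> s" for y
    proof -
      have "norm (f y - c - A *v y) \<le> (\<Sum>i\<in>UNIV. \<bar>(f y - c - A *v y) $ i\<bar>)" by (rule norm_le_l1_cart)
      also have "\<dots> \<le> (\<Sum>i\<in>(UNIV::'n set). 6 * (\<epsilon> * s))" using comp[OF y] by (intro sum_mono) simp
      also have "\<dots> = e * s" using n1 by (simp add: \<epsilon>_def)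
      finally show ?thesis .
    qed
    then show ?thesis by blast
  qed
  then show ?thesis using s0 unfolding A_def by blast
qed

end

section \<open>The energy is controlled by the multiplicity\<close>

text \<open>
  The library states the effect of linear maps on volume only for well-ordered index types; the order
  is needed there only to evaluate the determinant of a shear.
\<close>

lemma measure_shear_cbox:
  fixes a b :: "real^'n"
  assumes "m \<noteq> n"
  defines "h \<equiv> \<lambda>x::real^'n. \<chi> i. if i = m then x $ m + x $ n else x $ i"
  shows "measure lebesgue (h ` cbox a b) = measure lebesgue (cbox a b)"
proof (cases "cbox a b = {}")
  case False
  have lin: "linear h" unfolding h_def by (rule linearI) (auto simp: algebra_simps vec_eq_iff)
  \<comment> \<open>The formula for sheared boxes asks for a nonnegative \<open>n\<close>-th
    coordinate of the lower corner. Translating makes it zero and only translates the image.\<close>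
  define v where "v = (- a $ n) *\<^sub>R axis n (1::real)"
  have n0: "(v + a) $ n = 0" by (simp add: v_def)
  have ne: "cbox (v + a) (v + b) \<noteq> {}" using False by (simp add: cbox_translation)
  have "h ` cbox (v + a) (v + b) = (+) (h v) ` h ` cbox a b"
    by (simp add: cbox_translation image_image linear_add[OF lin])
  then have "measure lebesgue (h ` cbox a b) = measure lebesgue (h ` cbox (v + a) (v + b))"
    by (simp add: measure_translation)
  also have "\<dots> = measure lebesgue (cbox (v + a) (v + b))"
    unfolding h_def by (rule measure_shear_interval[OF assms(1) ne]) (simp only: n0 order_refl)
  also have "\<dots> = measure lebesgue (cbox a b)" by (simp only: cbox_translation measure_translation)
  finally show ?thesis .
qed simp

lemma det_shear:
  assumes "m \<noteq> n"
  shows "det (matrix (\<lambda>x::real^'n. \<chi> i. if i = m then x $ m + x $ n else x $ i)) = 1"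
proof -
  have "matrix (\<lambda>x::real^'n. \<chi> i. if i = m then x $ m + x $ n else x $ i)
      = (\<chi> k. if k = m then row m (mat 1) + 1 *s row n (mat 1) else row k (mat 1))"
    by (auto simp: matrix_def vec_eq_iff row_def mat_def axis_def)
  then show ?thesis using det_row_operation[OF assms, of "mat 1 :: real^'n^'n" 1] by simp
qed

text \<open>The swap is an involution that takes boxes to boxes and permutes their side
  lengths.\<close>

lemma measure_swap_cbox:
  fixes a b :: "real^'n" and m n :: 'n
  defines "h \<equiv> \<lambda>x::real^'n. \<chi> i. x $ Transposition.transpose m n i"
  shows "measure lebesgue (h ` cbox a b) = measure lebesgue (cbox a b)"
proof (cases "cbox a b = {}")
  case False
  have hh: "h (h x) = x" for x by (simp add: h_def vec_eq_iff)
  have box: "h x \<in> cbox (h a) (h b) \<longleftrightarrow> x \<in> cbox a b" for x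
    unfolding mem_box_cart h_def by (simp, metis transpose_involutory)
  then have eq: "h ` cbox a b = cbox (h a) (h b)"
  proof (intro subset_antisym subsetI)
    fix y assume "y \<in> cbox (h a) (h b)"
    then have "h y \<in> cbox a b" using box[of "h y"] hh by simp
    then show "y \<in> h ` cbox a b" using hh[of y] by (intro image_eqI[of _ _ "h y"]) auto
  qed (use box in auto)
  then have ne: "cbox (h a) (h b) \<noteq> {}" using False by auto
  have "(\<Prod>i\<in>UNIV. (b - a) $ Transposition.transpose m n i) = (\<Prod>i\<in>UNIV. (b - a) $ i)"
    by (rule prod.reindex_bij_betw[OF permutes_imp_bij[OF permutes_swap_id]]) auto
  then have "(\<Prod>i\<in>UNIV. h b $ i - h a $ i) = (\<Prod>i\<in>UNIV. b $ i - a $ i)" by (simp add: h_def)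
  then have "measure lborel (cbox (h a) (h b)) = measure lborel (cbox a b)"
    by (simp only: content_cbox_cart[OF ne] content_cbox_cart[OF False])
  then show ?thesis by (simp add: eq)
qed simp

lemma det_swap:
  assumes "m \<noteq> n"
  shows "\<bar>det (matrix (\<lambda>x::real^'n. \<chi> i. x $ Transposition.transpose m n i))\<bar> = 1"
proof -
  have "matrix (\<lambda>x::real^'n. \<chi> i. x $ Transposition.transpose m n i) = (\<chi> i. mat 1 $ Transposition.transpose m n i)"
    by (auto simp: matrix_def vec_eq_iff mat_def axis_def)
  then show ?thesis
    using assms by (simp add: det_permute_rows permutes_swap_id sign_swap_id)
qed

text \<open>Both the volume factor and the determinant are multiplicative under composition, so
  elementary maps suffice; a map with a vanishing coordinate is singular and its image
  negligible.\<close>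

lemma measure_linear_image_finite:
  fixes f :: "real^'n \<Rightarrow> real^'n"
  assumes "linear f" "S \<in> lmeasurable"
  shows "f ` S \<in> lmeasurable \<and> measure lebesgue (f ` S) = \<bar>det (matrix f)\<bar> * measure lebesgue S"
  using assms(2)
proof (induction f arbitrary: S rule: induct_linear_elementary)
  case (2 f g)
  then have gS: "g ` S \<in> lmeasurable" by blast
  have "(f \<circ> g) ` S = f ` g ` S" by (simp add: image_comp)
  then show ?case
    using 2(3)[OF gS] 2(4)[OF 2(5)] matrix_compose[OF 2(2) 2(1)] by (simp add: o_def det_mul abs_mult)
next
  case (3 f i)
  then have ni: "\<not> inj f"
    by (metis linear_injective_imp_surjective one_neq_zero surjE vec_component)
  then have "negligible (f ` S)" using 3(1) negligible_linear_singular_image by blast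
  moreover have "det (matrix f) = 0" using ni det_nz_iff_inj[OF 3(1)] by blast
  ultimately show ?case by (simp add: negligible_iff_measure)
next
  case (4 c)
  then show ?case
    using measurable_stretch[OF 4, of c] measure_stretch[OF 4, of c] by (simp add: axis_def matrix_def det_diagonal)
next
  case (5 m n)
  let ?h = "\<lambda>x::real^'n. \<chi> i. x $ Transposition.transpose m n i"
  have "linear ?h" by (rule linearI) (simp_all add: vec_eq_iff)
  from measure_linear_sufficient[OF this 5(2), of 1] show ?case
    using measure_swap_cbox[where m=m and n=n] det_swap[OF 5(1)] by simp
next
  case (6 m n)
  let ?h = "\<lambda>x::real^'n. \<chi> i. if i = m then x $ m + x $ n else x $ i"
  have "linear ?h" by (rule linearI) (auto simp: algebra_simps vec_eq_iff)
  from measure_linear_sufficient[OF this 6(2), of 1] show ?case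
    using measure_shear_cbox[OF 6(1)] det_shear[OF 6(1)] by simp
qed (fact assms(1))

text \<open>A fixed point of y -> w - B (\<phi> y - c - A y) solves \<phi> y = c + A w because A B =
  1. Brouwer's theorem provides one: the correction has norm at most b \<delta>, and
  \<open>w\<close> keeps that distance from the boundary of the ball.\<close>

lemma image_contains_affine_image:
  fixes \<phi> :: "real^'n \<Rightarrow> real^'n" and A B :: "real^'n^'n"
  assumes c\<phi>: "continuous_on (cball x s) \<phi>" and s: "0 < s" and AB: "A ** B = mat 1"
    and near: "\<And>y. norm (y - x) \<le> s \<Longrightarrow> norm (\<phi> y - c - A *v y) \<le> \<delta>"
    and b: "\<And>v. norm (B *v v) \<le> b * norm v" and b0: "0 \<le> b" and w: "norm (w - x) \<le> s - b * \<delta>"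
  shows "c + A *v w \<in> \<phi> ` cball x s"
proof -
  define T where "T y = w - B *v (\<phi> y - c - A *v y)" for y
  have "continuous_on (cball x s) T"
    unfolding T_def
    by (intro continuous_on_diff continuous_on_const c\<phi>
        bounded_linear.continuous_on[OF matrix_vector_mul_bounded_linear] continuous_on_id)
  moreover have "T ` cball x s \<subseteq> cball x s"
  proof (rule image_subsetI)
    fix y assume "y \<in> cball x s"
    then have "norm (\<phi> y - c - A *v y) \<le> \<delta>" by (intro near) (simp add: dist_norm norm_minus_commute)
    then have "norm (B *v (\<phi> y - c - A *v y)) \<le> b * \<delta>"
      using b[of "\<phi> y - c - A *v y"] b0 by (meson mult_left_mono order_trans)
    moreover have "T y - x = (w - x) - B *v (\<phi> y - c - A *v y)" by (simp add: T_def)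
    ultimately have "norm (T y - x) \<le> s"
      using w norm_triangle_ineq4[of "w - x" "B *v (\<phi> y - c - A *v y)"] by (simp only:)
    then show "T y \<in> cball x s" by (simp add: dist_norm norm_minus_commute)
  qed
  ultimately obtain y where y: "y \<in> cball x s" "T y = y" using brouwer_ball[OF s] by blast
  have "A *v y = A *v (w - B *v (\<phi> y - c - A *v y))" using y(2) by (simp add: T_def)
  also have "\<dots> = A *v w - (\<phi> y - c - A *v y)"
    by (simp only: matrix_vector_mult_diff_distrib[of A w] matrix_vector_mul_assoc AB matrix_vector_mul_lid)
  finally have "\<phi> y = c + A *v w" by (simp add: algebra_simps)
  then show ?thesis using y(1) by force
qed

context qr_map
begin

text \<open>When the determinant is positive, near-affinity with error \<theta> s puts the affine
  image of the ball of radius (1 - b \<theta>) s inside the image of the ball of radius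
  \<open>s\<close>. Otherwise the left side is not positive.\<close>

lemma image_volume_ge:
  assumes x: "norm x < 1" and Lp: "Lpoint x" and e: "e > 0"
  shows "\<exists>s0>0. \<forall>s. 0 < s \<and> s < s0 \<longrightarrow>
    (det (g x) - e) * (unit_ball_vol CARD('n) * s ^ CARD('n)) \<le> measure lebesgue (f ` cball x s)"
proof (cases "det (g x) \<le> 0")
  case True
  have "(det (g x) - e) * (unit_ball_vol CARD('n) * s ^ CARD('n)) \<le> measure lebesgue (f ` cball x s)" if "s > 0" for s
  proof -
    have "(det (g x) - e) * (unit_ball_vol CARD('n) * s ^ CARD('n)) \<le> 0"
      using True e that by (intro mult_nonpos_nonneg) auto
    then show ?thesis using measure_nonneg order_trans by blast
  qed
  then show ?thesis by (intro exI[of _ 1]) auto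
next
  case False
  let ?n = "CARD('n)"
  define A where "A = g x"
  define V where "V = unit_ball_vol (real ?n)"
  have V: "V > 0" by (simp add: V_def)
  have dA: "det A > 0" using False by (simp add: A_def)
  then have "invertible A" by (simp add: invertible_det_nz)
  then obtain B where AB: "A ** B = mat 1" "B ** A = mat 1" by (auto simp: invertible_def)
  define b where "b = onorm (\<lambda>v. B *v v) + 1"
  have b0: "b > 0" unfolding b_def using onorm_pos_le[OF matrix_vector_mul_bounded_linear[of B]] by linarith
  have b: "norm (B *v v) \<le> b * norm v" for v
  proof -
    have "norm (B *v v) \<le> onorm (\<lambda>v. B *v v) * norm v" by (rule onorm[OF matrix_vector_mul_bounded_linear])
    also have "\<dots> \<le> b * norm v" by (intro mult_right_mono) (auto simp: b_def)
    finally show ?thesis .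
  qed
  \<comment> \<open>Small enough that shrinking the radius by 1 - b \<theta> costs at most
    \<open>e\<close> in the volume factor.\<close>
  obtain \<theta> where \<theta>: "\<theta> > 0" "b * \<theta> < 1" "det A - e \<le> det A * (1 - b * \<theta>) ^ ?n"
  proof -
    have "((\<lambda>\<theta>. det A * (1 - b * \<theta>) ^ ?n) \<longlongrightarrow> det A * (1 - b * 0) ^ ?n) (at_right 0)"
      by (intro tendsto_intros)
    then have 1: "\<forall>\<^sub>F \<theta> in at_right 0. det A - e < det A * (1 - b * \<theta>) ^ ?n"
      using e by (intro order_tendstoD(1)) auto
    have "((\<lambda>\<theta>. b * \<theta>) \<longlongrightarrow> b * 0) (at_right 0)" by (intro tendsto_intros)
    then have 2: "\<forall>\<^sub>F \<theta> in at_right 0. b * \<theta> < 1" by (rule order_tendstoD(2)) simp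
    have 3: "\<forall>\<^sub>F \<theta>::real in at_right 0. \<theta> > 0" by (rule eventually_at_right_less)
    have "\<exists>\<theta>. det A - e < det A * (1 - b * \<theta>) ^ ?n \<and> b * \<theta> < 1 \<and> \<theta> > 0"
      using eventually_happens'[OF _ eventually_conj[OF 1 eventually_conj[OF 2 3]]] by simp
    then show thesis using that less_imp_le by blast
  qed
  obtain s1 where s1: "s1 > 0" "\<And>s. 0 < s \<Longrightarrow> s < s1 \<Longrightarrow> \<exists>c. \<forall>y. norm (y - x) \<le> s \<longrightarrow> norm (f y - c - A *v y) \<le> \<theta> * s"
    using nearly_affine[OF x Lp \<theta>(1)] unfolding A_def by blast
  define s0 where "s0 = min s1 (1 - norm x)"
  have s0: "s0 > 0" using s1 x by (simp add: s0_def)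
  have "(det A - e) * (V * s ^ ?n) \<le> measure lebesgue (f ` cball x s)" if s: "0 < s" "s < s0" for s
  proof -
    obtain c where c: "\<And>y. norm (y - x) \<le> s \<Longrightarrow> norm (f y - c - A *v y) \<le> \<theta> * s"
      using s1(2)[of s] s by (auto simp: s0_def)
    have sub: "cball x s \<subseteq> ball 0 1" using cball_sub[of x s "norm x + s"] s by (force simp: s0_def)
    have cf: "continuous_on (cball x s) f" by (rule continuous_on_subset[OF cont_f sub])
    define t where "t = s - b * (\<theta> * s)"
    have t: "t = (1 - b * \<theta>) * s" by (simp add: t_def algebra_simps)
    have t0: "t \<ge> 0" using \<theta> s by (simp add: t)
    have incl: "(\<lambda>y. c + y) ` ((\<lambda>w. A *v w) ` cball x t) \<subseteq> f ` cball x s"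
    proof (clarsimp simp: image_image)
      fix w assume "dist x w \<le> t"
      then show "c + A *v w \<in> f ` cball x s"
        by (intro image_contains_affine_image[OF cf s(1) AB(1) c b less_imp_le[OF b0]])
           (auto simp: t_def dist_norm norm_minus_commute)
    qed
    have lin: "linear (\<lambda>w. A *v w)" by (rule matrix_vector_mul_linear)
    have m1: "(\<lambda>w. A *v w) ` cball x t \<in> lmeasurable" using measure_linear_image_finite[OF lin, of "cball x t"] by simp
    have "measure lebesgue ((\<lambda>y. c + y) ` ((\<lambda>w. A *v w) ` cball x t)) = \<bar>det A\<bar> * measure lebesgue (cball x t)"
      using measure_linear_image_finite[OF lin, of "cball x t"] by (simp add: measure_translation)
    also have "\<dots> = det A * (V * t ^ ?n)" using dA t0 by (simp add: content_cball V_def)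
    finally have "det A * (V * t ^ ?n) = measure lebesgue ((\<lambda>y. c + y) ` ((\<lambda>w. A *v w) ` cball x t))" by simp
    also have "\<dots> \<le> measure lebesgue (f ` cball x s)"
      using incl m1 by (intro measure_mono_fmeasurable)
        (auto intro!: lmeasurable_compact compact_continuous_image cf fmeasurableD measurable_translation)
    finally have 1: "det A * (V * t ^ ?n) \<le> measure lebesgue (f ` cball x s)" .
    have "(det A - e) * (V * s ^ ?n) \<le> det A * (1 - b * \<theta>) ^ ?n * (V * s ^ ?n)"
      using \<theta>(3) V s by (intro mult_right_mono) auto
    also have "\<dots> = det A * (V * t ^ ?n)" by (simp add: t power_mult_distrib)
    finally show ?thesis using 1 by simp
  qed
  then show ?thesis using s0 unfolding A_def V_def by blast
qed

text \<open>Disjoint Vitali balls B on which the Jacobian integrates to at most |f(B)| +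
  \<epsilon>|B| fill the ball up to a null set. At most \<open>Nm\<close> of their images contain a
  given point and all images lie in the ball of radius \<open>M\<close>, which bounds the sum of
  |f(B)|.\<close>

theorem energy_le_multiplicity:
  assumes r: "0 < r" "r < 1" and M: "0 \<le> M" "\<And>x. norm x < 1 \<Longrightarrow> norm (f x) \<le> M"
    and mult: "\<And>y. finite {x \<in> ball 0 r. f x = y} \<and> real (card {x \<in> ball 0 r. f x = y}) \<le> Nm"
  shows "(LINT x:ball 0 r|lborel. norm (g x) ^ CARD('n)) \<le> K * (Nm * (unit_ball_vol CARD('n) * M ^ CARD('n)))"
proof -
  let ?n = "CARD('n)"
  define V where "V = unit_ball_vol (real ?n)"
  have V: "V > 0" by (simp add: V_def)
  have Nm: "Nm \<ge> 0" using mult[of undefined] of_nat_0_le_iff order_trans by blast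
  \<comment> \<open>The positive part is a density everywhere, whereas det g >= 0 is known only
    almost everywhere.\<close>
  define J where "J x = max 0 (indicator (ball 0 1) x * det (g x))" for x
  have det_m[measurable]: "(\<lambda>x. det (g x)) \<in> borel_measurable borel"
    unfolding det_def
    by (intro borel_measurable_sum borel_measurable_times borel_measurable_const borel_measurable_prod
        borel_measurable_vec_nth g_borel)
  have J_m: "J \<in> borel_measurable borel"
    unfolding J_def by (intro borel_measurable_max borel_measurable_times borel_measurable_indicator det_m) auto
  have J0: "J x \<ge> 0" for x by (simp add: J_def)
  \<comment> \<open>A margin beyond \<open>r\<close>: \<open>J2\<close> equals \<open>J\<close>
    throughout a neighbourhood of the closed ball of radius \<open>r\<close> and is globally
    integrable.\<close>
  define r2 where "r2 = (r + 1) / 2"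
  have r2: "r < r2" "r2 < 1" using r by (auto simp: r2_def)
  define J2 where "J2 x = indicator (cball 0 r2) x * J x" for x
  have J2_m: "J2 \<in> borel_measurable borel"
    unfolding J2_def by (intro borel_measurable_times borel_measurable_indicator J_m) auto
  obtain M1 where M1: "M1 \<ge> 0" "\<And>A B :: real^'n^'n. \<bar>det A - det B\<bar> \<le> 1 * norm B ^ ?n + M1 * norm (A - B) ^ ?n"
    by (rule det_diff_Young[of 1]) auto
  have det0: "det (0 :: real^'n^'n) = 0"
    by (rule det_zero_row(1)[of undefined]) (simp add: row_def vec_eq_iff)
  have det_le: "\<bar>det (g x)\<bar> \<le> M1 * norm (g x) ^ ?n" for x
    using M1(2)[of "g x" 0] by (simp add: det0 power_0_left)
  have J2_i: "integrable lborel J2"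
  proof (rule Bochner_Integration.integrable_bound)
    show "integrable lborel (\<lambda>x. indicator (cball 0 r2) x *\<^sub>R (M1 * norm (g x) ^ ?n))"
      using set_integrable_mult_right[OF g_Ln[OF r2(2)], of M1] by (simp add: set_integrable_def)
    show "AE x in lborel. norm (J2 x) \<le> norm (indicator (cball 0 r2) x *\<^sub>R (M1 * norm (g x) ^ ?n))"
    proof (rule AE_I2)
      fix x
      show "norm (J2 x) \<le> norm (indicator (cball 0 r2) x *\<^sub>R (M1 * norm (g x) ^ ?n))"
        using det_le[of x] M1(1) by (auto simp: J2_def J_def indicator_def)
    qed
  qed (use J2_m in simp)
  have J2_pw: "norm (J2 y) ^ 1 = J2 y" for y by (simp add: J2_def J0)
  have LJ: "AE x in lborel. ((\<lambda>s. (LINT y:cball x s|lborel. norm (J2 y - J2 x) ^ 1) / s ^ DIM(real^'n)) \<longlongrightarrow> 0) (at_right 0)"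
    by (rule AE_Lebesgue_point) (use J2_m J2_i in auto)
  define good where "good x \<longleftrightarrow> Lpoint x \<and> ((\<lambda>s. (LINT y:cball x s|lborel. norm (J2 y - J2 x) ^ 1) / s ^ ?n) \<longlongrightarrow> 0) (at_right 0)" for x
  have good: "AE x in lborel. x \<in> ball 0 1 \<longrightarrow> good x"
    using LJ AE_Lpoint by eventually_elim (auto simp: good_def)
  define N1 where "N1 = density lborel J2"
  have N1s: "sets N1 = sets borel" by (simp add: N1_def)
  have N1e: "emeasure N1 S = ennreal (LINT y:S|lborel. J2 y)" if "S \<in> sets borel" for S
  proof -
    have "set_integrable lborel S J2"
      using integrable_mult_indicator[OF _ J2_i, of S] that by (simp add: set_integrable_def)
    then show ?thesis
      unfolding N1_def by (intro emeasure_density_set_integral[OF J2_m that]) (simp_all add: J2_def J0)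
  qed
  have step: "emeasure N1 (ball 0 r) \<le> ennreal (Nm * (V * M ^ ?n) + \<epsilon> * (V * r ^ ?n))" if \<epsilon>: "\<epsilon> > 0" for \<epsilon>
  proof -
    define Q where "Q = {(x, s). x \<in> ball 0 r \<and> 0 < s \<and> cball x s \<subseteq> ball 0 r \<and>
        (LINT y:cball x s|lborel. J2 y) \<le> measure lebesgue (f ` cball x s) + \<epsilon> * (V * s ^ ?n)}"
    define Sg where "Sg = {x \<in> ball 0 r. good x}"
    \<comment> \<open>One half of \<epsilon> pays for replacing \<open>J2\<close> by its value at a
      Lebesgue point, the other half for the lower volume bound of the image.\<close>
    have cover: "\<exists>i. i \<in> Q \<and> x \<in> cball (fst i) (snd i) \<and> snd i < d" if x: "x \<in> Sg" and d: "d > 0" for x d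
    proof -
      have xr: "norm x < r" and gx: "good x" using x by (auto simp: Sg_def)
      have Jx: "J2 x = max 0 (det (g x))" using xr r r2 by (simp add: J2_def J_def)
      obtain s1 where s1: "s1 > 0" "\<And>s. 0 < s \<Longrightarrow> s < s1 \<Longrightarrow> (det (g x) - \<epsilon> / 2) * (V * s ^ ?n) \<le> measure lebesgue (f ` cball x s)"
        using image_volume_ge[of x "\<epsilon> / 2"] xr r gx \<epsilon> unfolding V_def good_def by auto
      have "\<forall>\<^sub>F s in at_right 0. (LINT y:cball x s|lborel. norm (J2 y - J2 x) ^ 1) / s ^ ?n < \<epsilon> / 2 * V"
        using gx \<epsilon> V unfolding good_def by (intro order_tendstoD(2)) auto
      then obtain s2 where s2: "s2 > 0" "\<And>s. 0 < s \<Longrightarrow> s < s2 \<Longrightarrow> (LINT y:cball x s|lborel. norm (J2 y - J2 x) ^ 1) / s ^ ?n < \<epsilon> / 2 * V"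
        by (auto simp: eventually_at_right[OF zero_less_one])
      define u where "u = min (min s1 s2) (min d (r - norm x))"
      have u: "0 < u" "u \<le> s1" "u \<le> s2" "u \<le> d" "u \<le> r - norm x" using s1(1) s2(1) d xr by (auto simp: u_def)
      define s where "s = u / 2"
      have s: "0 < s" "s < s1" "s < s2" "s < d" "norm x + s < r" using u unfolding s_def by linarith+
      have sub: "cball x s \<subseteq> ball 0 r" using cball_sub[of x s "norm x + s"] s by force
      have ci: "set_integrable lborel (cball x s) (\<lambda>y. J2 x)"
        by (rule set_integrable_continuous_compact) auto
      have ji: "set_integrable lborel (cball x s) J2"
        using integrable_mult_indicator[OF _ J2_i, of "cball x s"] by (simp add: set_integrable_def)
      have "(LINT y:cball x s|lborel. J2 y) \<le> (LINT y:cball x s|lborel. norm (J2 y - J2 x) ^ 1 + J2 x)"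
        by (rule set_integral_mono[OF ji set_integral_add(1)[OF _ ci]])
           (auto intro!: set_integrable_abs set_integral_diff(1)[OF ji ci])
      also have "\<dots> = (LINT y:cball x s|lborel. norm (J2 y - J2 x) ^ 1) + (LINT y:cball x s|lborel. J2 x)"
        by (rule set_integral_add(2)[OF _ ci]) (auto intro!: set_integrable_abs set_integral_diff(1)[OF ji ci])
      also have "(LINT y:cball x s|lborel. J2 x) = J2 x * (V * s ^ ?n)"
        using s by (subst set_integral_const) (auto simp: emeasure_cball content_cball V_def)
      also have "(LINT y:cball x s|lborel. norm (J2 y - J2 x) ^ 1) \<le> \<epsilon> / 2 * (V * s ^ ?n)"
        using s2(2)[OF s(1,3)] s(1) by (simp add: pos_divide_less_eq)
      also have "J2 x * (V * s ^ ?n) \<le> measure lebesgue (f ` cball x s) + \<epsilon> / 2 * (V * s ^ ?n)"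
      proof (cases "det (g x) \<ge> 0")
        case True
        then show ?thesis using s1(2)[OF s(1,2)] Jx by (simp add: algebra_simps)
      next
        case False
        then show ?thesis using Jx \<epsilon> V s by (auto intro!: add_nonneg_nonneg mult_nonneg_nonneg)
      qed
      finally have "(LINT y:cball x s|lborel. J2 y) \<le> measure lebesgue (f ` cball x s) + \<epsilon> * (V * s ^ ?n)"
        by (simp add: algebra_simps)
      then have "(x, s) \<in> Q" using xr s sub by (simp add: Q_def)
      then show ?thesis using s by (intro exI[of _ "(x, s)"]) auto
    qed
    have "\<And>i. i \<in> Q \<Longrightarrow> 0 < snd i" by (auto simp: Q_def)
    from Vitali_covering_theorem_cballs[of Q snd Sg fst, OF this cover]
    obtain C where C: "countable C" "C \<subseteq> Q"
      "pairwise (\<lambda>i j. disjnt (cball (fst i) (snd i)) (cball (fst j) (snd j))) C"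
      "negligible (Sg - (\<Union>i\<in>C. cball (fst i) (snd i)))"
      by blast
    let ?B = "\<lambda>i. cball (fst i) (snd i)"
    let ?W = "\<Union>i\<in>C. ?B i"
    have W: "?W \<in> sets borel" using C(1) by (intro sets.countable_UN') auto
    have CB: "?B i \<subseteq> ball 0 r" "snd i > 0" "(LINT y:?B i|lborel. J2 y) \<le> measure lebesgue (f ` ?B i) + \<epsilon> * (V * snd i ^ ?n)" if "i \<in> C" for i
    proof -
      have "(fst i, snd i) \<in> Q" using that C(2) by auto
      then show "?B i \<subseteq> ball 0 r" "snd i > 0" "(LINT y:?B i|lborel. J2 y) \<le> measure lebesgue (f ` ?B i) + \<epsilon> * (V * snd i ^ ?n)"
        unfolding Q_def mem_Collect_eq case_prod_conv by blast+
    qed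
    have Wr: "?W \<subseteq> ball 0 r" using CB(1) by blast
    have fc: "compact (f ` ?B i)" if "i \<in> C" for i
      using CB(1)[OF that] r by (intro compact_continuous_image continuous_on_subset[OF cont_f]) (auto simp: subset_iff intro: less_trans)
    have "AE x in lborel. x \<in> ball 0 r \<longrightarrow> x \<in> ?W"
    proof -
      have "AE x in lebesgue. x \<notin> Sg - ?W" using C(4) unfolding negligible_iff_null_sets by (rule AE_not_in)
      then have "AE x in lborel. x \<notin> Sg - ?W" by (simp only: AE_completion_iff)
      then show ?thesis using good
        by eventually_elim (use r in \<open>auto simp: Sg_def\<close>)
    qed
    then have "AE x in N1. x \<in> ball 0 r \<longrightarrow> x \<in> ?W"
      unfolding N1_def using J2_m by (subst AE_density) (auto elim: eventually_mono)
    then have "emeasure N1 (ball 0 r) \<le> emeasure N1 ?W"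
      using W N1s by (intro emeasure_mono_AE) auto
    also have "\<dots> = (\<integral>\<^sup>+i. emeasure N1 (?B i) \<partial>count_space C)"
      by (rule disjoint_cballs_measure[OF N1s C(1,3), symmetric])
    also have "\<dots> \<le> (\<integral>\<^sup>+i. emeasure lborel (f ` ?B i) + ennreal \<epsilon> * emeasure lborel (?B i) \<partial>count_space C)"
    proof (rule nn_integral_mono)
      fix i assume "i \<in> space (count_space C)"
      then have i: "i \<in> C" by simp
      have "emeasure N1 (?B i) \<le> ennreal (measure lebesgue (f ` ?B i) + \<epsilon> * (V * snd i ^ ?n))"
        using N1e[of "?B i"] CB(3)[OF i] by (simp add: ennreal_leI)
      also have "\<dots> = ennreal (measure lebesgue (f ` ?B i)) + ennreal \<epsilon> * ennreal (V * snd i ^ ?n)"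
        using \<epsilon> V CB(2)[OF i] by (simp add: ennreal_plus ennreal_mult)
      also have "ennreal (V * snd i ^ ?n) = emeasure lborel (?B i)"
        using CB(2)[OF i] by (simp add: emeasure_cball V_def)
      also have "ennreal (measure lebesgue (f ` ?B i)) = emeasure lborel (f ` ?B i)"
      proof -
        have "emeasure lborel (f ` ?B i) < \<infinity>" using fc[OF i] by (intro emeasure_bounded_finite compact_imp_bounded)
        then have "emeasure lborel (f ` ?B i) = ennreal (measure lborel (f ` ?B i))"
          by (intro emeasure_eq_ennreal_measure) auto
        moreover have "measure lebesgue (f ` ?B i) = measure lborel (f ` ?B i)"
          using fc[OF i] by (intro measure_completion) (auto intro: borel_compact)
        ultimately show ?thesis by simp
      qed
      finally show "emeasure N1 (?B i) \<le> emeasure lborel (f ` ?B i) + ennreal \<epsilon> * emeasure lborel (?B i)" .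
    qed
    also have "\<dots> = (\<integral>\<^sup>+i. emeasure lborel (f ` ?B i) \<partial>count_space C) + ennreal \<epsilon> * (\<integral>\<^sup>+i. emeasure lborel (?B i) \<partial>count_space C)"
      by (subst nn_integral_add) (auto simp: nn_integral_cmult)
    also have "(\<integral>\<^sup>+i. emeasure lborel (?B i) \<partial>count_space C) = emeasure lborel ?W"
      by (rule disjoint_cballs_measure[OF sets_lborel C(1,3)])
    also have "\<dots> \<le> emeasure lborel (ball (0::real^'n) r)" using Wr by (intro emeasure_mono) auto
    also have "\<dots> = ennreal (V * r ^ ?n)" using r by (simp add: emeasure_ball V_def)
    also have "(\<integral>\<^sup>+i. emeasure lborel (f ` ?B i) \<partial>count_space C) \<le> ennreal (Nm * (V * M ^ ?n))"
    proof -
      have "(\<integral>\<^sup>+i. emeasure lborel (f ` ?B i) \<partial>count_space C) = (\<integral>\<^sup>+i. \<integral>\<^sup>+y. indicator (f ` ?B i) y \<partial>lborel \<partial>count_space C)"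
        using fc by (intro nn_integral_cong) (simp add: nn_integral_indicator borel_compact)
      also have "\<dots> = (\<integral>\<^sup>+y. \<integral>\<^sup>+i. indicator (f ` ?B i) y \<partial>count_space C \<partial>lborel)"
        using fc by (intro nn_integral_count_space_nn_integral[symmetric] C(1)) (auto intro!: borel_measurable_indicator borel_compact)
      also have "\<dots> \<le> (\<integral>\<^sup>+y. ennreal Nm * indicator (cball (0::real^'n) M) y \<partial>lborel)"
      proof (rule nn_integral_mono)
        fix y
        \<comment> \<open>Choosing a preimage of \<open>y\<close> in each ball is injective since
          the balls are disjoint, so this index set is no larger than the fibre over
          \<open>y\<close>.\<close>
        define Cy where "Cy = {i \<in> C. y \<in> f ` ?B i}"
        have "(\<integral>\<^sup>+i. indicator (f ` ?B i) y \<partial>count_space C) = (\<integral>\<^sup>+i. indicator Cy i \<partial>count_space C)"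
          by (rule nn_integral_cong) (auto simp: Cy_def indicator_def)
        also have "\<dots> = emeasure (count_space C) Cy"
          by (rule nn_integral_indicator) (auto simp: Cy_def)
        also have "\<dots> \<le> ennreal Nm * indicator (cball 0 M) y"
        proof (cases "Cy = {}")
          case False
          have "\<forall>i\<in>Cy. \<exists>x. x \<in> ?B i \<and> f x = y" by (auto simp: Cy_def)
          then obtain X where X: "\<And>i. i \<in> Cy \<Longrightarrow> X i \<in> ?B i \<and> f (X i) = y" by metis
          have inj: "inj_on X Cy"
          proof (rule inj_onI)
            fix i j assume ij: "i \<in> Cy" "j \<in> Cy" "X i = X j"
            then have "\<not> disjnt (?B i) (?B j)" using X[of i] X[of j] by (auto simp: disjnt_iff)
            then show "i = j" using C(3) ij by (auto simp: pairwise_def Cy_def)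
          qed
          have im: "X ` Cy \<subseteq> {x \<in> ball 0 r. f x = y}" using X CB(1) by (fastforce simp: Cy_def)
          have fin: "finite Cy" using finite_imageD[OF finite_subset[OF im] inj] mult[of y] by blast
          have "card Cy = card (X ` Cy)" using inj by (simp add: card_image)
          also have "\<dots> \<le> card {x \<in> ball 0 r. f x = y}" using im mult[of y] by (intro card_mono) auto
          finally have "real (card Cy) \<le> Nm" using mult[of y] by linarith
          moreover have "y \<in> cball 0 M"
          proof -
            obtain i where i: "i \<in> Cy" using False by blast
            then have "X i \<in> ball 0 r" using im by blast
            then have "norm (X i) < 1" using r by simp
            then show ?thesis using M(2)[of "X i"] X[OF i] by simp
          qed
          moreover have "emeasure (count_space C) Cy = ennreal (real (card Cy))"
            using fin by (subst emeasure_count_space_finite) (auto simp: Cy_def ennreal_of_nat_eq_real_of_nat)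
          ultimately show ?thesis by (simp add: ennreal_leI)
        qed simp
        finally show "(\<integral>\<^sup>+i. indicator (f ` ?B i) y \<partial>count_space C) \<le> ennreal Nm * indicator (cball 0 M) y" .
      qed
      also have "\<dots> = ennreal Nm * emeasure lborel (cball (0::real^'n) M)"
        by (subst nn_integral_cmult_indicator) auto
      also have "\<dots> = ennreal (Nm * (V * M ^ ?n))"
        using Nm M V by (simp add: emeasure_cball V_def ennreal_mult)
      finally show ?thesis .
    qed
    finally show ?thesis
      using \<epsilon> V r Nm M by (simp add: ennreal_plus ennreal_mult mult_left_mono add_mono)
  qed
  have Ji: "set_integrable lborel (ball 0 r) J2"
    using integrable_mult_indicator[OF _ J2_i, of "ball 0 r"] by (simp add: set_integrable_def)
  have Jle: "(LINT y:ball 0 r|lborel. J2 y) \<le> Nm * (V * M ^ ?n)"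
  proof (rule field_le_epsilon)
    fix e :: real assume e: "e > 0"
    define \<epsilon> where "\<epsilon> = e / (V * r ^ ?n)"
    have pos: "V * r ^ ?n > 0" using V r by simp
    have \<epsilon>: "\<epsilon> > 0" using e pos by (simp add: \<epsilon>_def)
    have "ennreal (LINT y:ball 0 r|lborel. J2 y) \<le> ennreal (Nm * (V * M ^ ?n) + \<epsilon> * (V * r ^ ?n))"
      using step[OF \<epsilon>] N1e[of "ball 0 r"] by simp
    moreover have "0 \<le> Nm * (V * M ^ ?n) + \<epsilon> * (V * r ^ ?n)" using Nm M V pos \<epsilon> r by (intro add_nonneg_nonneg mult_nonneg_nonneg) auto
    ultimately have "(LINT y:ball 0 r|lborel. J2 y) \<le> Nm * (V * M ^ ?n) + \<epsilon> * (V * r ^ ?n)" by (simp add: ennreal_le_iff)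
    moreover have "\<epsilon> * (V * r ^ ?n) = e" using pos unfolding \<epsilon>_def by (metis less_irrefl nonzero_divide_eq_eq)
    ultimately show "(LINT y:ball 0 r|lborel. J2 y) \<le> Nm * (V * M ^ ?n) + e" by simp
  qed
  have "(LINT x:ball 0 r|lborel. norm (g x) ^ ?n) \<le> (LINT x:ball 0 r|lborel. K * J2 x)"
  proof (rule set_integral_mono_AE)
    show "set_integrable lborel (ball 0 r) (\<lambda>x. norm (g x) ^ ?n)"
      by (rule set_integrable_subset[OF g_Ln[OF r(2)]]) auto
    show "set_integrable lborel (ball 0 r) (\<lambda>x. K * J2 x)" by (intro set_integrable_mult_right Ji)
    show "AE x \<in> ball 0 r in lborel. norm (g x) ^ ?n \<le> K * J2 x"
      using distortion
    proof eventually_elim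
      case (elim x)
      show ?case
      proof
        assume x: "x \<in> ball 0 r"
        then have "norm (g x) ^ ?n \<le> K * det (g x)" using elim r by auto
        also have "\<dots> \<le> K * J2 x" using x r r2 K_pos by (intro mult_left_mono) (auto simp: J2_def J_def)
        finally show "norm (g x) ^ ?n \<le> K * J2 x" .
      qed
    qed
  qed
  also have "\<dots> = K * (LINT x:ball 0 r|lborel. J2 x)" by simp
  also have "\<dots> \<le> K * (Nm * (V * M ^ ?n))" using Jle K_pos by (intro mult_left_mono) auto
  finally show ?thesis by (simp add: V_def)
qed

end

section \<open>Hausdorff dimension of the exceptional set\<close>

text \<open>A disjoint subfamily of dense balls, enlarged five times, covers \<open>E\<close>. Its
  diameters to the power \<open>s\<close> sum to at most 10^s times the mass of the neighbourhood
  \<open>S\<close> of \<open>E\<close>, which is arbitrarily small.\<close>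

lemma hausdorff_measure_eq_0I:
  fixes E :: "'a::euclidean_space set"
  assumes sets: "sets N = sets borel" and s: "s > 0"
    and small: "\<And>\<epsilon>. \<epsilon> > 0 \<Longrightarrow> \<exists>d>0. \<exists>S\<in>sets borel. emeasure N S \<le> ennreal \<epsilon> \<and> (\<forall>x\<in>E. cball x d \<subseteq> S)"
    and dense: "\<And>x d. x \<in> E \<Longrightarrow> d > 0 \<Longrightarrow> \<exists>r. 0 < r \<and> r < d \<and> ennreal (r powr s) \<le> emeasure N (cball x r)"
  shows "hausdorff_measure s E = 0"
proof -
  have "hausdorff_premeasure \<delta> s E \<le> ennreal e" if \<delta>: "\<delta> > 0" and e: "e > 0" for \<delta> e :: real
  proof -
    have "e / 10 powr s > 0" using e by simp
    from small[OF this]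
    obtain d S where d: "d > 0" "S \<in> sets borel" "emeasure N S \<le> ennreal (e / 10 powr s)" "\<And>x. x \<in> E \<Longrightarrow> cball x d \<subseteq> S"
      by blast
    define d' where "d' = min d (\<delta> / 10)"
    have d': "d' > 0" "d' \<le> d" "10 * d' \<le> \<delta>" using d \<delta> by (auto simp: d'_def)
    have "\<exists>r. 0 < r \<and> r < d' \<and> ennreal (r powr s) \<le> emeasure N (cball x r)" if "x \<in> E" for x
      using dense[OF that d'(1)] .
    then obtain rad where rad: "\<And>x. x \<in> E \<Longrightarrow> 0 < rad x \<and> rad x < d' \<and> ennreal (rad x powr s) \<le> emeasure N (cball x (rad x))"
      by metis
    obtain C where C: "countable C" "C \<subseteq> E"
      "pairwise (\<lambda>i j. disjnt (cball i (rad i)) (cball j (rad j))) C"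
      "\<And>i. i \<in> E \<Longrightarrow> \<exists>j. j \<in> C \<and> \<not> disjnt (cball i (rad i)) (cball j (rad j)) \<and> cball i (rad i) \<subseteq> ball j (5 * rad j)"
      by (rule Vitali_covering_lemma_cballs_balls[of E rad d' "\<lambda>x. x"]) (use rad in \<open>auto simp: less_imp_le\<close>)
    \<comment> \<open>Covers are indexed by all natural numbers; indices outside \<open>I\<close>
      receive the empty set, for which \<open>diameter_powr\<close> is 0.\<close>
    define I where "I = to_nat_on C ` C"
    define U where "U k = (if k \<in> I then ball (from_nat_into C k) (5 * rad (from_nat_into C k)) else {})" for k
    have bij: "bij_betw (to_nat_on C) C I"
      unfolding I_def using inj_on_to_nat_on[OF C(1)] by (rule inj_on_imp_bij_betw)
    have Ui: "U (to_nat_on C x) = ball x (5 * rad x)" if "x \<in> C" for x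
      using that C(1) by (simp add: U_def I_def)
    have diam: "diameter (ball x (5 * rad x)) \<le> 10 * rad x" if "x \<in> E" for x
    proof (rule diameter_le)
      fix y z assume "y \<in> ball x (5 * rad x)" "z \<in> ball x (5 * rad x)"
      then show "norm (y - z) \<le> 10 * rad x"
        using dist_triangle3[of y z x] by (simp add: dist_norm)
    qed (use rad[OF that] in auto)
    have "E \<subseteq> (\<Union>k. U k)"
    proof
      fix x assume x: "x \<in> E"
      then obtain j where j: "j \<in> C" "cball x (rad x) \<subseteq> ball j (5 * rad j)" using C(4) by blast
      have "x \<in> cball x (rad x)" using rad[OF x] by simp
      then have "x \<in> U (to_nat_on C j)" using j(2) Ui[OF j(1)] by blast
      then show "x \<in> (\<Union>k. U k)" by blast
    qed
    moreover have "bounded (U k) \<and> diameter (U k) \<le> \<delta>" for k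
    proof (cases "k \<in> I")
      case True
      then obtain x where x: "x \<in> C" "k = to_nat_on C x" by (auto simp: I_def)
      then have "x \<in> E" using C by blast
      then show ?thesis using Ui[OF x(1)] diam[of x] rad[of x] d'(3) x(2) by auto
    qed (use \<delta> in \<open>simp add: U_def\<close>)
    ultimately have "hausdorff_premeasure \<delta> s E \<le> (\<Sum>k. ennreal (diameter_powr (U k) s))"
      unfolding hausdorff_premeasure_def by (intro INF_lower) auto
    also have "\<dots> = (\<integral>\<^sup>+k. ennreal (diameter_powr (U k) s) \<partial>count_space UNIV)"
      by (rule nn_integral_count_space_nat[symmetric])
    also have "\<dots> = (\<integral>\<^sup>+k. ennreal (diameter_powr (U k) s) * indicator I k \<partial>count_space UNIV)"
      by (rule nn_integral_cong) (auto simp: indicator_def U_def diameter_powr_def)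
    also have "\<dots> = (\<integral>\<^sup>+k. ennreal (diameter_powr (U k) s) \<partial>count_space I)"
      by (rule nn_integral_count_space_indicator[symmetric]) simp
    also have "\<dots> = (\<integral>\<^sup>+x. ennreal (diameter_powr (U (to_nat_on C x)) s) \<partial>count_space C)"
      by (rule nn_integral_bij_count_space[OF bij, symmetric])
    also have "\<dots> \<le> (\<integral>\<^sup>+x. ennreal (10 powr s) * emeasure N (cball x (rad x)) \<partial>count_space C)"
    proof (rule nn_integral_mono)
      fix x assume "x \<in> space (count_space C)"
      then have x: "x \<in> C" "x \<in> E" using C by auto
      have "diameter_powr (U (to_nat_on C x)) s \<le> (10 * rad x) powr s"
        unfolding Ui[OF x(1)] using s diam[OF x(2)] rad[OF x(2)]
        by (auto simp: diameter_powr_def intro!: powr_mono2 diameter_ge_0)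
      also have "\<dots> = 10 powr s * rad x powr s" using rad[OF x(2)] by (simp add: powr_mult)
      finally have "ennreal (diameter_powr (U (to_nat_on C x)) s) \<le> ennreal (10 powr s) * ennreal (rad x powr s)"
        by (simp add: ennreal_leI flip: ennreal_mult)
      also have "\<dots> \<le> ennreal (10 powr s) * emeasure N (cball x (rad x))"
        using rad[OF x(2)] by (intro mult_left_mono) auto
      finally show "ennreal (diameter_powr (U (to_nat_on C x)) s) \<le> ennreal (10 powr s) * emeasure N (cball x (rad x))" .
    qed
    also have "\<dots> = ennreal (10 powr s) * emeasure N (\<Union>x\<in>C. cball x (rad x))"
      by (subst nn_integral_cmult) (use disjoint_cballs_measure[OF sets C(1), of "\<lambda>x. x" rad] C(3) in auto)
    also have "\<dots> \<le> ennreal (10 powr s) * emeasure N S"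
    proof (intro mult_left_mono emeasure_mono UN_least)
      fix x assume "x \<in> C"
      then have x: "x \<in> E" using C by blast
      have "cball x (rad x) \<subseteq> cball x d" using rad[OF x] d'(2) by (intro subset_cball) linarith
      then show "cball x (rad x) \<subseteq> S" using d(4)[OF x] by blast
    qed (use d(2) sets in auto)
    also have "\<dots> \<le> ennreal (10 powr s) * ennreal (e / 10 powr s)" using d(3) by (intro mult_left_mono) auto
    also have "\<dots> = ennreal e" using e by (simp flip: ennreal_mult)
    finally show ?thesis .
  qed
  note le = this
  have "hausdorff_premeasure \<delta> s E \<le> 0" if "\<delta> > 0" for \<delta>
  proof (rule ennreal_le_epsilon)
    fix e :: real assume "0 < e"
    from le[OF that this] show "hausdorff_premeasure \<delta> s E \<le> 0 + ennreal e" by simp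
  qed
  then have "hausdorff_measure s E \<le> 0" unfolding hausdorff_measure_def by (intro SUP_least) simp
  then show ?thesis by simp
qed

text \<open>Where 1 - |x| is about 2^-k the weight is about 2^(-k b), while the energy of the ball
  reaching that shell is of order 2^(k a); the sum is geometric with ratio 2^(a - b).\<close>

lemma (in qr_map) weighted_energy_finite:
  assumes a: "0 \<le> a" "a < b" and D: "0 \<le> D"
    and E: "\<And>r. 0 < r \<Longrightarrow> r < 1 \<Longrightarrow> (LINT x:ball 0 r|lborel. norm (g x) ^ CARD('n)) \<le> D * (1 - r) powr (- a)"
  shows "(\<integral>\<^sup>+x. ennreal (indicator (ball 0 1) x * (norm (g x) ^ CARD('n) * (1 - norm x) powr b)) \<partial>lborel) < \<infinity>"
proof -
  let ?n = "CARD('n)"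
  define W where "W x = indicator (ball 0 1) x * (norm (g x) ^ ?n * (1 - norm x) powr b)" for x :: "real^'n"
  define R where "R k = 1 - (1/2::real) ^ Suc k" for k
  have R: "0 < R k" "R k < 1" for k
    using power_decreasing[of 1 "Suc k" "1/2::real"] by (auto simp: R_def)
  define Z where "Z k x = indicator (ball 0 (R k)) x *\<^sub>R norm (g x) ^ ?n" for k x
  have Zi: "integrable lborel (Z k)" for k
    using set_integrable_subset[OF g_Ln[OF R(2)[of k]], of "ball 0 (R k)"] by (simp add: Z_def[abs_def] set_integrable_def)
  have Z0: "0 \<le> Z k x" for k x by (simp add: Z_def)
  have Zm: "Z k \<in> borel_measurable borel" for k using Zi[of k] by auto
  define c where "c k = ((1/2::real) ^ k) powr b" for k
  have "ennreal (W x) \<le> (\<Sum>k. ennreal (c k * Z k x))" for x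
  proof (cases "norm x < 1")
    case False
    then show ?thesis by (simp add: W_def)
  next
    case True
    have "\<exists>k. (1/2::real) ^ Suc k < 1 - norm x"
    proof -
      obtain k where "(1/2::real) ^ k < 1 - norm x" using real_arch_pow_inv[of "1 - norm x" "1/2"] True by auto
      moreover have "(1/2::real) ^ Suc k \<le> (1/2) ^ k" by (rule power_decreasing) auto
      ultimately show ?thesis by (metis le_less_trans)
    qed
    \<comment> \<open>The defining inequality places \<open>x\<close> in the ball of radius
      \<open>R k\<close>; minimality gives 1 - |x| <= 2^-k and so bounds the weight.\<close>
    define k where "k = (LEAST k. (1/2::real) ^ Suc k < 1 - norm x)"
    have k: "(1/2::real) ^ Suc k < 1 - norm x"
      unfolding k_def by (rule LeastI_ex) fact
    have k2: "1 - norm x \<le> (1/2::real) ^ k"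
    proof (cases k)
      case (Suc j)
      then have "\<not> (1/2::real) ^ Suc j < 1 - norm x"
        using not_less_Least[of j "\<lambda>k. (1/2::real) ^ Suc k < 1 - norm x"] by (simp add: k_def)
      then show ?thesis using Suc by simp
    qed simp
    have "(1 - norm x) powr b \<le> c k" unfolding c_def using True a k2 by (intro powr_mono2) auto
    then have "norm (g x) ^ ?n * (1 - norm x) powr b \<le> norm (g x) ^ ?n * c k" by (intro mult_left_mono) auto
    then have "W x \<le> c k * Z k x" using True k by (simp add: W_def Z_def R_def mult.commute)
    then have "ennreal (W x) \<le> ennreal (c k * Z k x)" by (rule ennreal_leI)
    also have "\<dots> = (\<Sum>j\<in>{k}. ennreal (c j * Z j x))" by simp
    also have "\<dots> \<le> (\<Sum>j. ennreal (c j * Z j x))" by (rule sum_le_suminf) auto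
    finally show ?thesis .
  qed
  then have "(\<integral>\<^sup>+x. ennreal (W x) \<partial>lborel) \<le> (\<integral>\<^sup>+x. (\<Sum>k. ennreal (c k * Z k x)) \<partial>lborel)"
    by (intro nn_integral_mono)
  also have "\<dots> = (\<Sum>k. \<integral>\<^sup>+x. ennreal (c k * Z k x) \<partial>lborel)"
    by (rule nn_integral_suminf) (use Zm in \<open>auto intro!: measurable_compose[OF _ measurable_ennreal] borel_measurable_times\<close>)
  also have "\<dots> \<le> (\<Sum>k. ennreal (D * 2 powr a * (2 powr (a - b)) ^ k))"
  proof (intro suminf_le allI)
    fix k
    have c0: "c k \<ge> 0" by (simp add: c_def)
    have "(\<integral>\<^sup>+x. ennreal (c k * Z k x) \<partial>lborel) = ennreal (LINT x|lborel. c k * Z k x)"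
      using Zi[of k] Z0 c0 by (intro nn_integral_eq_integral) auto
    also have "(LINT x|lborel. c k * Z k x) = c k * (LINT x:ball 0 (R k)|lborel. norm (g x) ^ ?n)"
      by (simp add: Z_def[abs_def] set_lebesgue_integral_def)
    also have "\<dots> \<le> c k * (D * (1 - R k) powr (- a))"
      using E[OF R] c0 by (intro mult_left_mono)
    also have "\<dots> = D * 2 powr a * (2 powr (a - b)) ^ k"
    proof -
      have "c k = 2 powr (- b * k)"
        by (simp add: c_def power_divide powr_divide powr_powr[symmetric] powr_realpow[symmetric] powr_minus divide_simps)
           (simp add: powr_powr mult.commute powr_add[symmetric])
      moreover have "(1 - R k) powr (- a) = 2 powr (a * Suc k)"
      proof -
        have "1 - R k = 2 powr (- real (Suc k))" by (simp add: R_def powr_minus powr_realpow power_one_over inverse_eq_divide del: power_Suc of_nat_Suc)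
        then show ?thesis by (simp only: powr_powr minus_mult_minus mult.commute)
      qed
      moreover have "(2 powr (a - b)) ^ k = 2 powr ((a - b) * k)" by (simp add: powr_realpow[symmetric] powr_powr)
      moreover have "2 powr (- b * k) * 2 powr (a * Suc k) = 2 powr a * 2 powr ((a - b) * k)"
        by (simp add: powr_add[symmetric] algebra_simps)
      ultimately show ?thesis by (simp add: mult_ac)
    qed
    finally show "(\<integral>\<^sup>+x. ennreal (c k * Z k x) \<partial>lborel) \<le> ennreal (D * 2 powr a * (2 powr (a - b)) ^ k)"
      by (simp add: ennreal_leI)
  qed auto
  also have "\<dots> < \<infinity>"
  proof -
    have q: "2 powr (a - b) < 1" using powr_less_mono[of "a - b" 0 2] a by simp
    have "summable (\<lambda>k. D * 2 powr a * (2 powr (a - b)) ^ k)" using q by (intro summable_mult summable_geometric) simp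
    then have "(\<Sum>k. ennreal (D * 2 powr a * (2 powr (a - b)) ^ k)) = ennreal (\<Sum>k. D * 2 powr a * (2 powr (a - b)) ^ k)"
      using D by (intro suminf_ennreal2) auto
    then show ?thesis by simp
  qed
  finally show ?thesis by (simp add: W_def)
qed

text \<open>The constant X = Q/(1 - q^\<theta>) sums the geometric series along \<tau>, q \<tau>,
  q^2 \<tau> and so on. The relation X q^\<theta> + Q = X closes the induction on the number of
  factors \<open>q\<close> between the two parameters.\<close>

lemma radial_power_bound:
  fixes \<phi> :: "real \<Rightarrow> 'a::real_normed_vector"
  assumes q: "0 < q" "q < 1" and \<theta>: "\<theta> > 0" and Q: "0 \<le> Q"
    and step: "\<And>\<tau> \<tau>'. 0 < \<tau> \<Longrightarrow> \<tau> < d \<Longrightarrow> q * \<tau> \<le> \<tau>' \<Longrightarrow> \<tau>' \<le> \<tau> \<Longrightarrow> norm (\<phi> \<tau>' - \<phi> \<tau>) \<le> Q * \<tau> powr \<theta>"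
    and \<tau>: "0 < \<tau>'" "\<tau>' \<le> \<tau>" "\<tau> < d"
  shows "norm (\<phi> \<tau>' - \<phi> \<tau>) \<le> Q / (1 - q powr \<theta>) * \<tau> powr \<theta>"
proof -
  have q1: "0 < 1 - q powr \<theta>" using powr_less_mono2[of \<theta> q 1] q \<theta> by simp
  have "norm (\<phi> \<tau>' - \<phi> \<tau>) \<le> Q / (1 - q powr \<theta>) * \<tau> powr \<theta>" if "q ^ k * \<tau> \<le> \<tau>'" "0 < \<tau>'" "\<tau>' \<le> \<tau>" "\<tau> < d" for k \<tau>
    using that
  proof (induction k arbitrary: \<tau>)
    case 0
    then show ?case using Q q1 by (simp add: divide_nonneg_pos)
  next
    case (Suc k)
    show ?case
    proof (cases "q * \<tau> \<le> \<tau>'")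
      case True
      then have "norm (\<phi> \<tau>' - \<phi> \<tau>) \<le> Q * \<tau> powr \<theta>" using Suc.prems by (intro step) auto
      also have "\<dots> \<le> Q / (1 - q powr \<theta>) * \<tau> powr \<theta>"
        using Q q1 by (intro mult_right_mono) (auto simp: pos_le_divide_eq mult_left_le)
      finally show ?thesis .
    next
      case False
      have t: "0 < \<tau>" using Suc.prems by linarith
      have qt: "q * \<tau> \<le> \<tau>" using q t by simp
      have "norm (\<phi> \<tau>' - \<phi> (q * \<tau>)) \<le> Q / (1 - q powr \<theta>) * (q * \<tau>) powr \<theta>"
        using Suc.prems False qt by (intro Suc.IH) (auto simp: mult_ac)
      moreover have "norm (\<phi> (q * \<tau>) - \<phi> \<tau>) \<le> Q * \<tau> powr \<theta>" using t Suc.prems qt by (intro step) auto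
      moreover have "norm (\<phi> \<tau>' - \<phi> \<tau>) \<le> norm (\<phi> \<tau>' - \<phi> (q * \<tau>)) + norm (\<phi> (q * \<tau>) - \<phi> \<tau>)"
        using norm_triangle_ineq[of "\<phi> \<tau>' - \<phi> (q * \<tau>)" "\<phi> (q * \<tau>) - \<phi> \<tau>"] by simp
      moreover have "Q / (1 - q powr \<theta>) * (q * \<tau>) powr \<theta> + Q * \<tau> powr \<theta> = Q / (1 - q powr \<theta>) * \<tau> powr \<theta>"
      proof -
        have alg: "Q / (1 - z) * (z * T) + Q * T = Q / (1 - z) * T" if "0 < 1 - z" for z T :: real
          using that by (simp add: divide_simps) (simp add: algebra_simps)
        show ?thesis using alg[OF q1, of "\<tau> powr \<theta>"] q t by (simp add: powr_mult)
      qed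
      ultimately show ?thesis by linarith
    qed
  qed
  moreover obtain k where "q ^ k < \<tau>' / \<tau>" using real_arch_pow_inv[of "\<tau>' / \<tau>" q] q \<tau> by auto
  then have "q ^ k * \<tau> \<le> \<tau>'" using \<tau> by (simp add: pos_less_divide_eq less_imp_le)
  ultimately show ?thesis using \<tau> by blast
qed

lemma power_bound_imp_limit:
  fixes \<phi> :: "real \<Rightarrow> 'a::banach"
  assumes \<theta>: "\<theta> > 0" and Q: "0 \<le> Q" and d: "d > 0"
    and bound: "\<And>\<tau> \<tau>'. 0 < \<tau>' \<Longrightarrow> \<tau>' \<le> \<tau> \<Longrightarrow> \<tau> < d \<Longrightarrow> norm (\<phi> \<tau>' - \<phi> \<tau>) \<le> Q * \<tau> powr \<theta>"
  shows "\<exists>L. \<forall>\<tau>. 0 < \<tau> \<and> \<tau> < d \<longrightarrow> norm (\<phi> \<tau> - L) \<le> Q * \<tau> powr \<theta>"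
proof -
  \<comment> \<open>The offset 2 keeps every term strictly below \<open>d\<close>.\<close>
  define t where "t k = d / real (k + 2)" for k
  have t: "0 < t k" "t k < d" for k using d by (auto simp: t_def field_simps add_pos_nonneg)
  have tm: "t m \<le> t k" if "k \<le> m" for k m using that d by (auto simp: t_def intro!: divide_left_mono)
  have t0: "t \<longlonglongrightarrow> 0"
    unfolding t_def using LIMSEQ_ignore_initial_segment[OF lim_const_over_n[of d], of 2] by simp
  then have "(\<lambda>k. t k powr \<theta>) \<longlonglongrightarrow> 0"
    by (rule tendsto_zero_powrI[OF _ tendsto_const _ \<theta>]) (use t(1) in \<open>auto simp: less_imp_le\<close>)
  then have lim: "(\<lambda>k. Q * t k powr \<theta>) \<longlonglongrightarrow> Q * 0" by (intro tendsto_intros)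
  have "Cauchy (\<lambda>k. \<phi> (t k))"
  proof (rule metric_CauchyI)
    fix e :: real assume e: "e > 0"
    have "\<forall>\<^sub>F k in sequentially. Q * t k powr \<theta> < e / 2" by (rule order_tendstoD(2)[OF lim]) (use e in simp)
    then obtain k where k: "Q * t k powr \<theta> < e / 2" by (auto simp: eventually_sequentially)
    have "norm (\<phi> (t m) - \<phi> (t k)) < e / 2" if "m \<ge> k" for m
      using bound[OF t(1) tm[OF that] t(2)] k by linarith
    then have half: "dist (\<phi> (t m)) (\<phi> (t k)) < e / 2" if "m \<ge> k" for m using that by (simp only: dist_norm)
    have "dist (\<phi> (t m)) (\<phi> (t n)) < e" if "m \<ge> k" "n \<ge> k" for m n
      using half[OF that(1)] half[OF that(2)] dist_triangle2[of "\<phi> (t m)" "\<phi> (t n)" "\<phi> (t k)"] by linarith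
    then show "\<exists>M. \<forall>m\<ge>M. \<forall>n\<ge>M. dist (\<phi> (t m)) (\<phi> (t n)) < e" by blast
  qed
  then obtain L where L: "(\<lambda>k. \<phi> (t k)) \<longlonglongrightarrow> L" using Cauchy_convergent convergent_def by blast
  have "norm (\<phi> \<tau> - L) \<le> Q * \<tau> powr \<theta>" if \<tau>: "0 < \<tau>" "\<tau> < d" for \<tau>
  proof (rule tendsto_upperbound)
    show "(\<lambda>k. norm (\<phi> \<tau> - \<phi> (t k))) \<longlonglongrightarrow> norm (\<phi> \<tau> - L)" by (intro tendsto_intros L)
    have "\<forall>\<^sub>F k in sequentially. t k < \<tau>" by (rule order_tendstoD(2)[OF t0 \<tau>(1)])
    then show "\<forall>\<^sub>F k in sequentially. norm (\<phi> \<tau> - \<phi> (t k)) \<le> Q * \<tau> powr \<theta>"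
    proof eventually_elim
      case (elim k)
      then show ?case using bound[OF t(1), of k \<tau>] \<tau> by (simp add: norm_minus_commute)
    qed
  qed simp
  then show ?thesis by blast
qed

lemma norm_chain_le:
  fixes F :: "nat \<Rightarrow> 'a::real_normed_vector"
  assumes "\<And>m. m < k \<Longrightarrow> norm (F (Suc m) - F m) \<le> B"
  shows "norm (F k - F 0) \<le> real k * B"
  using assms
proof (induction k)
  case (Suc k)
  have "norm (F (Suc k) - F 0) \<le> norm (F (Suc k) - F k) + norm (F k - F 0)"
    using norm_triangle_ineq[of "F (Suc k) - F k" "F k - F 0"] by simp
  then show ?case using Suc.IH Suc.prems[of k] Suc.prems by (force simp: algebra_simps)
qed simp

text \<open>Radial points satisfy the cone condition with c = 1, which yields a radial limit. A
  point of a wider cone is joined to the radial point of equal norm by a number of steps that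
  depends only on \<open>c\<close> and \<kappa>. The limit is found on the radius and is therefore
  the same for all cones.\<close>

theorem nontangential_limitI:
  fixes f :: "real^'n \<Rightarrow> real^'n" and \<kappa> \<theta> :: real
  assumes \<zeta>: "norm \<zeta> = 1" and lam: "0 < \<kappa>" "\<kappa> < 1" and \<theta>: "\<theta> > 0"
    and local: "\<And>c. c \<ge> 1 \<Longrightarrow> \<exists>Q\<ge>0. \<exists>d>0. \<forall>x y. norm x < 1 \<and> 1 - norm x < d \<and> norm (x - \<zeta>) \<le> c * (1 - norm x)
       \<and> norm (y - x) \<le> \<kappa> * (1 - norm x) \<longrightarrow> norm (f y - f x) \<le> Q * (1 - norm x) powr \<theta>"
  shows "has_nontangential_limit f \<zeta>"
proof -
  obtain Q1 d1 where Q1: "Q1 \<ge> 0" "d1 > 0" "\<And>x y. norm x < 1 \<Longrightarrow> 1 - norm x < d1 \<Longrightarrow> norm (x - \<zeta>) \<le> 1 * (1 - norm x)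
       \<Longrightarrow> norm (y - x) \<le> \<kappa> * (1 - norm x) \<Longrightarrow> norm (f y - f x) \<le> Q1 * (1 - norm x) powr \<theta>"
    using local[of 1] by (metis order_refl)
  define \<phi> where "\<phi> \<tau> = f ((1 - \<tau>) *\<^sub>R \<zeta>)" for \<tau>
  define d0 where "d0 = min d1 1"
  have d0: "d0 > 0" "d0 \<le> 1" "d0 \<le> d1" using Q1 by (auto simp: d0_def)
  define q where "q = 1 - \<kappa>"
  have q: "0 < q" "q < 1" using lam by (auto simp: q_def)
  have step: "norm (\<phi> \<tau>' - \<phi> \<tau>) \<le> Q1 * \<tau> powr \<theta>" if t: "0 < \<tau>" "\<tau> < d0" "q * \<tau> \<le> \<tau>'" "\<tau>' \<le> \<tau>" for \<tau> \<tau>'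
  proof -
    let ?x = "(1 - \<tau>) *\<^sub>R \<zeta>"
    have nx: "norm ?x = 1 - \<tau>" using t d0 \<zeta> by simp
    have "?x - \<zeta> = (- \<tau>) *\<^sub>R \<zeta>" by (simp add: algebra_simps)
    then have xz: "norm (?x - \<zeta>) = \<tau>" using t \<zeta> by simp
    have "(1 - \<tau>') *\<^sub>R \<zeta> - ?x = (\<tau> - \<tau>') *\<^sub>R \<zeta>" by (simp add: algebra_simps)
    then have "norm ((1 - \<tau>') *\<^sub>R \<zeta> - ?x) = \<tau> - \<tau>'" using t \<zeta> by simp
    then have "norm ((1 - \<tau>') *\<^sub>R \<zeta> - ?x) \<le> \<kappa> * \<tau>" using t by (simp add: q_def algebra_simps)
    then show ?thesis
      unfolding \<phi>_def using Q1(3)[of ?x "(1 - \<tau>') *\<^sub>R \<zeta>"] nx xz t d0 by simp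
  qed
  define Q2 where "Q2 = Q1 / (1 - q powr \<theta>)"
  have Q2: "Q2 \<ge> 0" using Q1(1) powr_less_mono2[of \<theta> q 1] q \<theta> by (simp add: Q2_def)
  have "norm (\<phi> \<tau>' - \<phi> \<tau>) \<le> Q2 * \<tau> powr \<theta>" if "0 < \<tau>'" "\<tau>' \<le> \<tau>" "\<tau> < d0" for \<tau> \<tau>'
    unfolding Q2_def by (rule radial_power_bound[OF q \<theta> Q1(1) step that])
  from power_bound_imp_limit[OF \<theta> Q2 d0(1) this]
  obtain L where L: "\<And>\<tau>. 0 < \<tau> \<Longrightarrow> \<tau> < d0 \<Longrightarrow> norm (\<phi> \<tau> - L) \<le> Q2 * \<tau> powr \<theta>" by blast
  have "(f \<longlongrightarrow> L) (at \<zeta> within stolz_cone c \<zeta>)" if c: "c > 1" for c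
  proof -
    obtain Q d where Q: "Q \<ge> 0" "d > 0" "\<And>x y. norm x < 1 \<Longrightarrow> 1 - norm x < d \<Longrightarrow> norm (x - \<zeta>) \<le> c * (1 - norm x)
       \<Longrightarrow> norm (y - x) \<le> \<kappa> * (1 - norm x) \<Longrightarrow> norm (f y - f x) \<le> Q * (1 - norm x) powr \<theta>"
      using local[of c] c by (metis less_imp_le)
    \<comment> \<open>The distance to the radial point is at most (c + 1) t and is divided into
      steps of length at most \<kappa> t.\<close>
    obtain N :: nat where N: "(c + 1) / \<kappa> \<le> real N" using real_arch_simple by blast
    have N0: "N > 0" using N c lam by (metis add_pos_pos divide_pos_pos gr0I less_le_trans less_numeral_extra(1) of_nat_0 order_less_irrefl less_trans)
    have near: "norm (f x - L) \<le> (real N * (Q * c powr \<theta>) + Q2) * (1 - norm x) powr \<theta>"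
      if x: "x \<in> stolz_cone c \<zeta>" and small: "1 - norm x < min d0 (d / c)" for x
    proof -
      define t where "t = 1 - norm x"
      have t: "0 < t" "t < d0" "c * t < d" "norm (x - \<zeta>) \<le> c * t"
        using x small c by (auto simp: t_def stolz_cone_def norm_minus_commute field_simps)
      define z where "z = (1 - t) *\<^sub>R \<zeta>"
      have nz: "norm z = 1 - t" using t d0 \<zeta> by (simp add: z_def)
      have "z - \<zeta> = (- t) *\<^sub>R \<zeta>" by (simp add: z_def algebra_simps)
      then have zz: "norm (z - \<zeta>) = t" using t \<zeta> by simp
      have xz: "norm (x - z) \<le> (c + 1) * t"
        using norm_triangle_ineq4[of "x - \<zeta>" "z - \<zeta>"] t(4) zz by (simp add: algebra_simps)
      define P where "P m = z + (real m / real N) *\<^sub>R (x - z)" for m :: nat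
      have P0: "P 0 = z" and PN: "P N = x" using N0 by (auto simp: P_def)
      have Pstep: "norm (f (P (Suc m)) - f (P m)) \<le> Q * c powr \<theta> * t powr \<theta>" if m: "m < N" for m
      proof -
        define u where "u = real m / real N"
        have u: "0 \<le> u" "u \<le> 1" using m by (auto simp: u_def)
        \<comment> \<open>By convexity the whole segment keeps norm at most 1 - t and distance at
          most c t from \<zeta>, so every point of the chain satisfies the local hypothesis.\<close>
        have Pm: "P m = (1 - u) *\<^sub>R z + u *\<^sub>R x" by (simp add: P_def u_def[symmetric] algebra_simps)
        have "norm (P m) \<le> (1 - u) * norm z + u * norm x"
          unfolding Pm using norm_triangle_ineq[of "(1 - u) *\<^sub>R z" "u *\<^sub>R x"] u by simp
        also have "\<dots> = 1 - t" unfolding nz by (simp add: t_def algebra_simps)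
        finally have n1: "t \<le> 1 - norm (P m)" by simp
        have "P m - \<zeta> = (1 - u) *\<^sub>R (z - \<zeta>) + u *\<^sub>R (x - \<zeta>)" by (simp add: Pm algebra_simps)
        then have "norm (P m - \<zeta>) \<le> (1 - u) * t + u * (c * t)"
          using norm_triangle_ineq[of "(1 - u) *\<^sub>R (z - \<zeta>)" "u *\<^sub>R (x - \<zeta>)"] u zz mult_left_mono[OF t(4) u(1)] by simp
        also have "\<dots> \<le> (1 - u) * (c * t) + u * (c * t)" using u c t by (intro add_right_mono mult_left_mono) auto
        finally have n2: "norm (P m - \<zeta>) \<le> c * t" by (simp add: algebra_simps)
        have n3: "1 - norm (P m) \<le> c * t" using n2 norm_triangle_sub[of \<zeta> "P m"] \<zeta> by (simp add: norm_minus_commute)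
        have "P (Suc m) - P m = (1 / real N) *\<^sub>R (x - z)" by (simp add: P_def algebra_simps add_divide_distrib)
        then have "norm (P (Suc m) - P m) = norm (x - z) / real N" by simp
        also have "\<dots> \<le> (c + 1) * t / real N" using xz by (rule divide_right_mono) simp
        also have "\<dots> \<le> \<kappa> * t"
        proof -
          have "c + 1 \<le> \<kappa> * real N" using N lam by (simp add: pos_divide_le_eq mult.commute)
          then have "(c + 1) * t \<le> \<kappa> * real N * t" using t by (intro mult_right_mono) auto
          then show ?thesis using N0 by (simp add: pos_divide_le_eq mult_ac)
        qed
        also have "\<dots> \<le> \<kappa> * (1 - norm (P m))" using n1 lam by (intro mult_left_mono) auto
        finally have n4: "norm (P (Suc m) - P m) \<le> \<kappa> * (1 - norm (P m))" .
        have "c * t \<le> c * (1 - norm (P m))" using n1 c by (intro mult_left_mono) auto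
        then have "norm (f (P (Suc m)) - f (P m)) \<le> Q * (1 - norm (P m)) powr \<theta>"
          using n1 n2 n3 n4 t by (intro Q(3)) auto
        also have "\<dots> \<le> Q * (c * t) powr \<theta>" using n3 n1 t \<theta> Q(1) by (intro mult_left_mono powr_mono2) auto
        also have "\<dots> = Q * c powr \<theta> * t powr \<theta>" using c t by (simp add: powr_mult)
        finally show ?thesis .
      qed
      have "norm (f x - f z) \<le> real N * (Q * c powr \<theta> * t powr \<theta>)"
        using norm_chain_le[of N "\<lambda>m. f (P m)", OF Pstep] by (simp add: P0 PN)
      moreover have "norm (f z - L) \<le> Q2 * t powr \<theta>" using L[OF t(1,2)] by (simp add: \<phi>_def z_def)
      moreover have "norm (f x - L) \<le> norm (f x - f z) + norm (f z - L)"
        using norm_triangle_ineq[of "f x - f z" "f z - L"] by simp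
      ultimately have "norm (f x - L) \<le> real N * (Q * c powr \<theta> * t powr \<theta>) + Q2 * t powr \<theta>" by linarith
      also have "\<dots> = (real N * (Q * c powr \<theta>) + Q2) * (1 - norm x) powr \<theta>" by (simp add: t_def algebra_simps)
      finally show ?thesis .
    qed
    let ?F = "at \<zeta> within stolz_cone c \<zeta>"
    have "((\<lambda>x. 1 - norm x) \<longlongrightarrow> 1 - norm \<zeta>) ?F" by (intro tendsto_intros)
    then have lim0: "((\<lambda>x. 1 - norm x) \<longlongrightarrow> 0) ?F" using \<zeta> by simp
    have cone: "\<forall>\<^sub>F x in ?F. x \<in> stolz_cone c \<zeta>" by (auto simp: eventually_at_filter)
    have nn: "\<forall>\<^sub>F x in ?F. 0 \<le> 1 - norm x" using cone by eventually_elim (auto simp: stolz_cone_def)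
    have "((\<lambda>x. (1 - norm x) powr \<theta>) \<longlongrightarrow> 0) ?F"
      by (rule tendsto_zero_powrI[OF lim0 tendsto_const nn \<theta>])
    then have "((\<lambda>x. (real N * (Q * c powr \<theta>) + Q2) * (1 - norm x) powr \<theta>) \<longlongrightarrow> (real N * (Q * c powr \<theta>) + Q2) * 0) ?F"
      by (intro tendsto_intros)
    then have rhs: "((\<lambda>x. (real N * (Q * c powr \<theta>) + Q2) * (1 - norm x) powr \<theta>) \<longlongrightarrow> 0) ?F" by simp
    have "\<forall>\<^sub>F x in ?F. 1 - norm x < min d0 (d / c)"
      by (rule order_tendstoD(2)[OF lim0]) (use d0 Q c in auto)
    then have "\<forall>\<^sub>F x in ?F. norm (f x - L) \<le> (real N * (Q * c powr \<theta>) + Q2) * (1 - norm x) powr \<theta>"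
      using cone by eventually_elim (rule near)
    from Lim_null_comparison[OF this rhs] show ?thesis by (simp add: LIM_zero_iff)
  qed
  then show ?thesis unfolding has_nontangential_limit_def by blast
qed

context qr_map
begin

theorem exceptional_set_null:
  assumes a: "0 \<le> a" "a < s" and D: "0 \<le> D"
    and E: "\<And>r. 0 < r \<Longrightarrow> r < 1 \<Longrightarrow> (LINT x:ball 0 r|lborel. norm (g x) ^ CARD('n)) \<le> D * (1 - r) powr (- a)"
  shows "hausdorff_measure s {\<zeta> \<in> sphere 0 1. \<not> has_nontangential_limit f \<zeta>} = 0"
proof -
  let ?n = "CARD('n)"
  \<comment> \<open>Strict on both sides: b > a makes the weighted energy finite, b < s makes the
    exponent \<theta> below positive.\<close>
  define b where "b = (a + s) / 2"
  have b: "a < b" "b < s" "0 \<le> b" "0 < s" using a by (auto simp: b_def)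
  define W where "W x = indicator (ball 0 1) x * (norm (g x) ^ ?n * (1 - norm x) powr b)" for x :: "real^'n"
  have W0: "0 \<le> W x" for x by (simp add: W_def)
  have Wm: "W \<in> borel_measurable borel"
    unfolding W_def
  proof (intro borel_measurable_times borel_measurable_indicator borel_measurable_power borel_measurable_norm g_borel)
    show "(\<lambda>x::real^'n. (1 - norm x) powr b) \<in> borel_measurable borel" by measurable
  qed auto
  define N where "N = density lborel W"
  have Ns: "sets N = sets borel" by (simp add: N_def)
  have Nsp: "space N = UNIV" by (simp add: N_def)
  have "emeasure N (space N) = (\<integral>\<^sup>+x. ennreal (W x) \<partial>lborel)"
    using Wm by (simp add: N_def emeasure_density)
  then have fin: "emeasure N (space N) < \<infinity>" using weighted_energy_finite[OF a(1) b(1) D E] by (simp add: W_def)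
  interpret finite_measure N by (rule finite_measureI) (use fin in simp)
  have Wi: "integrable lborel W"
    by (rule integrableI_nonneg)
       (use Wm W0 weighted_energy_finite[OF a(1) b(1) D E] in \<open>auto simp: W_def\<close>)
  have Nm: "emeasure N S = ennreal (LINT x:S|lborel. W x)" if "S \<in> sets borel" for S
  proof -
    have "set_integrable lborel S W"
      using integrable_mult_indicator[OF _ Wi, of S] that by (simp add: set_integrable_def)
    then show ?thesis unfolding N_def by (intro emeasure_density_set_integral[OF Wm that]) (simp_all add: W0)
  qed
  \<comment> \<open>Points where the weighted energy is too dense at arbitrarily small scales, in
    the form asked for by \<open>hausdorff_measure_eq_0I\<close>.\<close>
  define bad where "bad = {\<zeta> \<in> sphere (0::real^'n) 1. \<forall>d>0. \<exists>r. 0 < r \<and> r < d \<and> ennreal (r powr s) \<le> emeasure N (cball \<zeta> r)}"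
  have good: "has_nontangential_limit f \<zeta>" if \<zeta>: "\<zeta> \<in> sphere 0 1" and nb: "\<zeta> \<notin> bad" for \<zeta>
  proof -
    obtain d0 where d0: "d0 > 0" "\<And>r. 0 < r \<Longrightarrow> r < d0 \<Longrightarrow> emeasure N (cball \<zeta> r) < ennreal (r powr s)"
      using \<zeta> nb unfolding bad_def by (auto simp: not_le)
    \<comment> \<open>Chosen so that (n + 2) \<kappa> t = t/2: the ball used by the oscillation
      estimate keeps distance t/2 from the unit sphere, and there the weight is at least
      (t/2)^b.\<close>
    define \<kappa> where "\<kappa> = 1 / (2 * (real ?n + 2))"
    define \<theta> where "\<theta> = (s - b) / real ?n"
    have n0: "real ?n > 0" by simp
    show ?thesis
    proof (rule nontangential_limitI)
      show "norm \<zeta> = 1" using \<zeta> by simp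
      show "0 < \<kappa>" by (simp add: \<kappa>_def add_nonneg_pos)
      show "\<kappa> < 1" using n0 by (simp add: \<kappa>_def field_simps)
      show "\<theta> > 0" using b n0 by (simp add: \<theta>_def)
      fix c :: real assume c: "c \<ge> 1"
      \<comment> \<open>The factor 2^b comes from dividing by the weight, (c + 1)^s from passing to
        the ball of radius (c + 1) t about \<zeta>.\<close>
      define A where "A = qr_osc_const ?n * (2 powr b * (c + 1) powr s)"
      have A: "A \<ge> 0" using qr_osc_const_pos[of ?n] by (simp add: A_def)
      define Q where "Q = root ?n A"
      have Q: "Q \<ge> 0" "Q ^ ?n = A" using A by (auto simp: Q_def)
      have "norm (f y - f x) \<le> Q * (1 - norm x) powr \<theta>"
        if x: "norm x < 1" "1 - norm x < d0 / (c + 1)" "norm (x - \<zeta>) \<le> c * (1 - norm x)"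
          and y: "norm (y - x) \<le> \<kappa> * (1 - norm x)" for x y
      proof (rule power_le_imp_le_base)
        define t where "t = 1 - norm x"
        have t: "0 < t" "(c + 1) * t < d0" "norm (x - \<zeta>) \<le> c * t"
          using x c by (auto simp: t_def field_simps)
        have nl: "(real ?n + 2) * (\<kappa> * t) = t / 2" using n0 by (simp add: \<kappa>_def field_simps)
        have lt: "0 < \<kappa> * t" using t by (simp add: \<kappa>_def add_nonneg_pos)
        have nx: "norm x = 1 - t" by (simp add: t_def)
        have x1: "norm x + t / 2 < 1" using t(1) nx by linarith
        have "norm (f y - f x) ^ ?n \<le> qr_osc_const ?n * en x (t / 2)"
          using oscillation[OF lt, of x y] y x1 by (simp only: nl t_def[symmetric])
        also have "en x (t / 2) \<le> 2 powr b * (c + 1) powr s * t powr (s - b)"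
        proof -
          have Wc: "set_integrable lborel (cball x (t / 2)) W"
            using integrable_mult_indicator[OF _ Wi, of "cball x (t / 2)"] by (simp add: set_integrable_def)
          have "en x (t / 2) \<le> (LINT y:cball x (t / 2)|lborel. (t / 2) powr (- b) * W y)"
            unfolding en_def
          proof (rule set_integral_mono[OF en_integrable[OF x1]])
            show "set_integrable lborel (cball x (t / 2)) (\<lambda>y. (t / 2) powr (- b) * W y)"
              by (rule set_integrable_mult_right) (rule Wc)
            fix y assume y: "y \<in> cball x (t / 2)"
            then have "norm y \<le> norm x + t / 2" using cball_sub[of x "t / 2" "norm x + t / 2"] by auto
            then have y1: "t / 2 \<le> 1 - norm y" using nx by linarith
            then have "(t / 2) powr b \<le> (1 - norm y) powr b" using t b by (intro powr_mono2) auto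
            then have "norm (g y) ^ ?n * (t / 2) powr b \<le> W y"
              using y1 t by (auto simp: W_def intro!: mult_left_mono)
            then have "(t / 2) powr (- b) * (norm (g y) ^ ?n * (t / 2) powr b) \<le> (t / 2) powr (- b) * W y"
              by (intro mult_left_mono) auto
            moreover have "(t / 2) powr (- b) * (norm (g y) ^ ?n * (t / 2) powr b) = norm (g y) ^ ?n"
              using t by (simp add: powr_minus field_simps)
            ultimately show "norm (g y) ^ ?n \<le> (t / 2) powr (- b) * W y" by simp
          qed
          also have "\<dots> = (t / 2) powr (- b) * (LINT y:cball x (t / 2)|lborel. W y)" by simp
          also have "\<dots> \<le> (t / 2) powr (- b) * ((c + 1) * t) powr s"
          proof (rule mult_left_mono)
            have "cball x (t / 2) \<subseteq> cball \<zeta> ((c + 1) * t)"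
            proof
              fix y assume "y \<in> cball x (t / 2)"
              then have "dist \<zeta> y \<le> dist \<zeta> x + t / 2" using dist_triangle[of \<zeta> y x] by simp
              also have "\<dots> \<le> c * t + t" using t by (simp add: dist_norm norm_minus_commute)
              finally show "y \<in> cball \<zeta> ((c + 1) * t)" by (simp add: algebra_simps)
            qed
            then have "emeasure N (cball x (t / 2)) \<le> emeasure N (cball \<zeta> ((c + 1) * t))"
              using Ns by (intro emeasure_mono) auto
            also have "\<dots> \<le> ennreal (((c + 1) * t) powr s)"
              using d0(2)[of "(c + 1) * t"] t c by (simp add: less_imp_le)
            finally show "(LINT y:cball x (t / 2)|lborel. W y) \<le> ((c + 1) * t) powr s"
              using Nm[of "cball x (t / 2)"] by (simp add: ennreal_le_iff)
          qed simp
          also have "(t / 2) powr (- b) * ((c + 1) * t) powr s = 2 powr b * (c + 1) powr s * t powr (s - b)"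
          proof -
            have e1: "((c + 1) * t) powr s = (c + 1) powr s * t powr s" by (rule powr_mult)
            have "(t / 2) powr (- b) = t powr (- b) / 2 powr (- b)" by (rule powr_divide)
            then have e2: "(t / 2) powr (- b) = 2 powr b * t powr (- b)" by (simp add: powr_minus divide_simps)
            have "t powr (- b) * t powr s = t powr (s - b)" by (simp flip: powr_add)
            then show ?thesis unfolding e1 e2 by (simp add: mult_ac)
          qed
          finally show ?thesis by simp
        qed
        finally have "norm (f y - f x) ^ ?n \<le> A * t powr (s - b)"
          using qr_osc_const_pos[of ?n] by (simp add: A_def mult_ac)
        also have "\<dots> = (Q * t powr \<theta>) ^ ?n"
          using t n0 by (simp add: power_mult_distrib Q(2) \<theta>_def powr_realpow[symmetric] powr_powr)
        finally show "norm (f y - f x) ^ Suc (?n - 1) \<le> (Q * (1 - norm x) powr \<theta>) ^ Suc (?n - 1)" by (simp add: t_def)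
      qed (use Q in auto)
      then show "\<exists>Q\<ge>0. \<exists>d>0. \<forall>x y. norm x < 1 \<and> 1 - norm x < d \<and> norm (x - \<zeta>) \<le> c * (1 - norm x)
         \<and> norm (y - x) \<le> \<kappa> * (1 - norm x) \<longrightarrow> norm (f y - f x) \<le> Q * (1 - norm x) powr \<theta>"
        using Q(1) d0(1) c by (intro exI[of _ Q] conjI exI[of _ "d0 / (c + 1)"]) auto
    qed
  qed
  show ?thesis
  proof (rule hausdorff_measure_eq_0I[OF Ns b(4)])
    fix \<zeta> :: "real^'n" and d :: real assume "\<zeta> \<in> {\<zeta> \<in> sphere 0 1. \<not> has_nontangential_limit f \<zeta>}" and d: "d > 0"
    then have "\<zeta> \<in> bad" using good by blast
    then show "\<exists>r. 0 < r \<and> r < d \<and> ennreal (r powr s) \<le> emeasure N (cball \<zeta> r)"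
      using d unfolding bad_def by blast
  next
    fix \<epsilon> :: real assume \<epsilon>: "\<epsilon> > 0"
    \<comment> \<open>Shrinking neighbourhoods of the sphere. Since \<open>W\<close> vanishes off
      the open ball, their mass tends to zero; the numerator 2 leaves room for balls of radius
      1/(k+1) about boundary points.\<close>
    define A where "A k = - cball (0::real^'n) (1 - 2 / real (Suc k))" for k
    have Ab: "A k \<in> sets borel" for k by (simp add: A_def)
    have "decseq A"
    proof (rule decseq_SucI)
      fix k
      have "2 / real (Suc (Suc k)) \<le> 2 / real (Suc k)" by (intro divide_left_mono) auto
      then show "A (Suc k) \<subseteq> A k" unfolding A_def by (intro Compl_anti_mono subset_cball) simp
    qed
    then have "(\<lambda>k. measure N (A k)) \<longlonglongrightarrow> measure N (\<Inter>k. A k)"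
      using Ab Ns by (intro finite_Lim_measure_decseq) auto
    moreover have "measure N (\<Inter>k. A k) = 0"
    proof -
      have "(\<Inter>k. A k) \<subseteq> - ball 0 1"
      proof
        fix x assume x: "x \<in> (\<Inter>k. A k)"
        show "x \<in> - ball 0 1"
        proof (rule ccontr)
          assume "x \<notin> - ball 0 1"
          then have "0 < (1 - norm x) / 2" by simp
          then obtain k where "1 / real (Suc k) < (1 - norm x) / 2" by (rule nat_approx_posE)
          then have "norm x \<le> 1 - 2 / real (Suc k)" by (simp add: field_simps)
          then have "x \<notin> A k" by (simp add: A_def)
          then show False using x by blast
        qed
      qed
      then have "emeasure N (\<Inter>k. A k) \<le> emeasure N (- ball 0 1)" using Ns by (intro emeasure_mono) auto
      also have "\<dots> = 0"
      proof -
        have "(\<lambda>x. indicator (- ball 0 1) x *\<^sub>R W x) = (\<lambda>x. 0)" by (auto simp: W_def indicator_def fun_eq_iff)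
        then show ?thesis by (simp add: Nm set_lebesgue_integral_def)
      qed
      finally show ?thesis by (simp add: measure_def)
    qed
    ultimately have "\<forall>\<^sub>F k in sequentially. measure N (A k) < \<epsilon>" using \<epsilon> by (intro order_tendstoD(2)) auto
    then obtain k where k: "measure N (A k) < \<epsilon>" by (auto simp: eventually_sequentially)
    have "cball \<zeta> (1 / real (Suc k)) \<subseteq> A k" if "\<zeta> \<in> sphere 0 1" for \<zeta>
    proof
      fix x assume "x \<in> cball \<zeta> (1 / real (Suc k))"
      then have "norm (\<zeta> - x) \<le> 1 / real (Suc k)" by (simp add: dist_norm)
      then have "norm x \<ge> 1 - 1 / real (Suc k)" using norm_triangle_sub[of \<zeta> x] that by simp
      moreover have "1 / real (Suc k) < 2 / real (Suc k)" by (simp add: divide_strict_right_mono)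
      ultimately have "norm x > 1 - 2 / real (Suc k)" by linarith
      then show "x \<in> A k" by (simp add: A_def)
    qed
    moreover have "emeasure N (A k) \<le> ennreal \<epsilon>" using k by (simp add: emeasure_eq_measure ennreal_leI)
    ultimately show "\<exists>d>0. \<exists>S\<in>sets borel. emeasure N S \<le> ennreal \<epsilon> \<and> (\<forall>\<zeta>\<in>{\<zeta> \<in> sphere 0 1. \<not> has_nontangential_limit f \<zeta>}. cball \<zeta> d \<subseteq> S)"
      using Ab by (intro exI[of _ "1 / real (Suc k)"] conjI bexI[of _ "A k"]) auto
  qed
qed

end

text \<open>A finite real bound excludes the value \<infinity>, which encodes infinite
  fibres.\<close>

lemma max_multiplicity_le_imp:
  assumes "ereal_of_enat (max_multiplicity f F) \<le> ereal B"
  shows "finite {x \<in> F. f x = y} \<and> real (card {x \<in> F. f x = y}) \<le> B"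
proof -
  have "multiplicity_at y f F \<le> max_multiplicity f F"
    unfolding max_multiplicity_def by (rule SUP_upper) simp
  then have "ereal_of_enat (multiplicity_at y f F) \<le> ereal_of_enat (max_multiplicity f F)" by simp
  then have "ereal_of_enat (multiplicity_at y f F) \<le> ereal B" using assms by (rule order_trans)
  then show ?thesis by (simp add: multiplicity_at_def split: if_splits)
qed

theorem theorem3p11:
  fixes f :: "real^'n \<Rightarrow> real^'n" and a C :: real
  assumes "2 \<le> CARD('n)"
    and "quasiregular_on (ball 0 1) f"
    and "bounded (f ` ball 0 1)"
    and "0 \<le> a" and "a < real CARD('n) - 1"
    and "\<forall>r. 0 < r \<and> r < 1 \<longrightarrow>
           ereal_of_enat (max_multiplicity f (ball 0 r)) \<le> ereal (C * (1 - r) powr (- a))"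
  shows "hausdorff_dim {\<zeta> \<in> sphere 0 1. \<not> has_nontangential_limit f \<zeta>} \<le> ereal a"
proof -
  obtain g K where "qr_map f g K" using quasiregular_imp_qr_map[OF assms(2)] by blast
  then interpret qr_map f g K .
  obtain M0 where "\<forall>y\<in>f ` ball 0 1. norm y \<le> M0" using assms(3) unfolding bounded_iff by blast
  then have M0: "norm (f x) \<le> M0" if "norm x < 1" for x using that by simp
  define M where "M = max M0 0"
  have M: "0 \<le> M" "\<And>x. norm x < 1 \<Longrightarrow> norm (f x) \<le> M" using M0 by (force simp: M_def)+
  have mult: "finite {x \<in> ball 0 r. f x = y} \<and> real (card {x \<in> ball 0 r. f x = y}) \<le> C * (1 - r) powr (- a)"
    if "0 < r" "r < 1" for r y
    using assms(6) that by (intro max_multiplicity_le_imp) auto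
  \<comment> \<open>The bound at r = 1/2 dominates a cardinality, which determines the sign of
    \<open>C\<close>.\<close>
  have "0 \<le> C * (1 - 1/2) powr (- a)" using mult[of "1/2" undefined] of_nat_0_le_iff order_trans by fastforce
  then have C: "C \<ge> 0" by (simp add: zero_le_mult_iff)
  define D where "D = K * (C * (unit_ball_vol CARD('n) * M ^ CARD('n)))"
  have D: "D \<ge> 0" using K_pos C M by (simp add: D_def)
  have E: "(LINT x:ball 0 r|lborel. norm (g x) ^ CARD('n)) \<le> D * (1 - r) powr (- a)" if r: "0 < r" "r < 1" for r
    using energy_le_multiplicity[OF r M mult[OF r]] by (simp add: D_def mult_ac)
  show ?thesis
  proof (rule ereal_le_epsilon2)
    fix e :: real assume e: "0 < e"
    \<comment> \<open>Every exponent a + e is admissible in the infimum that defines the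
      dimension.\<close>
    have "hausdorff_measure (a + e) {\<zeta> \<in> sphere 0 1. \<not> has_nontangential_limit f \<zeta>} = 0"
      by (rule exceptional_set_null[OF assms(4) _ D E]) (use e in auto)
    then have "hausdorff_dim {\<zeta> \<in> sphere 0 1. \<not> has_nontangential_limit f \<zeta>} \<le> ereal (a + e)"
      unfolding hausdorff_dim_def using assms(4) e by (intro Inf_lower) auto
    then show "hausdorff_dim {\<zeta> \<in> sphere 0 1. \<not> has_nontangential_limit f \<zeta>} \<le> ereal a + ereal e" by simp
  qed
qed

end
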